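(* Let the operators $\tilde{\mathcal K}_{\star,\bullet}$ ($\star,\bullet\in\{*_1,*_2,\circ_1,\circ_2\}$) be as in the context. Assume that for $i=1,2$ the operator $\tilde{\mathcal K}_{*_i,*_i}$ is invertible on $H^2(\Gamma_*^i)$; set $$\mathcal A_i=\tilde{\mathcal K}_{*_{\neg i},*_i}\tilde{\mathcal K}_{*_i,*_i}^{-1},$$ and assume that for $i=1,2$ the operator $\tilde{\mathcal K}_{*_i,*_i}-\mathcal A_{\neg i}\tilde{\mathcal K}_{*_{\neg i},*_i}$ is invertible on $H^2(\Gamma_*^i)$. Define, for $i=1,2$, $$\mathcal B_i=\big(\tilde{\mathcal K}_{*_i,*_i}-\mathcal A_{\neg i}\tilde{\mathcal K}_{*_{\neg i},*_i}\big)^{-1}\big(\mathcal A_{\neg i}\tilde{\mathcal K}_{*_{\neg i},\circ}-\tilde{\mathcal K}_{*_i,\circ}\big),$$ where $$\tilde{\mathcal K}_{*_i,\circ}=\begin{bmatrix}\tilde{\mathcal K}_{*_i,\circ_1}&\tilde{\mathcal K}_{*_i,\circ_2}\end{bmatrix},\quad \tilde{\mathcal K}_{\circ,*_i}=\begin{bmatrix}\tilde{\mathcal K}_{\circ_1,*_i}\\ \tilde{\mathcal K}_{\circ_2,*_i}\end{bmatrix},\quad \tilde{\mathcal K}_\circ=\begin{bmatrix}\tilde{\mathcal K}_{\circ_1,\circ_1}&\tilde{\mathcal K}_{\circ_1,\circ_2}\\ \tilde{\mathcal K}_{\circ_2,\circ_1}&\tilde{\mathcal K}_{\circ_2,\circ_2}\end{bmatrix}.$$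 Then the operator $$\mathcal M_{\circ,r}=\tilde{\mathcal K}_\circ+\tilde{\mathcal K}_{\circ,*_1}\mathcal B_1+\tilde{\mathcal K}_{\circ,*_2}\mathcal B_2:\ L^2(\Gamma_\circ)\to L^2(\Gamma_\circ)$$ is Fredholm second-kind, i.e. it is a nonzero scalar multiple of the identity plus a compact operator.
   Context: **Geometry.** $\Omega\subset\mathbb{R}^2$ is a region whose positively oriented boundary $\Gamma=\partial\Omega$ has finite length and is the union of $\Gamma_*=\Gamma_*^1\cup\Gamma_*^2$ and $\Gamma_\circ=\Gamma_\circ^1\cup\Gamma_\circ^2$. Here $\Gamma_*^1,\Gamma_*^2$ are disjoint smooth planar open curves (arcs), and so are $\Gamma_\circ^1,\Gamma_\circ^2$. The curves $\Gamma_*$ and $\Gamma_\circ$ meet only at their endpoints (the four corners of $\Gamma$, as for a finite waveguide with walls $\Gamma_*^1,\Gamma_*^2$ and end caps $\Gamma_\circ^1,\Gamma_\circ^2$), and they meet there at right angles. The curvature of $\Gamma_\circ$ vanishes at its endpoints. $n$ is the outward unit normal and $\kappa=\nabla_\Gamma\cdot n$ is the curvature. $L^2(\Gamma_\circ)=L^2(\Gamma_\circ^1)\times L^2(\Gamma_\circ^2)$. For $i\in\{1,2\}$, $\neg i$ denotes the other element of $\{1,2\}$. **Constants.** $k>0$ is the wave number; $a,c_1,c_2\in\mathbb{C}$ with $c_1\ne 0$; $k_\Gamma=\sqrt{(1+c_1c_2)/c_1^2}$ with the branch chosen so that $\Im k_\Gamma>0$ (it is assumed that $c_1,c_2$ are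 such that this strict inequality holds). **Layer potentials.** $G(x,y)=\frac{i}{4}H_0^{(1)}(k|x-y|)$. For a curve $C$ with unit normal $n$, $S[\sigma](x)=\int_C G(x,y)\sigma(y)\,ds(y)$ and $D[\sigma](x)=\int_C \partial_{n_y}G(x,y)\,\sigma(y)\,ds(y)$. A prime denotes that the kernel is differentiated in the direction $n_x$ (the normal to $\Gamma$ at the target $x$); two primes denote two such derivatives. On-surface integrals with hypersingular kernels are taken in the Hadamard finite part sense. **Fins.** Fix a small $R>0$. At each endpoint $x_0$ of a curve $C\in\{\Gamma_*^1,\Gamma_*^2,\Gamma_\circ^1,\Gamma_\circ^2\}$, let $\ell$ be the line through $x_0$ in the direction of the normal to $C$ at $x_0$. The fin of $C$ at $x_0$ is the reflection across $\ell$ of $C\cap B_R(x_0)$. It carries the reflected normals, so that $C$ together with its fins is an extended curve with continuous normal. $R$ is small enough that the fins lie outside $\Omega$ and meet $\Gamma$ only at the corners. The potentials $\tilde S_{*_i}\sigma$, $\tilde D_{*_i}\sigma$ are the single and double layer potentials over $\Gamma_*^i$ together with its fins, where the density on each fin is the even reflection of $\sigma$ (the value at a reflected point equals the value at the original point). The potential $\tilde S_{\circ_j}\rho$ is the single layer potential over $\Gamma_\circ^j$ together with its fins, where the density on each fin is the odd reflection of $\rho$ (the value at a reflected point is minus the value at the original point). For a target curve $\star$ and a source curve $\bullet$ (among $*_1,*_2,\circ_1,\circ_2$), $\tilde{\mathcal S}_{\star,\bullet}$ denotes the restriction of $\tilde S_\bullet$ to the curve $\star$ (on-surface evaluation), and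 similarly for $\tilde{\mathcal D}_{\star,\bullet}$ and for the primed and doubly primed versions. Also $\tilde{\mathcal S}_{\bullet}:=\tilde{\mathcal S}_{\bullet,\bullet}$, etc. **Surface operators.** Parameterize $\Gamma_*^i$ by arc length $s\in[0,L_i]$. $G_\Gamma^i(s,s')$ is the Green's function of $\frac{d^2}{ds^2}+k_\Gamma^2$ on $[0,L_i]$ with zero Neumann boundary conditions, i.e. $G_\Gamma^i(s,s')=\frac{1}{2ik_\Gamma}e^{ik_\Gamma|s-s'|}+\psi_i(s,s')$, where $\psi_i$ is smooth and annihilated by $\frac{d^2}{ds^2}+k_\Gamma^2$ in each variable, and $\partial_{s'}G_\Gamma^i(s,0)=\partial_{s'}G_\Gamma^i(s,L_i)=0$. Set $$\mathcal G_i[\varphi](s)=\int_0^{L_i}G_\Gamma^i(s,s')\varphi(s')\,ds',\qquad F_i[\varphi](s)=G_\Gamma^i(s,L_i)\varphi'(L_i)-G_\Gamma^i(s,0)\varphi'(0).$$ **Entries.** For $i,j\in\{1,2\}$ (first index = target, second index = source; densities on $\Gamma_*^i$ are in $H^2(\Gamma_*^i)$, densities on $\Gamma_\circ^j$ in $L^2(\Gamma_\circ^j)$, and likewise for the outputs): $$\tilde{\mathcal K}_{*_i,*_i}=-\tfrac{c_1}{2}I+c_1\tilde{\mathcal D}_{*_i}-\tfrac1{c_1}\mathcal G_i\tilde{\mathcal D}_{*_i}+\mathcal G_i(\tilde{\mathcal D}'_{*_i}+\tilde{\mathcal S}''_{*_i})+\Big(k^2-\tfrac{c_2}{c_1}\Big)\mathcal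 G_i\tilde{\mathcal S}_{*_i}+\mathcal G_i\Big(\kappa-\tfrac1{c_1}\Big)\tilde{\mathcal S}'_{*_i}+F_i\tilde{\mathcal S}_{*_i},$$ $$\tilde{\mathcal K}_{\circ_j,*_i}=a\Big(\tilde{\mathcal D}_{\circ_j,*_i}-\tfrac1{c_1}\tilde{\mathcal S}_{\circ_j,*_i}\Big)+\tilde{\mathcal D}'_{\circ_j,*_i}-\tfrac1{c_1}\tilde{\mathcal S}'_{\circ_j,*_i},$$ $$\tilde{\mathcal K}_{*_{\neg i},*_i}=c_1\Big(\tilde{\mathcal D}_{*_{\neg i},*_i}-\tfrac1{c_1}\tilde{\mathcal S}_{*_{\neg i},*_i}\Big)-\tfrac1{c_1}\mathcal G_{\neg i}\Big(\tilde{\mathcal D}_{*_{\neg i},*_i}-\tfrac1{c_1}\tilde{\mathcal S}_{*_{\neg i},*_i}\Big)+\mathcal G_{\neg i}\Big(\tilde{\mathcal D}'_{*_{\neg i},*_i}-\tfrac1{c_1}\tilde{\mathcal S}'_{*_{\neg i},*_i}\Big),$$ $$\tilde{\mathcal K}_{\circ_j,\circ_j}=\tfrac12 I+a\tilde{\mathcal S}_{\circ_j}+\tilde{\mathcal S}'_{\circ_j},\qquad \tilde{\mathcal K}_{\circ_{\neg j},\circ_j}=a\tilde{\mathcal S}_{\circ_{\neg j},\circ_j}+\tilde{\mathcal S}'_{\circ_{\neg j},\circ_j},$$ $$\tilde{\mathcal K}_{*_i,\circ_j}=c_1\tilde{\mathcal S}_{*_i,\circ_j}-\tfrac1{c_1}\mathcal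 G_i\tilde{\mathcal S}_{*_i,\circ_j}+\mathcal G_i\tilde{\mathcal S}'_{*_i,\circ_j}.$$ *)

theory Defs
  imports "HOL-Analysis.Analysis"
begin

section \<open>Seminormed function spaces and their operators\<close>

text \<open>
  Elements of \<open>L\<^sup>2\<close> and \<open>H\<^sup>2\<close> are represented by functions rather than by equivalence classes;
  \<open>f\<close> and \<open>g\<close> represent the same element iff \<open>fs_norm X (f - g) = 0\<close>.
\<close>

record 'a function_space =
  fs_set :: "('a \<Rightarrow> complex) set"
  fs_norm :: "('a \<Rightarrow> complex) \<Rightarrow> real"

definition fs_eq :: "'a function_space \<Rightarrow> ('a \<Rightarrow> complex) \<Rightarrow> ('a \<Rightarrow> complex) \<Rightarrow> bool" where
  "fs_eq X f g \<longleftrightarrow> fs_norm X (\<lambda>x. f x - g x) = 0"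

definition linear_op ::
  "'a function_space \<Rightarrow> 'b function_space \<Rightarrow> (('a \<Rightarrow> complex) \<Rightarrow> 'b \<Rightarrow> complex) \<Rightarrow> bool" where
  "linear_op X Y T \<longleftrightarrow>
     (\<forall>f\<in>fs_set X. T f \<in> fs_set Y) \<and>
     (\<forall>f\<in>fs_set X. \<forall>g\<in>fs_set X. fs_eq Y (T (\<lambda>x. f x + g x)) (\<lambda>y. T f y + T g y)) \<and>
     (\<forall>f\<in>fs_set X. \<forall>c. fs_eq Y (T (\<lambda>x. c * f x)) (\<lambda>y. c * T f y))"

definition bounded_op ::
  "'a function_space \<Rightarrow> 'b function_space \<Rightarrow> (('a \<Rightarrow> complex) \<Rightarrow> 'b \<Rightarrow> complex) \<Rightarrow> bool" where
  "bounded_op X Y T \<longleftrightarrow>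
     linear_op X Y T \<and> (\<exists>B. \<forall>f\<in>fs_set X. fs_norm Y (T f) \<le> B * fs_norm X f)"

definition compact_op ::
  "'a function_space \<Rightarrow> 'b function_space \<Rightarrow> (('a \<Rightarrow> complex) \<Rightarrow> 'b \<Rightarrow> complex) \<Rightarrow> bool" where
  "compact_op X Y T \<longleftrightarrow>
     linear_op X Y T \<and>
     (\<forall>f::nat \<Rightarrow> 'a \<Rightarrow> complex.
        (\<forall>n. f n \<in> fs_set X) \<and> (\<exists>B. \<forall>n. fs_norm X (f n) \<le> B) \<longrightarrow>
        (\<exists>r g. strict_mono r \<and> g \<in> fs_set Y \<and>
               (\<lambda>n. fs_norm Y (\<lambda>y. T (f (r n)) y - g y)) \<longlonglongrightarrow> 0))"

definition invertible_op ::
  "'a function_space \<Rightarrow> (('a \<Rightarrow> complex) \<Rightarrow> 'a \<Rightarrow> complex) \<Rightarrow> bool" where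
  "invertible_op X T \<longleftrightarrow>
     linear_op X X T \<and>
     (\<exists>S. bounded_op X X S \<and> (\<forall>f\<in>fs_set X. fs_eq X (S (T f)) f \<and> fs_eq X (T (S f)) f))"

definition inverse_op ::
  "'a function_space \<Rightarrow> (('a \<Rightarrow> complex) \<Rightarrow> 'a \<Rightarrow> complex) \<Rightarrow> ('a \<Rightarrow> complex) \<Rightarrow> 'a \<Rightarrow> complex" where
  "inverse_op X T g = (SOME f. f \<in> fs_set X \<and> fs_eq X (T f) g)"

definition fredholm_second_kind ::
  "'a function_space \<Rightarrow> (('a \<Rightarrow> complex) \<Rightarrow> 'a \<Rightarrow> complex) \<Rightarrow> bool" where
  "fredholm_second_kind X T \<longleftrightarrow>
     (\<forall>f\<in>fs_set X. T f \<in> fs_set X) \<and>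
     (\<exists>c C. c \<noteq> 0 \<and> compact_op X X C \<and> (\<forall>f\<in>fs_set X. fs_eq X (T f) (\<lambda>x. c * f x + C f x)))"

definition L2 :: "real \<Rightarrow> real function_space" where
  "L2 l = \<lparr>fs_set = {f. set_borel_measurable lebesgue {0..l} f \<and>
                       set_integrable lebesgue {0..l} (\<lambda>s. (cmod (f s))\<^sup>2)},
           fs_norm = (\<lambda>f. sqrt (LINT s:{0..l}|lebesgue. (cmod (f s))\<^sup>2))\<rparr>"

text \<open>
  \<open>H\<^sup>2(0,l)\<close> consists of the \<open>C\<^sup>1\<close> functions on \<open>[0,l]\<close> with absolutely continuous derivative and
  second derivative in \<open>L\<^sup>2\<close>. Elements are the \<open>C\<^sup>1\<close> representatives, so that boundary values of
  the first derivative make sense; the second derivative is determined almost everywhere.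
\<close>

definition is_H2_deriv2 :: "real \<Rightarrow> (real \<Rightarrow> complex) \<Rightarrow> (real \<Rightarrow> complex) \<Rightarrow> bool" where
  "is_H2_deriv2 l f f2 \<longleftrightarrow>
     f2 \<in> fs_set (L2 l) \<and>
     (\<exists>f1. (\<forall>s\<in>{0..l}. (f has_vector_derivative f1 s) (at s within {0..l})) \<and>
           (\<forall>s\<in>{0..l}. f1 s = f1 0 + (LINT t:{0..s}|lebesgue. f2 t)))"

definition H2 :: "real \<Rightarrow> real function_space" where
  "H2 l = \<lparr>fs_set = {f. \<exists>f2. is_H2_deriv2 l f f2},
           fs_norm = (\<lambda>f. sqrt ((fs_norm (L2 l) f)\<^sup>2 +
              (fs_norm (L2 l) (\<lambda>s. vector_derivative f (at s within {0..l})))\<^sup>2 +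
              (fs_norm (L2 l) (SOME f2. is_H2_deriv2 l f f2))\<^sup>2))\<rparr>"


section \<open>The Helmholtz Green's function\<close>

text \<open>The power series of \<open>J\<^sub>0\<close> and \<open>Y\<^sub>0\<close> on the positive half-line.\<close>

definition bessel_J0 :: "real \<Rightarrow> real" where
  "bessel_J0 x = (\<Sum>m. (-1) ^ m * (x / 2) ^ (2 * m) / (fact m)\<^sup>2)"

definition bessel_Y0 :: "real \<Rightarrow> real" where
  "bessel_Y0 x = 2 / pi * ((ln (x / 2) + euler_mascheroni) * bessel_J0 x
                  - (\<Sum>m. (-1) ^ m * harm m * (x / 2) ^ (2 * m) / (fact m)\<^sup>2))"

definition hankel_H0 :: "real \<Rightarrow> complex" where
  "hankel_H0 x = Complex (bessel_J0 x) (bessel_Y0 x)"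

definition helmholtz_G :: "real \<Rightarrow> complex \<Rightarrow> complex \<Rightarrow> complex" where
  "helmholtz_G k x y = \<i> / 4 * hankel_H0 (k * dist x y)"

definition dir_deriv :: "complex \<Rightarrow> (complex \<Rightarrow> complex) \<Rightarrow> complex \<Rightarrow> complex" where
  "dir_deriv v f x = vector_derivative (\<lambda>t. f (x + of_real t * v)) (at 0)"

text \<open>
  The finite part of \<open>I\<close> at \<open>0\<^sup>+\<close>: the constant term in an expansion
  \<open>I \<epsilon> = A / \<epsilon> + B ln \<epsilon> + l + o(1)\<close>.
\<close>

definition finite_part :: "(real \<Rightarrow> complex) \<Rightarrow> complex" where
  "finite_part I = (THE l. \<exists>A B.
     ((\<lambda>\<epsilon>. I \<epsilon> - A / of_real \<epsilon> - B * of_real (ln \<epsilon>)) \<longlongrightarrow> l) (at_right 0))"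


section \<open>Geometry\<close>

datatype side = One | Two

fun opp :: "side \<Rightarrow> side" where
  "opp One = Two"
| "opp Two = One"

text \<open>\<open>Star i\<close> and \<open>Circ j\<close> label the walls \<open>\<Gamma>\<^sub>*\<^sup>i\<close> and the end caps \<open>\<Gamma>\<^sub>\<circ>\<^sup>j\<close>.\<close>

datatype label = Star side | Circ side

record waveguide =
  region :: "complex set"
  curve :: "label \<Rightarrow> real \<Rightarrow> complex"
  len :: "label \<Rightarrow> real"
  fin_radius :: real
  wave_number :: real
  coef_a :: complex
  coef_c1 :: complex
  coef_c2 :: complex

definition arc_of :: "waveguide \<Rightarrow> label \<Rightarrow> complex set" where
  "arc_of W c = curve W c ` {0..len W c}"

definition ends_of :: "waveguide \<Rightarrow> label \<Rightarrow> complex set" where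
  "ends_of W c = {curve W c 0, curve W c (len W c)}"

definition tangent :: "waveguide \<Rightarrow> label \<Rightarrow> real \<Rightarrow> complex" where
  "tangent W c s = vector_derivative (curve W c) (at s within {0..len W c})"

text \<open>The curves run with \<open>\<Omega>\<close> on their left, so the outward normal is the tangent turned clockwise.\<close>

definition unit_normal :: "waveguide \<Rightarrow> label \<Rightarrow> real \<Rightarrow> complex" where
  "unit_normal W c s = - \<i> * tangent W c s"

text \<open>\<open>\<kappa> = \<nabla>\<^sub>\<Gamma> \<cdot> n\<close>, positive on a circle around \<open>\<Omega>\<close>.\<close>

definition curvature :: "waveguide \<Rightarrow> label \<Rightarrow> real \<Rightarrow> real" where
  "curvature W c s =
     tangent W c s \<bullet> vector_derivative (unit_normal W c) (at s within {0..len W c})"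

text \<open>
  \<open>fin_vec W c e\<close> and \<open>fin_point W c e\<close> are the reflections, of vectors and of points, across the
  line \<open>\<ell>\<close> through the endpoint \<open>curve W c e\<close> (with \<open>e = 0\<close> or \<open>e = len W c\<close>) in the direction of
  the normal there.
\<close>

definition fin_vec :: "waveguide \<Rightarrow> label \<Rightarrow> real \<Rightarrow> complex \<Rightarrow> complex" where
  "fin_vec W c e v = v - (2 * (v \<bullet> tangent W c e)) *\<^sub>R tangent W c e"

definition fin_point :: "waveguide \<Rightarrow> label \<Rightarrow> real \<Rightarrow> complex \<Rightarrow> complex" where
  "fin_point W c e y = curve W c e + fin_vec W c e (y - curve W c e)"

definition fin_of :: "waveguide \<Rightarrow> label \<Rightarrow> real \<Rightarrow> complex set" where
  "fin_of W c e = fin_point W c e ` (arc_of W c \<inter> ball (curve W c e) (fin_radius W))"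

definition smooth_on_interval :: "real \<Rightarrow> (real \<Rightarrow> complex) \<Rightarrow> bool" where
  "smooth_on_interval l f \<longleftrightarrow>
     (\<exists>d::nat \<Rightarrow> real \<Rightarrow> complex.
        (\<forall>s\<in>{0..l}. d 0 s = f s) \<and>
        (\<forall>m. \<forall>s\<in>{0..l}. (d m has_vector_derivative d (Suc m) s) (at s within {0..l})))"

definition k_Gamma :: "waveguide \<Rightarrow> complex" where
  "k_Gamma W =
     (let z = csqrt ((1 + coef_c1 W * coef_c2 W) / (coef_c1 W)\<^sup>2) in if Im z > 0 then z else - z)"

definition arcs_ok :: "waveguide \<Rightarrow> bool" where
  "arcs_ok W \<longleftrightarrow>
     (\<forall>c. 0 < len W c \<and> smooth_on_interval (len W c) (curve W c) \<and>
          inj_on (curve W c) {0..len W c} \<and> (\<forall>s\<in>{0..len W c}. norm (tangent W c s) = 1)) \<and>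
     arc_of W (Star One) \<inter> arc_of W (Star Two) = {} \<and>
     arc_of W (Circ One) \<inter> arc_of W (Circ Two) = {}"

definition corners_ok :: "waveguide \<Rightarrow> bool" where
  "corners_ok W \<longleftrightarrow>
     (\<Union>i. arc_of W (Star i)) \<inter> (\<Union>j. arc_of W (Circ j)) = (\<Union>i. ends_of W (Star i)) \<and>
     (\<Union>j. ends_of W (Circ j)) = (\<Union>i. ends_of W (Star i)) \<and>
     (\<forall>i j. \<forall>s\<in>{0, len W (Star i)}. \<forall>t\<in>{0, len W (Circ j)}.
        curve W (Star i) s = curve W (Circ j) t \<longrightarrow>
        tangent W (Star i) s \<bullet> tangent W (Circ j) t = 0) \<and>
     (\<forall>j. \<forall>t\<in>{0, len W (Circ j)}. curvature W (Circ j) t = 0)"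

text \<open>The last conjunct is positive orientation: \<open>- unit_normal\<close> points into \<open>\<Omega>\<close>, \<open>unit_normal\<close> out.\<close>

definition region_ok :: "waveguide \<Rightarrow> bool" where
  "region_ok W \<longleftrightarrow>
     open (region W) \<and> connected (region W) \<and> region W \<noteq> {} \<and>
     frontier (region W) = (\<Union>c. arc_of W c) \<and>
     (\<forall>c. \<forall>s\<in>{0<..<len W c}. \<forall>\<^sub>F t in at_right 0.
        curve W c s - of_real t * unit_normal W c s \<in> region W \<and>
        curve W c s + of_real t * unit_normal W c s \<notin> region W)"

definition fins_ok :: "waveguide \<Rightarrow> bool" where
  "fins_ok W \<longleftrightarrow>
     0 < fin_radius W \<and>
     (\<forall>c. \<forall>e\<in>{0, len W c}. closure (fin_of W c e) \<inter> closure (region W) = {curve W c e})"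

definition admissible :: "waveguide \<Rightarrow> bool" where
  "admissible W \<longleftrightarrow>
     arcs_ok W \<and> corners_ok W \<and> region_ok W \<and> fins_ok W \<and>
     0 < wave_number W \<and> coef_c1 W \<noteq> 0 \<and> 0 < Im (k_Gamma W)"


section \<open>Layer potentials over the curves with fins\<close>

text \<open>Densities are extended evenly to the fins of the walls and oddly to those of the end caps.\<close>

fun parity :: "label \<Rightarrow> complex" where
  "parity (Star i) = 1"
| "parity (Circ j) = - 1"

text \<open>
  \<open>fin_integral W c K \<sigma>\<close> is the integral of \<open>K y n\<^sub>y\<close> times the extended density over the curve \<open>c\<close>
  and its fins. Reflections preserve arc length, so each fin is integrated in the arc length
  parameter of the piece of \<open>c\<close> that it reflects.
\<close>

definition fin_integral ::
  "waveguide \<Rightarrow> label \<Rightarrow> (complex \<Rightarrow> complex \<Rightarrow> complex) \<Rightarrow> (real \<Rightarrow> complex) \<Rightarrow> complex" where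
  "fin_integral W c K \<sigma> =
     (LINT s:{0..len W c}|lebesgue. K (curve W c s) (unit_normal W c s) * \<sigma> s) +
     parity c * (\<Sum>e\<in>{0, len W c}.
       (LINT s:{s\<in>{0..len W c}. curve W c s \<in> ball (curve W c e) (fin_radius W)}|lebesgue.
          K (fin_point W c e (curve W c s)) (fin_vec W c e (unit_normal W c s)) * \<sigma> s))"

definition fin_integral_fp ::
  "waveguide \<Rightarrow> label \<Rightarrow> complex \<Rightarrow> (complex \<Rightarrow> complex \<Rightarrow> complex) \<Rightarrow> (real \<Rightarrow> complex) \<Rightarrow> complex" where
  "fin_integral_fp W c x K \<sigma> =
     finite_part (\<lambda>\<epsilon>. fin_integral W c (\<lambda>y n. if dist x y > \<epsilon> then K y n else 0) \<sigma>)"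

text \<open>
  Target curve \<open>t\<close>, source curve \<open>c\<close>; the results are functions of arc length on \<open>t\<close>. The suffixes
  \<open>'\<close> and \<open>''\<close> count derivatives in the direction of the normal at the target. Off the source curve
  the finite part is the ordinary integral.
\<close>

definition SL :: "waveguide \<Rightarrow> label \<Rightarrow> label \<Rightarrow> (real \<Rightarrow> complex) \<Rightarrow> real \<Rightarrow> complex" where
  "SL W t c \<sigma> s = fin_integral W c (\<lambda>y n. helmholtz_G (wave_number W) (curve W t s) y) \<sigma>"

definition DL :: "waveguide \<Rightarrow> label \<Rightarrow> label \<Rightarrow> (real \<Rightarrow> complex) \<Rightarrow> real \<Rightarrow> complex" where
  "DL W t c \<sigma> s =
     fin_integral W c (\<lambda>y n. dir_deriv n (helmholtz_G (wave_number W) (curve W t s)) y) \<sigma>"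

definition SL' :: "waveguide \<Rightarrow> label \<Rightarrow> label \<Rightarrow> (real \<Rightarrow> complex) \<Rightarrow> real \<Rightarrow> complex" where
  "SL' W t c \<sigma> s =
     fin_integral W c
       (\<lambda>y n. dir_deriv (unit_normal W t s) (\<lambda>x. helmholtz_G (wave_number W) x y) (curve W t s)) \<sigma>"

definition DL' :: "waveguide \<Rightarrow> label \<Rightarrow> label \<Rightarrow> (real \<Rightarrow> complex) \<Rightarrow> real \<Rightarrow> complex" where
  "DL' W t c \<sigma> s =
     fin_integral_fp W c (curve W t s)
       (\<lambda>y n. dir_deriv (unit_normal W t s)
                (\<lambda>x. dir_deriv n (helmholtz_G (wave_number W) x) y) (curve W t s)) \<sigma>"

definition SL'' :: "waveguide \<Rightarrow> label \<Rightarrow> label \<Rightarrow> (real \<Rightarrow> complex) \<Rightarrow> real \<Rightarrow> complex" where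
  "SL'' W t c \<sigma> s =
     fin_integral_fp W c (curve W t s)
       (\<lambda>y n. dir_deriv (unit_normal W t s)
                (dir_deriv (unit_normal W t s) (\<lambda>x. helmholtz_G (wave_number W) x y))
                (curve W t s)) \<sigma>"


section \<open>Surface operators on the walls\<close>

text \<open>
  The Neumann condition is imposed at \<open>s'\<close>-endpoints for \<open>s\<close> in the open interval only: at
  \<open>s = s' = 0\<close> and \<open>s = s' = l\<close> the singularity of the Green's function sits on the boundary. Joint
  smoothness of \<open>\<psi>\<close> is expressed by the family \<open>D m n\<close> of its mixed partial derivatives.
\<close>

definition is_green_remainder :: "complex \<Rightarrow> real \<Rightarrow> (real \<Rightarrow> real \<Rightarrow> complex) \<Rightarrow> bool" where
  "is_green_remainder \<kappa> l \<psi> \<longleftrightarrow>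
     (\<exists>D::nat \<Rightarrow> nat \<Rightarrow> real \<Rightarrow> real \<Rightarrow> complex.
        (\<forall>m n. continuous_on ({0..l} \<times> {0..l}) (\<lambda>(s, s'). D m n s s')) \<and>
        (\<forall>m n. \<forall>s\<in>{0..l}. \<forall>s'\<in>{0..l}.
           ((\<lambda>u. D m n u s') has_vector_derivative D (Suc m) n s s') (at s within {0..l}) \<and>
           ((\<lambda>u. D m n s u) has_vector_derivative D m (Suc n) s s') (at s' within {0..l})) \<and>
        (\<forall>s\<in>{0..l}. \<forall>s'\<in>{0..l}. \<psi> s s' = D 0 0 s s' \<and>
           D 2 0 s s' + \<kappa>\<^sup>2 * \<psi> s s' = 0 \<and> D 0 2 s s' + \<kappa>\<^sup>2 * \<psi> s s' = 0)) \<and>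
     (\<forall>s\<in>{0<..<l}. \<forall>e\<in>{0, l}.
        ((\<lambda>s'. exp (\<i> * \<kappa> * of_real \<bar>s - s'\<bar>) / (2 * \<i> * \<kappa>) + \<psi> s s')
           has_vector_derivative 0) (at e within {0..l}))"

definition green :: "complex \<Rightarrow> real \<Rightarrow> real \<Rightarrow> real \<Rightarrow> complex" where
  "green \<kappa> l s s' = exp (\<i> * \<kappa> * of_real \<bar>s - s'\<bar>) / (2 * \<i> * \<kappa>)
                    + (SOME \<psi>. is_green_remainder \<kappa> l \<psi>) s s'"

definition green_Gamma :: "waveguide \<Rightarrow> side \<Rightarrow> real \<Rightarrow> real \<Rightarrow> complex" where
  "green_Gamma W i = green (k_Gamma W) (len W (Star i))"

definition G_op :: "waveguide \<Rightarrow> side \<Rightarrow> (real \<Rightarrow> complex) \<Rightarrow> real \<Rightarrow> complex" where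
  "G_op W i \<phi> s = (LINT s':{0..len W (Star i)}|lebesgue. green_Gamma W i s s' * \<phi> s')"

definition F_op :: "waveguide \<Rightarrow> side \<Rightarrow> (real \<Rightarrow> complex) \<Rightarrow> real \<Rightarrow> complex" where
  "F_op W i \<phi> s =
     (let l = len W (Star i); d = (\<lambda>e. vector_derivative \<phi> (at e within {0..l}))
      in green_Gamma W i s l * d l - green_Gamma W i s 0 * d 0)"


section \<open>The entries and the reduced operator\<close>

fun K_op :: "waveguide \<Rightarrow> label \<Rightarrow> label \<Rightarrow> (real \<Rightarrow> complex) \<Rightarrow> real \<Rightarrow> complex" where
  "K_op W (Star h) (Star i) \<sigma> =
     (let k = of_real (wave_number W); c1 = coef_c1 W; c2 = coef_c2 W;
          S = SL W (Star h) (Star i) \<sigma>; D = DL W (Star h) (Star i) \<sigma>;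
          S' = SL' W (Star h) (Star i) \<sigma>; D' = DL' W (Star h) (Star i) \<sigma>;
          S'' = SL'' W (Star h) (Star i) \<sigma>
      in if h = i then
           (\<lambda>s. - (c1 / 2) * \<sigma> s + c1 * D s - 1 / c1 * G_op W i D s
                + G_op W i (\<lambda>u. D' u + S'' u) s
                + (k\<^sup>2 - c2 / c1) * G_op W i S s
                + G_op W i (\<lambda>u. (of_real (curvature W (Star i) u) - 1 / c1) * S' u) s
                + F_op W i S s)
         else
           (\<lambda>s. c1 * (D s - 1 / c1 * S s)
                - 1 / c1 * G_op W h (\<lambda>u. D u - 1 / c1 * S u) s
                + G_op W h (\<lambda>u. D' u - 1 / c1 * S' u) s))"
| "K_op W (Circ j) (Star i) \<sigma> =
     (\<lambda>s. coef_a W * (DL W (Circ j) (Star i) \<sigma> s - 1 / coef_c1 W * SL W (Circ j) (Star i) \<sigma> s)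
          + DL' W (Circ j) (Star i) \<sigma> s - 1 / coef_c1 W * SL' W (Circ j) (Star i) \<sigma> s)"
| "K_op W (Circ h) (Circ j) \<sigma> =
     (if h = j then
        (\<lambda>s. 1 / 2 * \<sigma> s + coef_a W * SL W (Circ j) (Circ j) \<sigma> s + SL' W (Circ j) (Circ j) \<sigma> s)
      else
        (\<lambda>s. coef_a W * SL W (Circ h) (Circ j) \<sigma> s + SL' W (Circ h) (Circ j) \<sigma> s))"
| "K_op W (Star i) (Circ j) \<sigma> =
     (\<lambda>s. coef_c1 W * SL W (Star i) (Circ j) \<sigma> s
          - 1 / coef_c1 W * G_op W i (SL W (Star i) (Circ j) \<sigma>) s
          + G_op W i (SL' W (Star i) (Circ j) \<sigma>) s)"

definition H2_star :: "waveguide \<Rightarrow> side \<Rightarrow> real function_space" where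
  "H2_star W i = H2 (len W (Star i))"

text \<open>A density on \<open>\<Gamma>\<^sub>\<circ>\<close> is a function of the index \<open>j\<close> of the end cap and of arc length on it.\<close>

definition L2_circ :: "waveguide \<Rightarrow> (side \<times> real) function_space" where
  "L2_circ W =
     \<lparr>fs_set = {\<rho>. \<forall>j. (\<lambda>s. \<rho> (j, s)) \<in> fs_set (L2 (len W (Circ j)))},
      fs_norm = (\<lambda>\<rho>. sqrt ((fs_norm (L2 (len W (Circ One))) (\<lambda>s. \<rho> (One, s)))\<^sup>2 +
                          (fs_norm (L2 (len W (Circ Two))) (\<lambda>s. \<rho> (Two, s)))\<^sup>2))\<rparr>"

definition K_star_circ :: "waveguide \<Rightarrow> side \<Rightarrow> (side \<times> real \<Rightarrow> complex) \<Rightarrow> real \<Rightarrow> complex" where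
  "K_star_circ W i \<rho> s = K_op W (Star i) (Circ One) (\<lambda>u. \<rho> (One, u)) s
                       + K_op W (Star i) (Circ Two) (\<lambda>u. \<rho> (Two, u)) s"

definition K_circ_star :: "waveguide \<Rightarrow> side \<Rightarrow> (real \<Rightarrow> complex) \<Rightarrow> side \<times> real \<Rightarrow> complex" where
  "K_circ_star W i \<sigma> = (\<lambda>(j, s). K_op W (Circ j) (Star i) \<sigma> s)"

definition K_circ :: "waveguide \<Rightarrow> (side \<times> real \<Rightarrow> complex) \<Rightarrow> side \<times> real \<Rightarrow> complex" where
  "K_circ W \<rho> = (\<lambda>(j, s). K_op W (Circ j) (Circ One) (\<lambda>u. \<rho> (One, u)) s
                        + K_op W (Circ j) (Circ Two) (\<lambda>u. \<rho> (Two, u)) s)"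

definition A_op :: "waveguide \<Rightarrow> side \<Rightarrow> (real \<Rightarrow> complex) \<Rightarrow> real \<Rightarrow> complex" where
  "A_op W i \<sigma> =
     K_op W (Star (opp i)) (Star i) (inverse_op (H2_star W i) (K_op W (Star i) (Star i)) \<sigma>)"

definition schur_op :: "waveguide \<Rightarrow> side \<Rightarrow> (real \<Rightarrow> complex) \<Rightarrow> real \<Rightarrow> complex" where
  "schur_op W i \<sigma> s = K_op W (Star i) (Star i) \<sigma> s
                    - A_op W (opp i) (K_op W (Star (opp i)) (Star i) \<sigma>) s"

definition B_op :: "waveguide \<Rightarrow> side \<Rightarrow> (side \<times> real \<Rightarrow> complex) \<Rightarrow> real \<Rightarrow> complex" where
  "B_op W i \<rho> = inverse_op (H2_star W i) (schur_op W i)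
     (\<lambda>s. A_op W (opp i) (K_star_circ W (opp i) \<rho>) s - K_star_circ W i \<rho> s)"

definition M_op :: "waveguide \<Rightarrow> (side \<times> real \<Rightarrow> complex) \<Rightarrow> side \<times> real \<Rightarrow> complex" where
  "M_op W \<rho> x = K_circ W \<rho> x + K_circ_star W One (B_op W One \<rho>) x
                           + K_circ_star W Two (B_op W Two \<rho>) x"


section \<open>Existence and uniqueness of the remainder in the definition of \<open>green\<close>\<close>

lemma green_remainder_exists:
  assumes "0 < Im \<kappa>" "0 < l"
  shows "\<exists>\<psi>. is_green_remainder \<kappa> l \<psi>"
proof -
  define L where "L = (of_real l :: complex)"
  define S where "S = sin (\<kappa> * L)"
  define h where "h = (of_real (pi / 2) :: complex)"
  have k0: "\<kappa> \<noteq> 0" using assms by auto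
  have S: "S \<noteq> 0"
  proof
    assume "S = 0"
    then obtain n :: int where n: "\<kappa> * L = of_real (n * pi)" unfolding S_def
      using sin_eq_0 by auto
    have "Im (\<kappa> * L) = 0" unfolding n by simp
    then show False using assms unfolding L_def by simp
  qed
  define P where "P = 1 / (2 * \<kappa> * S)"
  define Q where "Q = (cos (\<kappa> * L) + \<i> * S) / (2 * \<kappa> * S)"
  define E where "E m n s t =
      P * (- \<kappa>) ^ (m + n) * cos (\<kappa> * (L - s - t) + of_nat (m + n) * h)
    + Q * \<kappa> ^ m * (- \<kappa>) ^ n * cos (\<kappa> * (s - t) + of_nat (m + n) * h)" for m n :: nat and s t
  have h: "cos h = 0" "sin h = 1"
    unfolding h_def cos_of_real sin_of_real by simp_all
  have shift: "cos (z + of_nat (Suc j) * h) = - sin (z + of_nat j * h)" for z j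
  proof -
    have "z + of_nat (Suc j) * h = (z + of_nat j * h) + h"
      by (simp add: algebra_simps)
    then show ?thesis by (simp only: cos_add[of "z + of_nat j * h" h] h mult_zero_right mult_1_right diff_0)
  qed
  have sh: "sin (z + h) = cos z" for z
    by (simp add: sin_add h)
  have Es: "((\<lambda>u. E m n u t) has_field_derivative E (Suc m) n s t) (at s)" for m n s t
    unfolding E_def add_Suc shift by (auto intro!: derivative_eq_intros simp: algebra_simps)
  have Et: "((\<lambda>u. E m n s u) has_field_derivative E m (Suc n) s t) (at t)" for m n s t
    unfolding E_def add_Suc_right shift by (auto intro!: derivative_eq_intros simp: algebra_simps)
  define D where "D m n s t = E m n (of_real s) (of_real t)" for m n s t
  have Ds: "((\<lambda>u. D m n u t) has_vector_derivative D (Suc m) n s t) (at s within A)" for m n s t A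
    unfolding D_def by (rule has_vector_derivative_real_field) (rule Es)
  have Dt: "((\<lambda>u. D m n s u) has_vector_derivative D m (Suc n) s t) (at t within A)" for m n s t A
    unfolding D_def by (rule has_vector_derivative_real_field) (rule Et)
  have cont: "continuous_on A (\<lambda>(s, t). D m n s t)" for m n A
    unfolding D_def E_def case_prod_unfold by (intro continuous_intros)
  have ode: "D 2 0 s t + \<kappa>\<^sup>2 * D 0 0 s t = 0" "D 0 2 s t + \<kappa>\<^sup>2 * D 0 0 s t = 0" for s t
    unfolding D_def E_def numeral_2_eq_2 add_Suc add_Suc_right add_0 shift
    by (simp_all add: sh) (simp_all add: algebra_simps power2_eq_square)
  have "\<forall>s\<in>{0<..<l}. \<forall>e\<in>{0, l}.
     ((\<lambda>t. exp (\<i> * \<kappa> * of_real \<bar>s - t\<bar>) / (2 * \<i> * \<kappa>) + D 0 0 s t)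
        has_vector_derivative 0) (at e within {0..l})"
  proof (intro ballI)
    fix s e assume s: "s \<in> {0<..<l}" and e: "e \<in> {0, l}"
    define \<sigma> where "\<sigma> = (if e = 0 then 1 else -1 :: real)"
    have ev: "\<forall>\<^sub>F t in at e within {0..l}. \<bar>s - t\<bar> = \<sigma> * (s - t)"
    proof -
      have "\<forall>\<^sub>F t in at e. t \<in> (if e = 0 then {..<s} else {s<..})"
        using s e assms by (intro eventually_at_in_open') auto
      then show ?thesis using assms s
        by (auto simp: eventually_at_filter \<sigma>_def elim!: eventually_mono split: if_splits)
    qed
    have val: "- of_real \<sigma> * exp (\<i> * \<kappa> * of_real (\<sigma> * (s - e))) / 2 + D 0 1 s e = 0"
    proof -
      have D01: "D 0 1 s e = P * \<kappa> * sin (\<kappa> * (L - s - e)) + Q * \<kappa> * sin (\<kappa> * (s - e))"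
        unfolding D_def E_def One_nat_def add_0 shift by simp
      have ek: "exp (\<i> * z) = cos z + \<i> * sin z" for z :: complex
        by (rule exp_Euler)
      have PQ: "P * \<kappa> = 1 / (2 * S)" "Q * \<kappa> = (cos (\<kappa> * L) + \<i> * S) / (2 * S)"
        unfolding P_def Q_def using k0 by simp_all
      show ?thesis
      proof (cases "e = 0")
        case True
        have "sin (\<kappa> * (L - s)) = S * cos (\<kappa> * s) - cos (\<kappa> * L) * sin (\<kappa> * s)"
          by (simp add: right_diff_distrib sin_diff S_def)
        then show ?thesis unfolding D01 PQ using True S
          by (simp add: \<sigma>_def ek mult.assoc) (simp add: field_simps)
      next
        case False
        then have "e = l" using e by simp
        have 1: "sin (\<kappa> * (s - L)) = - sin (\<kappa> * (L - s))"
          by (simp add: sin_minus[symmetric] algebra_simps del: sin_minus)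
        have 2: "sin (\<kappa> * (L - s - L)) = - (S * cos (\<kappa> * (L - s)) - cos (\<kappa> * L) * sin (\<kappa> * (L - s)))"
          unfolding S_def sin_diff[symmetric] by (simp add: algebra_simps)
        show ?thesis unfolding D01 PQ using False S 1 2 \<open>e = l\<close>
          apply (simp add: \<sigma>_def ek mult.assoc flip: L_def)
          apply (thin_tac "_ = _")+
          apply (simp add: field_simps)
          done
      qed
    qed
    have "((\<lambda>t. exp (\<i> * \<kappa> * (of_real \<sigma> * (of_real s - t))) / (2 * \<i> * \<kappa>) + E 0 0 (of_real s) t)
            has_field_derivative
            (- of_real \<sigma> * exp (\<i> * \<kappa> * of_real (\<sigma> * (s - e))) / 2 + D 0 1 s e)) (at (of_real e))"
      unfolding D_def using k0
      by (auto intro!: derivative_eq_intros Et simp: field_simps)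
    from has_vector_derivative_real_field[OF this, of "{0..l}", unfolded val]
    have "((\<lambda>t. exp (\<i> * \<kappa> * of_real (\<sigma> * (s - t))) / (2 * \<i> * \<kappa>) + D 0 0 s t)
            has_vector_derivative 0) (at e within {0..l})"
      by (simp add: D_def)
    then show "((\<lambda>t. exp (\<i> * \<kappa> * of_real \<bar>s - t\<bar>) / (2 * \<i> * \<kappa>) + D 0 0 s t)
        has_vector_derivative 0) (at e within {0..l})"
      unfolding has_vector_derivative_def
    proof (rule has_derivative_transform_eventually)
      show "\<forall>\<^sub>F t in at e within {0..l}.
          exp (\<i> * \<kappa> * of_real (\<sigma> * (s - t))) / (2 * \<i> * \<kappa>) + D 0 0 s t =
          exp (\<i> * \<kappa> * of_real \<bar>s - t\<bar>) / (2 * \<i> * \<kappa>) + D 0 0 s t"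
        using ev by eventually_elim simp
      show "exp (\<i> * \<kappa> * of_real (\<sigma> * (s - e))) / (2 * \<i> * \<kappa>) + D 0 0 s e =
          exp (\<i> * \<kappa> * of_real \<bar>s - e\<bar>) / (2 * \<i> * \<kappa>) + D 0 0 s e"
        using s e assms by (auto simp: \<sigma>_def)
      show "e \<in> {0..l}" using e assms by auto
    qed
  qed
  then have "is_green_remainder \<kappa> l (D 0 0)"
    unfolding is_green_remainder_def using cont Ds Dt ode by (intro conjI exI[of _ D]) auto
  then show ?thesis by blast
qed

lemma green_remainder_unique:
  assumes im: "0 < Im \<kappa>" and l: "0 < l"
    and r: "is_green_remainder \<kappa> l \<psi>" "is_green_remainder \<kappa> l \<psi>'"
    and st: "s \<in> {0..l}" "t \<in> {0..l}"
  shows "\<psi> s t = \<psi>' s t"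
proof -
  have k0: "\<kappa> \<noteq> 0" using im by auto
  have S: "sin (\<kappa> * of_real l) \<noteq> 0"
  proof
    assume "sin (\<kappa> * of_real l) = 0"
    then obtain n :: int where n: "\<kappa> * of_real l = of_real (n * pi)"
      using sin_eq_0 by auto
    have "Im (\<kappa> * of_real l) = 0" unfolding n by simp
    then show False using im l by simp
  qed
  obtain D :: "nat \<Rightarrow> nat \<Rightarrow> real \<Rightarrow> real \<Rightarrow> complex" where D: "\<And>m n. continuous_on ({0..l} \<times> {0..l}) (\<lambda>(s, s'). D m n s s')"
    "\<And>m n s t. s \<in> {0..l} \<Longrightarrow> t \<in> {0..l} \<Longrightarrow>
       ((\<lambda>u. D m n s u) has_vector_derivative D m (Suc n) s t) (at t within {0..l})"
    "\<And>s t. s \<in> {0..l} \<Longrightarrow> t \<in> {0..l} \<Longrightarrow> \<psi> s t = D 0 0 s t"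
    "\<And>s t. s \<in> {0..l} \<Longrightarrow> t \<in> {0..l} \<Longrightarrow> D 0 2 s t + \<kappa>\<^sup>2 * \<psi> s t = 0"
    using r(1) unfolding is_green_remainder_def
    apply (elim conjE exE)
    subgoal for D by (rule that[of D]; blast)
    done
  obtain D' :: "nat \<Rightarrow> nat \<Rightarrow> real \<Rightarrow> real \<Rightarrow> complex" where D': "\<And>m n. continuous_on ({0..l} \<times> {0..l}) (\<lambda>(s, s'). D' m n s s')"
    "\<And>m n s t. s \<in> {0..l} \<Longrightarrow> t \<in> {0..l} \<Longrightarrow>
       ((\<lambda>u. D' m n s u) has_vector_derivative D' m (Suc n) s t) (at t within {0..l})"
    "\<And>s t. s \<in> {0..l} \<Longrightarrow> t \<in> {0..l} \<Longrightarrow> \<psi>' s t = D' 0 0 s t"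
    "\<And>s t. s \<in> {0..l} \<Longrightarrow> t \<in> {0..l} \<Longrightarrow> D' 0 2 s t + \<kappa>\<^sup>2 * \<psi>' s t = 0"
    using r(2) unfolding is_green_remainder_def
    apply (elim conjE exE)
    subgoal for D by (rule that[of D]; blast)
    done
  have inner: "D 0 0 x t = D' 0 0 x t" if x: "x \<in> {0<..<l}" for x
  proof -
    have x': "x \<in> {0..l}" using x by simp
    define u where "u y = D 0 0 x y - D' 0 0 x y" for y
    define v where "v y = D 0 1 x y - D' 0 1 x y" for y
    have u: "(u has_vector_derivative v y) (at y within {0..l})" if "y \<in> {0..l}" for y
      unfolding u_def v_def using D(2)[OF x' that, of 0 0] D'(2)[OF x' that, of 0 0]
      by (auto intro!: derivative_eq_intros)
    have v: "(v has_vector_derivative - \<kappa>\<^sup>2 * u y) (at y within {0..l})" if "y \<in> {0..l}" for y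
    proof -
      have "(v has_vector_derivative D 0 2 x y - D' 0 2 x y) (at y within {0..l})"
        unfolding v_def using D(2)[OF x' that, of 0 1] D'(2)[OF x' that, of 0 1]
        by (auto intro!: derivative_eq_intros simp: numeral_2_eq_2)
      moreover have "D 0 2 x y - D' 0 2 x y = - \<kappa>\<^sup>2 * u y"
        using D(3,4)[OF x' that] D'(3,4)[OF x' that]
        by (simp add: u_def algebra_simps add_eq_0_iff)
      ultimately show ?thesis by simp
    qed
    have bdry: "v e = 0" if e: "e \<in> {0, l}" for e
    proof -
      have e': "e \<in> {0..l}" using e l by auto
      let ?E = "\<lambda>y. exp (\<i> * \<kappa> * of_real \<bar>x - y\<bar>) / (2 * \<i> * \<kappa>)"
      have "((\<lambda>y. ?E y + \<psi> x y) has_vector_derivative 0) (at e within {0..l})"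
        "((\<lambda>y. ?E y + \<psi>' x y) has_vector_derivative 0) (at e within {0..l})"
        using r x e unfolding is_green_remainder_def by blast+
      from has_vector_derivative_diff[OF this]
      have "((\<lambda>y. \<psi> x y - \<psi>' x y) has_vector_derivative 0) (at e within {0..l})" by simp
      then have "(u has_vector_derivative 0) (at e within {0..l})"
        by (rule has_vector_derivative_transform[rotated 2])
           (use e' x' D(3) D'(3) in \<open>auto simp: u_def\<close>)
      with u[OF e'] show ?thesis
        using vector_derivative_unique_within[of e "{0..l}" u "v e" 0] l e'
        by (auto simp: trivial_limit_within islimpt_Icc)
    qed
    define c where "c y = cos (\<kappa> * of_real y)" for y :: real
    define d where "d y = sin (\<kappa> * of_real y)" for y :: real
    have c: "(c has_vector_derivative - \<kappa> * d y) (at y within {0..l})" for y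
      unfolding c_def[abs_def] d_def
      by (rule has_vector_derivative_real_field[where f = "\<lambda>z. cos (\<kappa> * z)"])
         (auto intro!: derivative_eq_intros)
    have d: "(d has_vector_derivative \<kappa> * c y) (at y within {0..l})" for y
      unfolding d_def[abs_def] c_def
      by (rule has_vector_derivative_real_field[where f = "\<lambda>z. sin (\<kappa> * z)"])
         (auto intro!: derivative_eq_intros)
    have p: "\<exists>C. \<forall>y\<in>{0..l}. \<kappa> * u y * c y - v y * d y = C"
    proof (rule has_vector_derivative_zero_constant[of "{0..l}"])
      show "((\<lambda>y. \<kappa> * u y * c y - v y * d y) has_vector_derivative 0) (at y within {0..l})"
        if "y \<in> {0..l}" for y
        using u[OF that] v[OF that] c[of y] d[of y]
        by (auto intro!: derivative_eq_intros simp: algebra_simps power2_eq_square)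
    qed (auto)
    have q: "\<exists>C. \<forall>y\<in>{0..l}. \<kappa> * u y * d y + v y * c y = C"
    proof (rule has_vector_derivative_zero_constant[of "{0..l}"])
      show "((\<lambda>y. \<kappa> * u y * d y + v y * c y) has_vector_derivative 0) (at y within {0..l})"
        if "y \<in> {0..l}" for y
        using u[OF that] v[OF that] c[of y] d[of y]
        by (auto intro!: derivative_eq_intros simp: algebra_simps power2_eq_square)
    qed (auto)
    have 0: "c 0 = 1" "d 0 = 0" "d l \<noteq> 0" using S by (auto simp: c_def d_def)
    have P: "\<kappa> * u y * c y - v y * d y = \<kappa> * u 0" if "y \<in> {0..l}" for y
      using p that l 0 bdry by (metis atLeastAtMost_iff diff_zero insertI1 less_imp_le mult_1_right mult_zero_left order_refl)
    have Q: "\<kappa> * u y * d y + v y * c y = 0" if "y \<in> {0..l}" for y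
      using q that l 0 bdry by (metis (no_types) add.right_neutral atLeastAtMost_iff insertI1 less_imp_le mult_zero_left mult_zero_right order_refl)
    have "u l = 0" using Q[of l] bdry[of l] l 0 k0 by auto
    then have "u 0 = 0" using P[of l] bdry[of l] l k0 by auto
    have cd: "c t * c t + d t * d t = 1"
      using sin_cos_squared_add3[of "\<kappa> * of_real t"] by (simp add: c_def d_def)
    have "\<kappa> * u t * (c t * c t + d t * d t) =
        (\<kappa> * u t * c t - v t * d t) * c t + (\<kappa> * u t * d t + v t * c t) * d t"
      by (simp add: algebra_simps)
    then have "u t = 0" unfolding P[OF st(2)] Q[OF st(2)] cd using \<open>u 0 = 0\<close> k0 by simp
    then show ?thesis by (simp add: u_def)
  qed
  have contD: "continuous_on {0..l} (\<lambda>x. D 0 0 x t - D' 0 0 x t)"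
  proof -
    have "continuous_on {0..l} (\<lambda>x. (\<lambda>(s, s'). D 0 0 s s') (x, t))"
      by (rule continuous_on_compose2[OF D(1)]) (use st in \<open>auto intro!: continuous_intros\<close>)
    moreover have "continuous_on {0..l} (\<lambda>x. (\<lambda>(s, s'). D' 0 0 s s') (x, t))"
      by (rule continuous_on_compose2[OF D'(1)]) (use st in \<open>auto intro!: continuous_intros\<close>)
    ultimately show ?thesis by (auto intro!: continuous_intros)
  qed
  have "D 0 0 s t - D' 0 0 s t = 0"
    by (rule continuous_constant_on_closure[of "{0<..<l}" "\<lambda>x. D 0 0 x t - D' 0 0 x t"])
       (use contD l st inner in auto)
  then show ?thesis using st D(3) D'(3) by simp
qed

end

(*
  Eliminating the wall densities leaves M = K_circ + sum_i K_(circ,star_i) B_i. The diagonal part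
  of K_circ is I/2 plus weakly singular operators, because an end cap with its fins is
  a C^(1,1) curve; these are compact on L2. It remains to see that each K_(circ,star_i) B_i
  is compact, and for this it is enough that B_i maps L2 boundedly into H2 and that K_(circ,star_i)
  is bounded on L2, since H2 embeds compactly into L2. Away from the corners the kernels are smooth.
  At a corner, where the arcs meet at a right angle, the fin of the source curve is its mirror image
  up to higher order in the line of the target curve, so that the even (odd) reflection cancels the
  leading singularity of D' from the walls (of two derivatives of S from the caps). What is left
  is bounded by the Hardy kernel 1/(s + u), which is bounded on L2 by the Schur test. The operators
  G_i gain the two derivatives for the remaining terms, and the invertibility hypotheses are only
  used to make the inverses bounded.
*)

theory Submission
  imports Defs "HOL-Complex_Analysis.Great_Picard" "HOL-Real_Asymp.Real_Asymp"
begin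

section \<open>Operators on seminormed function spaces\<close>

text \<open>Two obstacles shape the proof. Instead Taylor's formula writes the kernel as
  \<open>K 0 u + s * b u\<close> plus an integral of \<open>max 0 (s - t)\<close> against the second
  derivative; Fubini moves that integral outside, and \<open>H2\<close> membership is read off from
  the outcome. The slope \<open>b u\<close> is never estimated: the formula at \<open>s = l\<close>
  expresses it through terms that can be integrated against the density. The other obstacle is the
  value at corner targets, where integrals may diverge. Bounds into L2 between adjacent curves are
  proved from targets in the open interval, while S, whose singularity is logarithmic, is controlled
  on the closed one. The kernel enters as a function of the squared distance, which a reflection at
  a corner changes by a third-order term only; cancellation becomes a mean value estimate.
  Logarithms are bounded by a negative fourth root, whose square is integrable.\<close>

locale seminormed_fs =
  fixes X :: "'a function_space"
  assumes zero_mem: "(\<lambda>_. 0) \<in> fs_set X"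
    and add_mem: "f \<in> fs_set X \<Longrightarrow> g \<in> fs_set X \<Longrightarrow> (\<lambda>x. f x + g x) \<in> fs_set X"
    and scale_mem: "f \<in> fs_set X \<Longrightarrow> (\<lambda>x. c * f x) \<in> fs_set X"
    and norm_nonneg: "f \<in> fs_set X \<Longrightarrow> 0 \<le> fs_norm X f"
    and norm_add: "f \<in> fs_set X \<Longrightarrow> g \<in> fs_set X \<Longrightarrow>
      fs_norm X (\<lambda>x. f x + g x) \<le> fs_norm X f + fs_norm X g"
    and norm_scale: "f \<in> fs_set X \<Longrightarrow> fs_norm X (\<lambda>x. c * f x) = cmod c * fs_norm X f"
begin

lemma diff_mem: "f \<in> fs_set X \<Longrightarrow> g \<in> fs_set X \<Longrightarrow> (\<lambda>x. f x - g x) \<in> fs_set X"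
  using add_mem[of f "\<lambda>x. -1 * g x"] scale_mem[of g "-1"] by simp

lemma norm_diff_commute:
  "f \<in> fs_set X \<Longrightarrow> g \<in> fs_set X \<Longrightarrow> fs_norm X (\<lambda>x. f x - g x) = fs_norm X (\<lambda>x. g x - f x)"
  using norm_scale[of "\<lambda>x. g x - f x" "-1"] diff_mem[of g f] by simp

lemma norm_diff_triangle:
  assumes "f \<in> fs_set X" "g \<in> fs_set X" "h \<in> fs_set X"
  shows "fs_norm X (\<lambda>x. f x - h x) \<le> fs_norm X (\<lambda>x. f x - g x) + fs_norm X (\<lambda>x. g x - h x)"
  using norm_add[of "\<lambda>x. f x - g x" "\<lambda>x. g x - h x"] diff_mem assms by simp

lemma norm_le_diff:
  assumes "f \<in> fs_set X" "g \<in> fs_set X"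
  shows "fs_norm X f \<le> fs_norm X g + fs_norm X (\<lambda>x. f x - g x)"
  using norm_add[of g "\<lambda>x. f x - g x"] diff_mem assms by simp

lemma norm_zero: "fs_norm X (\<lambda>_. 0) = 0"
  using norm_scale[OF zero_mem, of 0] by simp

lemma eq_refl: "fs_eq X f f"
  using norm_zero by (simp add: fs_eq_def)

lemma eq_sym: "f \<in> fs_set X \<Longrightarrow> g \<in> fs_set X \<Longrightarrow> fs_eq X f g \<Longrightarrow> fs_eq X g f"
  using norm_diff_commute[of g f] by (simp add: fs_eq_def)

lemma eq_trans:
  assumes "f \<in> fs_set X" "g \<in> fs_set X" "h \<in> fs_set X" "fs_eq X f g" "fs_eq X g h"
  shows "fs_eq X f h"
  using norm_diff_triangle[of f g h] norm_nonneg[OF diff_mem[of f h]] assms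
  by (simp add: fs_eq_def)

lemma eq_add:
  assumes "f \<in> fs_set X" "g \<in> fs_set X" "f' \<in> fs_set X" "g' \<in> fs_set X"
    "fs_eq X f f'" "fs_eq X g g'"
  shows "fs_eq X (\<lambda>x. f x + g x) (\<lambda>x. f' x + g' x)"
proof -
  have "fs_norm X (\<lambda>x. (f x - f' x) + (g x - g' x)) \<le> 0"
    using norm_add[of "\<lambda>x. f x - f' x" "\<lambda>x. g x - g' x"] assms diff_mem by (simp add: fs_eq_def)
  moreover have "0 \<le> fs_norm X (\<lambda>x. (f x - f' x) + (g x - g' x))"
    using assms by (intro norm_nonneg add_mem diff_mem)
  ultimately show ?thesis by (simp add: fs_eq_def algebra_simps)
qed

lemma eq_scale:
  assumes "f \<in> fs_set X" "g \<in> fs_set X" "fs_eq X f g"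
  shows "fs_eq X (\<lambda>x. c * f x) (\<lambda>x. c * g x)"
  using norm_scale[OF diff_mem[OF assms(1,2)], of c] assms
  by (simp add: fs_eq_def right_diff_distrib)

lemma eq_norm:
  assumes "f \<in> fs_set X" "g \<in> fs_set X" "fs_eq X f g"
  shows "fs_norm X f = fs_norm X g"
  using norm_le_diff[of f g] norm_le_diff[of g f] norm_diff_commute[of f g] assms
  by (simp add: fs_eq_def)

end

section \<open>Linear and bounded operators modulo null functions\<close>

lemma linear_op_mem: "linear_op X Y T \<Longrightarrow> f \<in> fs_set X \<Longrightarrow> T f \<in> fs_set Y"
  by (simp add: linear_op_def)

text \<open>\<open>linear_op\<close> asserts additivity and homogeneity only up to
  \<open>fs_eq\<close>, so subtraction has to be assembled from them by transitivity of
  \<open>fs_eq\<close> in \<open>Y\<close>, with \<open>-1 * g\<close> in the role of the second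
  summand.\<close>

lemma linear_op_diff:
  assumes X: "seminormed_fs X" and Y: "seminormed_fs Y" and T: "linear_op X Y T"
    and f: "f \<in> fs_set X" and g: "g \<in> fs_set X"
  shows "fs_eq Y (T (\<lambda>x. f x - g x)) (\<lambda>y. T f y - T g y)"
proof -
  interpret X: seminormed_fs X by fact
  interpret Y: seminormed_fs Y by fact
  let ?g = "\<lambda>x. -1 * g x"
  have g': "?g \<in> fs_set X" using X.scale_mem[OF g] .
  have 1: "fs_eq Y (T (\<lambda>x. f x + ?g x)) (\<lambda>y. T f y + T ?g y)"
    by (rule T[unfolded linear_op_def, THEN conjunct2, THEN conjunct1, rule_format, OF f g'])
  have "fs_eq Y (T ?g) (\<lambda>y. -1 * T g y)"
    using T g unfolding linear_op_def by blast
  then have 2: "fs_eq Y (\<lambda>y. T f y + T ?g y) (\<lambda>y. T f y + -1 * T g y)"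
    by (intro Y.eq_add Y.eq_refl Y.scale_mem linear_op_mem[OF T] f g g')
  have "fs_eq Y (T (\<lambda>x. f x + ?g x)) (\<lambda>y. T f y + -1 * T g y)"
    by (rule Y.eq_trans[OF _ _ _ 1 2])
       (intro Y.add_mem Y.scale_mem linear_op_mem[OF T] X.add_mem X.scale_mem f g)+
  then show ?thesis by simp
qed

lemma bounded_opI:
  assumes "linear_op X Y T" "\<And>f. f \<in> fs_set X \<Longrightarrow> fs_norm Y (T f) \<le> B * fs_norm X f"
  shows "bounded_op X Y T"
  using assms by (auto simp: bounded_op_def)

lemma bounded_op_linear: "bounded_op X Y T \<Longrightarrow> linear_op X Y T"
  by (simp add: bounded_op_def)

lemma bounded_op_mem: "bounded_op X Y T \<Longrightarrow> f \<in> fs_set X \<Longrightarrow> T f \<in> fs_set Y"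
  by (simp add: bounded_op_def linear_op_def)

text \<open>\<open>bounded_op\<close> leaves the sign of its constant open. Passing to
  \<open>max B 0\<close> is possible because norms of members are nonnegative, and a nonnegative
  constant is what multiplying bounds requires.\<close>

lemma bounded_op_bound:
  assumes X: "seminormed_fs X" and T: "bounded_op X Y T"
  obtains B where "0 \<le> B" "\<And>f. f \<in> fs_set X \<Longrightarrow> fs_norm Y (T f) \<le> B * fs_norm X f"
proof -
  interpret X: seminormed_fs X by fact
  obtain B where B: "\<And>f. f \<in> fs_set X \<Longrightarrow> fs_norm Y (T f) \<le> B * fs_norm X f"
    using T by (auto simp: bounded_op_def)
  have "fs_norm Y (T f) \<le> max B 0 * fs_norm X f" if "f \<in> fs_set X" for f
    using B[OF that] X.norm_nonneg[OF that]
    by (meson dual_order.trans max.cobounded1 mult_right_mono)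
  then show ?thesis using that[of "max B 0"] by simp
qed

text \<open>\<open>T (f - g)\<close> and \<open>T f - T g\<close> agree only up to a null function,
  so the estimate goes through \<open>eq_norm\<close>. This is the form in which boundedness is
  applied to convergent sequences.\<close>

lemma bounded_op_lipschitz:
  assumes X: "seminormed_fs X" and Y: "seminormed_fs Y" and T: "bounded_op X Y T"
  obtains B where "0 \<le> B" "\<And>f g. f \<in> fs_set X \<Longrightarrow> g \<in> fs_set X \<Longrightarrow>
    fs_norm Y (\<lambda>y. T f y - T g y) \<le> B * fs_norm X (\<lambda>x. f x - g x)"
proof -
  interpret X: seminormed_fs X by fact
  interpret Y: seminormed_fs Y by fact
  obtain B where B: "0 \<le> B" "\<And>f. f \<in> fs_set X \<Longrightarrow> fs_norm Y (T f) \<le> B * fs_norm X f"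
    by (rule bounded_op_bound[OF X T]) auto
  have "fs_norm Y (\<lambda>y. T f y - T g y) \<le> B * fs_norm X (\<lambda>x. f x - g x)"
    if f: "f \<in> fs_set X" and g: "g \<in> fs_set X" for f g
  proof -
    have "fs_norm Y (T (\<lambda>x. f x - g x)) = fs_norm Y (\<lambda>y. T f y - T g y)"
      by (rule Y.eq_norm[OF _ _ linear_op_diff[OF X Y bounded_op_linear[OF T] f g]])
         (intro Y.diff_mem bounded_op_mem[OF T] X.diff_mem f g)+
    then show ?thesis using B(2)[OF X.diff_mem[OF f g]] by simp
  qed
  then show ?thesis using that B(1) by blast
qed

text \<open>Boundedness sends null functions to null functions, so the operator respects the choice
  of representatives. Compositions of operators that are linear only up to \<open>fs_eq\<close> rest
  on this.\<close>

lemma bounded_op_eq: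
  assumes "seminormed_fs X" and Y: "seminormed_fs Y" and T: "bounded_op X Y T"
    and "f \<in> fs_set X" "g \<in> fs_set X" "fs_eq X f g"
  shows "fs_eq Y (T f) (T g)"
proof -
  interpret Y: seminormed_fs Y by fact
  obtain B where "\<And>f g. f \<in> fs_set X \<Longrightarrow> g \<in> fs_set X \<Longrightarrow>
    fs_norm Y (\<lambda>y. T f y - T g y) \<le> B * fs_norm X (\<lambda>x. f x - g x)"
    by (rule bounded_op_lipschitz[OF assms(1-3)]) auto
  from this[of f g] assms Y.norm_nonneg[OF Y.diff_mem[of "T f" "T g"]] bounded_op_mem[OF T]
  show ?thesis by (auto simp: fs_eq_def intro: order.antisym)
qed

lemma linear_op_cong:
  assumes X: "seminormed_fs X" and Y: "seminormed_fs Y" and T: "linear_op X Y T"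
    and mem: "\<And>f. f \<in> fs_set X \<Longrightarrow> T' f \<in> fs_set Y"
    and eq: "\<And>f. f \<in> fs_set X \<Longrightarrow> fs_eq Y (T' f) (T f)"
  shows "linear_op X Y T'"
proof -
  interpret X: seminormed_fs X by fact
  interpret Y: seminormed_fs Y by fact
  note Tm = linear_op_mem[OF T]
  have eq': "f \<in> fs_set X \<Longrightarrow> fs_eq Y (T f) (T' f)" for f
    using Y.eq_sym eq mem Tm by blast
  have "fs_eq Y (T' (\<lambda>x. f x + g x)) (\<lambda>y. T' f y + T' g y)" if f: "f \<in> fs_set X" and g: "g \<in> fs_set X" for f g
  proof -
    have "fs_eq Y (T (\<lambda>x. f x + g x)) (\<lambda>y. T f y + T g y)"
      using T f g by (simp add: linear_op_def)
    with eq[OF X.add_mem[OF f g]] have "fs_eq Y (T' (\<lambda>x. f x + g x)) (\<lambda>y. T f y + T g y)"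
      by (rule Y.eq_trans[rotated 3]) (intro X.add_mem Y.add_mem mem Tm f g)+
    moreover have "fs_eq Y (\<lambda>y. T f y + T g y) (\<lambda>y. T' f y + T' g y)"
      by (intro Y.eq_add eq' mem Tm f g)
    ultimately show ?thesis
      by (rule Y.eq_trans[rotated 3]) (intro X.add_mem Y.add_mem mem Tm f g)+
  qed
  moreover have "fs_eq Y (T' (\<lambda>x. c * f x)) (\<lambda>y. c * T' f y)" if f: "f \<in> fs_set X" for f c
  proof -
    have "fs_eq Y (T (\<lambda>x. c * f x)) (\<lambda>y. c * T f y)"
      using T f by (simp add: linear_op_def)
    with eq[OF X.scale_mem[OF f]] have "fs_eq Y (T' (\<lambda>x. c * f x)) (\<lambda>y. c * T f y)"
      by (rule Y.eq_trans[rotated 3]) (intro X.scale_mem Y.scale_mem mem Tm f)+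
    moreover have "fs_eq Y (\<lambda>y. c * T f y) (\<lambda>y. c * T' f y)"
      by (intro Y.eq_scale eq' mem Tm f)
    ultimately show ?thesis
      by (rule Y.eq_trans[rotated 3]) (intro X.scale_mem Y.scale_mem mem Tm f)+
  qed
  ultimately show ?thesis using mem by (simp add: linear_op_def)
qed

lemma bounded_op_cong:
  assumes X: "seminormed_fs X" and Y: "seminormed_fs Y" and T: "bounded_op X Y T"
    and mem: "\<And>f. f \<in> fs_set X \<Longrightarrow> T' f \<in> fs_set Y"
    and eq: "\<And>f. f \<in> fs_set X \<Longrightarrow> fs_eq Y (T' f) (T f)"
  shows "bounded_op X Y T'"
proof -
  interpret Y: seminormed_fs Y by fact
  have "fs_norm Y (T' f) = fs_norm Y (T f)" if "f \<in> fs_set X" for f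
    using Y.eq_norm[OF mem bounded_op_mem[OF T] eq] that by blast
  then show ?thesis
    using linear_op_cong[OF X Y bounded_op_linear[OF T] mem eq] T by (simp add: bounded_op_def)
qed

text \<open>\<open>T\<close> respects sums only up to \<open>fs_eq\<close> in \<open>Y\<close>; the
  assumption \<open>S_eq\<close> transports such an equation through \<open>S\<close>, after which
  the linearity of \<open>S\<close> finishes.\<close>

lemma linear_op_comp:
  assumes X: "seminormed_fs X" and Y: "seminormed_fs Y" and Z: "seminormed_fs Z"
    and T: "linear_op X Y T" and S: "linear_op Y Z S"
    and S_eq: "\<And>f g. f \<in> fs_set Y \<Longrightarrow> g \<in> fs_set Y \<Longrightarrow> fs_eq Y f g \<Longrightarrow> fs_eq Z (S f) (S g)"
  shows "linear_op X Z (\<lambda>f. S (T f))"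
proof -
  interpret X: seminormed_fs X by fact
  interpret Y: seminormed_fs Y by fact
  interpret Z: seminormed_fs Z by fact
  note Tm = linear_op_mem[OF T] and Sm = linear_op_mem[OF S]
  have "fs_eq Z (S (T (\<lambda>x. f x + g x))) (\<lambda>y. S (T f) y + S (T g) y)" if f: "f \<in> fs_set X" and g: "g \<in> fs_set X" for f g
  proof -
    have "fs_eq Z (S (T (\<lambda>x. f x + g x))) (S (\<lambda>y. T f y + T g y))"
      by (intro S_eq Tm X.add_mem Y.add_mem f g) (use T f g in \<open>auto simp: linear_op_def\<close>)
    moreover have "fs_eq Z (S (\<lambda>y. T f y + T g y)) (\<lambda>y. S (T f) y + S (T g) y)"
      using S Tm[OF f] Tm[OF g] by (simp add: linear_op_def)
    ultimately show ?thesis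
      by (rule Z.eq_trans[rotated 3]) (intro X.add_mem Y.add_mem Z.add_mem Sm Tm f g)+
  qed
  moreover have "fs_eq Z (S (T (\<lambda>x. c * f x))) (\<lambda>y. c * S (T f) y)" if f: "f \<in> fs_set X" for f c
  proof -
    have "fs_eq Z (S (T (\<lambda>x. c * f x))) (S (\<lambda>y. c * T f y))"
      by (intro S_eq Tm X.scale_mem Y.scale_mem f) (use T f in \<open>auto simp: linear_op_def\<close>)
    moreover have "fs_eq Z (S (\<lambda>y. c * T f y)) (\<lambda>y. c * S (T f) y)"
      using S Tm[OF f] by (simp add: linear_op_def)
    ultimately show ?thesis
      by (rule Z.eq_trans[rotated 3]) (intro X.scale_mem Y.scale_mem Z.scale_mem Sm Tm f)+
  qed
  ultimately show ?thesis using Tm Sm by (simp add: linear_op_def)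
qed

lemma bounded_op_comp:
  assumes X: "seminormed_fs X" and Y: "seminormed_fs Y" and Z: "seminormed_fs Z"
    and T: "bounded_op X Y T" and S: "bounded_op Y Z S"
  shows "bounded_op X Z (\<lambda>f. S (T f))"
proof -
  obtain A where A: "0 \<le> A" "\<And>f. f \<in> fs_set X \<Longrightarrow> fs_norm Y (T f) \<le> A * fs_norm X f"
    by (rule bounded_op_bound[OF X T]) auto
  obtain B where B: "0 \<le> B" "\<And>f. f \<in> fs_set Y \<Longrightarrow> fs_norm Z (S f) \<le> B * fs_norm Y f"
    by (rule bounded_op_bound[OF Y S]) auto
  show ?thesis
  proof (rule bounded_opI)
    show "linear_op X Z (\<lambda>f. S (T f))"
      by (rule linear_op_comp[OF X Y Z bounded_op_linear[OF T] bounded_op_linear[OF S]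
            bounded_op_eq[OF Y Z S]])
    show "fs_norm Z (S (T f)) \<le> (B * A) * fs_norm X f" if "f \<in> fs_set X" for f
      using B(2)[OF bounded_op_mem[OF T that]] mult_left_mono[OF A(2)[OF that] B(1)]
      by (simp add: mult.assoc)
  qed
qed

lemma linear_op_add:
  assumes Y: "seminormed_fs Y" and S: "linear_op X Y S" and T: "linear_op X Y T"
    and X: "seminormed_fs X"
  shows "linear_op X Y (\<lambda>f y. S f y + T f y)"
proof -
  interpret X: seminormed_fs X by fact
  interpret Y: seminormed_fs Y by fact
  note Tm = linear_op_mem[OF T] and Sm = linear_op_mem[OF S]
  have "fs_eq Y (\<lambda>y. S (\<lambda>x. f x + g x) y + T (\<lambda>x. f x + g x) y)
      (\<lambda>y. (S f y + S g y) + (T f y + T g y))" if f: "f \<in> fs_set X" and g: "g \<in> fs_set X" for f g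
    by (intro Y.eq_add X.add_mem Y.add_mem Sm Tm f g) (use S T f g in \<open>auto simp: linear_op_def\<close>)
  moreover have "fs_eq Y (\<lambda>y. S (\<lambda>x. c * f x) y + T (\<lambda>x. c * f x) y)
      (\<lambda>y. c * S f y + c * T f y)" if f: "f \<in> fs_set X" for f c
    by (intro Y.eq_add X.scale_mem Y.scale_mem Sm Tm f) (use S T f in \<open>auto simp: linear_op_def\<close>)
  ultimately show ?thesis
    using Y.add_mem[OF Sm Tm] by (simp add: linear_op_def algebra_simps)
qed

lemma bounded_op_add:
  assumes X: "seminormed_fs X" and Y: "seminormed_fs Y"
    and S: "bounded_op X Y S" and T: "bounded_op X Y T"
  shows "bounded_op X Y (\<lambda>f y. S f y + T f y)"
proof -
  interpret Y: seminormed_fs Y by fact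
  obtain A where A: "0 \<le> A" "\<And>f. f \<in> fs_set X \<Longrightarrow> fs_norm Y (S f) \<le> A * fs_norm X f"
    by (rule bounded_op_bound[OF X S]) auto
  obtain B where B: "0 \<le> B" "\<And>f. f \<in> fs_set X \<Longrightarrow> fs_norm Y (T f) \<le> B * fs_norm X f"
    by (rule bounded_op_bound[OF X T]) auto
  show ?thesis
  proof (rule bounded_opI)
    show "linear_op X Y (\<lambda>f y. S f y + T f y)"
      by (rule linear_op_add[OF Y bounded_op_linear[OF S] bounded_op_linear[OF T] X])
    show "fs_norm Y (\<lambda>y. S f y + T f y) \<le> (A + B) * fs_norm X f" if f: "f \<in> fs_set X" for f
      using Y.norm_add[OF bounded_op_mem[OF S f] bounded_op_mem[OF T f]] A(2)[OF f] B(2)[OF f]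
      by (simp add: distrib_right)
  qed
qed

lemma bounded_op_scaling:
  assumes "seminormed_fs X"
  shows "bounded_op X X (\<lambda>f x. c * f x)"
proof -
  interpret X: seminormed_fs X by fact
  show ?thesis
    by (intro bounded_opI[where B = "cmod c"])
       (auto simp: linear_op_def X.scale_mem X.norm_scale X.eq_refl distrib_left mult.left_commute)
qed

lemma bounded_op_scale:
  assumes "seminormed_fs X" "seminormed_fs Y" "bounded_op X Y T"
  shows "bounded_op X Y (\<lambda>f y. c * T f y)"
  by (rule bounded_op_comp[OF assms(1,2,2,3) bounded_op_scaling[OF assms(2)]])

lemma bounded_op_diff:
  assumes "seminormed_fs X" "seminormed_fs Y" "bounded_op X Y S" "bounded_op X Y T"
  shows "bounded_op X Y (\<lambda>f y. S f y - T f y)"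
  using bounded_op_add[OF assms(1-3) bounded_op_scale[OF assms(1,2,4), of "-1"]] by simp

text \<open>\<open>inverse_op\<close> picks an arbitrary solution for each right-hand side, so
  nothing about its regularity is visible at first. Applying the bounded inverse \<open>S\<close> to
  \<open>T f = g\<close> shows that every solution equals \<open>S g\<close> up to
  \<open>fs_eq\<close>; the choice therefore inherits linearity and the bound from
  \<open>S\<close>.\<close>

lemma bounded_inverse_op:
  assumes X: "seminormed_fs X" and T: "invertible_op X T"
  shows "bounded_op X X (inverse_op X T)"
proof -
  interpret X: seminormed_fs X by fact
  obtain S where S: "bounded_op X X S"
    and inv: "\<And>f. f \<in> fs_set X \<Longrightarrow> fs_eq X (S (T f)) f \<and> fs_eq X (T (S f)) f"
    using T by (auto simp: invertible_op_def)
  have T: "linear_op X X T" using T by (simp add: invertible_op_def)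
  have sol: "inverse_op X T g \<in> fs_set X \<and> fs_eq X (T (inverse_op X T g)) g" if g: "g \<in> fs_set X" for g
    unfolding inverse_op_def
    by (rule someI[of _ "S g"]) (use bounded_op_mem[OF S g] inv[OF g] in blast)
  have "fs_eq X (inverse_op X T g) (S g)" if g: "g \<in> fs_set X" for g
  proof -
    let ?f = "inverse_op X T g"
    have f: "?f \<in> fs_set X" and Tf: "fs_eq X (T ?f) g" using sol[OF g] by auto
    have "fs_eq X (S (T ?f)) (S g)"
      by (rule bounded_op_eq[OF X X S linear_op_mem[OF T f] g Tf])
    have "fs_eq X ?f (S (T ?f))"
      using inv[OF f] X.eq_sym bounded_op_mem[OF S] linear_op_mem[OF T] f by blast
    then show ?thesis using \<open>fs_eq X (S (T ?f)) (S g)\<close>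
      by (rule X.eq_trans[rotated 3]) (intro f g bounded_op_mem[OF S] linear_op_mem[OF T])+
  qed
  then show ?thesis using bounded_op_cong[OF X X S] sol by blast
qed

section \<open>Compact operators between seminormed spaces\<close>

lemma compact_op_linear: "compact_op X Y T \<Longrightarrow> linear_op X Y T"
  by (simp add: compact_op_def)

lemma compact_op_subseq:
  fixes f :: "nat \<Rightarrow> 'a \<Rightarrow> complex"
  assumes "compact_op X Y T" "\<And>n. f n \<in> fs_set X" "\<And>n. fs_norm X (f n) \<le> B"
  obtains r g where "strict_mono r" "g \<in> fs_set Y"
    "(\<lambda>n. fs_norm Y (\<lambda>y. T (f (r n)) y - g y)) \<longlonglongrightarrow> 0"
proof -
  have "\<exists>r g. strict_mono r \<and> g \<in> fs_set Y \<and> (\<lambda>n. fs_norm Y (\<lambda>y. T (f (r n)) y - g y)) \<longlonglongrightarrow> 0"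
    using assms unfolding compact_op_def by blast
  then show ?thesis using that by blast
qed

lemma compact_opI:
  assumes "linear_op X Y T"
    and "\<And>f B. (\<And>n. f n \<in> fs_set X) \<Longrightarrow> (\<And>n. fs_norm X (f n) \<le> B) \<Longrightarrow>
      \<exists>r g. strict_mono (r :: nat \<Rightarrow> nat) \<and> g \<in> fs_set Y \<and>
        (\<lambda>n. fs_norm Y (\<lambda>y. T (f (r n)) y - g y)) \<longlonglongrightarrow> 0"
  shows "compact_op X Y T"
  unfolding compact_op_def
proof (intro conjI allI impI assms(1))
  fix f :: "nat \<Rightarrow> 'a \<Rightarrow> complex"
  assume "(\<forall>n. f n \<in> fs_set X) \<and> (\<exists>B. \<forall>n. fs_norm X (f n) \<le> B)"
  then obtain B where "\<forall>n. f n \<in> fs_set X" "\<forall>n. fs_norm X (f n) \<le> B" by blast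
  then show "\<exists>r g. strict_mono r \<and> g \<in> fs_set Y \<and>
      (\<lambda>n. fs_norm Y (\<lambda>y. T (f (r n)) y - g y)) \<longlonglongrightarrow> 0"
    using assms(2)[of f B] by simp
qed

lemma compact_op_add:
  assumes X: "seminormed_fs X" and Y: "seminormed_fs Y"
    and S: "compact_op X Y S" and T: "compact_op X Y T"
  shows "compact_op X Y (\<lambda>f y. S f y + T f y)"
proof (rule compact_opI)
  interpret Y: seminormed_fs Y by fact
  show "linear_op X Y (\<lambda>f y. S f y + T f y)"
    by (rule linear_op_add[OF Y compact_op_linear[OF S] compact_op_linear[OF T] X])
  fix f :: "nat \<Rightarrow> 'a \<Rightarrow> complex" and B
  assume f: "\<And>n. f n \<in> fs_set X" and B: "\<And>n. fs_norm X (f n) \<le> B"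
  obtain r g where r: "strict_mono r" and g: "g \<in> fs_set Y"
    and rg: "(\<lambda>n. fs_norm Y (\<lambda>y. S (f (r n)) y - g y)) \<longlonglongrightarrow> 0"
    by (rule compact_op_subseq[OF S, of f, OF f B])
  \<comment> \<open>The second subsequence is extracted from the first, so that both limits hold
    along \<open>\<lambda>n. r (q n)\<close>.\<close>
  obtain q h where q: "strict_mono q" and h: "h \<in> fs_set Y"
    and qh: "(\<lambda>n. fs_norm Y (\<lambda>y. T (f (r (q n))) y - h y)) \<longlonglongrightarrow> 0"
    by (rule compact_op_subseq[OF T, of "\<lambda>n. f (r n)", OF f B])
  note mem = linear_op_mem[OF compact_op_linear[OF S] f] linear_op_mem[OF compact_op_linear[OF T] f]
  have lim: "(\<lambda>n. fs_norm Y (\<lambda>y. S (f (r (q n))) y - g y) + fs_norm Y (\<lambda>y. T (f (r (q n))) y - h y)) \<longlonglongrightarrow> 0"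
    using tendsto_add[OF LIMSEQ_subseq_LIMSEQ[OF rg q] qh] by (simp add: comp_def)
  have "(\<lambda>n. fs_norm Y (\<lambda>y. (S (f (r (q n))) y + T (f (r (q n))) y) - (g y + h y))) \<longlonglongrightarrow> 0"
  proof (rule tendsto_sandwich[OF _ _ tendsto_const lim])
    have "0 \<le> fs_norm Y (\<lambda>y. (S (f (r (q n))) y + T (f (r (q n))) y) - (g y + h y))" for n
      by (intro Y.norm_nonneg Y.diff_mem Y.add_mem mem g h)
    then show "\<forall>\<^sub>F n in sequentially. 0 \<le> fs_norm Y (\<lambda>y. (S (f (r (q n))) y + T (f (r (q n))) y) - (g y + h y))"
      by simp
    have "fs_norm Y (\<lambda>y. (S (f (r (q n))) y - g y) + (T (f (r (q n))) y - h y)) \<le>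
        fs_norm Y (\<lambda>y. S (f (r (q n))) y - g y) + fs_norm Y (\<lambda>y. T (f (r (q n))) y - h y)" for n
      by (intro Y.norm_add Y.diff_mem mem g h)
    then show "\<forall>\<^sub>F n in sequentially.
        fs_norm Y (\<lambda>y. (S (f (r (q n))) y + T (f (r (q n))) y) - (g y + h y)) \<le>
        fs_norm Y (\<lambda>y. S (f (r (q n))) y - g y) + fs_norm Y (\<lambda>y. T (f (r (q n))) y - h y)"
      by (simp add: algebra_simps)
  qed
  moreover have "strict_mono (\<lambda>n. r (q n))"
    using strict_mono_o[OF r q] by (simp add: comp_def)
  ultimately show "\<exists>r g. strict_mono r \<and> g \<in> fs_set Y \<and>
      (\<lambda>n. fs_norm Y (\<lambda>y. (S (f (r n)) y + T (f (r n)) y) - g y)) \<longlonglongrightarrow> 0"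
    using Y.add_mem[OF g h] by (intro exI[of _ "\<lambda>n. r (q n)"] exI[of _ "\<lambda>y. g y + h y"]) simp
qed

lemma bounded_compact_op:
  assumes X: "seminormed_fs X" and Y: "seminormed_fs Y" and Z: "seminormed_fs Z"
    and T: "compact_op X Y T" and S: "bounded_op Y Z S"
  shows "compact_op X Z (\<lambda>f. S (T f))"
proof (rule compact_opI)
  interpret Z: seminormed_fs Z by fact
  note TL = compact_op_linear[OF T]
  show "linear_op X Z (\<lambda>f. S (T f))"
    by (rule linear_op_comp[OF X Y Z TL bounded_op_linear[OF S] bounded_op_eq[OF Y Z S]])
  fix f :: "nat \<Rightarrow> 'a \<Rightarrow> complex" and B
  assume f: "\<And>n. f n \<in> fs_set X" and B: "\<And>n. fs_norm X (f n) \<le> B"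
  obtain r g where r: "strict_mono r" and g: "g \<in> fs_set Y"
    and rg: "(\<lambda>n. fs_norm Y (\<lambda>y. T (f (r n)) y - g y)) \<longlonglongrightarrow> 0"
    by (rule compact_op_subseq[OF T, of f, OF f B])
  obtain A where A: "\<And>f g. f \<in> fs_set Y \<Longrightarrow> g \<in> fs_set Y \<Longrightarrow>
    fs_norm Z (\<lambda>y. S f y - S g y) \<le> A * fs_norm Y (\<lambda>x. f x - g x)"
    by (rule bounded_op_lipschitz[OF Y Z S]) auto
  have "(\<lambda>n. fs_norm Z (\<lambda>y. S (T (f (r n))) y - S g y)) \<longlonglongrightarrow> 0"
  proof (rule tendsto_sandwich[OF _ _ tendsto_const])
    show "(\<lambda>n. A * fs_norm Y (\<lambda>y. T (f (r n)) y - g y)) \<longlonglongrightarrow> 0"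
      using tendsto_mult_left[OF rg, of A] by simp
    show "\<forall>\<^sub>F n in sequentially. 0 \<le> fs_norm Z (\<lambda>y. S (T (f (r n))) y - S g y)"
      by (intro always_eventually allI Z.norm_nonneg Z.diff_mem bounded_op_mem[OF S] linear_op_mem[OF TL] f g)
    show "\<forall>\<^sub>F n in sequentially. fs_norm Z (\<lambda>y. S (T (f (r n))) y - S g y) \<le> A * fs_norm Y (\<lambda>y. T (f (r n)) y - g y)"
      by (intro always_eventually allI A linear_op_mem[OF TL] f g)
  qed
  then show "\<exists>r g. strict_mono r \<and> g \<in> fs_set Z \<and>
      (\<lambda>n. fs_norm Z (\<lambda>y. S (T (f (r n))) y - g y)) \<longlonglongrightarrow> 0"
    using r bounded_op_mem[OF S g] by blast
qed

text \<open>A bounded operator maps bounded sequences to bounded ones, to which compactness of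
  \<open>S\<close> applies. \<open>S_eq\<close> serves linearity of the composition; in the
  applications it is obtained from boundedness of \<open>S\<close>.\<close>

lemma compact_bounded_op:
  assumes X: "seminormed_fs X" and Y: "seminormed_fs Y" and Z: "seminormed_fs Z"
    and T: "bounded_op X Y T" and S: "compact_op Y Z S"
    and S_eq: "\<And>f g. f \<in> fs_set Y \<Longrightarrow> g \<in> fs_set Y \<Longrightarrow> fs_eq Y f g \<Longrightarrow> fs_eq Z (S f) (S g)"
  shows "compact_op X Z (\<lambda>f. S (T f))"
proof (rule compact_opI)
  show "linear_op X Z (\<lambda>f. S (T f))"
    by (rule linear_op_comp[OF X Y Z bounded_op_linear[OF T] compact_op_linear[OF S] S_eq])
  obtain A where A: "0 \<le> A" "\<And>f. f \<in> fs_set X \<Longrightarrow> fs_norm Y (T f) \<le> A * fs_norm X f"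
    by (rule bounded_op_bound[OF X T]) auto
  fix f :: "nat \<Rightarrow> 'a \<Rightarrow> complex" and B
  assume f: "\<And>n. f n \<in> fs_set X" and B: "\<And>n. fs_norm X (f n) \<le> B"
  have "fs_norm Y (T (f n)) \<le> A * B" for n
    using A(2)[OF f, of n] mult_left_mono[OF B A(1), of n] by linarith
  then obtain r g where "strict_mono r" "g \<in> fs_set Z"
    "(\<lambda>n. fs_norm Z (\<lambda>y. S (T (f (r n))) y - g y)) \<longlonglongrightarrow> 0"
    by (rule compact_op_subseq[OF S bounded_op_mem[OF T f]])
  then show "\<exists>r g. strict_mono r \<and> g \<in> fs_set Z \<and>
      (\<lambda>n. fs_norm Z (\<lambda>y. S (T (f (r n))) y - g y)) \<longlonglongrightarrow> 0" by blast
qed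

section \<open>The spaces \<open>L\<^sup>2(0,l)\<close> and \<open>H\<^sup>2(0,l)\<close>\<close>

text \<open>The set integrals over \<open>lebesgue\<close> in the definitions are moved to this
  restricted measure. It is finite, so constants are integrable and products of two such measures
  obey Fubini.\<close>

abbreviation interval_measure :: "real \<Rightarrow> real measure" where
  "interval_measure l \<equiv> lebesgue_on {0..l}"

interpretation interval_measure: finite_measure "interval_measure l" for l
  by (rule finite_measure_lebesgue_on) simp

lemma set_integral_interval_measure:
  fixes f :: "real \<Rightarrow> 'b::{banach, second_countable_topology}"
  assumes "A \<in> sets lebesgue" "A \<subseteq> {0..l}"
  shows "(LINT s:A|lebesgue. f s) = (LINT s|interval_measure l. indicator A s *\<^sub>R f s)"
proof -
  have "indicator {0..l} s *\<^sub>R indicator A s *\<^sub>R f s = indicator A s *\<^sub>R f s" for s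
    using assms(2) by (auto simp: indicator_def)
  then show ?thesis
    by (simp add: set_lebesgue_integral_def integral_restrict_space del: scaleR_scaleR)
qed

lemma set_integral_interval_measure_full:
  fixes f :: "real \<Rightarrow> 'b::{banach, second_countable_topology}"
  shows "(LINT s:{0..l}|lebesgue. f s) = (LINT s|interval_measure l. f s)"
  by (simp add: set_lebesgue_integral_def integral_restrict_space)

section \<open>Square integrable functions on an interval\<close>

lemma L2_set_iff:
  "f \<in> fs_set (L2 l) \<longleftrightarrow>
    f \<in> borel_measurable (interval_measure l) \<and> integrable (interval_measure l) (\<lambda>s. (cmod (f s))\<^sup>2)"
  by (simp add: L2_def set_borel_measurable_def set_integrable_def
      borel_measurable_restrict_space_iff integrable_restrict_space)

lemma L2_norm_eq: "fs_norm (L2 l) f = sqrt (LINT s|interval_measure l. (cmod (f s))\<^sup>2)"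
  by (simp add: L2_def set_integral_interval_measure_full)

lemma L2_measurable: "f \<in> fs_set (L2 l) \<Longrightarrow> f \<in> borel_measurable (interval_measure l)"
  by (simp add: L2_set_iff)

lemma L2_square_integrable:
  "f \<in> fs_set (L2 l) \<Longrightarrow> integrable (interval_measure l) (\<lambda>s. (cmod (f s))\<^sup>2)"
  by (simp add: L2_set_iff)

lemma L2_norm_nonneg [simp]: "0 \<le> fs_norm (L2 l) f"
  by (simp add: L2_norm_eq)

lemma L2_norm_square: "(fs_norm (L2 l) f)\<^sup>2 = (LINT s|interval_measure l. (cmod (f s))\<^sup>2)"
  by (simp add: L2_norm_eq)

lemma L2_nn_integral:
  assumes "f \<in> fs_set (L2 l)"
  shows "(\<integral>\<^sup>+s. ennreal (cmod (f s))^2 \<partial>interval_measure l) = ennreal ((fs_norm (L2 l) f)\<^sup>2)"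
proof -
  have "(\<integral>\<^sup>+s. ennreal ((cmod (f s))\<^sup>2) \<partial>interval_measure l) = ennreal ((fs_norm (L2 l) f)\<^sup>2)"
    unfolding L2_norm_square by (rule nn_integral_eq_integral) (use L2_square_integrable[OF assms] in auto)
  then show ?thesis by (simp add: ennreal_power)
qed

text \<open>Nonnegative integrals presuppose no integrability, so a single estimate delivers
  membership and the norm bound together. The Schur test and the estimates of singular kernels are
  stated in this form.\<close>

lemma L2_memI_nn:
  assumes "f \<in> borel_measurable (interval_measure l)" "0 \<le> B"
    and "(\<integral>\<^sup>+s. ennreal (cmod (f s))^2 \<partial>interval_measure l) \<le> ennreal (B\<^sup>2)"
  shows "f \<in> fs_set (L2 l)" "fs_norm (L2 l) f \<le> B"
proof -
  have *: "(\<integral>\<^sup>+s. ennreal ((cmod (f s))\<^sup>2) \<partial>interval_measure l) \<le> ennreal (B\<^sup>2)"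
    using assms(3) by (simp add: ennreal_power)
  show mem: "f \<in> fs_set (L2 l)"
    unfolding L2_set_iff
  proof (intro conjI assms(1) integrableI_bounded)
    show "(\<lambda>s. (cmod (f s))\<^sup>2) \<in> borel_measurable (interval_measure l)" using assms(1) by measurable
    show "(\<integral>\<^sup>+s. ennreal (norm ((cmod (f s))\<^sup>2)) \<partial>interval_measure l) < \<infinity>"
      using * by (simp add: order_le_less_trans)
  qed
  have "ennreal ((fs_norm (L2 l) f)\<^sup>2) \<le> ennreal (B\<^sup>2)"
    using L2_nn_integral[OF mem] assms(3) by simp
  then show "fs_norm (L2 l) f \<le> B"
    using assms(2) by (auto simp: ennreal_le_iff power2_le_iff_abs_le)
qed

text \<open>Both claims come from the Cauchy-Schwarz inequality for nonnegative integrals: its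
  right-hand side is finite, which gives integrability, and then the two kinds of integral
  agree.\<close>

lemma L2_Cauchy_Schwarz:
  assumes f: "f \<in> fs_set (L2 l)" and g: "g \<in> fs_set (L2 l)"
  shows "integrable (interval_measure l) (\<lambda>s. cmod (f s) * cmod (g s))"
    and "(LINT s|interval_measure l. cmod (f s) * cmod (g s)) \<le> fs_norm (L2 l) f * fs_norm (L2 l) g"
proof -
  note [measurable] = L2_measurable[OF f] L2_measurable[OF g]
  let ?I = "\<integral>\<^sup>+s. ennreal (cmod (f s)) * ennreal (cmod (g s)) \<partial>interval_measure l"
  have "?I\<^sup>2 \<le> ennreal ((fs_norm (L2 l) f)\<^sup>2) * ennreal ((fs_norm (L2 l) g)\<^sup>2)"
    using Cauchy_Schwarz_nn_integral[of "\<lambda>s. ennreal (cmod (f s))" "interval_measure l" "\<lambda>s. ennreal (cmod (g s))"]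
    unfolding L2_nn_integral[OF f] L2_nn_integral[OF g] by simp
  also have "\<dots> = (ennreal (fs_norm (L2 l) f * fs_norm (L2 l) g))\<^sup>2"
    by (simp add: ennreal_power ennreal_mult power_mult_distrib)
  finally have I: "?I \<le> ennreal (fs_norm (L2 l) f * fs_norm (L2 l) g)"
    by (cases ?I) (auto simp: ennreal_power power2_le_iff_abs_le neq_top_trans[OF ennreal_neq_top] top_unique)
  then have I': "(\<integral>\<^sup>+s. ennreal (cmod (f s) * cmod (g s)) \<partial>interval_measure l) \<le> ennreal (fs_norm (L2 l) f * fs_norm (L2 l) g)"
    by (simp add: ennreal_mult)
  show int: "integrable (interval_measure l) (\<lambda>s. cmod (f s) * cmod (g s))"
    by (rule integrableI_bounded) (use I' in \<open>auto simp: order_le_less_trans abs_mult\<close>)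
  have "ennreal (LINT s|interval_measure l. cmod (f s) * cmod (g s)) \<le> ennreal (fs_norm (L2 l) f * fs_norm (L2 l) g)"
    using I' nn_integral_eq_integral[OF int] by simp
  then show "(LINT s|interval_measure l. cmod (f s) * cmod (g s)) \<le> fs_norm (L2 l) f * fs_norm (L2 l) g"
    by (simp add: ennreal_le_iff)
qed

lemma L2_mult_integrable:
  assumes f: "f \<in> fs_set (L2 l)" and g: "g \<in> fs_set (L2 l)"
  shows "integrable (interval_measure l) (\<lambda>s. f s * g s)"
    and "cmod (LINT s|interval_measure l. f s * g s) \<le> fs_norm (L2 l) f * fs_norm (L2 l) g"
proof -
  note [measurable] = L2_measurable[OF f] L2_measurable[OF g]
  show "integrable (interval_measure l) (\<lambda>s. f s * g s)"
    by (rule Bochner_Integration.integrable_bound[OF L2_Cauchy_Schwarz(1)[OF f g]]) (auto simp: norm_mult)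
  have "cmod (LINT s|interval_measure l. f s * g s) \<le> (LINT s|interval_measure l. cmod (f s) * cmod (g s))"
    using integral_norm_bound[of "interval_measure l" "\<lambda>s. f s * g s"] by (simp add: norm_mult)
  also have "\<dots> \<le> fs_norm (L2 l) f * fs_norm (L2 l) g" by (rule L2_Cauchy_Schwarz(2)[OF f g])
  finally show "cmod (LINT s|interval_measure l. f s * g s) \<le> fs_norm (L2 l) f * fs_norm (L2 l) g" .
qed

lemma seminormed_L2: "seminormed_fs (L2 l)"
proof
  show "(\<lambda>_. 0) \<in> fs_set (L2 l)" by (simp add: L2_set_iff)
  fix f g :: "real \<Rightarrow> complex" and c :: complex
  assume f: "f \<in> fs_set (L2 l)"
  note [measurable] = L2_measurable[OF f]
  show "(\<lambda>x. c * f x) \<in> fs_set (L2 l)"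
    using f by (simp add: L2_set_iff norm_mult power_mult_distrib)
  show "fs_norm (L2 l) (\<lambda>x. c * f x) = cmod c * fs_norm (L2 l) f"
    by (simp add: L2_norm_eq norm_mult power_mult_distrib real_sqrt_mult)
  show "0 \<le> fs_norm (L2 l) f" by simp
  assume g: "g \<in> fs_set (L2 l)"
  note [measurable] = L2_measurable[OF g]
  note sq = L2_square_integrable[OF f] L2_square_integrable[OF g] L2_Cauchy_Schwarz(1)[OF f g]
  have le: "(cmod (f s + g s))\<^sup>2 \<le> (cmod (f s))\<^sup>2 + 2 * (cmod (f s) * cmod (g s)) + (cmod (g s))\<^sup>2" for s
  proof -
    have "(cmod (f s + g s))\<^sup>2 \<le> (cmod (f s) + cmod (g s))\<^sup>2"
      by (intro power_mono norm_triangle_ineq) simp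
    then show ?thesis by (simp add: power2_sum algebra_simps)
  qed
  have int: "integrable (interval_measure l) (\<lambda>s. (cmod (f s))\<^sup>2 + 2 * (cmod (f s) * cmod (g s)) + (cmod (g s))\<^sup>2)"
    using sq by auto
  show mem: "(\<lambda>x. f x + g x) \<in> fs_set (L2 l)"
    unfolding L2_set_iff
  proof (intro conjI)
    show "integrable (interval_measure l) (\<lambda>s. (cmod (f s + g s))\<^sup>2)"
      by (rule Bochner_Integration.integrable_bound[OF int]) (auto intro!: AE_I2 order.trans[OF le])
  qed measurable
  have "(fs_norm (L2 l) (\<lambda>x. f x + g x))\<^sup>2 \<le>
      (LINT s|interval_measure l. (cmod (f s))\<^sup>2 + 2 * (cmod (f s) * cmod (g s)) + (cmod (g s))\<^sup>2)"
    unfolding L2_norm_square using L2_square_integrable[OF mem] int le by (intro integral_mono) auto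
  also have "\<dots> = (fs_norm (L2 l) f)\<^sup>2 + 2 * (LINT s|interval_measure l. cmod (f s) * cmod (g s)) + (fs_norm (L2 l) g)\<^sup>2"
    using sq by (simp add: L2_norm_square)
  also have "\<dots> \<le> (fs_norm (L2 l) f)\<^sup>2 + 2 * (fs_norm (L2 l) f * fs_norm (L2 l) g) + (fs_norm (L2 l) g)\<^sup>2"
    using L2_Cauchy_Schwarz(2)[OF f g] by simp
  also have "\<dots> = (fs_norm (L2 l) f + fs_norm (L2 l) g)\<^sup>2" by (simp add: power2_sum)
  finally show "fs_norm (L2 l) (\<lambda>x. f x + g x) \<le> fs_norm (L2 l) f + fs_norm (L2 l) g"
    by (rule power2_le_imp_le) (simp add: add_nonneg_nonneg)
qed

interpretation L2: seminormed_fs "L2 l" for l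
  by (rule seminormed_L2)

lemma L2_cong_AE:
  assumes f: "f \<in> fs_set (L2 l)" and g: "g \<in> borel_measurable (interval_measure l)"
    and eq: "AE s in interval_measure l. f s = g s"
  shows "g \<in> fs_set (L2 l)" "fs_eq (L2 l) f g" "fs_norm (L2 l) f = fs_norm (L2 l) g"
proof -
  note [measurable] = L2_measurable[OF f] g
  show g': "g \<in> fs_set (L2 l)"
    unfolding L2_set_iff
    by (intro conjI g integrable_cong_AE_imp[OF L2_square_integrable[OF f]]) (use eq in auto)
  have "(LINT s|interval_measure l. (cmod (f s - g s))\<^sup>2) = (LINT s|interval_measure l. 0)"
    by (rule integral_cong_AE) (use eq in auto)
  then show "fs_eq (L2 l) f g" by (simp add: fs_eq_def L2_norm_eq)
  then show "fs_norm (L2 l) f = fs_norm (L2 l) g" using L2.eq_norm f g' by blast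
qed

lemma AE_interior:
  "AE s in interval_measure l. s \<in> {0<..<l}"
proof -
  have "AE s in lebesgue. s \<noteq> 0 \<and> s \<noteq> (l::real)"
    by (intro AE_conjI AE_completion AE_lborel_singleton)
  then show ?thesis
    by (subst AE_restrict_space_iff) (auto elim: eventually_mono)
qed

lemma measurable_continuous:
  fixes f :: "real \<Rightarrow> 'b::{banach, second_countable_topology}"
  assumes "continuous_on {0..l} f"
  shows "f \<in> borel_measurable (interval_measure l)"
proof -
  have "(\<lambda>s. indicator {0..l} s *\<^sub>R f s) \<in> borel_measurable borel"
    by (rule borel_measurable_continuous_on_indicator[OF _ assms]) simp
  then have "(\<lambda>s. indicator {0..l} s *\<^sub>R f s) \<in> borel_measurable lebesgue"
    by (intro measurable_completion) simp
  then show ?thesis by (simp add: borel_measurable_restrict_space_iff)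
qed

lemma L2_bounded:
  assumes l: "0 \<le> l" and f: "f \<in> borel_measurable (interval_measure l)"
    and B: "\<And>s. s \<in> {0..l} \<Longrightarrow> cmod (f s) \<le> B" and B0: "0 \<le> B"
  shows "f \<in> fs_set (L2 l)" "fs_norm (L2 l) f \<le> sqrt l * B"
proof -
  have "(\<integral>\<^sup>+s. ennreal (cmod (f s))^2 \<partial>interval_measure l) \<le> (\<integral>\<^sup>+s. ennreal (B\<^sup>2) \<partial>interval_measure l)"
    by (intro nn_integral_mono) (use B in \<open>auto simp: ennreal_power intro!: power_mono\<close>)
  also have "\<dots> = ennreal ((sqrt l * B)\<^sup>2)"
    using l by (simp add: emeasure_restrict_space power_mult_distrib ennreal_mult' mult.commute)
  finally show "f \<in> fs_set (L2 l)" "fs_norm (L2 l) f \<le> sqrt l * B"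
    using L2_memI_nn[OF f, of "sqrt l * B"] l B0 by auto
qed

lemma L2_continuous:
  assumes l: "0 \<le> l" and f: "continuous_on {0..l} f"
  shows "f \<in> fs_set (L2 l)"
proof -
  obtain B where "\<And>s. s \<in> {0..l} \<Longrightarrow> cmod (f s) \<le> B" "0 \<le> B"
    using compact_imp_bounded[OF compact_continuous_image[OF f compact_Icc]]
    unfolding bounded_iff by (metis imageI order.trans norm_ge_zero nle_le)
  then show ?thesis using L2_bounded(1)[OF l measurable_continuous[OF f]] by blast
qed

lemma L2_integrable: "f \<in> fs_set (L2 l) \<Longrightarrow> 0 \<le> l \<Longrightarrow> integrable (interval_measure l) f"
  using L2_mult_integrable(1)[of f l "\<lambda>_. 1"] L2_continuous[of l "\<lambda>_. 1"] by simp

lemma L2_indicator_mult: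
  assumes f: "f \<in> fs_set (L2 l)" and A: "A \<in> sets lebesgue"
  shows "(\<lambda>s. indicator A s *\<^sub>R f s) \<in> fs_set (L2 l)" "fs_norm (L2 l) (\<lambda>s. indicator A s *\<^sub>R f s) \<le> fs_norm (L2 l) f"
proof -
  have [measurable]: "indicat_real A \<in> borel_measurable (interval_measure l)"
    using A by (intro measurable_restrict_space1) simp
  note [measurable] = L2_measurable[OF f]
  have "(\<integral>\<^sup>+s. ennreal (cmod (indicator A s *\<^sub>R f s))^2 \<partial>interval_measure l) \<le> (\<integral>\<^sup>+s. ennreal (cmod (f s))^2 \<partial>interval_measure l)"
    by (intro nn_integral_mono) (auto simp: indicator_def)
  then have 1: "(\<integral>\<^sup>+s. ennreal (cmod (indicator A s *\<^sub>R f s))^2 \<partial>interval_measure l) \<le> ennreal ((fs_norm (L2 l) f)\<^sup>2)"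
    using L2_nn_integral[OF f] by simp
  show "(\<lambda>s. indicator A s *\<^sub>R f s) \<in> fs_set (L2 l)" "fs_norm (L2 l) (\<lambda>s. indicator A s *\<^sub>R f s) \<le> fs_norm (L2 l) f"
    by (rule L2_memI_nn[OF _ _ 1]; simp)+
qed

text \<open>Cauchy-Schwarz against the indicator of \<open>{a..b}\<close>, whose L2 norm is
  \<open>sqrt (b - a)\<close>. All Hoelder estimates with exponent 1/2 originate here.\<close>

lemma interval_integral_bound:
  assumes f: "f \<in> fs_set (L2 l)" and ab: "0 \<le> a" "a \<le> b" "b \<le> l"
  shows "(LINT s|interval_measure l. indicator {a..b} s * cmod (f s)) \<le> sqrt (b - a) * fs_norm (L2 l) f"
proof -
  have l: "0 \<le> l" using ab by simp
  let ?c = "\<lambda>s. indicator {a..b} s *\<^sub>R (1::complex)"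
  have c: "?c \<in> fs_set (L2 l)"
    by (intro L2_indicator_mult L2_continuous l) auto
  have "(fs_norm (L2 l) ?c)\<^sup>2 = (LINT s|interval_measure l. indicator {a..b} s)"
    unfolding L2_norm_square by (intro Bochner_Integration.integral_cong) (auto simp: indicator_def)
  also have "\<dots> = b - a"
    using ab by (simp add: measure_restrict_space Int_absorb2)
  finally have "fs_norm (L2 l) ?c = sqrt (b - a)"
    by (metis L2_norm_nonneg real_sqrt_unique)
  moreover have "cmod (?c s) * cmod (f s) = indicator {a..b} s * cmod (f s)" for s
    by (auto simp: indicator_def)
  ultimately show ?thesis using L2_Cauchy_Schwarz(2)[OF c f] by simp
qed

text \<open>The half-lines \<open>{..a}\<close> are stable under intersection and generate the Borel
  sets. A vanishing primitive means a vanishing integral over each of them, a Dynkin argument passes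
  to all Borel sets, and a function whose integral over every measurable set is zero vanishes almost
  everywhere. The purpose is uniqueness of the weak second derivative.\<close>

lemma AE_zero_if_primitive_zero:
  fixes h :: "real \<Rightarrow> complex"
  assumes h: "integrable (interval_measure l) h"
    and zero: "\<And>s. s \<in> {0..l} \<Longrightarrow> (LINT t|interval_measure l. indicator {0..s} t *\<^sub>R h t) = 0"
    and l: "0 \<le> l"
  shows "AE t in interval_measure l. h t = 0"
proof (rule interval_measure.density_zero[OF h])
  let ?M = "interval_measure l"
  have space: "t \<in> {0..l}" if "t \<in> space ?M" for t using that by simp
  have meas: "A \<in> sets borel \<Longrightarrow> A \<inter> {0..l} \<in> sets ?M" for A
    by (auto simp: sets_restrict_space)
  have borel: "(LINT t|?M. indicator (A \<inter> {0..l}) t *\<^sub>R h t) = 0" if "A \<in> sets borel" for A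
  proof -
    have "Int_stable (range (\<lambda>a. {..a::real}))"
      by (auto simp: Int_stable_def)
    moreover have "range (\<lambda>a. {..a::real}) \<subseteq> Pow UNIV" by simp
    moreover have "A \<in> sigma_sets UNIV (range (\<lambda>a. {..a::real}))"
      using that by (simp add: borel_eq_atMost)
    ultimately show ?thesis
    proof (induction rule: sigma_sets_induct_disjoint)
      case (basic A)
      then obtain a where A: "A = {..a}" by auto
      show ?case
      proof (cases "a < 0")
        case True
        then have "A \<inter> {0..l} = {}" using A by auto
        then show ?thesis by simp
      next
        case False
        then have "A \<inter> {0..l} = {0..min a l}" using A by auto
        then show ?thesis using zero[of "min a l"] False l by simp
      qed
    next
      case empty
      then show ?case by simp
    next
      case (compl A)
      then have A: "A \<inter> {0..l} \<in> sets ?M" using meas by (simp add: borel_eq_atMost)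
      have "(LINT t|?M. indicator ((UNIV - A) \<inter> {0..l}) t *\<^sub>R h t) =
            (LINT t|?M. indicator {0..l} t *\<^sub>R h t - indicator (A \<inter> {0..l}) t *\<^sub>R h t)"
        by (intro Bochner_Integration.integral_cong) (auto simp: indicator_def)
      also have "\<dots> = 0"
        using compl zero[of l] l integrable_mult_indicator[OF A h] integrable_mult_indicator[OF meas[of UNIV] h]
        by (subst Bochner_Integration.integral_diff) auto
      finally show ?case .
    next
      case (union A)
      have A: "A i \<inter> {0..l} \<in> sets ?M" for i using union(2) meas by (auto simp: borel_eq_atMost)
      have int: "set_integrable ?M (\<Union>i. A i \<inter> {0..l}) h"
        unfolding set_integrable_def
        by (intro integrable_mult_indicator h sets.countable_UN image_subsetI A)
      have "(LINT t:(\<Union>i. A i \<inter> {0..l})|?M. h t) = (\<Sum>i. LINT t:(A i \<inter> {0..l})|?M. h t)"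
        by (rule lebesgue_integral_countable_add[OF A _ int])
           (use union(1) in \<open>auto simp: disjoint_family_on_def\<close>)
      also have "\<dots> = 0" using union(3) by (simp add: set_lebesgue_integral_def)
      finally show ?case by (simp add: set_lebesgue_integral_def)
    qed
  qed
  fix A assume "A \<in> sets ?M"
  then have A: "A \<in> sets lebesgue" "A \<subseteq> {0..l}" by (auto simp: sets_restrict_space)
  have A': "A \<in> sets ?M" by fact
  \<comment> \<open>A Lebesgue set differs from its Borel main part by a null set, so the Borel case
    already covers it.\<close>
  let ?B = "main_part lborel A"
  have B: "?B \<in> sets borel" using A main_part_sets[of A lborel] by simp
  have "AE t in lebesgue. t \<in> A \<longleftrightarrow> t \<in> ?B"
    using AE_in_main_part[of A lborel] A by (auto intro: AE_completion)
  then have "AE t in ?M. t \<in> A \<longleftrightarrow> t \<in> ?B"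
    by (subst AE_restrict_space_iff) auto
  then have "(LINT t|?M. indicator A t *\<^sub>R h t) = (LINT t|?M. indicator (?B \<inter> {0..l}) t *\<^sub>R h t)"
  proof (intro integral_cong_AE)
    show "(\<lambda>t. indicator A t *\<^sub>R h t) \<in> borel_measurable ?M"
      using A' h by (intro borel_measurable_integrable integrable_mult_indicator)
    show "(\<lambda>t. indicator (?B \<inter> {0..l}) t *\<^sub>R h t) \<in> borel_measurable ?M"
      using meas[OF B] h by (intro borel_measurable_integrable integrable_mult_indicator)
    assume "AE t in ?M. t \<in> A \<longleftrightarrow> t \<in> ?B"
    then show "AE t in ?M. indicator A t *\<^sub>R h t = indicator (?B \<inter> {0..l}) t *\<^sub>R h t"
      by eventually_elim (use A(2) in \<open>auto simp: indicator_def\<close>)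
  qed
  with borel[OF B] show "set_lebesgue_integral ?M A h = 0" by (simp add: set_lebesgue_integral_def)
qed

text \<open>The fundamental theorem is applied on \<open>lborel\<close>. The integrand cut off to
  \<open>{a..b}\<close> is Borel measurable, hence completing the measure does not change its
  integral.\<close>

lemma FTC_interval_measure:
  fixes F :: "real \<Rightarrow> complex"
  assumes ab: "0 \<le> a" "a \<le> b" "b \<le> l"
    and F: "\<And>t. t \<in> {0..l} \<Longrightarrow> (F has_vector_derivative f t) (at t within {0..l})"
    and f: "continuous_on {0..l} f"
  shows "(LINT t|interval_measure l. indicator {a..b} t *\<^sub>R f t) = F b - F a"
proof -
  have cont: "continuous_on {a..b} f" using continuous_on_subset[OF f] ab by auto
  have meas: "(\<lambda>t. indicator {a..b} t *\<^sub>R f t) \<in> borel_measurable lborel"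
    using borel_measurable_continuous_on_indicator[OF _ cont] by simp
  have "(LINT t|interval_measure l. indicator {a..b} t *\<^sub>R f t) = (LINT t:{a..b}|lebesgue. f t)"
    using set_integral_interval_measure[of "{a..b}" l f] ab by simp
  also have "\<dots> = (LINT t|lborel. indicator {a..b} t *\<^sub>R f t)"
    unfolding set_lebesgue_integral_def by (rule integral_completion[OF meas])
  also have "\<dots> = F b - F a"
    by (rule integral_FTC_atLeastAtMost[OF ab(2) _ cont])
       (use has_vector_derivative_within_subset[OF F] ab in auto)
  finally show ?thesis .
qed

section \<open>The Sobolev space and its compact embedding\<close>

lemma H2_set_iff: "f \<in> fs_set (H2 l) \<longleftrightarrow> (\<exists>f2. is_H2_deriv2 l f f2)"
  by (simp add: H2_def)

lemma vector_derivative_within_interval: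
  assumes "0 < l" "s \<in> {0..l}" "(f has_vector_derivative D) (at s within {0..l})"
  shows "vector_derivative f (at s within {0..l}) = D"
  using vector_derivative_within_cbox[of 0 l s f D] assms by auto

lemma L2_primitive_bound:
  assumes f: "f \<in> fs_set (L2 l)" and rs: "0 \<le> r" "r \<le> s" "s \<le> l"
  shows "cmod ((LINT t|interval_measure l. indicator {0..s} t *\<^sub>R f t) -
               (LINT t|interval_measure l. indicator {0..r} t *\<^sub>R f t)) \<le> sqrt (s - r) * fs_norm (L2 l) f"
proof -
  have l: "0 \<le> l" using rs by simp
  have int: "integrable (interval_measure l) (\<lambda>t. indicator A t *\<^sub>R f t)" if "A \<in> sets lebesgue" for A
    by (rule L2_integrable[OF L2_indicator_mult(1)[OF f that] l])
  have "(LINT t|interval_measure l. indicator {0..s} t *\<^sub>R f t) - (LINT t|interval_measure l. indicator {0..r} t *\<^sub>R f t)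
      = (LINT t|interval_measure l. indicator {0..s} t *\<^sub>R f t - indicator {0..r} t *\<^sub>R f t)"
    by (rule Bochner_Integration.integral_diff[symmetric]) (intro int; simp)+
  also have "cmod \<dots> \<le> (LINT t|interval_measure l. indicator {r..s} t * cmod (f t))"
  proof (rule order.trans[OF integral_norm_bound integral_mono])
    show "integrable (interval_measure l) (\<lambda>t. cmod (indicator {0..s} t *\<^sub>R f t - indicator {0..r} t *\<^sub>R f t))"
      by (intro integrable_norm Bochner_Integration.integrable_diff int) auto
    have "integrable (interval_measure l) (\<lambda>t. cmod (indicator {r..s} t *\<^sub>R f t))"
      by (intro integrable_norm int) auto
    then show "integrable (interval_measure l) (\<lambda>t. indicator {r..s} t * cmod (f t))" by simp
  qed (use rs in \<open>auto simp: indicator_def\<close>)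
  also have "\<dots> \<le> sqrt (s - r) * fs_norm (L2 l) f" by (rule interval_integral_bound[OF f rs])
  finally show ?thesis .
qed

lemma sqrt_Hoelder_continuous:
  fixes f :: "real \<Rightarrow> complex"
  assumes "\<And>r s. 0 \<le> r \<Longrightarrow> r \<le> s \<Longrightarrow> s \<le> l \<Longrightarrow> cmod (f s - f r) \<le> sqrt (s - r) * C" and C: "0 \<le> C"
  shows "x \<in> {0..l} \<Longrightarrow> 0 < e \<Longrightarrow> \<exists>d>0. \<forall>y. y \<in> {0..l} \<and> norm (x - y) < d \<longrightarrow> norm (f x - f y) < e"
    and "continuous_on {0..l} f"
proof -
  have H: "cmod (f x - f y) \<le> sqrt \<bar>x - y\<bar> * C" if "x \<in> {0..l}" "y \<in> {0..l}" for x y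
    using assms(1)[of x y] assms(1)[of y x] that by (cases "x \<le> y") (auto simp: norm_minus_commute)
  have *: "\<exists>d>0. \<forall>y. y \<in> {0..l} \<and> norm (x - y) < d \<longrightarrow> norm (f x - f y) < e" if x: "x \<in> {0..l}" and e: "0 < e" for x e
  \<comment> \<open>\<open>C + 1\<close> in place of \<open>C\<close> keeps the radius meaningful
    when \<open>C = 0\<close>.\<close>
  proof (intro exI[of _ "(e / (C + 1))\<^sup>2"] conjI allI impI)
    show "0 < (e / (C + 1))\<^sup>2" using e C by simp
    fix y assume y: "y \<in> {0..l} \<and> norm (x - y) < (e / (C + 1))\<^sup>2"
    have "sqrt \<bar>x - y\<bar> < e / (C + 1)"
      by (rule real_less_lsqrt) (use y e C in auto)
    then have "sqrt \<bar>x - y\<bar> * (C + 1) < e" using C by (simp add: field_simps)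
    moreover have "sqrt \<bar>x - y\<bar> * C \<le> sqrt \<bar>x - y\<bar> * (C + 1)" by (intro mult_left_mono) auto
    ultimately show "norm (f x - f y) < e" using H[OF x, of y] y by linarith
  qed
  then show "x \<in> {0..l} \<Longrightarrow> 0 < e \<Longrightarrow> \<exists>d>0. \<forall>y. y \<in> {0..l} \<and> norm (x - y) < d \<longrightarrow> norm (f x - f y) < e" .
  show "continuous_on {0..l} f"
    unfolding continuous_on_iff
  proof (intro ballI allI impI)
    fix x e :: real assume "x \<in> {0..l}" "0 < e"
    from *[OF this] show "\<exists>d>0. \<forall>y\<in>{0..l}. dist y x < d \<longrightarrow> dist (f y) (f x) < e"
      by (auto simp: dist_norm norm_minus_commute)
  qed
qed

lemma is_H2_deriv2I:
  assumes "f2 \<in> fs_set (L2 l)"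
    and "\<And>s. s \<in> {0..l} \<Longrightarrow> (f has_vector_derivative f1 s) (at s within {0..l})"
    and "\<And>s. s \<in> {0..l} \<Longrightarrow> f1 s = f1 0 + (LINT t:{0..s}|lebesgue. f2 t)"
  shows "is_H2_deriv2 l f f2"
  unfolding is_H2_deriv2_def by (intro conjI exI[of _ f1] ballI assms)

text \<open>Replaces the existential first derivative by the canonical
  \<open>vector_derivative\<close>: derivatives within a nondegenerate interval are unique, also at
  its ends. Continuity of \<open>f1\<close> and the modulus of \<open>f\<close> then follow because
  each is a primitive of an L2 function.\<close>

lemma H2_deriv2_facts:
  assumes l: "0 < l" and d: "is_H2_deriv2 l f f2"
  defines "f1 \<equiv> \<lambda>s. vector_derivative f (at s within {0..l})"
  shows "f2 \<in> fs_set (L2 l)"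
    and "\<And>s. s \<in> {0..l} \<Longrightarrow> (f has_vector_derivative f1 s) (at s within {0..l})"
    and "\<And>s. s \<in> {0..l} \<Longrightarrow> f1 s = f1 0 + (LINT t|interval_measure l. indicator {0..s} t *\<^sub>R f2 t)"
    and "continuous_on {0..l} f1" "continuous_on {0..l} f"
    and "f \<in> fs_set (L2 l)" "f1 \<in> fs_set (L2 l)"
    and "\<And>r s. 0 \<le> r \<Longrightarrow> r \<le> s \<Longrightarrow> s \<le> l \<Longrightarrow> cmod (f s - f r) \<le> sqrt (s - r) * fs_norm (L2 l) f1"
proof -
  show f2: "f2 \<in> fs_set (L2 l)" using d by (simp add: is_H2_deriv2_def)
  obtain g where g: "\<And>s. s \<in> {0..l} \<Longrightarrow> (f has_vector_derivative g s) (at s within {0..l})"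
    "\<And>s. s \<in> {0..l} \<Longrightarrow> g s = g 0 + (LINT t:{0..s}|lebesgue. f2 t)"
    using d unfolding is_H2_deriv2_def by blast
  have gf1: "f1 s = g s" if "s \<in> {0..l}" for s
    unfolding f1_def by (rule vector_derivative_within_interval[OF l that g(1)[OF that]])
  show d1: "(f has_vector_derivative f1 s) (at s within {0..l})" if "s \<in> {0..l}" for s
    using g(1)[OF that] gf1[OF that] by simp
  show d2: "f1 s = f1 0 + (LINT t|interval_measure l. indicator {0..s} t *\<^sub>R f2 t)" if "s \<in> {0..l}" for s
  proof -
    have "(LINT t:{0..s}|lebesgue. f2 t) = (LINT t|interval_measure l. indicator {0..s} t *\<^sub>R f2 t)"
      using that by (intro set_integral_interval_measure) auto
    then show ?thesis using g(2)[OF that] gf1[OF that] gf1[of 0] l by simp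
  qed
  show c1: "continuous_on {0..l} f1"
  proof (rule sqrt_Hoelder_continuous(2))
    show "cmod (f1 s - f1 r) \<le> sqrt (s - r) * fs_norm (L2 l) f2" if "0 \<le> r" "r \<le> s" "s \<le> l" for r s
      using L2_primitive_bound[OF f2 that] that by (subst (1 2) d2) auto
  qed simp
  show c: "continuous_on {0..l} f"
    by (rule continuous_on_vector_derivative[OF d1])
  show "f \<in> fs_set (L2 l)" by (rule L2_continuous[OF less_imp_le[OF l] c])
  show L1: "f1 \<in> fs_set (L2 l)" by (rule L2_continuous[OF less_imp_le[OF l] c1])
  show "cmod (f s - f r) \<le> sqrt (s - r) * fs_norm (L2 l) f1" if "0 \<le> r" "r \<le> s" "s \<le> l" for r s
    using L2_primitive_bound[OF L1 that] FTC_interval_measure[of 0 s l f f1, OF _ _ _ d1 c1]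
      FTC_interval_measure[of 0 r l f f1, OF _ _ _ d1 c1] that by simp
qed

text \<open>Both candidates have the same primitive, namely the increment of the first derivative.
  Hence the \<open>SOME\<close> in the definition of the norm has no influence on its value.\<close>

lemma H2_deriv2_unique:
  assumes l: "0 < l" and f: "is_H2_deriv2 l f f2" "is_H2_deriv2 l f g2"
  shows "AE s in interval_measure l. f2 s = g2 s" "fs_norm (L2 l) f2 = fs_norm (L2 l) g2"
proof -
  note F = H2_deriv2_facts[OF l f(1)] and G = H2_deriv2_facts[OF l f(2)]
  note int = L2_integrable[OF F(1)] L2_integrable[OF G(1)]
  have "AE s in interval_measure l. f2 s - g2 s = 0"
  proof (rule AE_zero_if_primitive_zero)
    show "integrable (interval_measure l) (\<lambda>s. f2 s - g2 s)" using int l by auto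
    fix s assume s: "s \<in> {0..l}"
    have i: "integrable (interval_measure l) (\<lambda>t. indicator {0..s} t *\<^sub>R h t)" if "h \<in> fs_set (L2 l)" for h
      by (rule L2_integrable[OF L2_indicator_mult(1)[OF that]]) (use l in auto)
    have "(LINT t|interval_measure l. indicator {0..s} t *\<^sub>R (f2 t - g2 t)) =
      (LINT t|interval_measure l. indicator {0..s} t *\<^sub>R f2 t) - (LINT t|interval_measure l. indicator {0..s} t *\<^sub>R g2 t)"
      using i[OF F(1)] i[OF G(1)] by (simp add: scaleR_diff_right)
    then show "(LINT t|interval_measure l. indicator {0..s} t *\<^sub>R (f2 t - g2 t)) = 0"
      using F(3)[OF s] G(3)[OF s] by simp
  qed (use l in simp)
  then show AE: "AE s in interval_measure l. f2 s = g2 s" by simp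
  then show "fs_norm (L2 l) f2 = fs_norm (L2 l) g2"
    by (rule L2_cong_AE(3)[OF F(1) L2_measurable[OF G(1)]])
qed

text \<open>Writing the norm as the Euclidean norm of a nested pair reduces homogeneity and the
  triangle inequality in \<open>H2\<close> to those of the pair space and of L2.\<close>

lemma H2_norm_eq:
  assumes l: "0 < l" and f: "is_H2_deriv2 l f f2"
  shows "fs_norm (H2 l) f = norm (fs_norm (L2 l) f,
    (fs_norm (L2 l) (\<lambda>s. vector_derivative f (at s within {0..l})), fs_norm (L2 l) f2))"
proof -
  have "fs_norm (L2 l) (SOME f2. is_H2_deriv2 l f f2) = fs_norm (L2 l) f2"
    by (rule H2_deriv2_unique(2)[OF l someI[of "is_H2_deriv2 l f", OF f] f])
  then show ?thesis by (simp add: H2_def norm_Pair add.assoc)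
qed

lemma is_H2_deriv2_add:
  assumes l: "0 < l" and f: "is_H2_deriv2 l f f2" and g: "is_H2_deriv2 l g g2"
  shows "is_H2_deriv2 l (\<lambda>s. f s + g s) (\<lambda>s. f2 s + g2 s)"
proof -
  note F = H2_deriv2_facts[OF l f] and G = H2_deriv2_facts[OF l g]
  let ?h1 = "\<lambda>s. vector_derivative f (at s within {0..l}) + vector_derivative g (at s within {0..l})"
  have "?h1 s = ?h1 0 + (LINT t:{0..s}|lebesgue. f2 t + g2 t)" if s: "s \<in> {0..l}" for s
  proof -
    have i: "integrable (interval_measure l) (\<lambda>t. indicator {0..s} t *\<^sub>R h t)" if "h \<in> fs_set (L2 l)" for h
      by (rule L2_integrable[OF L2_indicator_mult(1)[OF that]]) (use l in auto)
    have "(LINT t:{0..s}|lebesgue. f2 t + g2 t) =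
      (LINT t|interval_measure l. indicator {0..s} t *\<^sub>R f2 t) + (LINT t|interval_measure l. indicator {0..s} t *\<^sub>R g2 t)"
      using i[OF F(1)] i[OF G(1)] s by (simp add: set_integral_interval_measure[of _ l] scaleR_add_right)
    then show ?thesis by (subst F(3)[OF s], subst G(3)[OF s]) simp
  qed
  moreover have "(\<lambda>s. f2 s + g2 s) \<in> fs_set (L2 l)" by (rule L2.add_mem[OF F(1) G(1)])
  moreover have "((\<lambda>s. f s + g s) has_vector_derivative ?h1 s) (at s within {0..l})" if "s \<in> {0..l}" for s
    by (rule has_vector_derivative_add[OF F(2)[OF that] G(2)[OF that]])
  ultimately show ?thesis by (intro is_H2_deriv2I[of _ l _ ?h1])
qed

lemma is_H2_deriv2_scale:
  assumes l: "0 < l" and f: "is_H2_deriv2 l f f2"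
  shows "is_H2_deriv2 l (\<lambda>s. c * f s) (\<lambda>s. c * f2 s)"
proof -
  note F = H2_deriv2_facts[OF l f]
  let ?h1 = "\<lambda>s. c * vector_derivative f (at s within {0..l})"
  have "?h1 s = ?h1 0 + (LINT t:{0..s}|lebesgue. c * f2 t)" if s: "s \<in> {0..l}" for s
  proof -
    have "(LINT t:{0..s}|lebesgue. f2 t) = (LINT t|interval_measure l. indicator {0..s} t *\<^sub>R f2 t)"
      by (rule set_integral_interval_measure) (use s in auto)
    then have "(LINT t:{0..s}|lebesgue. c * f2 t) = c * (LINT t|interval_measure l. indicator {0..s} t *\<^sub>R f2 t)"
      by (simp only: set_integral_mult_right)
    then show ?thesis by (subst F(3)[OF s]) (simp only: distrib_left)
  qed
  moreover have "(\<lambda>s. c * f2 s) \<in> fs_set (L2 l)" by (rule L2.scale_mem[OF F(1)])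
  moreover have "((\<lambda>s. c * f s) has_vector_derivative ?h1 s) (at s within {0..l})" if "s \<in> {0..l}" for s
    by (rule has_vector_derivative_mult_right[OF F(2)[OF that]])
  ultimately show ?thesis by (intro is_H2_deriv2I[of _ l _ ?h1])
qed

lemma seminormed_H2:
  assumes l: "0 < l"
  shows "seminormed_fs (H2 l)"
proof
  have "is_H2_deriv2 l (\<lambda>_. 0) (\<lambda>_. 0)"
    unfolding is_H2_deriv2_def by (auto intro!: L2.zero_mem exI[of _ "\<lambda>_. 0"] simp: set_lebesgue_integral_def)
  then show "(\<lambda>_. 0) \<in> fs_set (H2 l)" by (auto simp: H2_set_iff)
  fix f g :: "real \<Rightarrow> complex" and c :: complex
  assume "f \<in> fs_set (H2 l)"
  then obtain f2 where f: "is_H2_deriv2 l f f2" by (auto simp: H2_set_iff)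
  note F = H2_deriv2_facts[OF l f]
  note cf = is_H2_deriv2_scale[OF l f, of c]
  let ?f1 = "\<lambda>s. vector_derivative f (at s within {0..l})"
  show "(\<lambda>x. c * f x) \<in> fs_set (H2 l)" using cf by (auto simp: H2_set_iff)
  show "0 \<le> fs_norm (H2 l) f" by (simp add: H2_norm_eq[OF l f])
  have "fs_norm (L2 l) (\<lambda>s. vector_derivative (\<lambda>x. c * f x) (at s within {0..l})) = fs_norm (L2 l) (\<lambda>s. c * ?f1 s)"
    unfolding L2_norm_eq
    by (intro arg_cong[where f = sqrt] Bochner_Integration.integral_cong refl arg_cong[where f = "\<lambda>x. (cmod x)\<^sup>2"]
        vector_derivative_within_interval[OF l] has_vector_derivative_mult_right F(2)) auto
  then have "fs_norm (H2 l) (\<lambda>x. c * f x) = norm (cmod c *\<^sub>R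
      (fs_norm (L2 l) f, (fs_norm (L2 l) ?f1, fs_norm (L2 l) f2)))"
    unfolding H2_norm_eq[OF l cf] using F(1,6,7) by (simp add: L2.norm_scale scaleR_Pair)
  also have "\<dots> = cmod c * fs_norm (H2 l) f"
    unfolding H2_norm_eq[OF l f] norm_scaleR by simp
  finally show "fs_norm (H2 l) (\<lambda>x. c * f x) = cmod c * fs_norm (H2 l) f" .
  assume "g \<in> fs_set (H2 l)"
  then obtain g2 where g: "is_H2_deriv2 l g g2" by (auto simp: H2_set_iff)
  note G = H2_deriv2_facts[OF l g]
  note fg = is_H2_deriv2_add[OF l f g]
  let ?g1 = "\<lambda>s. vector_derivative g (at s within {0..l})"
  show "(\<lambda>x. f x + g x) \<in> fs_set (H2 l)" using fg by (auto simp: H2_set_iff)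
  have "fs_norm (L2 l) (\<lambda>s. vector_derivative (\<lambda>x. f x + g x) (at s within {0..l})) = fs_norm (L2 l) (\<lambda>s. ?f1 s + ?g1 s)"
    unfolding L2_norm_eq
    by (intro arg_cong[where f = sqrt] Bochner_Integration.integral_cong refl arg_cong[where f = "\<lambda>x. (cmod x)\<^sup>2"]
        vector_derivative_within_interval[OF l] has_vector_derivative_add F(2) G(2)) auto
  then have "fs_norm (H2 l) (\<lambda>x. f x + g x) = norm (fs_norm (L2 l) (\<lambda>s. f s + g s),
      (fs_norm (L2 l) (\<lambda>s. ?f1 s + ?g1 s), fs_norm (L2 l) (\<lambda>s. f2 s + g2 s)))"
    unfolding H2_norm_eq[OF l fg] by simp
  also have "\<dots> \<le> norm (fs_norm (L2 l) f + fs_norm (L2 l) g,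
      (fs_norm (L2 l) ?f1 + fs_norm (L2 l) ?g1, fs_norm (L2 l) f2 + fs_norm (L2 l) g2))"
    using L2.norm_add[OF F(6) G(6)] L2.norm_add[OF F(7) G(7)] L2.norm_add[OF F(1) G(1)]
    unfolding norm_Pair by (intro real_sqrt_le_mono add_mono) (auto intro!: power_mono real_sqrt_le_mono add_mono)
  also have "\<dots> = norm ((fs_norm (L2 l) f, (fs_norm (L2 l) ?f1, fs_norm (L2 l) f2)) +
      (fs_norm (L2 l) g, (fs_norm (L2 l) ?g1, fs_norm (L2 l) g2)))"
    by simp
  also have "\<dots> \<le> fs_norm (H2 l) f + fs_norm (H2 l) g"
    unfolding H2_norm_eq[OF l f] H2_norm_eq[OF l g] by (rule norm_triangle_ineq)
  finally show "fs_norm (H2 l) (\<lambda>x. f x + g x) \<le> fs_norm (H2 l) f + fs_norm (H2 l) g" .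
qed

lemma H2_L2_norm_le:
  assumes l: "0 < l" and f: "is_H2_deriv2 l f f2"
  shows "fs_norm (L2 l) f \<le> fs_norm (H2 l) f"
    and "fs_norm (L2 l) (\<lambda>s. vector_derivative f (at s within {0..l})) \<le> fs_norm (H2 l) f"
proof -
  let ?a = "fs_norm (L2 l) f" and ?b = "fs_norm (L2 l) (\<lambda>s. vector_derivative f (at s within {0..l}))"
  have "norm ?a \<le> norm (?a, (?b, fs_norm (L2 l) f2))"
    by (metis fst_conv norm_fst_le)
  then show "?a \<le> fs_norm (H2 l) f" unfolding H2_norm_eq[OF l f] by simp
  have "norm ?b \<le> norm (?b, fs_norm (L2 l) f2)"
    by (metis fst_conv norm_fst_le)
  also have "\<dots> \<le> norm (?a, (?b, fs_norm (L2 l) f2))"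
    by (metis snd_conv norm_snd_le)
  finally show "?b \<le> fs_norm (H2 l) f" unfolding H2_norm_eq[OF l f] by simp
qed

lemma bounded_H2_L2:
  assumes l: "0 < l"
  shows "bounded_op (H2 l) (L2 l) (\<lambda>f. f)"
proof (rule bounded_opI[where B = 1])
  have "f \<in> fs_set (L2 l) \<and> fs_norm (L2 l) f \<le> 1 * fs_norm (H2 l) f" if "f \<in> fs_set (H2 l)" for f
    using H2_deriv2_facts(6)[OF l] H2_L2_norm_le(1)[OF l] that by (auto simp: H2_set_iff)
  then show "linear_op (H2 l) (L2 l) (\<lambda>f. f)" "\<And>f. f \<in> fs_set (H2 l) \<Longrightarrow> fs_norm (L2 l) f \<le> 1 * fs_norm (H2 l) f"
    by (auto simp: linear_op_def L2.eq_refl)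
qed

text \<open>The Hoelder estimate compares \<open>f s\<close> with \<open>f r\<close> for every
  \<open>r\<close>; averaging over \<open>r\<close> replaces the unknown value \<open>f r\<close> by
  the L2 norm of \<open>f\<close>, which accounts for the term \<open>1 / sqrt l\<close>.\<close>

lemma H2_sup_bound:
  assumes l: "0 < l" and f: "is_H2_deriv2 l f f2" and s: "s \<in> {0..l}"
  shows "cmod (f s) \<le> (sqrt l + 1 / sqrt l) * fs_norm (H2 l) f"
proof -
  note F = H2_deriv2_facts[OF l f]
  let ?f1 = "\<lambda>s. vector_derivative f (at s within {0..l})"
  have le: "cmod (f s) \<le> cmod (f r) + sqrt l * fs_norm (L2 l) ?f1" if r: "r \<in> {0..l}" for r
  proof -
    have "cmod (f s - f r) \<le> sqrt \<bar>s - r\<bar> * fs_norm (L2 l) ?f1"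
      using F(8)[of r s] F(8)[of s r] r s by (cases "r \<le> s") (auto simp: norm_minus_commute)
    also have "\<dots> \<le> sqrt l * fs_norm (L2 l) ?f1"
      using r s by (intro mult_right_mono real_sqrt_le_mono) auto
    finally show ?thesis using norm_triangle_sub[of "f s" "f r"] by linarith
  qed
  have int: "integrable (interval_measure l) (\<lambda>r. cmod (f r))"
    using L2_integrable[OF F(6)] l by (intro integrable_norm) simp
  have ls: "l * (1 / sqrt l) = sqrt l" using l by (simp add: real_div_sqrt)
  have meas: "measure (interval_measure l) {0..l} = l"
    using l by (simp add: measure_restrict_space)
  have "l * cmod (f s) = (LINT r|interval_measure l. cmod (f s))"
    using meas by simp
  also have "\<dots> \<le> (LINT r|interval_measure l. cmod (f r) + sqrt l * fs_norm (L2 l) ?f1)"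
    using int le by (intro integral_mono) (auto simp del: of_real_add)
  also have "\<dots> = (LINT r|interval_measure l. cmod (f r)) + l * (sqrt l * fs_norm (L2 l) ?f1)"
    using int meas by simp
  also have "(LINT r|interval_measure l. cmod (f r)) = (LINT r|interval_measure l. indicator {0..l} r * cmod (f r))"
    by (intro Bochner_Integration.integral_cong) auto
  also have "\<dots> \<le> sqrt l * fs_norm (L2 l) f"
    using interval_integral_bound[OF F(6), of 0 l] l by simp
  finally have "l * cmod (f s) \<le> l * ((1 / sqrt l) * fs_norm (L2 l) f + sqrt l * fs_norm (L2 l) ?f1)"
    unfolding distrib_left mult.assoc[symmetric] ls by simp
  then have "cmod (f s) \<le> (1 / sqrt l) * fs_norm (L2 l) f + sqrt l * fs_norm (L2 l) ?f1"
    using l by simp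
  also have "\<dots> \<le> (1 / sqrt l) * fs_norm (H2 l) f + sqrt l * fs_norm (H2 l) f"
    using H2_L2_norm_le[OF l f] l by (intro add_mono mult_left_mono) auto
  finally show ?thesis by (simp add: algebra_simps)
qed

lemma L2_tendsto_uniform:
  assumes l: "0 \<le> l" and f: "\<And>n. continuous_on {0..l} (f n)" and g: "continuous_on {0..l} g"
    and u: "\<And>e. 0 < e \<Longrightarrow> \<exists>N. \<forall>n x. n \<ge> N \<and> x \<in> {0..l} \<longrightarrow> norm (f n x - g x) < e"
  shows "(\<lambda>n. fs_norm (L2 l) (\<lambda>y. f n y - g y)) \<longlonglongrightarrow> 0"
proof (rule LIMSEQ_I)
  fix e :: real assume e: "0 < e"
  obtain N where N: "\<And>n x. n \<ge> N \<Longrightarrow> x \<in> {0..l} \<Longrightarrow> norm (f n x - g x) < e / (sqrt l + 1)"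
    using u[of "e / (sqrt l + 1)"] e l by (auto simp: add_nonneg_pos)
  have "fs_norm (L2 l) (\<lambda>y. f n y - g y) < e" if "n \<ge> N" for n
  proof -
    have "fs_norm (L2 l) (\<lambda>y. f n y - g y) \<le> sqrt l * (e / (sqrt l + 1))"
      by (rule L2_bounded(2)[OF l measurable_continuous])
         (use N[OF that] e l f g in \<open>auto intro!: continuous_intros less_imp_le\<close>)
    also have "\<dots> < e"
    proof -
      have "0 < sqrt l + 1" using l by (simp add: add_nonneg_pos)
      then show ?thesis using e by (simp add: pos_divide_less_eq distrib_left mult.commute)
    qed
    finally show ?thesis .
  qed
  then show "\<exists>N. \<forall>n\<ge>N. norm (fs_norm (L2 l) (\<lambda>y. f n y - g y) - 0) < e" by auto
qed

text \<open>A sequence bounded in \<open>H2\<close> is uniformly bounded and has a common Hoelder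
  modulus with exponent 1/2, so Arzela-Ascoli yields a uniformly convergent subsequence; on a finite
  interval this is convergence in L2.\<close>

lemma compact_H2_L2:
  assumes l: "0 < l"
  shows "compact_op (H2 l) (L2 l) (\<lambda>f. f)"
proof (rule compact_opI[OF bounded_op_linear[OF bounded_H2_L2[OF l]]])
  fix f :: "nat \<Rightarrow> real \<Rightarrow> complex" and B
  assume f: "\<And>n. f n \<in> fs_set (H2 l)" and B: "\<And>n. fs_norm (H2 l) (f n) \<le> B"
  have B0: "0 \<le> B" using seminormed_fs.norm_nonneg[OF seminormed_H2[OF l] f] B by (rule order.trans)
  have "\<forall>n. \<exists>f2. is_H2_deriv2 l (f n) f2" using f by (simp add: H2_set_iff)
  then obtain f2 where f2: "\<And>n. is_H2_deriv2 l (f n) (f2 n)" by metis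
  note F = H2_deriv2_facts[OF l f2]
  have H: "cmod (f n s - f n r) \<le> sqrt (s - r) * B" if "0 \<le> r" "r \<le> s" "s \<le> l" for n r s
    using F(8)[OF that, of n] H2_L2_norm_le(2)[OF l f2, of n] B[of n] that
    by (smt (verit) mult_left_mono real_sqrt_ge_zero)
  have bound: "norm (f n x) \<le> (sqrt l + 1 / sqrt l) * B" if "x \<in> {0..l}" for n x
    using H2_sup_bound[OF l f2 that, of n] mult_left_mono[OF B[of n], of "sqrt l + 1 / sqrt l"] l by auto
  obtain g k where g: "continuous_on {0..l} g" and k: "strict_mono (k :: nat \<Rightarrow> nat)"
    and lim: "\<And>e. 0 < e \<Longrightarrow> \<exists>N. \<forall>n x. n \<ge> N \<and> x \<in> {0..l} \<longrightarrow> norm (f (k n) x - g x) < e"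
  proof (rule Arzela_Ascoli[of "{0..l}" f "(sqrt l + 1 / sqrt l) * B"])
    fix x e :: real assume x: "x \<in> {0..l}" and e: "0 < e"
    show "\<exists>d. 0 < d \<and> (\<forall>n y. y \<in> {0..l} \<and> norm (x - y) < d \<longrightarrow> norm (f n x - f n y) < e)"
    proof (intro exI[of _ "(e / (B + 1))\<^sup>2"] conjI allI impI)
      show "0 < (e / (B + 1))\<^sup>2" using e B0 by simp
      fix n y assume y: "y \<in> {0..l} \<and> norm (x - y) < (e / (B + 1))\<^sup>2"
      have "sqrt \<bar>x - y\<bar> < e / (B + 1)"
        by (rule real_less_lsqrt) (use y e B0 in auto)
      then have "sqrt \<bar>x - y\<bar> * (B + 1) < e" using B0 by (simp add: field_simps)
      moreover have "sqrt \<bar>x - y\<bar> * B \<le> sqrt \<bar>x - y\<bar> * (B + 1)" by (intro mult_left_mono) auto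
      moreover have "cmod (f n x - f n y) \<le> sqrt \<bar>x - y\<bar> * B"
        using H[of x y n] H[of y x n] x y by (cases "x \<le> y") (auto simp: norm_minus_commute)
      ultimately show "norm (f n x - f n y) < e" by linarith
    qed
  qed (use bound in auto)
  have "(\<lambda>n. fs_norm (L2 l) (\<lambda>y. f (k n) y - g y)) \<longlonglongrightarrow> 0"
    by (rule L2_tendsto_uniform[OF _ _ g lim]) (use l F(5) in auto)
  then show "\<exists>r g. strict_mono r \<and> g \<in> fs_set (L2 l) \<and> (\<lambda>n. fs_norm (L2 l) (\<lambda>y. f (r n) y - g y)) \<longlonglongrightarrow> 0"
    using k L2_continuous[OF _ g] l by (intro exI[of _ k] exI[of _ g]) auto
qed

section \<open>Integral operators\<close>

text \<open>The derivative is required in the open interval only: the integrands in question blow up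
  like an inverse square root at an end, where the primitive is still continuous.\<close>

lemma nn_integral_FTC_interior:
  fixes F f :: "real \<Rightarrow> real"
  assumes "a \<le> b" "continuous_on {a..b} F" "\<And>x. x \<in> {a<..<b} \<Longrightarrow> (F has_real_derivative f x) (at x)"
    and "\<And>x. x \<in> {a..b} \<Longrightarrow> 0 \<le> f x"
  shows "(\<integral>\<^sup>+x. ennreal (f x) * indicator {a..b} x \<partial>lborel) = ennreal (F b - F a)"
  using assms
  by (intro nn_integral_has_integral_lebesgue' fundamental_theorem_of_calculus_interior)
     (auto simp flip: has_real_derivative_iff_has_vector_derivative)

lemma nn_integral_interval_measure:
  assumes "f \<in> borel_measurable borel"
  shows "(\<integral>\<^sup>+x. f x \<partial>interval_measure l) = (\<integral>\<^sup>+x. f x * indicator {0..l} x \<partial>lborel)"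
  using assms by (simp add: nn_integral_restrict_space nn_integral_completion)

text \<open>The primitives on the two sides of \<open>s\<close> are \<open>2 * sqrt (u - s)\<close>
  and \<open>- 2 * sqrt (s - u)\<close>. This makes the square of a fourth-root singularity
  integrable, with a small integral over short intervals.\<close>

lemma nn_integral_inverse_sqrt:
  assumes "0 \<le> d"
  shows "(\<integral>\<^sup>+u. ennreal (1 / sqrt \<bar>u - s\<bar>) * indicator {s - d..s + d} u \<partial>lborel) \<le> ennreal (4 * sqrt d)"
proof -
  have 1: "(\<integral>\<^sup>+u. ennreal (1 / sqrt \<bar>u - s\<bar>) * indicator {s..s + d} u \<partial>lborel) = ennreal (2 * sqrt (s + d - s) - 2 * sqrt (s - s))"
    by (rule nn_integral_FTC_interior)
       (use assms in \<open>auto intro!: continuous_intros derivative_eq_intros simp: field_simps\<close>)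
  have 2: "(\<integral>\<^sup>+u. ennreal (1 / sqrt \<bar>u - s\<bar>) * indicator {s - d..s} u \<partial>lborel) = ennreal (- (2 * sqrt (s - s)) - - (2 * sqrt (s - (s - d))))"
    by (rule nn_integral_FTC_interior)
       (use assms in \<open>auto intro!: continuous_intros derivative_eq_intros simp: field_simps\<close>)
  have "(\<integral>\<^sup>+u. ennreal (1 / sqrt \<bar>u - s\<bar>) * indicator {s - d..s + d} u \<partial>lborel) \<le>
    (\<integral>\<^sup>+u. ennreal (1 / sqrt \<bar>u - s\<bar>) * indicator {s..s + d} u + ennreal (1 / sqrt \<bar>u - s\<bar>) * indicator {s - d..s} u \<partial>lborel)"
    by (intro nn_integral_mono) (auto simp: indicator_def)
  also have "\<dots> = ennreal (2 * sqrt d) + ennreal (2 * sqrt d)"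
    using 1 2 by (subst nn_integral_add) auto
  also have "\<dots> = ennreal (4 * sqrt d)" using assms by (simp flip: ennreal_plus)
  finally show ?thesis .
qed

text \<open>After cancellation, all kernels between adjacent arcs are bounded by this kernel.\<close>

definition end_dist :: "real \<Rightarrow> real \<Rightarrow> real" where
  "end_dist l s = min s (l - s)"

definition hardy :: "real \<Rightarrow> real \<Rightarrow> real \<Rightarrow> real \<Rightarrow> real" where
  "hardy l m s u = 1 / (end_dist l s + end_dist m u)"

lemma end_dist_nonneg: "s \<in> {0..l} \<Longrightarrow> 0 \<le> end_dist l s"
  by (simp add: end_dist_def)

lemma end_dist_pos: "s \<in> {0<..<l} \<Longrightarrow> 0 < end_dist l s"
  by (simp add: end_dist_def)

lemma end_dist_measurable [measurable]: "end_dist l \<in> borel_measurable borel"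
  unfolding end_dist_def[abs_def] by measurable

lemma hardy_nonneg: "s \<in> {0..l} \<Longrightarrow> u \<in> {0..m} \<Longrightarrow> 0 \<le> hardy l m s u"
  using end_dist_nonneg[of s l] end_dist_nonneg[of u m] by (simp add: hardy_def)

lemma hardy_commute: "hardy l m s u = hardy m l u s"
  by (simp add: hardy_def add.commute)

lemma hardy_lower_bound:
  assumes "s \<in> {0<..<l}" "u \<in> {0<..<m}"
  shows "1 / (l + m) \<le> hardy l m s u"
  using assms end_dist_pos[OF assms(1)] end_dist_pos[OF assms(2)]
  unfolding hardy_def by (intro divide_left_mono mult_pos_pos) (auto simp: end_dist_def min_def)

text \<open>Substituting the square root of \<open>u\<close> leads to the primitive
  \<open>2 / sqrt t * arctan (sqrt u / sqrt t)\<close>, and \<open>arctan\<close> stays below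
  \<open>pi / 2\<close>. So the kernel \<open>1 / (t + u)\<close> reproduces the weight
  \<open>1 / sqrt u\<close> up to the factor \<open>pi\<close>.\<close>

lemma nn_integral_hardy_one_end:
  assumes t: "0 < t" and m: "0 < m"
  shows "(\<integral>\<^sup>+u. ennreal (1 / ((t + u) * sqrt u)) * indicator {0..m} u \<partial>lborel) \<le> ennreal (pi / sqrt t)"
    and "(\<integral>\<^sup>+u. ennreal (1 / ((t + (m - u)) * sqrt (m - u))) * indicator {0..m} u \<partial>lborel) \<le> ennreal (pi / sqrt t)"
proof -
  have der: "((\<lambda>v. 2 / sqrt t * arctan (sqrt v / sqrt t)) has_real_derivative 1 / ((t + v) * sqrt v)) (at v)"
    if "0 < v" for v
  proof -
    define a b where "a = sqrt t" and "b = sqrt v"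
    have ab: "0 < a" "0 < b" "t = a * a" "v = b * b" using t that by (auto simp: a_def b_def)
    define S where "S = a * a + b * b"
    have S: "0 < S" using ab by (simp add: S_def add_pos_pos)
    have 1: "1 + (b / a)\<^sup>2 = S / (a * a)" using ab(1) by (simp add: S_def power_divide power2_eq_square add_divide_distrib)
    have "2 / a * (inverse (1 + (b / a)\<^sup>2) * (inverse b / 2 / a)) = 1 / (S * b)"
      unfolding 1 using ab(1,2) S by (simp add: divide_simps)
    then have "2 / sqrt t * (inverse (1 + (sqrt v / sqrt t)\<^sup>2) * (inverse (sqrt v) / 2 / sqrt t)) = 1 / ((t + v) * sqrt v)"
      unfolding a_def[symmetric] b_def[symmetric] S_def ab(3,4)[symmetric] by simp
    note eq = this
    have cancel: "X * (Y * sqrt t) * sqrt t / (t * t) = X * Y / t" for X Y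
    proof -
      have "X * (Y * sqrt t) * sqrt t / (t * t) = X * Y * (sqrt t * sqrt t) / (t * t)" by (simp add: mult_ac)
      then show ?thesis using t by simp
    qed
    show ?thesis
      by (rule DERIV_cong[OF _ eq]) (use t that in \<open>auto intro!: derivative_eq_intros simp: cancel\<close>)
  qed
  have le: "ennreal (2 / sqrt t * arctan (sqrt m / sqrt t)) \<le> ennreal (pi / sqrt t)"
    using t arctan_ubound[of "sqrt m / sqrt t"] by (intro ennreal_leI) (simp add: divide_right_mono)
  have "(\<integral>\<^sup>+u. ennreal (1 / ((t + u) * sqrt u)) * indicator {0..m} u \<partial>lborel) =
     ennreal (2 / sqrt t * arctan (sqrt m / sqrt t) - 2 / sqrt t * arctan (sqrt 0 / sqrt t))"
    by (rule nn_integral_FTC_interior) (use t m der in \<open>auto intro!: continuous_intros\<close>)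
  then show "(\<integral>\<^sup>+u. ennreal (1 / ((t + u) * sqrt u)) * indicator {0..m} u \<partial>lborel) \<le> ennreal (pi / sqrt t)"
    using le by simp
  have der': "((\<lambda>v. - (2 / sqrt t * arctan (sqrt (m - v) / sqrt t))) has_real_derivative
     1 / ((t + (m - v)) * sqrt (m - v))) (at v)" if "v < m" for v
  proof -
    have "((\<lambda>v. 2 / sqrt t * arctan (sqrt (m - v) / sqrt t)) has_real_derivative
        1 / ((t + (m - v)) * sqrt (m - v)) * - 1) (at v)"
      by (rule DERIV_chain2[where g = "\<lambda>v. m - v" and f = "\<lambda>v. 2 / sqrt t * arctan (sqrt v / sqrt t)"])
         (use der[of "m - v"] that in \<open>auto intro!: derivative_eq_intros\<close>)
    from DERIV_minus[OF this] show ?thesis by simp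
  qed
  have "(\<integral>\<^sup>+u. ennreal (1 / ((t + (m - u)) * sqrt (m - u))) * indicator {0..m} u \<partial>lborel) =
     ennreal (- (2 / sqrt t * arctan (sqrt (m - m) / sqrt t)) - - (2 / sqrt t * arctan (sqrt (m - 0) / sqrt t)))"
    by (rule nn_integral_FTC_interior) (use t m der' in \<open>auto intro!: continuous_intros\<close>)
  then show "(\<integral>\<^sup>+u. ennreal (1 / ((t + (m - u)) * sqrt (m - u))) * indicator {0..m} u \<partial>lborel) \<le> ennreal (pi / sqrt t)"
    using le by simp
qed

text \<open>\<open>end_dist m u\<close> is \<open>u\<close> or \<open>m - u\<close>, so the
  integrand is at most the sum of the two one-end integrands; each contributes
  \<open>pi\<close>.\<close>

lemma nn_integral_hardy_weight:
  assumes s: "s \<in> {0<..<l}" and m: "0 < m"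
  shows "(\<integral>\<^sup>+u. ennreal (hardy l m s u / sqrt (end_dist m u)) \<partial>interval_measure m) \<le> ennreal (2 * pi / sqrt (end_dist l s))"
proof -
  let ?t = "end_dist l s"
  have t: "0 < ?t" by (rule end_dist_pos[OF s])
  have [measurable]: "hardy l m s \<in> borel_measurable borel"
    unfolding hardy_def[abs_def] by measurable
  have "(\<integral>\<^sup>+u. ennreal (hardy l m s u / sqrt (end_dist m u)) \<partial>interval_measure m)
     = (\<integral>\<^sup>+u. ennreal (hardy l m s u / sqrt (end_dist m u)) * indicator {0..m} u \<partial>lborel)"
    by (rule nn_integral_interval_measure) measurable
  also have "\<dots> \<le> (\<integral>\<^sup>+u. ennreal (1 / ((?t + u) * sqrt u)) * indicator {0..m} u +
      ennreal (1 / ((?t + (m - u)) * sqrt (m - u))) * indicator {0..m} u \<partial>lborel)"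
  proof (intro nn_integral_mono)
    fix u :: real
    have "ennreal (hardy l m s u / sqrt (end_dist m u)) \<le> ennreal (1 / ((?t + u) * sqrt u)) + ennreal (1 / ((?t + (m - u)) * sqrt (m - u)))"
      if "u \<in> {0..m}"
    proof (cases "u \<le> m - u")
      case True
      then show ?thesis by (simp add: hardy_def end_dist_def[of m])
    next
      case False
      then show ?thesis by (simp add: hardy_def end_dist_def[of m])
    qed
    then show "ennreal (hardy l m s u / sqrt (end_dist m u)) * indicator {0..m} u \<le> ennreal (1 / ((?t + u) * sqrt u)) * indicator {0..m} u +
      ennreal (1 / ((?t + (m - u)) * sqrt (m - u))) * indicator {0..m} u"
      by (auto simp: indicator_def)
  qed
  also have "\<dots> \<le> ennreal (pi / sqrt ?t) + ennreal (pi / sqrt ?t)"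
    by (subst nn_integral_add; (intro add_mono nn_integral_hardy_one_end t m)?) auto
  also have "\<dots> = ennreal (2 * pi / sqrt ?t)"
    using t by (simp flip: ennreal_plus)
  finally show ?thesis .
qed

text \<open>The Schur test with weight \<open>1 / sqrt (end_dist u)\<close>.\<close>

lemma hardy_nn_integral_bound:
  assumes l: "0 < l" and m: "0 < m" and f[measurable]: "f \<in> borel_measurable (interval_measure m)"
  shows "(\<integral>\<^sup>+s. (\<integral>\<^sup>+u. ennreal (hardy l m s u) * f u \<partial>interval_measure m)\<^sup>2 \<partial>interval_measure l) \<le>
     ennreal ((2 * pi)\<^sup>2) * (\<integral>\<^sup>+u. (f u)\<^sup>2 \<partial>interval_measure m)"
proof -
  let ?M = "interval_measure l" and ?N = "interval_measure m"
  interpret pair_sigma_finite ?M ?N ..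
  have id[measurable]: "(\<lambda>x. x) \<in> borel_measurable (interval_measure r)" for r
    by (rule measurable_restrict_space1) (rule measurable_completion, simp)
  have d[measurable]: "end_dist r \<in> borel_measurable (interval_measure r')" for r r'
    using measurable_compose[OF id end_dist_measurable] .
  have k[measurable]: "(\<lambda>(s, u). hardy l m s u) \<in> borel_measurable (?M \<Otimes>\<^sub>M ?N)"
    unfolding hardy_def[abs_def] by measurable
  define w where "w u = sqrt (end_dist m u)" for u
  have w[measurable]: "w \<in> borel_measurable ?N" unfolding w_def[abs_def] by measurable
  have ks[measurable]: "hardy l m s \<in> borel_measurable ?N" for s
    unfolding hardy_def[abs_def] by measurable
  have ku[measurable]: "(\<lambda>s. hardy l m s u) \<in> borel_measurable ?M" for u
    unfolding hardy_def[abs_def] by measurable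
  \<comment> \<open>Cauchy-Schwarz after splitting the kernel into the square roots of
    \<open>hardy / w\<close> and \<open>hardy * w\<close>; the first factor is the weighted integral
    just estimated.\<close>
  have inner: "(\<integral>\<^sup>+u. ennreal (hardy l m s u) * f u \<partial>?N)\<^sup>2 \<le>
     ennreal (2 * pi / sqrt (end_dist l s)) * (\<integral>\<^sup>+u. ennreal (hardy l m s u * w u) * (f u)\<^sup>2 \<partial>?N)"
    if s: "s \<in> {0<..<l}" for s
  proof -
    have kw: "0 \<le> hardy l m s u" "0 \<le> w u" if "u \<in> space ?N" for u
      using that s hardy_nonneg[of s l u m] end_dist_nonneg[of u m] by (auto simp: w_def)
    have "(\<integral>\<^sup>+u. ennreal (hardy l m s u) * f u \<partial>?N) =
       (\<integral>\<^sup>+u. ennreal (sqrt (hardy l m s u / w u)) * (ennreal (sqrt (hardy l m s u * w u)) * f u) \<partial>?N)"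
    proof (rule nn_integral_cong_AE)
      show "AE u in ?N. ennreal (hardy l m s u) * f u =
        ennreal (sqrt (hardy l m s u / w u)) * (ennreal (sqrt (hardy l m s u * w u)) * f u)"
        using AE_interior[of m]
      proof eventually_elim
        fix u assume u: "u \<in> {0<..<m}"
        have k0: "0 \<le> hardy l m s u" using s u by (intro hardy_nonneg) auto
        have w0: "0 < w u" using end_dist_pos[OF u] by (simp add: w_def)
        have "sqrt (hardy l m s u / w u) * sqrt (hardy l m s u * w u) = hardy l m s u"
          using k0 w0 by (simp flip: real_sqrt_mult)
        then show "ennreal (hardy l m s u) * f u =
          ennreal (sqrt (hardy l m s u / w u)) * (ennreal (sqrt (hardy l m s u * w u)) * f u)"
          using k0 w0 by (simp add: ennreal_mult'[symmetric] mult.assoc[symmetric])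
      qed
    qed
    then have "(\<integral>\<^sup>+u. ennreal (hardy l m s u) * f u \<partial>?N)\<^sup>2 \<le> (\<integral>\<^sup>+u. (ennreal (sqrt (hardy l m s u / w u)))\<^sup>2 \<partial>?N) *
        (\<integral>\<^sup>+u. (ennreal (sqrt (hardy l m s u * w u)) * f u)\<^sup>2 \<partial>?N)"
      by (simp only:) (rule Cauchy_Schwarz_nn_integral; measurable)
    also have "(\<integral>\<^sup>+u. (ennreal (sqrt (hardy l m s u * w u)) * f u)\<^sup>2 \<partial>?N) = (\<integral>\<^sup>+u. ennreal (hardy l m s u * w u) * (f u)\<^sup>2 \<partial>?N)"
      using kw by (intro nn_integral_cong) (simp add: ennreal_power power_mult_distrib)
    also have "(\<integral>\<^sup>+u. (ennreal (sqrt (hardy l m s u / w u)))\<^sup>2 \<partial>?N) = (\<integral>\<^sup>+u. ennreal (hardy l m s u / w u) \<partial>?N)"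
      using kw by (intro nn_integral_cong) (simp add: ennreal_power)
    also have "\<dots> * (\<integral>\<^sup>+u. ennreal (hardy l m s u * w u) * (f u)\<^sup>2 \<partial>?N) \<le>
        ennreal (2 * pi / sqrt (end_dist l s)) * (\<integral>\<^sup>+u. ennreal (hardy l m s u * w u) * (f u)\<^sup>2 \<partial>?N)"
      unfolding w_def by (intro mult_right_mono nn_integral_hardy_weight[OF s m]) simp
    finally show ?thesis .
  qed
  have "(\<integral>\<^sup>+s. (\<integral>\<^sup>+u. ennreal (hardy l m s u) * f u \<partial>?N)\<^sup>2 \<partial>?M) \<le>
     (\<integral>\<^sup>+s. ennreal (2 * pi / sqrt (end_dist l s)) * (\<integral>\<^sup>+u. ennreal (hardy l m s u * w u) * (f u)\<^sup>2 \<partial>?N) \<partial>?M)"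
    by (rule nn_integral_mono_AE) (use AE_interior[of l] inner in \<open>auto elim: eventually_mono\<close>)
  also have "\<dots> = (\<integral>\<^sup>+s. (\<integral>\<^sup>+u. ennreal (2 * pi / sqrt (end_dist l s)) * (ennreal (hardy l m s u * w u) * (f u)\<^sup>2) \<partial>?N) \<partial>?M)"
    by (intro nn_integral_cong nn_integral_cmult[symmetric]) measurable
  \<comment> \<open>With the order exchanged, the weight estimate applies once more, now in
    \<open>s\<close>, because the kernel is symmetric. The square roots of \<open>end_dist\<close>
    cancel and \<open>(2 * pi)\<^sup>2\<close> remains.\<close>
  also have "\<dots> = (\<integral>\<^sup>+u. (\<integral>\<^sup>+s. ennreal (2 * pi / sqrt (end_dist l s)) * (ennreal (hardy l m s u * w u) * (f u)\<^sup>2) \<partial>?M) \<partial>?N)"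
    by (rule Fubini'[symmetric]) measurable
  also have "\<dots> \<le> (\<integral>\<^sup>+u. ennreal ((2 * pi)\<^sup>2) * (f u)\<^sup>2 \<partial>?N)"
  proof (rule nn_integral_mono_AE)
    show "AE u in ?N. (\<integral>\<^sup>+s. ennreal (2 * pi / sqrt (end_dist l s)) * (ennreal (hardy l m s u * w u) * (f u)\<^sup>2) \<partial>?M) \<le>
       ennreal ((2 * pi)\<^sup>2) * (f u)\<^sup>2"
      using AE_interior[of m]
    proof eventually_elim
      fix u assume u: "u \<in> {0<..<m}"
      have w0: "0 < w u" using end_dist_pos[OF u] by (simp add: w_def)
      have "(\<integral>\<^sup>+s. ennreal (2 * pi / sqrt (end_dist l s)) * (ennreal (hardy l m s u * w u) * (f u)\<^sup>2) \<partial>?M) =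
        (\<integral>\<^sup>+s. ennreal (hardy m l u s / sqrt (end_dist l s)) * (ennreal (2 * pi * w u) * (f u)\<^sup>2) \<partial>?M)"
      proof (rule nn_integral_cong)
        fix s assume "s \<in> space ?M"
        then have s: "s \<in> {0..l}" by simp
        have n: "0 \<le> hardy l m s u" "0 \<le> sqrt (end_dist l s)"
          using hardy_nonneg[OF s, of u m] end_dist_nonneg[OF s] u by auto
        have "2 * pi / sqrt (end_dist l s) * (hardy l m s u * w u) = hardy l m s u / sqrt (end_dist l s) * (2 * pi * w u)"
          by simp
        then have "ennreal (2 * pi / sqrt (end_dist l s)) * ennreal (hardy l m s u * w u) =
            ennreal (hardy l m s u / sqrt (end_dist l s)) * ennreal (2 * pi * w u)"
          using n w0 by (simp only: ennreal_mult[symmetric] divide_nonneg_nonneg mult_nonneg_nonneg less_imp_le pi_ge_zero zero_le_numeral)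
        then show "ennreal (2 * pi / sqrt (end_dist l s)) * (ennreal (hardy l m s u * w u) * (f u)\<^sup>2) =
          ennreal (hardy m l u s / sqrt (end_dist l s)) * (ennreal (2 * pi * w u) * (f u)\<^sup>2)"
          by (simp add: mult.assoc[symmetric] hardy_commute[of m l])
      qed
      also have "\<dots> = (\<integral>\<^sup>+s. ennreal (hardy m l u s / sqrt (end_dist l s)) \<partial>?M) * (ennreal (2 * pi * w u) * (f u)\<^sup>2)"
        by (rule nn_integral_multc) (unfold hardy_commute[of m l], measurable)
      also have "\<dots> \<le> ennreal (2 * pi / w u) * (ennreal (2 * pi * w u) * (f u)\<^sup>2)"
        unfolding w_def by (intro mult_right_mono nn_integral_hardy_weight[OF u l]) auto
      also have "\<dots> = ennreal ((2 * pi)\<^sup>2) * (f u)\<^sup>2"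
        using w0 by (simp add: mult.assoc[symmetric] ennreal_mult[symmetric] power2_eq_square)
      finally show "(\<integral>\<^sup>+s. ennreal (2 * pi / sqrt (end_dist l s)) * (ennreal (hardy l m s u * w u) * (f u)\<^sup>2) \<partial>?M) \<le>
       ennreal ((2 * pi)\<^sup>2) * (f u)\<^sup>2" .
    qed
  qed
  also have "\<dots> = ennreal ((2 * pi)\<^sup>2) * (\<integral>\<^sup>+u. (f u)\<^sup>2 \<partial>?N)"
    by (rule nn_integral_cmult) measurable
  finally show ?thesis .
qed

section \<open>Integral operators with kernels of Hardy type\<close>

lemma ident_interval_measurable: "(\<lambda>x. x) \<in> borel_measurable (interval_measure l)"
  by (rule measurable_restrict_space1) (rule measurable_completion, simp)

lemma borel_interval_measurable: "f \<in> borel_measurable borel \<Longrightarrow> f \<in> borel_measurable (interval_measure l)"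
  using measurable_compose[OF ident_interval_measurable] .

lemma borel_product_interval_measurable:
  fixes f :: "real \<times> real \<Rightarrow> 'b::topological_space"
  assumes "f \<in> borel_measurable borel"
  shows "(\<lambda>(s, u). f (s, u)) \<in> borel_measurable (interval_measure l \<Otimes>\<^sub>M interval_measure m)"
proof -
  have "(\<lambda>p. (fst p, snd p)) \<in> (interval_measure l \<Otimes>\<^sub>M interval_measure m) \<rightarrow>\<^sub>M (borel :: (real \<times> real) measure)"
    unfolding borel_prod[symmetric]
    by (intro measurable_Pair measurable_compose[OF measurable_fst ident_interval_measurable]
        measurable_compose[OF measurable_snd ident_interval_measurable])
  from measurable_compose[OF this assms] show ?thesis by (simp add: case_prod_unfold)
qed

lemma L2_cong_interior:
  assumes f: "f \<in> fs_set (L2 l)" and eq: "\<And>s. s \<in> {0<..<l} \<Longrightarrow> g s = f s"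
  shows "g \<in> fs_set (L2 l)" "fs_eq (L2 l) f g" "fs_norm (L2 l) g = fs_norm (L2 l) f"
proof -
  have g: "g \<in> borel_measurable (interval_measure l)"
    by (rule measurable_discrete_difference[OF L2_measurable[OF f], of "{0, l} \<inter> {0..l}"])
       (use eq in \<open>auto simp: sets_restrict_space\<close>)
  have ae: "AE s in interval_measure l. f s = g s"
    using AE_interior[of l] by eventually_elim (use eq in auto)
  show "g \<in> fs_set (L2 l)" "fs_eq (L2 l) f g" "fs_norm (L2 l) g = fs_norm (L2 l) f"
    using L2_cong_AE[OF f g ae] by auto
qed

lemma L2_weight_integral:
  assumes l: "0 \<le> l" and g: "g \<in> fs_set (L2 l)"
    and w: "w \<in> borel_measurable (interval_measure l)" and B: "\<And>t. t \<in> {0..l} \<Longrightarrow> cmod (w t) \<le> B" "0 \<le> B"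
  shows "integrable (interval_measure l) (\<lambda>t. w t * g t)"
    and "cmod (LINT t|interval_measure l. w t * g t) \<le> B * sqrt l * fs_norm (L2 l) g"
proof -
  have w': "w \<in> fs_set (L2 l)" "fs_norm (L2 l) w \<le> sqrt l * B"
    using L2_bounded[OF l w B] by auto
  show "integrable (interval_measure l) (\<lambda>t. w t * g t)"
    by (rule L2_mult_integrable(1)[OF w'(1) g])
  have "fs_norm (L2 l) w * fs_norm (L2 l) g \<le> B * sqrt l * fs_norm (L2 l) g"
    using w'(2) by (intro mult_right_mono) (auto simp: mult.commute)
  then show "cmod (LINT t|interval_measure l. w t * g t) \<le> B * sqrt l * fs_norm (L2 l) g"
    using L2_mult_integrable(2)[OF w'(1) g] by linarith
qed

lemma linear_op_integral:
  assumes mem: "\<And>f. f \<in> fs_set (L2 m) \<Longrightarrow> T f \<in> fs_set (L2 l)"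
    and k: "\<And>s. s \<in> {0<..<l} \<Longrightarrow> k s \<in> fs_set (L2 m)"
    and T: "\<And>f s. f \<in> fs_set (L2 m) \<Longrightarrow> s \<in> {0<..<l} \<Longrightarrow> T f s = (LINT u|interval_measure m. k s u * f u)"
  shows "linear_op (L2 m) (L2 l) T"
proof -
  have "fs_eq (L2 l) (T (\<lambda>x. f x + g x)) (\<lambda>y. T f y + T g y)" if f: "f \<in> fs_set (L2 m)" and g: "g \<in> fs_set (L2 m)" for f g
    by (rule L2_cong_interior(2)[OF mem[OF L2.add_mem[OF f g]]])
       (use T[OF L2.add_mem[OF f g]] T[OF f] T[OF g] L2_mult_integrable(1)[OF k f] L2_mult_integrable(1)[OF k g]
        in \<open>simp add: distrib_left\<close>)
  moreover have "fs_eq (L2 l) (T (\<lambda>x. c * f x)) (\<lambda>y. c * T f y)" if f: "f \<in> fs_set (L2 m)" for f c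
    by (rule L2_cong_interior(2)[OF mem[OF L2.scale_mem[OF f]]])
       (use T[OF L2.scale_mem[OF f]] T[OF f] in \<open>simp add: mult.left_commute\<close>)
  ultimately show ?thesis using mem by (simp add: linear_op_def)
qed

text \<open>Targets are confined to the open interval, so the denominator of \<open>hardy\<close> is
  positive even for \<open>u\<close> at an end; at a corner it would vanish and \<open>hardy\<close>
  would take the default value 0. Sections in \<open>u\<close> are then bounded by
  \<open>C / end_dist l s\<close>, while the operator norm is governed by the Schur test with
  constant \<open>C * (2 * pi)\<close>.\<close>

locale hardy_kernel =
  fixes l m :: real and k :: "real \<Rightarrow> real \<Rightarrow> complex" and C :: real
  assumes l: "0 < l" and m: "0 < m"
    and measurable: "(\<lambda>(s, u). k s u) \<in> borel_measurable (interval_measure l \<Otimes>\<^sub>M interval_measure m)"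
    and bound: "\<And>s u. s \<in> {0<..<l} \<Longrightarrow> u \<in> {0..m} \<Longrightarrow> cmod (k s u) \<le> C * hardy l m s u"
begin

lemma C_nonneg: "0 \<le> C"
proof -
  have "0 \<le> C * hardy l m (l / 2) (m / 2)"
    using order.trans[OF norm_ge_zero bound[of "l / 2" "m / 2"]] l m by simp
  moreover have "0 < hardy l m (l / 2) (m / 2)"
    using l m by (intro less_le_trans[OF _ hardy_lower_bound]) auto
  ultimately show ?thesis by (simp add: zero_le_mult_iff)
qed

lemma section_L2: "s \<in> {0<..<l} \<Longrightarrow> k s \<in> fs_set (L2 m)"
proof (rule L2_bounded(1)[where B = "C / end_dist l s"])
  assume s: "s \<in> {0<..<l}"
  have "s \<in> space (interval_measure l)" using s by auto
  from measurable_Pair2[OF measurable this] show "k s \<in> borel_measurable (interval_measure m)" by simp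
  have e: "0 < end_dist l s" by (rule end_dist_pos[OF s])
  fix u assume u: "u \<in> {0..m}"
  have "C * hardy l m s u \<le> C * (1 / end_dist l s)"
    unfolding hardy_def using e end_dist_nonneg[OF u] C_nonneg
    by (intro mult_left_mono divide_left_mono mult_pos_pos) auto
  then show "cmod (k s u) \<le> C / end_dist l s" using bound[OF s u] by simp
next
  assume "s \<in> {0<..<l}"
  then show "0 \<le> C / end_dist l s" using C_nonneg end_dist_pos[of s l] by simp
qed (use m in simp)

lemma nn_integral_square_bound:
  assumes f: "f \<in> fs_set (L2 m)"
  shows "(\<integral>\<^sup>+s. (\<integral>\<^sup>+u. ennreal (cmod (k s u) * cmod (f u)) \<partial>interval_measure m)\<^sup>2 \<partial>interval_measure l) \<le>
    ennreal ((C * (2 * pi) * fs_norm (L2 m) f)\<^sup>2)"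
proof -
  note [measurable] = L2_measurable[OF f]
  have hm: "hardy l m s \<in> borel_measurable (interval_measure m)" for s
    by (rule borel_interval_measurable) (simp add: hardy_def[abs_def])
  have "(\<integral>\<^sup>+s. (\<integral>\<^sup>+u. ennreal (cmod (k s u) * cmod (f u)) \<partial>interval_measure m)\<^sup>2 \<partial>interval_measure l) \<le>
    (\<integral>\<^sup>+s. (ennreal C)\<^sup>2 * (\<integral>\<^sup>+u. ennreal (hardy l m s u) * ennreal (cmod (f u)) \<partial>interval_measure m)\<^sup>2 \<partial>interval_measure l)"
  proof (rule nn_integral_mono_AE)
    show "AE s in interval_measure l. (\<integral>\<^sup>+u. ennreal (cmod (k s u) * cmod (f u)) \<partial>interval_measure m)\<^sup>2 \<le>
      (ennreal C)\<^sup>2 * (\<integral>\<^sup>+u. ennreal (hardy l m s u) * ennreal (cmod (f u)) \<partial>interval_measure m)\<^sup>2"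
      using AE_interior[of l]
    proof eventually_elim
      fix s assume s: "s \<in> {0<..<l}"
      have "(\<integral>\<^sup>+u. ennreal (cmod (k s u) * cmod (f u)) \<partial>interval_measure m) \<le>
        (\<integral>\<^sup>+u. ennreal C * (ennreal (hardy l m s u) * ennreal (cmod (f u))) \<partial>interval_measure m)"
      proof (rule nn_integral_mono)
        fix u assume "u \<in> space (interval_measure m)"
        then have u: "u \<in> {0..m}" by simp
        have h: "0 \<le> hardy l m s u" using s u by (intro hardy_nonneg) auto
        have "cmod (k s u) * cmod (f u) \<le> C * (hardy l m s u * cmod (f u))"
          using mult_right_mono[OF bound[OF s u], of "cmod (f u)"] by (simp add: mult.assoc)
        then show "ennreal (cmod (k s u) * cmod (f u)) \<le> ennreal C * (ennreal (hardy l m s u) * ennreal (cmod (f u)))"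
          using h C_nonneg by (simp add: ennreal_mult[symmetric] ennreal_leI)
      qed
      also have "\<dots> = ennreal C * (\<integral>\<^sup>+u. ennreal (hardy l m s u) * ennreal (cmod (f u)) \<partial>interval_measure m)"
        by (rule nn_integral_cmult) (use hm in measurable)
      finally show "(\<integral>\<^sup>+u. ennreal (cmod (k s u) * cmod (f u)) \<partial>interval_measure m)\<^sup>2 \<le>
        (ennreal C)\<^sup>2 * (\<integral>\<^sup>+u. ennreal (hardy l m s u) * ennreal (cmod (f u)) \<partial>interval_measure m)\<^sup>2"
        unfolding power_mult_distrib[symmetric] by (rule power_mono) simp
    qed
  qed
  also have "\<dots> = (ennreal C)\<^sup>2 * (\<integral>\<^sup>+s. (\<integral>\<^sup>+u. ennreal (hardy l m s u) * ennreal (cmod (f u)) \<partial>interval_measure m)\<^sup>2 \<partial>interval_measure l)"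
  proof (rule nn_integral_cmult)
    have [measurable]: "(\<lambda>(s, u). hardy l m s u) \<in> borel_measurable (interval_measure l \<Otimes>\<^sub>M interval_measure m)"
      unfolding hardy_def[abs_def] using borel_interval_measurable[OF end_dist_measurable] by measurable
    show "(\<lambda>s. (\<integral>\<^sup>+u. ennreal (hardy l m s u) * ennreal (cmod (f u)) \<partial>interval_measure m)\<^sup>2) \<in> borel_measurable (interval_measure l)"
      by measurable
  qed
  also have "\<dots> \<le> (ennreal C)\<^sup>2 * (ennreal ((2 * pi)\<^sup>2) * (\<integral>\<^sup>+u. (ennreal (cmod (f u)))\<^sup>2 \<partial>interval_measure m))"
    by (intro mult_left_mono hardy_nn_integral_bound l m) auto
  also have "\<dots> = ennreal ((C * (2 * pi) * fs_norm (L2 m) f)\<^sup>2)"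
    unfolding L2_nn_integral[OF f] using C_nonneg
    by (simp add: ennreal_power ennreal_mult[symmetric] power_mult_distrib mult.assoc)
  finally show ?thesis .
qed

lemma integral_L2:
  assumes f: "f \<in> fs_set (L2 m)"
  shows "(\<lambda>s. LINT u|interval_measure m. k s u * f u) \<in> fs_set (L2 l)"
    and "fs_norm (L2 l) (\<lambda>s. LINT u|interval_measure m. k s u * f u) \<le> C * (2 * pi) * fs_norm (L2 m) f"
proof -
  note [measurable] = L2_measurable[OF f] measurable
  have 1: "(\<lambda>s. LINT u|interval_measure m. k s u * f u) \<in> borel_measurable (interval_measure l)"
    by measurable
  have "(\<integral>\<^sup>+s. ennreal (cmod (LINT u|interval_measure m. k s u * f u))^2 \<partial>interval_measure l) \<le>
    (\<integral>\<^sup>+s. (\<integral>\<^sup>+u. ennreal (cmod (k s u) * cmod (f u)) \<partial>interval_measure m)\<^sup>2 \<partial>interval_measure l)"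
  proof (rule nn_integral_mono_AE)
    show "AE s in interval_measure l. ennreal (cmod (LINT u|interval_measure m. k s u * f u))^2 \<le>
      (\<integral>\<^sup>+u. ennreal (cmod (k s u) * cmod (f u)) \<partial>interval_measure m)\<^sup>2"
      using AE_interior[of l]
    proof eventually_elim
      fix s assume s: "s \<in> {0<..<l}"
      have "ennreal (cmod (LINT u|interval_measure m. k s u * f u)) \<le> (\<integral>\<^sup>+u. ennreal (cmod (k s u * f u)) \<partial>interval_measure m)"
        by (rule integral_norm_bound_ennreal[OF L2_mult_integrable(1)[OF section_L2[OF s] f]])
      then show "ennreal (cmod (LINT u|interval_measure m. k s u * f u))^2 \<le>
        (\<integral>\<^sup>+u. ennreal (cmod (k s u) * cmod (f u)) \<partial>interval_measure m)\<^sup>2"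
        by (intro power_mono) (auto simp: norm_mult)
    qed
  qed
  also have "\<dots> \<le> ennreal ((C * (2 * pi) * fs_norm (L2 m) f)\<^sup>2)" by (rule nn_integral_square_bound[OF f])
  finally have 2: "(\<integral>\<^sup>+s. ennreal (cmod (LINT u|interval_measure m. k s u * f u))^2 \<partial>interval_measure l) \<le>
    ennreal ((C * (2 * pi) * fs_norm (L2 m) f)\<^sup>2)" .
  have 3: "0 \<le> C * (2 * pi) * fs_norm (L2 m) f" using C_nonneg by simp
  show "(\<lambda>s. LINT u|interval_measure m. k s u * f u) \<in> fs_set (L2 l)"
    and "fs_norm (L2 l) (\<lambda>s. LINT u|interval_measure m. k s u * f u) \<le> C * (2 * pi) * fs_norm (L2 m) f"
    by (rule L2_memI_nn[OF 1 3 2])+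
qed

lemma bounded_op_L2:
  assumes T: "\<And>f s. f \<in> fs_set (L2 m) \<Longrightarrow> s \<in> {0<..<l} \<Longrightarrow> T f s = (LINT u|interval_measure m. k s u * f u)"
  shows "bounded_op (L2 m) (L2 l) T"
proof (rule bounded_opI)
  note cong = L2_cong_interior[OF integral_L2(1) T]
  show "linear_op (L2 m) (L2 l) T"
    by (rule linear_op_integral[OF cong(1) section_L2 T])
  show "fs_norm (L2 l) (T f) \<le> C * (2 * pi) * fs_norm (L2 m) f" if f: "f \<in> fs_set (L2 m)" for f
    using cong(3)[OF f f] integral_L2(2)[OF f] by simp
qed

text \<open>The Schur test bounds the inner integrals in the square mean. Since
  \<open>x \<le> 1 + x\<^sup>2\<close> and the measure is finite, this gives absolute integrability
  on the product, which Fubini needs.\<close>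

lemma Fubini_weighted:
  assumes f: "f \<in> fs_set (L2 m)" and w: "w \<in> borel_measurable (interval_measure l)"
    and B: "\<And>t. t \<in> {0..l} \<Longrightarrow> cmod (w t) \<le> B" "0 \<le> B"
  shows "integrable (interval_measure m) (\<lambda>u. (LINT t|interval_measure l. w t * k t u) * f u)"
    and "(LINT u|interval_measure m. (LINT t|interval_measure l. w t * k t u) * f u) =
         (LINT t|interval_measure l. w t * (LINT u|interval_measure m. k t u * f u))"
proof -
  let ?M = "interval_measure l" and ?N = "interval_measure m"
  interpret pair_sigma_finite ?M ?N ..
  note [measurable] = L2_measurable[OF f] measurable w
  have Phi: "integrable (?M \<Otimes>\<^sub>M ?N) (\<lambda>(t, u). w t * k t u * f u)"
  proof (rule integrableI_bounded)
    have "(\<integral>\<^sup>+p. ennreal (norm (case p of (t, u) \<Rightarrow> w t * k t u * f u)) \<partial>(?M \<Otimes>\<^sub>M ?N)) =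
       (\<integral>\<^sup>+t. (\<integral>\<^sup>+u. ennreal (norm (w t * k t u * f u)) \<partial>?N) \<partial>?M)"
      by (subst interval_measure.nn_integral_fst[symmetric]) auto
    also have "\<dots> \<le> (\<integral>\<^sup>+t. ennreal B * (1 + (\<integral>\<^sup>+u. ennreal (cmod (k t u) * cmod (f u)) \<partial>?N)\<^sup>2) \<partial>?M)"
    proof (rule nn_integral_mono)
      fix t assume "t \<in> space ?M"
      then have t: "t \<in> {0..l}" by simp
      have [measurable]: "k t \<in> borel_measurable ?N"
        using measurable_Pair2[OF measurable, of t] t by simp
      have "(\<integral>\<^sup>+u. ennreal (norm (w t * k t u * f u)) \<partial>?N) = ennreal (cmod (w t)) * (\<integral>\<^sup>+u. ennreal (cmod (k t u) * cmod (f u)) \<partial>?N)"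
        by (subst nn_integral_cmult[symmetric]) (auto simp: norm_mult ennreal_mult' mult.assoc)
      also have "\<dots> \<le> ennreal B * (1 + (\<integral>\<^sup>+u. ennreal (cmod (k t u) * cmod (f u)) \<partial>?N)\<^sup>2)"
      proof (intro mult_mono ennreal_leI B t)
        have "x \<le> 1 + x\<^sup>2" for x :: ennreal
        proof (cases "x \<le> 1")
          case False
          then have "x * 1 \<le> x * x" by (intro mult_left_mono) auto
          then show ?thesis by (simp add: power2_eq_square add_increasing)
        qed (simp add: add_increasing2)
        then show "(\<integral>\<^sup>+u. ennreal (cmod (k t u) * cmod (f u)) \<partial>?N) \<le> 1 + (\<integral>\<^sup>+u. ennreal (cmod (k t u) * cmod (f u)) \<partial>?N)\<^sup>2" .
      qed auto
      finally show "(\<integral>\<^sup>+u. ennreal (norm (w t * k t u * f u)) \<partial>?N) \<le> ennreal B * (1 + (\<integral>\<^sup>+u. ennreal (cmod (k t u) * cmod (f u)) \<partial>?N)\<^sup>2)" .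
    qed
    also have "\<dots> = ennreal B * (emeasure ?M (space ?M) + (\<integral>\<^sup>+t. (\<integral>\<^sup>+u. ennreal (cmod (k t u) * cmod (f u)) \<partial>?N)\<^sup>2 \<partial>?M))"
      by (subst nn_integral_cmult; (subst nn_integral_add)?) auto
    also have "\<dots> < \<infinity>"
    proof -
      have "(\<integral>\<^sup>+t. (\<integral>\<^sup>+u. ennreal (cmod (k t u) * cmod (f u)) \<partial>?N)\<^sup>2 \<partial>?M) < \<infinity>"
        using nn_integral_square_bound[OF f] by (simp add: order_le_less_trans)
      moreover have "emeasure ?M (space ?M) < \<infinity>"
        using interval_measure.finite_emeasure_space[of l] by (simp only: infinity_ennreal_def less_top)
      ultimately show ?thesis by (simp add: ennreal_mult_less_top)
    qed
    finally show "(\<integral>\<^sup>+p. ennreal (norm (case p of (t, u) \<Rightarrow> w t * k t u * f u)) \<partial>(?M \<Otimes>\<^sub>M ?N)) < \<infinity>" .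
  qed measurable
  have "integrable ?N (\<lambda>u. LINT t|?M. w t * k t u * f u)"
    by (rule integrable_snd[OF Phi])
  then show "integrable ?N (\<lambda>u. (LINT t|?M. w t * k t u) * f u)" by simp
  have "(LINT u|?N. LINT t|?M. w t * k t u * f u) = (LINT t|?M. LINT u|?N. w t * k t u * f u)"
    using integral_fst[OF Phi] integral_snd[OF Phi] by simp
  moreover have "(LINT t|?M. w t * k t u * f u) = (LINT t|?M. w t * k t u) * f u" for u
    by (rule integral_mult_left_zero)
  moreover have "(LINT u|?N. w t * k t u * f u) = w t * (LINT u|?N. k t u * f u)" for t
    unfolding mult.assoc by (rule integral_mult_right_zero)
  ultimately show "(LINT u|?N. (LINT t|?M. w t * k t u) * f u) = (LINT t|?M. w t * (LINT u|?N. k t u * f u))"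
    by (simp only:)
qed

end

section \<open>Integration against the ramp \<open>max 0 (s - t)\<close> and bounds into
  \<open>H2\<close>\<close>

lemma ramp_measurable: "(\<lambda>t. complex_of_real (max 0 (s - t))) \<in> borel_measurable (interval_measure l)"
  by (rule borel_interval_measurable) measurable

lemma ramp_bound: "s \<in> {0..l} \<Longrightarrow> t \<in> {0..l} \<Longrightarrow> cmod (complex_of_real (max 0 (s - t))) \<le> l"
  by auto

text \<open>The increment of the ramp minus its linear part is supported between \<open>r\<close>
  and \<open>s\<close> and is at most \<open>\<bar>r - s\<bar>\<close> there. Cauchy-Schwarz on that
  short interval makes the remainder of order
  \<open>\<bar>r - s\<bar> * sqrt \<bar>r - s\<bar>\<close>, so no continuity of \<open>g\<close> is
  involved.\<close>

lemma ramp_integral_deriv: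
  assumes l: "0 < l" and g: "g \<in> fs_set (L2 l)" and s: "s \<in> {0..l}"
  shows "((\<lambda>s. LINT t|interval_measure l. complex_of_real (max 0 (s - t)) * g t) has_vector_derivative
     (LINT t|interval_measure l. indicator {0..s} t *\<^sub>R g t)) (at s within {0..l})"
  (is "(?W has_vector_derivative ?P) _")
  unfolding has_vector_derivative_def
proof (rule has_derivativeI_sandwich[of 1])
  show "((\<lambda>r. sqrt \<bar>r - s\<bar> * fs_norm (L2 l) g) \<longlongrightarrow> 0) (at s within {0..l})"
    by (auto intro!: tendsto_eq_intros)
  show "bounded_linear (\<lambda>r. r *\<^sub>R ?P)" by (rule bounded_linear_scaleR_left)
  have l': "0 \<le> l" using l by simp
  fix r assume r: "r \<in> {0..l}" and rs: "r \<noteq> s"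
  let ?A = "{min r s..max r s}"
  have mm: "max r s - min r s = \<bar>r - s\<bar>" by auto
  have int: "integrable (interval_measure l) (\<lambda>t. complex_of_real (max 0 (q - t)) * g t)" if "q \<in> {0..l}" for q
    by (rule L2_weight_integral(1)[OF l' g ramp_measurable ramp_bound[OF that] l'])
  have ind: "integrable (interval_measure l) (\<lambda>t. indicator A t *\<^sub>R g t)" if "A \<in> sets lebesgue" for A
    by (rule L2_integrable[OF L2_indicator_mult(1)[OF g that] l'])
  have i2: "integrable (interval_measure l) (\<lambda>t. indicator ?A t * cmod (g t))"
    using integrable_norm[OF ind[of ?A]] by simp
  have eq: "?W r - ?W s - (r - s) *\<^sub>R ?P =
    (LINT t|interval_measure l. complex_of_real (max 0 (r - t)) * g t - complex_of_real (max 0 (s - t)) * g t - (r - s) *\<^sub>R (indicator {0..s} t *\<^sub>R g t))"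
    using int[OF r] int[OF s] ind[of "{0..s}"] by (simp del: scaleR_scaleR of_real_diff)
  have "cmod (?W r - ?W s - (r - s) *\<^sub>R ?P) \<le> (LINT t|interval_measure l. \<bar>r - s\<bar> * (indicator ?A t * cmod (g t)))"
    unfolding eq
  proof (rule order.trans[OF integral_norm_bound integral_mono])
    show "integrable (interval_measure l) (\<lambda>t. cmod (complex_of_real (max 0 (r - t)) * g t - complex_of_real (max 0 (s - t)) * g t - (r - s) *\<^sub>R (indicator {0..s} t *\<^sub>R g t)))"
      by (intro integrable_norm Bochner_Integration.integrable_diff integrable_scaleR_right int r s ind) auto
    show "integrable (interval_measure l) (\<lambda>t. \<bar>r - s\<bar> * (indicator ?A t * cmod (g t)))"
      using i2 by simp
    fix t assume "t \<in> space (interval_measure l)"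
    then have t: "t \<in> {0..l}" by simp
    have "complex_of_real (max 0 (r - t)) * g t - complex_of_real (max 0 (s - t)) * g t - (r - s) *\<^sub>R (indicator {0..s} t *\<^sub>R g t)
      = complex_of_real (max 0 (r - t) - max 0 (s - t) - (r - s) * indicator {0..s} t) * g t"
      by (simp add: algebra_simps scaleR_conv_of_real)
    moreover have "\<bar>max 0 (r - t) - max 0 (s - t) - (r - s) * indicator {0..s} t\<bar> \<le> \<bar>r - s\<bar> * indicator ?A t"
      using t by (auto simp: indicator_def min_def max_def)
    ultimately show "cmod (complex_of_real (max 0 (r - t)) * g t - complex_of_real (max 0 (s - t)) * g t - (r - s) *\<^sub>R (indicator {0..s} t *\<^sub>R g t))
      \<le> \<bar>r - s\<bar> * (indicator ?A t * cmod (g t))"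
      by (simp only: norm_mult norm_of_real mult.assoc[symmetric]) (simp only: mult_right_mono norm_ge_zero)
  qed
  also have "\<dots> = \<bar>r - s\<bar> * (LINT t|interval_measure l. indicator ?A t * cmod (g t))" by simp
  also have "\<dots> \<le> \<bar>r - s\<bar> * (sqrt \<bar>r - s\<bar> * fs_norm (L2 l) g)"
    using interval_integral_bound[OF g, of "min r s" "max r s"] r s mm by (intro mult_left_mono) auto
  finally show "norm (?W r - ?W s - (r - s) *\<^sub>R ?P) / norm (r - s) \<le> sqrt \<bar>r - s\<bar> * fs_norm (L2 l) g"
    using rs by (simp add: divide_le_eq mult.commute)
qed simp

text \<open>The ramp integral is the twofold primitive of \<open>g\<close>, so \<open>g\<close> is
  the weak second derivative of \<open>h\<close>. This is the criterion by which membership and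
  bounds in \<open>H2\<close> are established; \<open>B\<close> depends on \<open>l\<close>
  alone.\<close>

lemma H2_of_ramp_integral:
  assumes l: "0 < l"
  obtains B where "0 \<le> B"
    "\<And>g h \<alpha> \<beta>. g \<in> fs_set (L2 l) \<Longrightarrow>
      (\<And>s. s \<in> {0..l} \<Longrightarrow> h s = \<alpha> + of_real s * \<beta> + (LINT t|interval_measure l. complex_of_real (max 0 (s - t)) * g t)) \<Longrightarrow>
      h \<in> fs_set (H2 l) \<and> fs_norm (H2 l) h \<le> B * (cmod \<alpha> + cmod \<beta> + fs_norm (L2 l) g)"
proof -
  have l': "0 \<le> l" using l by simp
  \<comment> \<open>The three summands bound, in this order, the function, its first and its second
    derivative.\<close>
  define B where "B = sqrt l * (1 + l + l * sqrt l) + sqrt l * (1 + sqrt l) + 1"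
  have B0: "0 \<le> B" using l by (simp add: B_def)
  have BX: "B * x = sqrt l * ((1 + l + l * sqrt l) * x) + sqrt l * ((1 + sqrt l) * x) + x" for x
    by (simp add: B_def distrib_right mult.assoc)
  have "h \<in> fs_set (H2 l) \<and> fs_norm (H2 l) h \<le> B * (cmod \<alpha> + cmod \<beta> + fs_norm (L2 l) g)"
    if g: "g \<in> fs_set (L2 l)"
      and h: "\<And>s. s \<in> {0..l} \<Longrightarrow> h s = \<alpha> + of_real s * \<beta> + (LINT t|interval_measure l. complex_of_real (max 0 (s - t)) * g t)"
    for g h \<alpha> \<beta>
  proof -
    let ?W = "\<lambda>s. LINT t|interval_measure l. complex_of_real (max 0 (s - t)) * g t"
    let ?P = "\<lambda>s. LINT t|interval_measure l. indicator {0..s} t *\<^sub>R g t"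
    let ?n = "fs_norm (L2 l) g"
    have der: "(h has_vector_derivative \<beta> + ?P s) (at s within {0..l})" if s: "s \<in> {0..l}" for s
    proof (rule has_vector_derivative_transform[OF s])
      show "((\<lambda>s. \<alpha> + of_real s * \<beta> + ?W s) has_vector_derivative \<beta> + ?P s) (at s within {0..l})"
        using ramp_integral_deriv[OF l g s] by (auto intro!: derivative_eq_intros)
    qed (use h in simp)
    have P0: "?P 0 = 0"
      using L2_primitive_bound[OF g, of 0 0]
    proof -
      have "AE t in interval_measure l. indicator {0..0} t *\<^sub>R g t = 0"
        using AE_interior[of l] by eventually_elim auto
      then show ?thesis by (rule integral_eq_zero_AE)
    qed
    have d2: "is_H2_deriv2 l h g"
    proof (rule is_H2_deriv2I[OF g der])
      show "\<beta> + ?P s = \<beta> + ?P 0 + (LINT t:{0..s}|lebesgue. g t)" if s: "s \<in> {0..l}" for s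
      proof -
        have "(LINT t:{0..s}|lebesgue. g t) = ?P s"
          by (rule set_integral_interval_measure) (use s in auto)
        then show ?thesis unfolding P0 by simp
      qed
    qed
    note H = H2_deriv2_facts[OF l d2]
    have Pb: "cmod (?P s) \<le> sqrt l * ?n" if s: "s \<in> {0..l}" for s
    proof -
      have "cmod (?P s) \<le> sqrt (s - 0) * ?n"
        using L2_primitive_bound[OF g, of 0 s] s unfolding P0 by simp
      also have "\<dots> \<le> sqrt l * ?n" using s by (intro mult_right_mono) auto
      finally show ?thesis .
    qed
    have Wb: "cmod (?W s) \<le> l * sqrt l * ?n" if "s \<in> {0..l}" for s
      by (rule L2_weight_integral(2)[OF l' g ramp_measurable ramp_bound[OF that] l'])
    have hb: "cmod (h s) \<le> (1 + l + l * sqrt l) * (cmod \<alpha> + cmod \<beta> + ?n)" if s: "s \<in> {0..l}" for s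
    proof -
      have "cmod (h s) \<le> cmod \<alpha> + s * cmod \<beta> + cmod (?W s)"
        unfolding h[OF s] using s
        by (intro order.trans[OF norm_triangle_ineq] add_right_mono order.trans[OF norm_triangle_ineq]) (auto simp: norm_mult)
      also have "\<dots> \<le> cmod \<alpha> + l * cmod \<beta> + l * sqrt l * ?n"
        using s Wb[OF s] by (intro add_mono mult_right_mono) auto
      also have "\<dots> \<le> (1 + l + l * sqrt l) * (cmod \<alpha> + cmod \<beta> + ?n)"
        using l by (simp add: distrib_left distrib_right)
      finally show ?thesis .
    qed
    have h1: "vector_derivative h (at s within {0..l}) = \<beta> + ?P s" if "s \<in> {0..l}" for s
      by (rule vector_derivative_within_interval[OF l that der[OF that]])
    have h1b: "cmod (vector_derivative h (at s within {0..l})) \<le> (1 + sqrt l) * (cmod \<alpha> + cmod \<beta> + ?n)" if s: "s \<in> {0..l}" for s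
    proof -
      have "cmod (\<beta> + ?P s) \<le> cmod \<beta> + sqrt l * ?n"
        using Pb[OF s] norm_triangle_ineq[of \<beta> "?P s"] by linarith
      also have "\<dots> \<le> (1 + sqrt l) * (cmod \<alpha> + cmod \<beta> + ?n)"
        using l by (simp add: distrib_left distrib_right)
      finally show ?thesis unfolding h1[OF s] .
    qed
    have "fs_norm (L2 l) h \<le> sqrt l * ((1 + l + l * sqrt l) * (cmod \<alpha> + cmod \<beta> + ?n))"
      by (rule L2_bounded(2)[OF l' L2_measurable[OF H(6)] hb]) (use l in auto)
    moreover have "fs_norm (L2 l) (\<lambda>s. vector_derivative h (at s within {0..l})) \<le> sqrt l * ((1 + sqrt l) * (cmod \<alpha> + cmod \<beta> + ?n))"
      by (rule L2_bounded(2)[OF l' L2_measurable[OF H(7)] h1b]) (use l in auto)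
    moreover have "fs_norm (H2 l) h \<le> fs_norm (L2 l) h + (fs_norm (L2 l) (\<lambda>s. vector_derivative h (at s within {0..l})) + ?n)"
      unfolding H2_norm_eq[OF l d2]
      by (intro order.trans[OF norm_Pair_le] add_mono order.trans[OF norm_Pair_le]) auto
    moreover have "?n \<le> cmod \<alpha> + cmod \<beta> + ?n" by simp
    ultimately have "fs_norm (H2 l) h \<le> B * (cmod \<alpha> + cmod \<beta> + ?n)"
      using BX[of "cmod \<alpha> + cmod \<beta> + ?n"] by linarith
    then show ?thesis using d2 by (auto simp: H2_set_iff)
  qed
  then show ?thesis using that B0 by blast
qed

text \<open>Integrating \<open>rep\<close> against \<open>f\<close> and exchanging the integrals
  puts \<open>T f\<close> into the form of the ramp criterion, with a second derivative that the
  Schur test controls. The term with \<open>\<gamma>\<close> stands for a Dirac mass on the diagonal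
  in the second derivative of the kernel: it is present for the surface Green's function and absent
  for layer potentials, and a diagonal presupposes \<open>l = m\<close>.\<close>

lemma (in hardy_kernel) bounded_op_H2:
  assumes kL2: "\<And>s. s \<in> {0..l} \<Longrightarrow> K s \<in> fs_set (L2 m)"
    and rep: "\<And>s u. s \<in> {0..l} \<Longrightarrow> u \<in> {0<..<m} \<Longrightarrow> K s u = K 0 u + of_real s * b u
      + (LINT t|interval_measure l. complex_of_real (max 0 (s - t)) * k t u) + \<gamma> * complex_of_real (max 0 (s - u))"
    and \<gamma>: "\<gamma> = 0 \<or> l = m"
    and T: "\<And>f s. f \<in> fs_set (L2 m) \<Longrightarrow> s \<in> {0..l} \<Longrightarrow> T f s = (LINT u|interval_measure m. K s u * f u)"
  shows "bounded_op (L2 m) (H2 l) T"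
proof -
  interpret H2: seminormed_fs "H2 l" by (rule seminormed_H2[OF l])
  have l': "0 \<le> l" and m': "0 \<le> m" using l m by auto
  \<comment> \<open>\<open>R f\<close> will be the weak second derivative of
    \<open>T f\<close>.\<close>
  define R where "R f t = (LINT u|interval_measure m. k t u * f u) + \<gamma> * f t" for f t
  define J where "J f s = (LINT t|interval_measure l. complex_of_real (max 0 (s - t)) * R f t)" for f s
  have R: "R f \<in> fs_set (L2 l)" "fs_norm (L2 l) (R f) \<le> (C * (2 * pi) + cmod \<gamma>) * fs_norm (L2 m) f"
    if f: "f \<in> fs_set (L2 m)" for f
  proof -
    have 1: "(\<lambda>t. \<gamma> * f t) \<in> fs_set (L2 l)" "fs_norm (L2 l) (\<lambda>t. \<gamma> * f t) = cmod \<gamma> * fs_norm (L2 m) f"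
      using \<gamma> L2.scale_mem[OF f, of \<gamma>] L2.norm_scale[OF f, of \<gamma>] L2.zero_mem L2.norm_zero by (cases "\<gamma> = 0"; auto)+
    show "R f \<in> fs_set (L2 l)" unfolding R_def[abs_def] by (rule L2.add_mem[OF integral_L2(1)[OF f] 1(1)])
    have "fs_norm (L2 l) (R f) \<le> fs_norm (L2 l) (\<lambda>t. LINT u|interval_measure m. k t u * f u) + cmod \<gamma> * fs_norm (L2 m) f"
      unfolding R_def[abs_def] 1(2)[symmetric] by (rule L2.norm_add[OF integral_L2(1)[OF f] 1(1)])
    then show "fs_norm (L2 l) (R f) \<le> (C * (2 * pi) + cmod \<gamma>) * fs_norm (L2 m) f"
      using integral_L2(2)[OF f] by (simp add: distrib_right)
  qed
  have Jb: "cmod (J f s) \<le> l * sqrt l * fs_norm (L2 l) (R f)" if "f \<in> fs_set (L2 m)" "s \<in> {0..l}" for f s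
    unfolding J_def by (rule L2_weight_integral(2)[OF l' R(1)[OF that(1)] ramp_measurable ramp_bound[OF that(2)] l'])
  have Tb: "cmod (T f s) \<le> fs_norm (L2 m) (K s) * fs_norm (L2 m) f" if "f \<in> fs_set (L2 m)" "s \<in> {0..l}" for f s
    unfolding T[OF that] by (rule L2_mult_integrable(2)[OF kL2[OF that(2)] that(1)])
  have repr: "T f s = T f 0 + of_real s * ((T f l - T f 0 - J f l) / of_real l) + J f s"
    if f: "f \<in> fs_set (L2 m)" and s: "s \<in> {0..l}" for f s
  proof -
    let ?N = "interval_measure m"
    define w where "w s t = complex_of_real (max 0 (s - t))" for s t :: real
    have wm: "w s \<in> borel_measurable (interval_measure r)" for s r
      unfolding w_def[abs_def] by (rule ramp_measurable)
    have wb: "cmod (w s t) \<le> l" if "s \<in> {0..l}" "t \<in> {0..l}" for s t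
      unfolding w_def by (rule ramp_bound[OF that])
    define V where "V s u = (LINT t|interval_measure l. w s t * k t u) + \<gamma> * w s u" for s u
    have V: "integrable ?N (\<lambda>u. V s u * f u)" "(LINT u|?N. V s u * f u) = J f s" if s: "s \<in> {0..l}" for s
    proof -
      note F = Fubini_weighted[OF f wm wb[OF s] l']
      have G: "integrable ?N (\<lambda>u. \<gamma> * w s u * f u)"
        "(LINT u|?N. \<gamma> * w s u * f u) = (LINT t|interval_measure l. w s t * (\<gamma> * f t))"
      proof -
        have "integrable ?N (\<lambda>u. w s u * f u)" if "l = m"
          by (rule L2_weight_integral(1)[OF m' f wm wb[OF s] l']) (use that in auto)
        then show "integrable ?N (\<lambda>u. \<gamma> * w s u * f u)" using \<gamma> by (cases "\<gamma> = 0") (auto simp: mult.assoc)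
        show "(LINT u|?N. \<gamma> * w s u * f u) = (LINT t|interval_measure l. w s t * (\<gamma> * f t))"
          using \<gamma> by (cases "\<gamma> = 0") (auto simp: mult_ac)
      qed
      show "integrable ?N (\<lambda>u. V s u * f u)"
        unfolding V_def distrib_right by (intro Bochner_Integration.integrable_add F(1) G(1))
      have i1: "integrable (interval_measure l) (\<lambda>t. w s t * (LINT u|?N. k t u * f u))"
        by (rule L2_weight_integral(1)[OF l' integral_L2(1)[OF f] wm wb[OF s] l'])
      have gf: "(\<lambda>t. \<gamma> * f t) \<in> fs_set (L2 l)"
        using \<gamma> L2.scale_mem[OF f, of \<gamma>] L2.zero_mem by (cases "\<gamma> = 0") auto
      have i2: "integrable (interval_measure l) (\<lambda>t. w s t * (\<gamma> * f t))"
        by (rule L2_weight_integral(1)[OF l' gf wm wb[OF s] l'])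
      have "(LINT u|?N. V s u * f u) = (LINT u|?N. (LINT t|interval_measure l. w s t * k t u) * f u) + (LINT u|?N. \<gamma> * w s u * f u)"
        unfolding V_def distrib_right by (rule Bochner_Integration.integral_add[OF F(1) G(1)])
      also have "\<dots> = (LINT t|interval_measure l. w s t * (LINT u|?N. k t u * f u)) + (LINT t|interval_measure l. w s t * (\<gamma> * f t))"
        by (simp only: F(2) G(2))
      also have "\<dots> = J f s"
        unfolding J_def R_def w_def[symmetric] distrib_left
        by (rule Bochner_Integration.integral_add[OF i1 i2, symmetric])
      finally show "(LINT u|?N. V s u * f u) = J f s" .
    qed
    \<comment> \<open>Nothing is known about the slope \<open>b\<close> as a function of
      \<open>u\<close>. Solving \<open>rep\<close> at \<open>s = l\<close> for \<open>b u\<close>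
      yields this integrand, whose product with \<open>f\<close> is integrable.\<close>
    define \<beta> where "\<beta> = (LINT u|?N. ((K l u - K 0 u - V l u) / of_real l) * f u)"
    have l0: "(of_real l :: complex) \<noteq> 0" using l by simp
    have e: "0 \<in> {0..l}" "l \<in> {0..l}" using l by auto
    have iK: "integrable ?N (\<lambda>u. K s u * f u)" if "s \<in> {0..l}" for s
      by (rule L2_mult_integrable(1)[OF kL2[OF that] f])
    have i\<beta>: "integrable ?N (\<lambda>u. ((K l u - K 0 u - V l u) / of_real l) * f u)"
      "\<beta> = (T f l - T f 0 - J f l) / of_real l"
    proof -
      have eq: "((K l u - K 0 u - V l u) / of_real l) * f u = (K l u * f u - K 0 u * f u - V l u * f u) / of_real l" for u
        by (simp add: field_simps)
      show "integrable ?N (\<lambda>u. ((K l u - K 0 u - V l u) / of_real l) * f u)"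
        unfolding eq using iK[OF e(1)] iK[OF e(2)] V(1)[OF e(2)] by auto
      show "\<beta> = (T f l - T f 0 - J f l) / of_real l"
        unfolding \<beta>_def eq T[OF f e(1)] T[OF f e(2)] V(2)[OF e(2), symmetric]
        using iK[OF e(1)] iK[OF e(2)] V(1)[OF e(2)] by simp
    qed
    have rep': "K s u = K 0 u + of_real s * b u + V s u" if "s \<in> {0..l}" "u \<in> {0<..<m}" for s u
      using rep[OF that] by (simp add: V_def w_def add.assoc)
    have "AE u in ?N. K s u * f u = K 0 u * f u + of_real s * (((K l u - K 0 u - V l u) / of_real l) * f u) + V s u * f u"
      using AE_interior[of m]
    proof eventually_elim
      fix u assume u: "u \<in> {0<..<m}"
      have "b u = (K l u - K 0 u - V l u) / of_real l"
        using rep'[OF e(2) u] l0 by (simp add: field_simps)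
      then show "K s u * f u = K 0 u * f u + of_real s * (((K l u - K 0 u - V l u) / of_real l) * f u) + V s u * f u"
        using rep'[OF s u] by (simp add: distrib_right)
    qed
    then have "T f s = (LINT u|?N. K 0 u * f u + of_real s * (((K l u - K 0 u - V l u) / of_real l) * f u) + V s u * f u)"
      unfolding T[OF f s] using iK[OF s] iK[OF e(1)] i\<beta>(1) V(1)[OF s]
      by (intro integral_cong_AE borel_measurable_integrable Bochner_Integration.integrable_add integrable_mult_right) auto
    also have "\<dots> = T f 0 + of_real s * \<beta> + J f s"
      unfolding \<beta>_def T[OF f e(1)] V(2)[OF s, symmetric]
      using iK[OF e(1)] i\<beta>(1) V(1)[OF s] by (simp del: times_divide_eq_left)
    finally show ?thesis unfolding i\<beta>(2) .
  qed
  obtain B where B: "0 \<le> B" and H: "\<And>g h \<alpha> \<beta>. g \<in> fs_set (L2 l) \<Longrightarrow>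
      (\<And>s. s \<in> {0..l} \<Longrightarrow> h s = \<alpha> + of_real s * \<beta> + (LINT t|interval_measure l. complex_of_real (max 0 (s - t)) * g t)) \<Longrightarrow>
      h \<in> fs_set (H2 l) \<and> fs_norm (H2 l) h \<le> B * (cmod \<alpha> + cmod \<beta> + fs_norm (L2 l) g)"
    by (rule H2_of_ramp_integral[OF l]) blast
  have HT: "T f \<in> fs_set (H2 l)" "fs_norm (H2 l) (T f) \<le> B * (cmod (T f 0) + cmod ((T f l - T f 0 - J f l) / of_real l) + fs_norm (L2 l) (R f))"
    if f: "f \<in> fs_set (L2 m)" for f
    using H[OF R(1)[OF f] repr[OF f, unfolded J_def[of f s for s]]] unfolding J_def by blast+
  \<comment> \<open>The criterion with vanishing data shows that a function zero on the interval is
    null in \<open>H2\<close>, so pointwise linearity of the integral suffices for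
    \<open>linear_op\<close>.\<close>
  have zero: "fs_norm (H2 l) h = 0" if h: "h \<in> fs_set (H2 l)" "\<And>s. s \<in> {0..l} \<Longrightarrow> h s = 0" for h
    using H[OF L2.zero_mem, of h 0 0] h H2.norm_nonneg[OF h(1)] L2.norm_zero[of l] by (auto intro: order.antisym)
  show ?thesis
  proof (rule bounded_opI)
    have "fs_eq (H2 l) (T (\<lambda>x. f x + g x)) (\<lambda>y. T f y + T g y)" if f: "f \<in> fs_set (L2 m)" and g: "g \<in> fs_set (L2 m)" for f g
      unfolding fs_eq_def
    proof (rule zero)
      show "(\<lambda>y. T (\<lambda>x. f x + g x) y - (T f y + T g y)) \<in> fs_set (H2 l)"
        by (intro H2.diff_mem H2.add_mem HT f g L2.add_mem)
      show "T (\<lambda>x. f x + g x) s - (T f s + T g s) = 0" if s: "s \<in> {0..l}" for s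
        unfolding T[OF f s] T[OF g s] T[OF L2.add_mem[OF f g] s]
        using L2_mult_integrable(1)[OF kL2[OF s] f] L2_mult_integrable(1)[OF kL2[OF s] g] by (simp add: distrib_left)
    qed
    moreover have "fs_eq (H2 l) (T (\<lambda>x. c * f x)) (\<lambda>y. c * T f y)" if f: "f \<in> fs_set (L2 m)" for f c
      unfolding fs_eq_def
    proof (rule zero)
      show "(\<lambda>y. T (\<lambda>x. c * f x) y - c * T f y) \<in> fs_set (H2 l)"
        by (intro H2.diff_mem H2.scale_mem HT f L2.scale_mem)
      show "T (\<lambda>x. c * f x) s - c * T f s = 0" if s: "s \<in> {0..l}" for s
        unfolding T[OF f s] T[OF L2.scale_mem[OF f] s] by (simp add: mult.left_commute)
    qed
    ultimately show "linear_op (L2 m) (H2 l) T" using HT(1) by (simp add: linear_op_def)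
    define K0 Kl D where "K0 = fs_norm (L2 m) (K 0)" and "Kl = fs_norm (L2 m) (K l)" and "D = C * (2 * pi) + cmod \<gamma>"
    fix f assume f: "f \<in> fs_set (L2 m)"
    let ?n = "fs_norm (L2 m) f"
    have e: "0 \<in> {0..l}" "l \<in> {0..l}" using l by auto
    have "cmod (T f l - T f 0 - J f l) \<le> cmod (T f l) + cmod (T f 0) + cmod (J f l)"
      by (intro order.trans[OF norm_triangle_ineq4] add_right_mono norm_triangle_ineq4)
    also have "\<dots> \<le> Kl * ?n + K0 * ?n + l * sqrt l * (D * ?n)"
      unfolding Kl_def K0_def D_def using Tb[OF f e(1)] Tb[OF f e(2)] Jb[OF f e(2)] R(2)[OF f] l
      by (intro add_mono order.trans[OF Jb[OF f e(2)]] mult_left_mono) auto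
    finally have 1: "cmod ((T f l - T f 0 - J f l) / of_real l) \<le> (Kl * ?n + K0 * ?n + l * sqrt l * (D * ?n)) / l"
      using l by (simp add: norm_divide divide_right_mono)
    have "fs_norm (H2 l) (T f) \<le> B * (K0 * ?n + (Kl * ?n + K0 * ?n + l * sqrt l * (D * ?n)) / l + D * ?n)"
      using HT(2)[OF f] Tb[OF f e(1)] 1 R(2)[OF f] B unfolding K0_def[symmetric] D_def[symmetric]
      by (elim order.trans) (intro mult_left_mono add_mono)
    also have "\<dots> = (B * (K0 + (Kl + K0 + l * sqrt l * D) / l + D)) * ?n"
      using l by (simp add: field_simps)
    finally show "fs_norm (H2 l) (T f) \<le> (B * (K0 + (Kl + K0 + l * sqrt l * D) / l + D)) * ?n" .
  qed
qed

text \<open>Continuity of the sections as elements of L2 gives every image \<open>T f\<close> a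
  modulus of continuity that depends only on a bound for the norm of \<open>f\<close>. Images of
  bounded sequences are thus equicontinuous and Arzela-Ascoli applies.\<close>

lemma L2_continuous_kernel_op:
  assumes l: "0 < l" and m: "0 < m"
    and kL2: "\<And>s. s \<in> {0..l} \<Longrightarrow> k s \<in> fs_set (L2 m)"
    and cont: "\<And>s e. s \<in> {0..l} \<Longrightarrow> 0 < e \<Longrightarrow>
      \<exists>d>0. \<forall>r\<in>{0..l}. \<bar>r - s\<bar> < d \<longrightarrow> fs_norm (L2 m) (\<lambda>u. k r u - k s u) < e"
    and T: "\<And>f s. f \<in> fs_set (L2 m) \<Longrightarrow> s \<in> {0..l} \<Longrightarrow> T f s = (LINT u|interval_measure m. k s u * f u)"
  shows "bounded_op (L2 m) (L2 l) T" "compact_op (L2 m) (L2 l) T"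
proof -
  have l': "0 \<le> l" using l by simp
  have Td: "cmod (T f r - T f s) \<le> fs_norm (L2 m) (\<lambda>u. k r u - k s u) * fs_norm (L2 m) f"
    if f: "f \<in> fs_set (L2 m)" and r: "r \<in> {0..l}" and s: "s \<in> {0..l}" for f r s
  proof -
    have "T f r - T f s = (LINT u|interval_measure m. (k r u - k s u) * f u)"
      unfolding T[OF f r] T[OF f s] left_diff_distrib
      by (rule Bochner_Integration.integral_diff[OF L2_mult_integrable(1)[OF kL2[OF r] f] L2_mult_integrable(1)[OF kL2[OF s] f], symmetric])
    then show ?thesis using L2_mult_integrable(2)[OF L2.diff_mem[OF kL2[OF r] kL2[OF s]] f] by simp
  qed
  have "continuous_on {0..l} (\<lambda>s. fs_norm (L2 m) (k s))"
    unfolding continuous_on_iff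
  proof (intro ballI allI impI)
    fix s e :: real assume s: "s \<in> {0..l}" and e: "0 < e"
    obtain d where d: "0 < d" "\<And>r. r \<in> {0..l} \<Longrightarrow> \<bar>r - s\<bar> < d \<Longrightarrow> fs_norm (L2 m) (\<lambda>u. k r u - k s u) < e"
      using cont[OF s e] by blast
    have "\<bar>fs_norm (L2 m) (k r) - fs_norm (L2 m) (k s)\<bar> < e" if r: "r \<in> {0..l}" and "\<bar>r - s\<bar> < d" for r
      using d(2)[OF that] L2.norm_le_diff[OF kL2[OF r] kL2[OF s]] L2.norm_le_diff[OF kL2[OF s] kL2[OF r]]
        L2.norm_diff_commute[OF kL2[OF r] kL2[OF s]] by linarith
    then show "\<exists>d>0. \<forall>r\<in>{0..l}. dist r s < d \<longrightarrow> dist (fs_norm (L2 m) (k r)) (fs_norm (L2 m) (k s)) < e"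
      using d(1) by (auto simp: dist_real_def)
  qed
  from compact_imp_bounded[OF compact_continuous_image[OF this compact_Icc]]
  obtain N where "\<forall>s\<in>{0..l}. fs_norm (L2 m) (k s) \<le> N"
    by (auto simp: bounded_iff)
  then have N: "fs_norm (L2 m) (k s) \<le> N" if "s \<in> {0..l}" for s using that by blast
  have N0: "0 \<le> N" using order.trans[OF L2_norm_nonneg N[of 0]] l by simp
  have Tb: "cmod (T f s) \<le> N * fs_norm (L2 m) f" if f: "f \<in> fs_set (L2 m)" and s: "s \<in> {0..l}" for f s
    using L2_mult_integrable(2)[OF kL2[OF s] f] mult_right_mono[OF N[OF s], of "fs_norm (L2 m) f"]
    unfolding T[OF f s] by simp
  have equi: "\<exists>d>0. \<forall>f r. f \<in> fs_set (L2 m) \<and> fs_norm (L2 m) f \<le> B \<and> r \<in> {0..l} \<and> \<bar>r - s\<bar> < d \<longrightarrow> cmod (T f r - T f s) < e"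
    if s: "s \<in> {0..l}" and e: "0 < e" for s e B
  proof -
    have "0 < e / (\<bar>B\<bar> + 1)" using e by simp
    from cont[OF s this] obtain d where d: "0 < d"
      "\<And>r. r \<in> {0..l} \<Longrightarrow> \<bar>r - s\<bar> < d \<Longrightarrow> fs_norm (L2 m) (\<lambda>u. k r u - k s u) < e / (\<bar>B\<bar> + 1)" by blast
    have "cmod (T f r - T f s) < e" if "f \<in> fs_set (L2 m)" "fs_norm (L2 m) f \<le> B" "r \<in> {0..l}" "\<bar>r - s\<bar> < d" for f r
    proof -
      have "cmod (T f r - T f s) \<le> fs_norm (L2 m) (\<lambda>u. k r u - k s u) * (\<bar>B\<bar> + 1)"
        by (rule order.trans[OF Td[OF that(1,3) s] mult_left_mono]) (use that in auto)
      also have "\<dots> < e" using d(2)[OF that(3,4)] by (simp add: pos_less_divide_eq)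
      finally show ?thesis .
    qed
    then show ?thesis using d(1) by blast
  qed
  have Tc: "continuous_on {0..l} (T f)" if f: "f \<in> fs_set (L2 m)" for f
    unfolding continuous_on_iff
  proof (intro ballI allI impI)
    fix s e :: real assume s: "s \<in> {0..l}" "0 < e"
    from equi[OF this, of "fs_norm (L2 m) f"] f
    show "\<exists>d>0. \<forall>r\<in>{0..l}. dist r s < d \<longrightarrow> dist (T f r) (T f s) < e"
      unfolding dist_real_def dist_norm by blast
  qed
  have TL2: "T f \<in> fs_set (L2 l)" if "f \<in> fs_set (L2 m)" for f
    by (rule L2_continuous[OF l' Tc[OF that]])
  have lin: "linear_op (L2 m) (L2 l) T"
    by (rule linear_op_integral[OF TL2, where k = k]) (use kL2 T in auto)
  show "bounded_op (L2 m) (L2 l) T"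
  proof (rule bounded_opI[OF lin])
    show "fs_norm (L2 l) (T f) \<le> (sqrt l * N) * fs_norm (L2 m) f" if f: "f \<in> fs_set (L2 m)" for f
      using L2_bounded(2)[OF l' L2_measurable[OF TL2[OF f]] Tb[OF f]] N0 by (simp add: mult.assoc)
  qed
  show "compact_op (L2 m) (L2 l) T"
  proof (rule compact_opI[OF lin])
    fix f :: "nat \<Rightarrow> real \<Rightarrow> complex" and B
    assume f: "\<And>n. f n \<in> fs_set (L2 m)" and B: "\<And>n. fs_norm (L2 m) (f n) \<le> B"
    obtain g q where g: "continuous_on {0..l} g" and q: "strict_mono (q :: nat \<Rightarrow> nat)"
      and lim: "\<And>e. 0 < e \<Longrightarrow> \<exists>N. \<forall>n x. n \<ge> N \<and> x \<in> {0..l} \<longrightarrow> norm (T (f (q n)) x - g x) < e"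
    proof (rule Arzela_Ascoli[of "{0..l}" "\<lambda>n. T (f n)" "N * B"])
      show "norm (T (f n) x) \<le> N * B" if "x \<in> {0..l}" for n x
        using Tb[OF f that, of n] mult_left_mono[OF B[of n] N0] by linarith
      fix x e :: real assume x: "x \<in> {0..l}" and e: "0 < e"
      from equi[OF x e, of B] obtain d where d: "0 < d"
        "\<And>h r. h \<in> fs_set (L2 m) \<Longrightarrow> fs_norm (L2 m) h \<le> B \<Longrightarrow> r \<in> {0..l} \<Longrightarrow> \<bar>r - x\<bar> < d \<Longrightarrow> cmod (T h r - T h x) < e"
        by blast
      have "norm (T (f n) x - T (f n) y) < e" if "y \<in> {0..l} \<and> norm (x - y) < d" for n y
        using d(2)[OF f B, of y n] that by (simp add: norm_minus_commute abs_minus_commute)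
      then show "\<exists>d. 0 < d \<and> (\<forall>n y. y \<in> {0..l} \<and> norm (x - y) < d \<longrightarrow> norm (T (f n) x - T (f n) y) < e)"
        using d(1) by blast
    qed auto
    have "(\<lambda>n. fs_norm (L2 l) (\<lambda>y. T (f (q n)) y - g y)) \<longlonglongrightarrow> 0"
      by (rule L2_tendsto_uniform[OF l' Tc[OF f] g lim])
    then show "\<exists>r g. strict_mono r \<and> g \<in> fs_set (L2 l) \<and> (\<lambda>n. fs_norm (L2 l) (\<lambda>y. T (f (r n)) y - g y)) \<longlonglongrightarrow> 0"
      using q L2_continuous[OF l' g] by (intro exI[of _ q] exI[of _ g]) auto
  qed
qed

text \<open>Near the diagonal the two sections are small separately, since the fourth-root
  singularity squares to an integrable one; away from it the kernel is uniformly continuous on a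
  compact set. The domain \<open>A\<close> of a fin is not closed, so continuity is required on a
  compact superset \<open>B\<close>.\<close>

lemma weakly_singular_L2_continuous:
  fixes \<kappa> :: "real \<Rightarrow> real \<Rightarrow> complex"
  assumes l: "0 < l" and m: "0 < m"
    and A: "A \<in> sets lebesgue" "A \<subseteq> B" and B: "compact B" "B \<subseteq> {0..m}"
    and cont: "continuous_on {(s, u). s \<in> {0..l} \<and> u \<in> B \<and> s \<noteq> u} (\<lambda>(s, u). \<kappa> s u)"
    and bound: "\<And>s u. s \<in> {0..l} \<Longrightarrow> u \<in> A \<Longrightarrow> s \<noteq> u \<Longrightarrow> cmod (\<kappa> s u) \<le> C / sqrt (sqrt \<bar>s - u\<bar>)"
  defines "k \<equiv> \<lambda>s u. if u \<in> A \<and> u \<noteq> s then \<kappa> s u else 0"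
  shows "s \<in> {0..l} \<Longrightarrow> k s \<in> fs_set (L2 m)"
    and "s \<in> {0..l} \<Longrightarrow> 0 < e \<Longrightarrow>
      \<exists>d>0. \<forall>r\<in>{0..l}. \<bar>r - s\<bar> < d \<longrightarrow> fs_norm (L2 m) (\<lambda>u. k r u - k s u) < e"
proof -
  have meas: "k s \<in> borel_measurable (interval_measure m)" if s: "s \<in> {0..l}" for s
  proof -
    have "continuous_on (B - {s}) (\<lambda>u. (\<lambda>(s, u). \<kappa> s u) (s, u))"
      by (rule continuous_on_compose2[OF cont]) (use s in \<open>auto intro!: continuous_intros\<close>)
    then have "(\<lambda>u. indicator (B - {s}) u *\<^sub>R \<kappa> s u) \<in> borel_measurable borel"
      using B(1) by (intro borel_measurable_continuous_on_indicator sets.Diff borel_closed compact_imp_closed) auto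
    then have 1: "(\<lambda>u. indicator (B - {s}) u *\<^sub>R \<kappa> s u) \<in> borel_measurable (interval_measure m)"
      by (rule borel_interval_measurable)
    have 2: "indicat_real A \<in> borel_measurable (interval_measure m)"
      using A by (intro measurable_restrict_space1) simp
    have "k s = (\<lambda>u. indicator A u *\<^sub>R (indicator (B - {s}) u *\<^sub>R \<kappa> s u))"
      using A(2) by (intro ext) (auto simp: k_def indicator_def)
    then show ?thesis using borel_measurable_scaleR[OF 2 1] by simp
  qed
  have sqb: "(cmod (k s u))\<^sup>2 \<le> C\<^sup>2 * (1 / sqrt \<bar>u - s\<bar>)" if "s \<in> {0..l}" for s u
  proof (cases "u \<in> A \<and> u \<noteq> s")
    case True
    then have "cmod (k s u) \<le> C / sqrt (sqrt \<bar>s - u\<bar>)" using bound[OF that, of u] by (auto simp: k_def)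
    then have "(cmod (k s u))\<^sup>2 \<le> (C / sqrt (sqrt \<bar>s - u\<bar>))\<^sup>2" by (intro power_mono) auto
    then show ?thesis by (simp add: power_divide abs_minus_commute)
  qed (auto simp: k_def)
  have sing: "(\<integral>\<^sup>+u. ennreal (C\<^sup>2 * (1 / sqrt \<bar>u - s\<bar>)) * indicator {s - d..s + d} u \<partial>interval_measure m) \<le> ennreal (C\<^sup>2 * (4 * sqrt d))"
    if "0 \<le> d" for s d
  proof -
    have "(\<integral>\<^sup>+u. ennreal (C\<^sup>2 * (1 / sqrt \<bar>u - s\<bar>)) * indicator {s - d..s + d} u \<partial>interval_measure m) =
       (\<integral>\<^sup>+u. ennreal (C\<^sup>2 * (1 / sqrt \<bar>u - s\<bar>)) * indicator {s - d..s + d} u * indicator {0..m} u \<partial>lborel)"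
      by (rule nn_integral_interval_measure) measurable
    also have "\<dots> \<le> (\<integral>\<^sup>+u. ennreal (C\<^sup>2) * (ennreal (1 / sqrt \<bar>u - s\<bar>) * indicator {s - d..s + d} u) \<partial>lborel)"
      by (rule nn_integral_mono) (simp add: indicator_def ennreal_mult[symmetric])
    also have "\<dots> = ennreal (C\<^sup>2) * (\<integral>\<^sup>+u. ennreal (1 / sqrt \<bar>u - s\<bar>) * indicator {s - d..s + d} u \<partial>lborel)"
      by (rule nn_integral_cmult) measurable
    also have "\<dots> \<le> ennreal (C\<^sup>2) * ennreal (4 * sqrt d)"
      by (intro mult_left_mono nn_integral_inverse_sqrt that) simp
    finally show ?thesis using that by (simp add: ennreal_mult)
  qed
  show kL2: "k s \<in> fs_set (L2 m)" if s: "s \<in> {0..l}" for s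
  proof (rule L2_memI_nn(1)[OF meas[OF s], of "sqrt (C\<^sup>2 * (4 * sqrt (l + m)))"])
    have "(\<integral>\<^sup>+u. (ennreal (cmod (k s u)))\<^sup>2 \<partial>interval_measure m) \<le>
      (\<integral>\<^sup>+u. ennreal (C\<^sup>2 * (1 / sqrt \<bar>u - s\<bar>)) * indicator {s - (l + m)..s + (l + m)} u \<partial>interval_measure m)"
    proof (rule nn_integral_mono)
      fix u assume "u \<in> space (interval_measure m)"
      then have "u \<in> {s - (l + m)..s + (l + m)}" using s l m by auto
      then show "(ennreal (cmod (k s u)))\<^sup>2 \<le> ennreal (C\<^sup>2 * (1 / sqrt \<bar>u - s\<bar>)) * indicator {s - (l + m)..s + (l + m)} u"
        using sqb[OF s, of u] by (simp add: ennreal_power ennreal_leI)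
    qed
    also have "\<dots> \<le> ennreal (C\<^sup>2 * (4 * sqrt (l + m)))" using l m by (intro sing) auto
    finally show "(\<integral>\<^sup>+u. (ennreal (cmod (k s u)))\<^sup>2 \<partial>interval_measure m) \<le> ennreal ((sqrt (C\<^sup>2 * (4 * sqrt (l + m))))\<^sup>2)"
      using l m by simp
  qed (use l m in simp)
  show "\<exists>d>0. \<forall>r\<in>{0..l}. \<bar>r - s\<bar> < d \<longrightarrow> fs_norm (L2 m) (\<lambda>u. k r u - k s u) < e" if s: "s \<in> {0..l}" and e: "0 < e" for s e
  proof -
    \<comment> \<open>Chosen so that the singular part costs at most \<open>e\<^sup>2 / 4\<close>;
      \<open>\<eta>\<close> costs the same away from the diagonal. The intervals below have radius
      \<open>3 * \<delta>\<close> because a point within \<open>2 * \<delta>\<close> of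
      \<open>s\<close> lies within \<open>3 * \<delta>\<close> of \<open>r\<close>.\<close>
    define \<delta> where "\<delta> = (e\<^sup>2 / (64 * (C\<^sup>2 + 1)))\<^sup>2 / 3"
    have c0: "0 < C\<^sup>2 + 1" by (simp add: add_nonneg_pos)
    have \<delta>: "0 < \<delta>" using e c0 by (simp add: \<delta>_def)
    have s3: "sqrt (3 * \<delta>) = e\<^sup>2 / (64 * (C\<^sup>2 + 1))"
      unfolding \<delta>_def using c0 by (simp add: real_sqrt_unique)
    define \<eta> where "\<eta> = e\<^sup>2 / (4 * m)"
    have \<eta>: "0 < \<eta>" using e m by (simp add: \<eta>_def)
    define Q where "Q = {(s, u). s \<in> {0..l} \<and> u \<in> B \<and> \<delta> \<le> \<bar>s - u\<bar>}"
    have "Q = ({0..l} \<times> B) \<inter> {p. \<delta> \<le> \<bar>fst p - snd p\<bar>}" by (auto simp: Q_def)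
    moreover have "closed {p :: real \<times> real. \<delta> \<le> \<bar>fst p - snd p\<bar>}"
      by (intro closed_Collect_le continuous_intros)
    ultimately have "compact Q" using B(1) by (simp add: compact_Int_closed compact_Times)
    moreover have "continuous_on Q (\<lambda>(s, u). \<kappa> s u)"
      by (rule continuous_on_subset[OF cont]) (use \<delta> in \<open>auto simp: Q_def\<close>)
    ultimately have "uniformly_continuous_on Q (\<lambda>(s, u). \<kappa> s u)"
      by (intro compact_uniformly_continuous)
    then obtain d where d: "0 < d" and unif: "\<And>p q. p \<in> Q \<Longrightarrow> q \<in> Q \<Longrightarrow> dist q p < d \<Longrightarrow>
        dist (case q of (s, u) \<Rightarrow> \<kappa> s u) (case p of (s, u) \<Rightarrow> \<kappa> s u) < sqrt \<eta>"
      using \<eta> unfolding uniformly_continuous_on_def by (metis real_sqrt_gt_zero)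
    have "fs_norm (L2 m) (\<lambda>u. k r u - k s u) < e" if r: "r \<in> {0..l}" and rs: "\<bar>r - s\<bar> < min d \<delta>" for r
    proof -
      let ?S = "\<lambda>s u. ennreal (C\<^sup>2 * (1 / sqrt \<bar>u - s\<bar>)) * indicator {s - 3 * \<delta>..s + 3 * \<delta>} u"
      have pt: "ennreal (cmod (k r u - k s u))^2 \<le> 2 * ?S r u + 2 * ?S s u + ennreal \<eta>" if u: "u \<in> {0..m}" for u
      proof (cases "\<bar>u - s\<bar> \<le> 2 * \<delta>")
        case True
        then have "u \<in> {s - 3 * \<delta>..s + 3 * \<delta>}" "u \<in> {r - 3 * \<delta>..r + 3 * \<delta>}" using rs \<delta> by auto
        moreover have "(cmod (k r u - k s u))\<^sup>2 \<le> 2 * (C\<^sup>2 * (1 / sqrt \<bar>u - r\<bar>)) + 2 * (C\<^sup>2 * (1 / sqrt \<bar>u - s\<bar>))"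
        proof -
          have "(cmod (k r u - k s u))\<^sup>2 \<le> (cmod (k r u) + cmod (k s u))\<^sup>2"
            by (intro power_mono norm_triangle_ineq4) simp
          also have "\<dots> \<le> 2 * (cmod (k r u))\<^sup>2 + 2 * (cmod (k s u))\<^sup>2"
            using sum_squares_bound[of "cmod (k r u)" "cmod (k s u)"] by (simp add: power2_sum)
          finally show ?thesis using sqb[OF r, of u] sqb[OF s, of u] by linarith
        qed
        then have "ennreal ((cmod (k r u - k s u))\<^sup>2) \<le> 2 * ennreal (C\<^sup>2 * (1 / sqrt \<bar>u - r\<bar>)) + 2 * ennreal (C\<^sup>2 * (1 / sqrt \<bar>u - s\<bar>))"
          by (simp add: ennreal_mult'[symmetric] ennreal_plus[symmetric] ennreal_leI numeral_mult_ennreal del: ennreal_plus)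
        ultimately show ?thesis by (simp add: ennreal_power add_increasing2)
      next
        case False
        have "cmod (k r u - k s u) \<le> sqrt \<eta>"
        proof (cases "u \<in> A")
          case uA: True
          have "u \<noteq> s" "u \<noteq> r" using False rs \<delta> by auto
          moreover have "(r, u) \<in> Q" "(s, u) \<in> Q" using False rs \<delta> uA A(2) r s by (auto simp: Q_def)
          moreover have "dist (r, u) (s, u) < d" using rs by (simp add: dist_Pair_Pair dist_real_def)
          ultimately show ?thesis using unif[of "(s, u)" "(r, u)"] uA by (simp add: k_def dist_norm less_imp_le)
        qed (use \<eta> in \<open>simp add: k_def\<close>)
        then have "(cmod (k r u - k s u))\<^sup>2 \<le> \<eta>" using \<eta> by (metis norm_ge_zero power_mono real_sqrt_pow2 less_imp_le)
        then have "ennreal (cmod (k r u - k s u))^2 \<le> ennreal \<eta>" by (simp add: ennreal_power ennreal_leI)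
        then show ?thesis by (simp add: add_increasing)
      qed
      have "(\<integral>\<^sup>+u. ennreal (cmod (k r u - k s u))^2 \<partial>interval_measure m) \<le>
         (\<integral>\<^sup>+u. 2 * ?S r u + 2 * ?S s u + ennreal \<eta> \<partial>interval_measure m)"
        by (rule nn_integral_mono) (use pt in simp)
      also have "\<dots> = 2 * (\<integral>\<^sup>+u. ?S r u \<partial>interval_measure m) + 2 * (\<integral>\<^sup>+u. ?S s u \<partial>interval_measure m) + ennreal \<eta> * emeasure (interval_measure m) {0..m}"
      proof -
        have S: "?S q \<in> borel_measurable (interval_measure m)" for q
          by (rule borel_interval_measurable) measurable
        have "(\<integral>\<^sup>+u. 2 * X u + 2 * Y u + ennreal \<eta> \<partial>interval_measure m) =
            2 * (\<integral>\<^sup>+u. X u \<partial>interval_measure m) + 2 * (\<integral>\<^sup>+u. Y u \<partial>interval_measure m) + ennreal \<eta> * emeasure (interval_measure m) {0..m}"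
          if [measurable]: "X \<in> borel_measurable (interval_measure m)" "Y \<in> borel_measurable (interval_measure m)" for X Y
          by (simp add: nn_integral_add nn_integral_cmult)
        from this[OF S S] show ?thesis .
      qed
      also have "\<dots> \<le> 2 * ennreal (C\<^sup>2 * (4 * sqrt (3 * \<delta>))) + 2 * ennreal (C\<^sup>2 * (4 * sqrt (3 * \<delta>))) + ennreal \<eta> * ennreal m"
        using sing[of "3 * \<delta>"] \<delta> m by (intro add_mono mult_left_mono) (auto simp: emeasure_restrict_space)
      also have "\<dots> = ennreal (16 * C\<^sup>2 * sqrt (3 * \<delta>) + \<eta> * m)"
        using \<delta> \<eta> m by (simp add: ennreal_mult'[symmetric] ennreal_plus[symmetric] numeral_mult_ennreal del: ennreal_plus)
      also have "\<dots> \<le> ennreal ((e / sqrt 2)\<^sup>2)"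
      proof (rule ennreal_leI)
        have "16 * C\<^sup>2 * sqrt (3 * \<delta>) \<le> e\<^sup>2 / 4"
          unfolding s3 using c0 by (simp add: field_simps)
        moreover have "\<eta> * m = e\<^sup>2 / 4" using m by (simp add: \<eta>_def)
        ultimately show "16 * C\<^sup>2 * sqrt (3 * \<delta>) + \<eta> * m \<le> (e / sqrt 2)\<^sup>2" by (simp add: power_divide)
      qed
      finally have "fs_norm (L2 m) (\<lambda>u. k r u - k s u) \<le> e / sqrt 2"
        by (intro L2_memI_nn(2) borel_measurable_diff meas r s) (use e in auto)
      also have "\<dots> < e" using e by (simp add: divide_less_eq)
      finally show ?thesis .
    qed
    then show ?thesis using d \<delta> by (intro exI[of _ "min d \<delta>"]) auto
  qed
qed

lemma continuous_product_measurable: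
  fixes g :: "real \<times> real \<Rightarrow> complex"
  assumes "continuous_on ({0..l} \<times> {0..m}) g"
  shows "(\<lambda>(s, u). g (s, u)) \<in> borel_measurable (interval_measure l \<Otimes>\<^sub>M interval_measure m)"
proof -
  have "(\<lambda>p. indicator ({0..l} \<times> {0..m}) p *\<^sub>R g p) \<in> borel_measurable borel"
    by (rule borel_measurable_continuous_on_indicator[OF _ assms]) (intro borel_closed closed_Times; simp)
  from borel_product_interval_measurable[OF this, of l m] show ?thesis
    by (rule measurable_cong[THEN iffD1, rotated]) (auto simp: space_pair_measure)
qed

text \<open>On a finite rectangle the Hardy kernel is at least \<open>1 / (l + m)\<close>, so
  bounded kernels fall under the same theory as the corner kernels.\<close>

lemma hardy_kernel_bounded:
  assumes l: "0 < l" and m: "0 < m"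
    and meas: "(\<lambda>(s, u). k s u) \<in> borel_measurable (interval_measure l \<Otimes>\<^sub>M interval_measure m)"
    and bound: "\<And>s u. s \<in> {0<..<l} \<Longrightarrow> u \<in> {0..m} \<Longrightarrow> cmod (k s u) \<le> B"
  shows "hardy_kernel l m k (B * (l + m))"
proof
  fix s u assume s: "s \<in> {0<..<l}" and u: "u \<in> {0..m}"
  have B: "0 \<le> B" using order.trans[OF norm_ge_zero bound[OF s u]] .
  have e: "0 < end_dist l s" "0 \<le> end_dist m u" "end_dist l s \<le> l" "end_dist m u \<le> m"
    using end_dist_pos[OF s] end_dist_nonneg[OF u] s u by (auto simp: end_dist_def)
  then have "1 \<le> (l + m) * hardy l m s u" by (simp add: hardy_def)
  from mult_left_mono[OF this B] show "cmod (k s u) \<le> B * (l + m) * hardy l m s u"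
    using bound[OF s u] by (simp add: mult.assoc)
qed (use l m meas in auto)

text \<open>Taylor's formula with integral remainder. The ramp continues the weight
  \<open>s - t\<close> by zero beyond \<open>s\<close>, so that the domain of integration no longer
  depends on \<open>s\<close> and Fubini becomes applicable.\<close>

lemma taylor_ramp:
  fixes F F1 F2 :: "real \<Rightarrow> complex"
  assumes F: "\<And>t. t \<in> {0..l} \<Longrightarrow> (F has_vector_derivative F1 t) (at t within {0..l})"
    and F1: "\<And>t. t \<in> {0..l} \<Longrightarrow> (F1 has_vector_derivative F2 t) (at t within {0..l})"
    and F2: "continuous_on {0..l} F2" and s: "s \<in> {0..l}"
  shows "F s = F 0 + of_real s * F1 0 + (LINT t|interval_measure l. complex_of_real (max 0 (s - t)) * F2 t)"
proof -
  \<comment> \<open>In the derivative of \<open>\<Phi>\<close> the terms with \<open>F1\<close>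
    cancel, leaving the integrand of the remainder.\<close>
  define \<Phi> where "\<Phi> t = of_real (s - t) * F1 t + F t" for t
  have "(LINT t|interval_measure l. complex_of_real (max 0 (s - t)) * F2 t) =
    (LINT t|interval_measure l. indicator {0..s} t *\<^sub>R (of_real (s - t) * F2 t))"
    by (intro Bochner_Integration.integral_cong) (auto simp: indicator_def max_def)
  also have "\<dots> = \<Phi> s - \<Phi> 0"
  proof (rule FTC_interval_measure)
    show "(\<Phi> has_vector_derivative of_real (s - t) * F2 t) (at t within {0..l})" if "t \<in> {0..l}" for t
      unfolding \<Phi>_def by (auto intro!: derivative_eq_intros F[OF that] F1[OF that])
    show "continuous_on {0..l} (\<lambda>t. of_real (s - t) * F2 t)" by (intro continuous_intros F2)
  qed (use s in auto)
  finally show ?thesis by (simp add: \<Phi>_def)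
qed

section \<open>The surface Green's function\<close>

text \<open>The kink of \<open>exp (\<i> * \<kappa> * \<bar>s - u\<bar>)\<close> is split off: what
  remains is a smooth solution \<open>A\<close> of the homogeneous equation, and the kink is carried
  by \<open>V (max 0 (s - u))\<close>, where \<open>V\<close> is the solution with value 0 and slope
  1 at 0. The unit jump of the slope is the final ramp term.\<close>

lemma green_kernel_rep:
  assumes \<kappa>: "0 < Im \<kappa>" and l: "0 < l"
  shows "continuous_on ({0..l} \<times> {0..l}) (\<lambda>(s, u). green \<kappa> l s u)"
    and "\<exists>b. \<forall>s\<in>{0..l}. \<forall>u\<in>{0..l}. green \<kappa> l s u = green \<kappa> l 0 u + of_real s * b u
      + (LINT t|interval_measure l. complex_of_real (max 0 (s - t)) * (- \<kappa>\<^sup>2 * green \<kappa> l t u)) + complex_of_real (max 0 (s - u))"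
proof -
  have k0: "\<kappa> \<noteq> 0" using \<kappa> by auto
  define \<psi> where "\<psi> = (SOME \<psi>. is_green_remainder \<kappa> l \<psi>)"
  have "is_green_remainder \<kappa> l \<psi>"
    unfolding \<psi>_def by (rule someI_ex[OF green_remainder_exists[OF \<kappa> l]])
  then obtain D :: "nat \<Rightarrow> nat \<Rightarrow> real \<Rightarrow> real \<Rightarrow> complex" where
    Dc: "\<And>m n. continuous_on ({0..l} \<times> {0..l}) (\<lambda>(s, u). D m n s u)" and
    Dd: "\<And>m n s u. s \<in> {0..l} \<Longrightarrow> u \<in> {0..l} \<Longrightarrow> ((\<lambda>r. D m n r u) has_vector_derivative D (Suc m) n s u) (at s within {0..l})" and
    D\<psi>: "\<And>s u. s \<in> {0..l} \<Longrightarrow> u \<in> {0..l} \<Longrightarrow> \<psi> s u = D 0 0 s u \<and> D 2 0 s u + \<kappa>\<^sup>2 * \<psi> s u = 0"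
    unfolding is_green_remainder_def
    apply (elim conjE exE)
    subgoal for D by (rule that[of D]; blast)
    done
  define A where "A s u = exp (- \<i> * \<kappa> * of_real (s - u)) / (2 * \<i> * \<kappa>) + D 0 0 s u" for s u :: real
  define A1 where "A1 s u = - exp (- \<i> * \<kappa> * of_real (s - u)) / 2 + D 1 0 s u" for s u :: real
  define V where "V z = sin (\<kappa> * of_real z) / \<kappa>" for z :: real
  have green_eq: "green \<kappa> l s u = A s u + V (max 0 (s - u))" if "s \<in> {0..l}" "u \<in> {0..l}" for s u
  proof -
    have "exp (\<i> * \<kappa> * of_real \<bar>s - u\<bar>) / (2 * \<i> * \<kappa>) = exp (- \<i> * \<kappa> * of_real (s - u)) / (2 * \<i> * \<kappa>) + V (max 0 (s - u))"
    proof (cases "u \<le> s")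
      case True
      then have "\<bar>s - u\<bar> = s - u" "max 0 (s - u) = s - u" by auto
      moreover have "sin (\<kappa> * of_real (s - u)) = (exp (\<i> * \<kappa> * of_real (s - u)) - exp (- \<i> * \<kappa> * of_real (s - u))) / (2 * \<i>)"
        unfolding sin_exp_eq by (simp add: mult.assoc)
      ultimately show ?thesis using k0 by (simp add: V_def field_simps)
    next
      case False
      then have "\<bar>s - u\<bar> = - (s - u)" "max 0 (s - u) = 0" by auto
      then show ?thesis by (simp add: V_def algebra_simps)
    qed
    then show ?thesis using D\<psi>[OF that] by (simp add: green_def \<psi>_def[symmetric] A_def)
  qed
  have Acont: "continuous_on ({0..l} \<times> {0..l}) (\<lambda>(s, u). A s u)"
    unfolding A_def case_prod_unfold using Dc[of 0 0] k0
    by (intro continuous_intros) (auto simp: case_prod_unfold)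
  have "continuous_on ({0..l} \<times> {0..l}) (\<lambda>(s, u). A s u + V (max 0 (s - u)))"
    unfolding V_def case_prod_unfold using Acont k0
    by (intro continuous_intros) (auto simp: case_prod_unfold)
  then show "continuous_on ({0..l} \<times> {0..l}) (\<lambda>(s, u). green \<kappa> l s u)"
    by (rule continuous_on_eq) (auto simp: green_eq)
  have A_deriv: "((\<lambda>r. A r u) has_vector_derivative A1 s u) (at s within {0..l})"
    "((\<lambda>r. A1 r u) has_vector_derivative - \<kappa>\<^sup>2 * A s u) (at s within {0..l})" if "s \<in> {0..l}" "u \<in> {0..l}" for s u
  proof -
    have "((\<lambda>z. exp (- \<i> * \<kappa> * (z - of_real u))) has_field_derivative - \<i> * \<kappa> * exp (- \<i> * \<kappa> * of_real (s - u))) (at (of_real s))"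
      by (auto intro!: derivative_eq_intros)
    from has_vector_derivative_real_field[OF this, of "{0..l}"]
    have e: "((\<lambda>r. exp (- \<i> * \<kappa> * of_real (r - u))) has_vector_derivative - \<i> * \<kappa> * exp (- \<i> * \<kappa> * of_real (s - u))) (at s within {0..l})"
      by simp
    have "((\<lambda>r. exp (- \<i> * \<kappa> * of_real (r - u)) * (1 / (2 * \<i> * \<kappa>)) + D 0 0 r u) has_vector_derivative
       - \<i> * \<kappa> * exp (- \<i> * \<kappa> * of_real (s - u)) * (1 / (2 * \<i> * \<kappa>)) + D 1 0 s u) (at s within {0..l})"
      using Dd[OF that, of 0 0] by (intro has_vector_derivative_add has_vector_derivative_mult_left e) simp
    moreover have "- \<i> * \<kappa> * exp (- \<i> * \<kappa> * of_real (s - u)) * (1 / (2 * \<i> * \<kappa>)) = - exp (- \<i> * \<kappa> * of_real (s - u)) / 2"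
      using k0 by (simp add: field_simps)
    ultimately show "((\<lambda>r. A r u) has_vector_derivative A1 s u) (at s within {0..l})"
      unfolding A_def A1_def using k0 by simp
    have "((\<lambda>r. exp (- \<i> * \<kappa> * of_real (r - u)) * (- 1 / 2) + D 1 0 r u) has_vector_derivative
       - \<i> * \<kappa> * exp (- \<i> * \<kappa> * of_real (s - u)) * (- 1 / 2) + D 2 0 s u) (at s within {0..l})"
      using Dd[OF that, of 1 0] by (intro has_vector_derivative_add has_vector_derivative_mult_left e) (simp add: numeral_2_eq_2)
    moreover have "- \<i> * \<kappa> * exp (- \<i> * \<kappa> * of_real (s - u)) * (- 1 / 2) + D 2 0 s u = - \<kappa>\<^sup>2 * A s u"
    proof -
      have "D 2 0 s u = - \<kappa>\<^sup>2 * D 0 0 s u" using D\<psi>[OF that] by (auto simp: eq_neg_iff_add_eq_0)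
      moreover have "- \<i> * \<kappa> * exp (- \<i> * \<kappa> * of_real (s - u)) * (- 1 / 2) = - \<kappa>\<^sup>2 * (exp (- \<i> * \<kappa> * of_real (s - u)) / (2 * \<i> * \<kappa>))"
        using k0 by (simp add: field_simps power2_eq_square)
      ultimately show ?thesis unfolding A_def distrib_left by simp
    qed
    ultimately show "((\<lambda>r. A1 r u) has_vector_derivative - \<kappa>\<^sup>2 * A s u) (at s within {0..l})"
      unfolding A1_def by simp
  qed
  have Aslice: "continuous_on {0..l} (\<lambda>t. A t u)" if "u \<in> {0..l}" for u
    using continuous_on_vector_derivative[OF A_deriv(1)[OF _ that]] by blast
  have Vcont: "continuous_on {0..l} (\<lambda>t. V (max 0 (t - u)))" for u
    unfolding V_def by (intro continuous_intros) (use k0 in auto)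
  \<comment> \<open>Twofold integration of \<open>- \<kappa>\<^sup>2 * V\<close> from the kink at
    \<open>u\<close>; the unit slope there contributes the separate ramp.\<close>
  have V_rep: "V (max 0 (s - u)) = (LINT t|interval_measure l. complex_of_real (max 0 (s - t)) * (- \<kappa>\<^sup>2 * V (max 0 (t - u)))) + complex_of_real (max 0 (s - u))"
    if "s \<in> {0..l}" "u \<in> {0..l}" for s u
  proof (cases "u \<le> s")
    case True
    define \<Phi> where "\<Phi> z = (of_real s - z) * cos (\<kappa> * (z - of_real u)) + sin (\<kappa> * (z - of_real u)) / \<kappa>" for z
    define f where "f t = complex_of_real (s - t) * (- \<kappa> * sin (\<kappa> * of_real (t - u)))" for t
    have "(LINT t|interval_measure l. complex_of_real (max 0 (s - t)) * (- \<kappa>\<^sup>2 * V (max 0 (t - u)))) =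
      (LINT t|interval_measure l. indicator {u..s} t *\<^sub>R f t)"
      using k0 by (intro Bochner_Integration.integral_cong) (auto simp: indicator_def max_def V_def f_def power2_eq_square)
    also have "\<dots> = \<Phi> (of_real s) - \<Phi> (of_real u)"
    proof (rule FTC_interval_measure[where F = "\<lambda>t. \<Phi> (of_real t)"])
      show "((\<lambda>t. \<Phi> (of_real t)) has_vector_derivative f t) (at t within {0..l})" for t
        by (rule has_vector_derivative_real_field) (use k0 in \<open>auto intro!: derivative_eq_intros simp: \<Phi>_def f_def\<close>)
      show "continuous_on {0..l} f" unfolding f_def by (intro continuous_intros)
    qed (use that True in auto)
    finally show ?thesis using True by (simp add: \<Phi>_def V_def)
  next
    case False
    then have "complex_of_real (max 0 (s - t)) * (- \<kappa>\<^sup>2 * V (max 0 (t - u))) = 0" for t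
      by (auto simp: max_def V_def)
    then have "(LINT t|interval_measure l. complex_of_real (max 0 (s - t)) * (- \<kappa>\<^sup>2 * V (max 0 (t - u)))) = 0"
      by (simp only: Bochner_Integration.integral_zero)
    then show ?thesis using False by (simp only:) (simp add: V_def)
  qed
  show "\<exists>b. \<forall>s\<in>{0..l}. \<forall>u\<in>{0..l}. green \<kappa> l s u = green \<kappa> l 0 u + of_real s * b u
      + (LINT t|interval_measure l. complex_of_real (max 0 (s - t)) * (- \<kappa>\<^sup>2 * green \<kappa> l t u)) + complex_of_real (max 0 (s - u))"
  proof (intro exI[of _ "A1 0"] ballI)
    fix s u assume s: "s \<in> {0..l}" and u: "u \<in> {0..l}"
    have int: "integrable (interval_measure l) (\<lambda>t. complex_of_real (max 0 (s - t)) * (- \<kappa>\<^sup>2 * h t))" if "continuous_on {0..l} h" for h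
      using l that by (intro L2_integrable L2_continuous continuous_intros) auto
    have "(LINT t|interval_measure l. complex_of_real (max 0 (s - t)) * (- \<kappa>\<^sup>2 * green \<kappa> l t u)) =
      (LINT t|interval_measure l. complex_of_real (max 0 (s - t)) * (- \<kappa>\<^sup>2 * A t u) + complex_of_real (max 0 (s - t)) * (- \<kappa>\<^sup>2 * V (max 0 (t - u))))"
      by (intro Bochner_Integration.integral_cong) (use u in \<open>auto simp: green_eq algebra_simps\<close>)
    also have "\<dots> = (LINT t|interval_measure l. complex_of_real (max 0 (s - t)) * (- \<kappa>\<^sup>2 * A t u)) + (LINT t|interval_measure l. complex_of_real (max 0 (s - t)) * (- \<kappa>\<^sup>2 * V (max 0 (t - u))))"
      by (rule Bochner_Integration.integral_add[OF int[OF Aslice[OF u]] int[OF Vcont]])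
    also have "\<dots> = (A s u - A 0 u - of_real s * A1 0 u) + (V (max 0 (s - u)) - complex_of_real (max 0 (s - u)))"
    proof -
      have "A s u = A 0 u + of_real s * A1 0 u + (LINT t|interval_measure l. complex_of_real (max 0 (s - t)) * (- \<kappa>\<^sup>2 * A t u))"
        by (rule taylor_ramp[OF A_deriv(1) A_deriv(2) _ s]) (use u in \<open>auto intro!: continuous_intros Aslice\<close>)
      moreover note V_rep[OF s u]
      ultimately show ?thesis by (simp only: add_diff_cancel_left' add_diff_cancel_right' diff_diff_add[symmetric] diff_add_eq algebra_simps)
    qed
    finally have eq: "(LINT t|interval_measure l. complex_of_real (max 0 (s - t)) * (- \<kappa>\<^sup>2 * green \<kappa> l t u)) =
      (A s u - A 0 u - of_real s * A1 0 u) + (V (max 0 (s - u)) - complex_of_real (max 0 (s - u)))" .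
    show "green \<kappa> l s u = green \<kappa> l 0 u + of_real s * A1 0 u
      + (LINT t|interval_measure l. complex_of_real (max 0 (s - t)) * (- \<kappa>\<^sup>2 * green \<kappa> l t u)) + complex_of_real (max 0 (s - u))"
      unfolding eq using s u l by (simp add: green_eq V_def)
  qed
qed

text \<open>By its differential equation, the second derivative of the kernel is
  \<open>- k_Gamma\<^sup>2\<close> times the kernel plus a Dirac mass. The first part is continuous,
  hence of Hardy type, and the second is the case \<open>\<gamma> = 1\<close>. This is the gain of
  two derivatives.\<close>

lemma bounded_G_op:
  assumes W: "admissible W"
  shows "bounded_op (L2 (len W (Star i))) (H2 (len W (Star i))) (G_op W i)"
proof -
  let ?l = "len W (Star i)" and ?\<kappa> = "k_Gamma W"
  have l: "0 < ?l" and \<kappa>: "0 < Im ?\<kappa>" using W by (auto simp: admissible_def arcs_ok_def)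
  let ?g = "green ?\<kappa> ?l"
  note cont = green_kernel_rep(1)[OF \<kappa> l]
  obtain b where rep: "\<And>s u. s \<in> {0..?l} \<Longrightarrow> u \<in> {0..?l} \<Longrightarrow> ?g s u = ?g 0 u + of_real s * b u
      + (LINT t|interval_measure ?l. complex_of_real (max 0 (s - t)) * (- ?\<kappa>\<^sup>2 * ?g t u)) + complex_of_real (max 0 (s - u))"
    using green_kernel_rep(2)[OF \<kappa> l] by blast
  have "bounded ((\<lambda>(s, u). - ?\<kappa>\<^sup>2 * ?g s u) ` ({0..?l} \<times> {0..?l}))"
    using cont unfolding case_prod_unfold
    by (intro compact_imp_bounded compact_continuous_image continuous_intros compact_Times compact_Icc)
  then obtain B where "\<forall>s\<in>{0..?l}. \<forall>u\<in>{0..?l}. cmod (- ?\<kappa>\<^sup>2 * ?g s u) \<le> B"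
    unfolding bounded_iff by auto
  moreover have "(\<lambda>(s, u). - ?\<kappa>\<^sup>2 * ?g s u) \<in> borel_measurable (interval_measure ?l \<Otimes>\<^sub>M interval_measure ?l)"
    using continuous_product_measurable[of ?l ?l "\<lambda>p. - ?\<kappa>\<^sup>2 * ?g (fst p) (snd p)"] cont
    by (simp add: case_prod_unfold continuous_intros)
  ultimately interpret hardy_kernel ?l ?l "\<lambda>s u. - ?\<kappa>\<^sup>2 * ?g s u" "B * (?l + ?l)"
    using l by (intro hardy_kernel_bounded) auto
  show ?thesis
  proof (rule bounded_op_H2[where K = ?g and b = b and \<gamma> = 1])
    show "?g s \<in> fs_set (L2 ?l)" if "s \<in> {0..?l}" for s
    proof (rule L2_continuous)
      show "continuous_on {0..?l} (?g s)"
      proof -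
        have "continuous_on {0..?l} (\<lambda>u. (\<lambda>(s, u). ?g s u) (s, u))"
          by (rule continuous_on_compose2[OF cont]) (use that in \<open>auto intro!: continuous_intros\<close>)
        then show ?thesis by simp
      qed
    qed (use l in simp)
    show "?g s u = ?g 0 u + of_real s * b u + (LINT t|interval_measure ?l. complex_of_real (max 0 (s - t)) * (- ?\<kappa>\<^sup>2 * ?g t u))
      + 1 * complex_of_real (max 0 (s - u))" if "s \<in> {0..?l}" "u \<in> {0<..<?l}" for s u
      using rep[of s u] that by simp
    show "G_op W i f s = (LINT u|interval_measure ?l. ?g s u * f u)" for f s
      by (simp add: G_op_def green_Gamma_def set_integral_interval_measure_full)
  qed auto
qed

section \<open>The Helmholtz kernel as a function of the squared distance\<close>

text \<open>
  \<open>\<phi> 0\<close> is the kernel as a function of \<open>q = \<bar>x - y\<bar>\<^sup>2\<close>, and \<open>\<phi> n\<close> is its \<open>n\<close>-th derivative. These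
  bounds are all that the estimates of the layer potentials use.
\<close>

locale radial_kernel =
  fixes k :: real and \<phi> :: "nat \<Rightarrow> real \<Rightarrow> complex"
  assumes kernel: "x \<noteq> y \<Longrightarrow> helmholtz_G k x y = \<phi> 0 ((dist x y)\<^sup>2)"
    and deriv: "n < 3 \<Longrightarrow> 0 < q \<Longrightarrow> (\<phi> n has_vector_derivative \<phi> (Suc n) q) (at q)"
    and continuous3: "continuous_on {0<..} (\<phi> 3)"
    and log_bound: "\<exists>C\<ge>0. \<forall>r\<in>{0<..R}. cmod (\<phi> 0 (r\<^sup>2)) \<le> C / sqrt (sqrt r)"
    and deriv_bound: "n \<in> {1, 2, 3} \<Longrightarrow> \<exists>C\<ge>0. \<forall>q\<in>{0<..R}. cmod (\<phi> n q) \<le> C / q ^ n"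

lemma summable_fact_square:
  fixes c :: "nat \<Rightarrow> complex" and z :: complex
  assumes "\<And>m. cmod (c m) \<le> B * b ^ m / fact m" "0 \<le> b"
  shows "summable (\<lambda>m. c m * z ^ m)"
proof (rule summable_comparison_test')
  show "summable (\<lambda>m. B * (inverse (fact m) * (b * cmod z) ^ m))"
    by (intro summable_mult summable_exp)
  show "norm (c m * z ^ m) \<le> B * (inverse (fact m) * (b * cmod z) ^ m)" if "m \<ge> 0" for m
    using mult_right_mono[OF assms(1)[of m], of "cmod z ^ m"]
    by (simp add: norm_mult norm_power power_mult_distrib field_simps)
qed

text \<open>Iterated \<open>diffs\<close> are the coefficients of the iterated derivatives, and the
  series converges everywhere, so all derivatives are bounded on bounded intervals of the real
  line.\<close>

lemma entire_real_derivative: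
  fixes c :: "nat \<Rightarrow> complex"
  assumes c: "\<And>z. summable (\<lambda>m. c m * z ^ m)"
  defines "P \<equiv> \<lambda>n q. (\<Sum>m. (diffs ^^ n) c m * of_real q ^ m)"
  shows "(P n has_vector_derivative P (Suc n) q) (at q)"
    and "\<exists>B\<ge>0. \<forall>q\<in>{0..Q}. cmod (P n q) \<le> B"
proof -
  have s: "summable (\<lambda>m. (diffs ^^ n) c m * z ^ m)" for n z
    by (induction n arbitrary: z) (simp_all add: c termdiff_converges_all)
  show d: "(P n has_vector_derivative P (Suc n) q) (at q)" for n q
    unfolding P_def funpow.simps comp_apply
    by (rule has_vector_derivative_real_field[OF termdiffs_strong_converges_everywhere[OF s]])
  have "continuous_on {0..Q} (P n)"
    by (rule continuous_on_vector_derivative[OF has_vector_derivative_at_within[OF d]])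
  then have "bounded (P n ` {0..Q})"
    by (intro compact_imp_bounded compact_continuous_image compact_Icc)
  then obtain B where B: "\<forall>q\<in>{0..Q}. cmod (P n q) \<le> B" by (auto simp: bounded_iff)
  show "\<exists>B\<ge>0. \<forall>q\<in>{0..Q}. cmod (P n q) \<le> B"
    by (rule exI[of _ "max B 0"]) (use B in auto)
qed

text \<open>Collecting the two series in powers of \<open>(x / 2)\<^sup>2\<close> isolates the
  logarithm as the only factor that is not entire in the squared distance.\<close>

lemma hankel_series:
  assumes x: "0 < x"
  defines "a \<equiv> \<lambda>m. (- 1) ^ m / (fact m)\<^sup>2"
  shows "hankel_H0 x = (\<Sum>m. complex_of_real (a m) * of_real ((x / 2)\<^sup>2) ^ m) * (1 + \<i> * of_real (2 / pi * (ln (x / 2) + euler_mascheroni)))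
    - \<i> * of_real (2 / pi) * (\<Sum>m. complex_of_real (harm m * a m) * of_real ((x / 2)\<^sup>2) ^ m)"
    and "\<And>z. summable (\<lambda>m. complex_of_real (a m) * z ^ m)"
    and "\<And>z. summable (\<lambda>m. complex_of_real (harm m * a m) * z ^ m)"
proof -
  \<comment> \<open>A crude bound, but one of the two factors \<open>1 / fact m\<close> survives it,
    which is enough for convergence everywhere.\<close>
  have h: "harm m \<le> (fact m :: real)" for m
  proof (induction m)
    case (Suc m)
    have "harm (Suc m) \<le> harm m + (1 :: real)" by (simp add: harm_Suc inverse_le_1_iff)
    also have "\<dots> \<le> fact (Suc m)"
    proof (cases "m = 0")
      case False
      have "(1 :: real) \<le> fact m" by simp
      moreover have "fact m + 1 \<le> (fact m + real m * fact m)"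
        using False mult_mono[of 1 "real m" 1 "fact m"] by simp
      ultimately show ?thesis using Suc by (simp add: algebra_simps)
    qed (simp add: harm_expand)
    finally show ?case .
  qed (simp add: harm_expand)
  have a: "\<bar>a m\<bar> \<le> 1 / fact m" for m
  proof -
    have "(fact m :: real) * 1 \<le> fact m * fact m" by (intro mult_left_mono) auto
    then show ?thesis by (simp add: a_def power2_eq_square abs_mult frac_le)
  qed
  have ha: "\<bar>harm m * a m\<bar> \<le> 1 / fact m" for m
  proof -
    have "\<bar>harm m * a m\<bar> = harm m / (fact m * fact m)"
      by (simp add: a_def abs_mult harm_nonneg power2_eq_square)
    also have "\<dots> \<le> fact m / (fact m * fact m)" by (intro divide_right_mono h) simp
    finally show ?thesis by simp
  qed
  show sa: "summable (\<lambda>m. complex_of_real (a m) * z ^ m)" for z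
    by (rule summable_fact_square[of _ 1 1]) (use a in \<open>simp_all del: of_real_mult\<close>)
  show sb: "summable (\<lambda>m. complex_of_real (harm m * a m) * z ^ m)" for z
    by (rule summable_fact_square[of _ 1 1]) (use ha in \<open>simp_all del: of_real_mult\<close>)
  let ?z = "(x / 2)\<^sup>2"
  have ra: "summable (\<lambda>m. a m * ?z ^ m)"
    using sa[of "of_real ?z"] by (simp only: of_real_power[symmetric] of_real_mult[symmetric] summable_complex_of_real)
  have rb: "summable (\<lambda>m. harm m * a m * ?z ^ m)"
    using sb[of "of_real ?z"] by (simp only: of_real_power[symmetric] of_real_mult[symmetric] summable_complex_of_real)
  have J: "complex_of_real (bessel_J0 x) = (\<Sum>m. complex_of_real (a m) * of_real ?z ^ m)"
  proof -
    have "bessel_J0 x = (\<Sum>m. a m * ?z ^ m)"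
      by (simp add: bessel_J0_def a_def power_mult[symmetric])
    then show ?thesis using suminf_of_real[OF ra, where 'a = complex] by simp
  qed
  have Y: "complex_of_real (\<Sum>m. (- 1) ^ m * harm m * (x / 2) ^ (2 * m) / (fact m)\<^sup>2) = (\<Sum>m. complex_of_real (harm m * a m) * of_real ?z ^ m)"
  proof -
    have "(\<Sum>m. (- 1) ^ m * harm m * (x / 2) ^ (2 * m) / (fact m)\<^sup>2) = (\<Sum>m. harm m * a m * ?z ^ m)"
      by (simp add: a_def power_mult[symmetric] mult_ac)
    then show ?thesis using suminf_of_real[OF rb, where 'a = complex] by simp
  qed
  have "hankel_H0 x = complex_of_real (bessel_J0 x) + \<i> * complex_of_real (bessel_Y0 x)"
    by (simp add: hankel_H0_def complex_eq_iff)
  also have "complex_of_real (bessel_Y0 x) = of_real (2 / pi) * (of_real (ln (x / 2) + euler_mascheroni) * complex_of_real (bessel_J0 x)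
     - complex_of_real (\<Sum>m. (- 1) ^ m * harm m * (x / 2) ^ (2 * m) / (fact m)\<^sup>2))"
    unfolding bessel_Y0_def by (simp only: of_real_mult of_real_diff)
  finally show "hankel_H0 x = (\<Sum>m. complex_of_real (a m) * of_real ((x / 2)\<^sup>2) ^ m) * (1 + \<i> * of_real (2 / pi * (ln (x / 2) + euler_mascheroni)))
    - \<i> * of_real (2 / pi) * (\<Sum>m. complex_of_real (harm m * a m) * of_real ((x / 2)\<^sup>2) ^ m)"
    unfolding J Y by (simp add: algebra_simps)
qed

text \<open>In terms of the squared distance \<open>q\<close> the kernel is
  \<open>A q + B q * ln q\<close> with entire \<open>A\<close> and \<open>B\<close>. Differentiation
  produces negative powers of \<open>q\<close> from the logarithm, and these dominate the
  bounds.\<close>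

lemma radial_kernel_exists:
  assumes k: "0 < k"
  shows "\<exists>\<phi>. radial_kernel k \<phi>"
proof -
  define a :: "nat \<Rightarrow> real" where "a m = (- 1) ^ m / (fact m)\<^sup>2" for m
  define \<mu> where "\<mu> = (k / 2)\<^sup>2"
  \<comment> \<open>The constant is \<open>\<i> / 4 * \<i> * (2 / pi)\<close> times the factor 1/2
    in \<open>ln r = ln (r\<^sup>2) / 2\<close>.\<close>
  define cB where "cB m = complex_of_real (- 1 / (4 * pi)) * (complex_of_real (a m) * of_real \<mu> ^ m)" for m
  define cA where "cA m = (\<i> / 4 - of_real ((ln (k / 2) + euler_mascheroni) / (2 * pi))) * (complex_of_real (a m) * of_real \<mu> ^ m)
     + of_real (1 / (2 * pi)) * (complex_of_real (harm m * a m) * of_real \<mu> ^ m)" for m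
  note H = hankel_series[folded a_def]
  have s1: "summable (\<lambda>m. complex_of_real (a m) * of_real \<mu> ^ m * z ^ m)" for z
    using H(2)[of 1 "of_real \<mu> * z"] by (simp add: power_mult_distrib mult.assoc)
  have s2: "summable (\<lambda>m. complex_of_real (harm m * a m) * of_real \<mu> ^ m * z ^ m)" for z
    using H(3)[of 1 "of_real \<mu> * z"] by (simp add: power_mult_distrib mult.assoc)
  have cB: "summable (\<lambda>m. cB m * z ^ m)" for z
    unfolding cB_def mult.assoc[of "complex_of_real (- 1 / (4 * pi))"] by (intro summable_mult s1)
  have cA: "summable (\<lambda>m. cA m * z ^ m)" for z
    unfolding cA_def distrib_right mult.assoc[of "\<i> / 4 - of_real ((ln (k / 2) + euler_mascheroni) / (2 * pi))"]
      mult.assoc[of "complex_of_real (1 / (2 * pi))"]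
    by (intro summable_add summable_mult s1 s2)
  define A where "A n q = (\<Sum>m. (diffs ^^ n) cA m * of_real q ^ m)" for n q
  define B where "B n q = (\<Sum>m. (diffs ^^ n) cB m * of_real q ^ m)" for n q
  note Ad[derivative_intros] = has_vector_derivative_at_within[OF entire_real_derivative(1)[OF cA, folded A_def]]
  note Bd[derivative_intros] = has_vector_derivative_at_within[OF entire_real_derivative(1)[OF cB, folded B_def]]
  \<comment> \<open>The derivatives of \<open>A q + B q * ln q\<close> by the Leibniz rule, written
    out up to the third.\<close>
  define \<phi> where "\<phi> n q = (if n = 0 then A 0 q + B 0 q * of_real (ln q)
     else if n = 1 then A 1 q + (B 1 q * of_real (ln q) + B 0 q * of_real (1 / q))
     else if n = 2 then A 2 q + (B 2 q * of_real (ln q) + 2 * (B 1 q * of_real (1 / q)) - B 0 q * of_real (1 / q\<^sup>2))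
     else A 3 q + (B 3 q * of_real (ln q) + 3 * (B 2 q * of_real (1 / q)) - 3 * (B 1 q * of_real (1 / q\<^sup>2)) + 2 * (B 0 q * of_real (1 / q ^ 3))))"
    for n :: nat and q :: real
  have ln: "((\<lambda>q. complex_of_real (ln q)) has_vector_derivative of_real (1 / q)) (at q)" if "0 < q" for q
    using that by (intro has_vector_derivative_of_real) (auto intro!: derivative_eq_intros)
  have i1: "((\<lambda>q. complex_of_real (1 / q)) has_vector_derivative of_real (- 1 / q\<^sup>2)) (at q)" if "0 < q" for q :: real
    using that by (intro has_vector_derivative_of_real) (auto intro!: derivative_eq_intros simp: power2_eq_square)
  have i2: "((\<lambda>q. complex_of_real (1 / q\<^sup>2)) has_vector_derivative of_real (- 2 / q ^ 3)) (at q)" if "0 < q" for q :: real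
    using that by (intro has_vector_derivative_of_real) (auto intro!: derivative_eq_intros simp: power2_eq_square power3_eq_cube field_simps)
  have "radial_kernel k \<phi>"
  proof
    fix x y :: complex assume xy: "x \<noteq> y"
    define r where "r = dist x y"
    have r: "0 < r" using xy by (simp add: r_def)
    have z: "(k * r / 2)\<^sup>2 = \<mu> * r\<^sup>2" by (simp add: \<mu>_def power_mult_distrib power_divide)
    have lnz: "ln (k * r / 2) = ln (k / 2) + ln (r\<^sup>2) / 2"
      using r k by (simp add: ln_mult ln_div ln_realpow)
    let ?S = "\<Sum>m. complex_of_real (a m) * of_real \<mu> ^ m * of_real (r\<^sup>2) ^ m"
    let ?T = "\<Sum>m. complex_of_real (harm m * a m) * of_real \<mu> ^ m * of_real (r\<^sup>2) ^ m"
    have B0: "B 0 (r\<^sup>2) = complex_of_real (- 1 / (4 * pi)) * ?S"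
      unfolding B_def cB_def funpow_0 mult.assoc[of "complex_of_real (- 1 / (4 * pi))"]
      by (rule suminf_mult[OF s1])
    have A0: "A 0 (r\<^sup>2) = (\<i> / 4 - of_real ((ln (k / 2) + euler_mascheroni) / (2 * pi))) * ?S + of_real (1 / (2 * pi)) * ?T"
      unfolding A_def cA_def funpow_0 distrib_right mult.assoc[of "\<i> / 4 - of_real ((ln (k / 2) + euler_mascheroni) / (2 * pi))"]
        mult.assoc[of "complex_of_real (1 / (2 * pi))"]
      by (subst suminf_add[symmetric], (intro summable_mult s1 s2)+, subst (1 2) suminf_mult, (rule s1 s2)+, rule refl)
    have "helmholtz_G k x y = \<i> / 4 * hankel_H0 (k * r)" by (simp add: helmholtz_G_def r_def)
    also have "hankel_H0 (k * r) = ?S * (1 + \<i> * of_real (2 / pi * (ln (k / 2) + ln (r\<^sup>2) / 2 + euler_mascheroni))) - \<i> * of_real (2 / pi) * ?T"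
      using H(1)[of "k * r"] r k unfolding z lnz by (simp add: power_mult_distrib mult.assoc)
    also have "\<i> / 4 * \<dots> = A 0 (r\<^sup>2) + B 0 (r\<^sup>2) * of_real (ln (r\<^sup>2))"
      unfolding A0 B0 by (simp add: field_simps)
    finally show "helmholtz_G k x y = \<phi> 0 ((dist x y)\<^sup>2)" by (simp add: \<phi>_def r_def)
  next
    fix n :: nat and q :: real assume n: "n < 3" and q: "0 < q"
    define L r1 r2 r3 where "L q = complex_of_real (ln q)" and "r1 q = complex_of_real (1 / q)"
      and "r2 q = complex_of_real (1 / q\<^sup>2)" and "r3 q = complex_of_real (1 / q ^ 3)" for q
    have \<phi>_eq: "\<phi> 0 = (\<lambda>q. A 0 q + B 0 q * L q)" "\<phi> 1 = (\<lambda>q. A 1 q + (B 1 q * L q + B 0 q * r1 q))"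
      "\<phi> 2 = (\<lambda>q. A 2 q + (B 2 q * L q + 2 * (B 1 q * r1 q) - B 0 q * r2 q))"
      "\<phi> 3 = (\<lambda>q. A 3 q + (B 3 q * L q + 3 * (B 2 q * r1 q) - 3 * (B 1 q * r2 q) + 2 * (B 0 q * r3 q)))"
      by (simp_all add: \<phi>_def[abs_def] L_def r1_def r2_def r3_def)
    have [derivative_intros]: "(L has_vector_derivative r1 q) (at q)" "(r1 has_vector_derivative - r2 q) (at q)"
      "(r2 has_vector_derivative - 2 * r3 q) (at q)"
      using ln[OF q] i1[OF q] i2[OF q] by (simp_all add: L_def[abs_def] r1_def[abs_def] r2_def[abs_def] r3_def[abs_def])
    have Suc_eq: "Suc 0 = 1" "Suc 1 = 2" "Suc 2 = 3" by simp_all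
    consider "n = 0" | "n = 1" | "n = 2" using n by linarith
    then show "(\<phi> n has_vector_derivative \<phi> (Suc n) q) (at q)"
    proof cases
      case 1
      show ?thesis unfolding 1 Suc_eq \<phi>_eq
        by (rule has_vector_derivative_eq_rhs, (rule derivative_intros)+) (simp add: algebra_simps)
    next
      case 2
      show ?thesis unfolding 2 Suc_eq \<phi>_eq
        by (rule has_vector_derivative_eq_rhs, (rule derivative_intros)+) (simp add: algebra_simps numeral_2_eq_2)
    next
      case 3
      show ?thesis unfolding 3 Suc_eq \<phi>_eq
        by (rule has_vector_derivative_eq_rhs, (rule derivative_intros)+) (simp add: algebra_simps numeral_2_eq_2 numeral_3_eq_3)
    qed
  next
    have "continuous_on {0<..} (A n)" "continuous_on {0<..} (B n)" for n
      by (rule continuous_on_vector_derivative, rule Ad, rule continuous_on_vector_derivative, rule Bd)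
    then show "continuous_on {0<..} (\<phi> 3)"
      unfolding \<phi>_def[abs_def] by (auto intro!: continuous_intros)
  next
    have bnd: "\<exists>M\<ge>0. \<forall>n\<le>3. \<forall>q\<in>{0..Q}. cmod (A n q) \<le> M \<and> cmod (B n q) \<le> M" for Q
    proof -
      have "\<exists>M\<ge>0. \<forall>q\<in>{0..Q}. cmod (A n q) \<le> M \<and> cmod (B n q) \<le> M" for n
      proof -
        obtain a b where "0 \<le> a" "\<forall>q\<in>{0..Q}. cmod (A n q) \<le> a" "0 \<le> b" "\<forall>q\<in>{0..Q}. cmod (B n q) \<le> b"
          using entire_real_derivative(2)[OF cA, of Q n, folded A_def] entire_real_derivative(2)[OF cB, of Q n, folded B_def] by blast
        then show ?thesis by (intro exI[of _ "a + b"]) (auto intro: add_increasing add_increasing2)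
      qed
      then obtain M where M: "\<And>n. 0 \<le> M n" "\<And>n q. q \<in> {0..Q} \<Longrightarrow> cmod (A n q) \<le> M n \<and> cmod (B n q) \<le> M n" by metis
      have le: "M n \<le> (\<Sum>n\<le>3. M n)" if "n \<le> 3" for n using that M(1) by (intro member_le_sum) auto
      show ?thesis
      proof (intro exI[of _ "\<Sum>n\<le>3. M n"] conjI allI impI ballI)
        show "0 \<le> (\<Sum>n\<le>3. M n)" using M(1) by (rule sum_nonneg)
        fix n :: nat and q assume "n \<le> 3" "q \<in> {0..Q}"
        then show "cmod (A n q) \<le> (\<Sum>n\<le>3. M n)" "cmod (B n q) \<le> (\<Sum>n\<le>3. M n)"
          using M(2)[of q n] le[of n] by auto
      qed
    qed
    have lnb: "\<bar>ln w\<bar> \<le> w + 1 / w" if "0 < w" for w :: real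
    proof -
      have "ln w \<le> w - 1" "- ln w \<le> 1 / w - 1" "0 < 1 / w"
        using ln_le_minus_one[OF that] ln_le_minus_one[of "1 / w"] that by (auto simp: ln_div)
      then show ?thesis using that by linarith
    qed
    show "\<exists>C\<ge>0. \<forall>r\<in>{0<..R}. cmod (\<phi> 0 (r\<^sup>2)) \<le> C / sqrt (sqrt r)" for R
    proof -
      obtain M where M: "0 \<le> M" "\<And>q. q \<in> {0..R\<^sup>2} \<Longrightarrow> cmod (A 0 q) \<le> M" "\<And>q. q \<in> {0..R\<^sup>2} \<Longrightarrow> cmod (B 0 q) \<le> M"
        using bnd[of "R\<^sup>2"] by (metis le0)
      define S where "S = sqrt (sqrt \<bar>R\<bar>)"
      have "cmod (\<phi> 0 (r\<^sup>2)) \<le> (M * S + M * (8 * (S\<^sup>2 + 1))) / sqrt (sqrt r)" if r: "r \<in> {0<..R}" for r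
      proof -
        \<comment> \<open>With the fourth root \<open>w\<close> of \<open>r\<close>,
          \<open>ln (r\<^sup>2)\<close> is \<open>8 * ln w\<close>, and
          \<open>\<bar>ln w\<bar> \<le> w + 1 / w\<close> leaves exactly one negative fourth
          root.\<close>
        define w where "w = sqrt (sqrt r)"
        have w: "0 < w" "w \<le> S" using r by (auto simp: w_def S_def)
        have q: "r\<^sup>2 \<in> {0..R\<^sup>2}" using r by (auto intro!: power_mono)
        have "r = w ^ 4" using r by (simp add: w_def power4_eq_xxxx mult.assoc)
        then have "ln (r\<^sup>2) = 8 * ln w" using w by (simp add: ln_realpow power_mult[symmetric])
        then have "\<bar>ln (r\<^sup>2)\<bar> \<le> 8 * (w + 1 / w)" using lnb[OF w(1)] by simp
        also have "\<dots> = 8 * (w\<^sup>2 + 1) / w" using w by (simp add: field_simps power2_eq_square)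
        also have "\<dots> \<le> 8 * (S\<^sup>2 + 1) / w"
          using w by (intro divide_right_mono mult_left_mono add_right_mono power_mono) auto
        finally have l: "\<bar>ln (r\<^sup>2)\<bar> \<le> 8 * (S\<^sup>2 + 1) / w" .
        have "cmod (\<phi> 0 (r\<^sup>2)) \<le> cmod (A 0 (r\<^sup>2)) + cmod (B 0 (r\<^sup>2)) * \<bar>ln (r\<^sup>2)\<bar>"
          unfolding \<phi>_def using norm_triangle_ineq[of "A 0 (r\<^sup>2)" "B 0 (r\<^sup>2) * of_real (ln (r\<^sup>2))"] by (simp add: norm_mult)
        also have "\<dots> \<le> M * (S / w) + M * (8 * (S\<^sup>2 + 1) / w)"
        proof (intro add_mono mult_mono M q l)
          have "M * 1 \<le> M * (S / w)" using w M(1) by (intro mult_left_mono) auto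
          then show "cmod (A 0 (r\<^sup>2)) \<le> M * (S / w)" using M(2)[OF q] by simp
        qed auto
        also have "\<dots> = (M * S + M * (8 * (S\<^sup>2 + 1))) / w" using w by (simp add: field_simps)
        finally show ?thesis by (simp add: w_def)
      qed
      then show ?thesis by (intro exI[of _ "M * S + M * (8 * (S\<^sup>2 + 1))"]) (use M in \<open>auto simp: S_def intro!: add_nonneg_nonneg mult_nonneg_nonneg\<close>)
    qed
    show "\<exists>C\<ge>0. \<forall>q\<in>{0<..R}. cmod (\<phi> n q) \<le> C / q ^ n" if n: "n \<in> {1, 2, 3}" for n R
    proof -
      \<comment> \<open>\<open>Q\<close> is at least 1, so its powers grow with the exponent,
        whatever the sign of \<open>R\<close>.\<close>
      define Q where "Q = \<bar>R\<bar> + 1"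
      have Q: "1 \<le> Q" by (simp add: Q_def)
      obtain M where M: "0 \<le> M" "\<And>n q. n \<le> 3 \<Longrightarrow> q \<in> {0..Q} \<Longrightarrow> cmod (A n q) \<le> M \<and> cmod (B n q) \<le> M"
        using bnd[of Q] by blast
      \<comment> \<open>For \<open>n = 3\<close> the terms contribute
        \<open>1 + 2 + 3 + 3 + 2 = 11\<close> multiples of \<open>M * t\<close>, so 20 is a common
        generous factor. The fourth power of \<open>Q\<close> absorbs the summand \<open>q\<close>
        in the bound of the logarithm when \<open>n = 3\<close>.\<close>
      have "cmod (\<phi> n q) \<le> (20 * M * Q ^ 4) / q ^ n" if q: "q \<in> {0<..R}" for q
      proof -
        have q': "0 < q" "q \<le> Q" "q \<in> {0..Q}" using q by (auto simp: Q_def)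
        have p1: "1 / q ^ i \<le> Q ^ (n - i) / q ^ n" if "i \<le> n" for i
        proof -
          have "q ^ n = q ^ i * q ^ (n - i)" using that by (simp flip: power_add)
          moreover have "q ^ (n - i) \<le> Q ^ (n - i)" using q' by (intro power_mono) auto
          ultimately show ?thesis using q' by (simp add: field_simps)
        qed
        have p: "1 / q ^ i \<le> Q ^ 4 / q ^ n" if "i \<le> n" for i
        proof -
          have "Q ^ (n - i) \<le> Q ^ 4" using n Q by (intro power_increasing) auto
          then show ?thesis using p1[OF that] divide_right_mono[of "Q ^ (n - i)" "Q ^ 4" "q ^ n"] q' by (auto intro: order.trans)
        qed
        define t where "t = Q ^ 4 / q ^ n"
        have t0: "0 \<le> t" using q' by (simp add: t_def)
        have lnt: "\<bar>ln q\<bar> \<le> 2 * t"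
        proof -
          have "q \<le> t"
          proof -
            have "q * q ^ n \<le> Q * Q ^ n" using q' by (intro mult_mono power_mono) auto
            also have "\<dots> \<le> Q ^ 4" using n Q power_increasing[of "Suc n" 4 Q] by auto
            finally show ?thesis using q' by (simp add: t_def pos_le_divide_eq)
          qed
          then show ?thesis using lnb[OF q'(1)] p[of 1] n by (auto simp: t_def)
        qed
        have tA: "cmod (A i q) \<le> M * t" if "i \<le> 3" for i
        proof -
          have "M * 1 \<le> M * t" using p[of 0] M(1) by (intro mult_left_mono) (auto simp: t_def)
          then show ?thesis using M(2)[OF that q'(3)] by simp
        qed
        have tL: "cmod (B i q * of_real (ln q)) \<le> 2 * (M * t)" if "i \<le> 3" for i
          using mult_mono[of "cmod (B i q)" M "\<bar>ln q\<bar>" "2 * t"] M(1) M(2)[OF that q'(3)] lnt by (simp add: norm_mult)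
        have tP: "cmod (B i q * of_real (1 / q ^ j)) \<le> M * t" if "i \<le> 3" "j \<le> n" for i j
          using mult_mono[of "cmod (B i q)" M "1 / q ^ j" t] M(1) M(2)[OF that(1) q'(3)] p[OF that(2)] q'
          by (simp add: norm_mult norm_divide norm_power t_def)
        have n3: "cmod (3 * z) = 3 * cmod z" "cmod (2 * z) = 2 * cmod z" for z :: complex by (simp_all add: norm_mult)
        consider "n = 1" | "n = 2" | "n = 3" using n by auto
        then have "cmod (\<phi> n q) \<le> 20 * (M * t)"
        proof cases
          case 1
          have "cmod (\<phi> n q) \<le> cmod (A 1 q) + (cmod (B 1 q * of_real (ln q)) + cmod (B 0 q * of_real (1 / q ^ 1)))"
            unfolding \<phi>_def using 1 by (auto intro!: norm_triangle_mono simp del: of_real_divide norm_mult)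
          then show ?thesis using tA[of 1] tL[of 1] tP[of 0 1] 1 mult_nonneg_nonneg[OF M(1) t0] by simp
        next
          case 2
          have "cmod (\<phi> n q) \<le> cmod (A 2 q) + (cmod (B 2 q * of_real (ln q)) + 2 * cmod (B 1 q * of_real (1 / q ^ 1)) + cmod (B 0 q * of_real (1 / q ^ 2)))"
            unfolding \<phi>_def n3[symmetric] using 2
            by (auto intro!: norm_triangle_mono norm_triangle_le_diff simp del: of_real_divide norm_mult)
          then show ?thesis using tA[of 2] tL[of 2] tP[of 1 1] tP[of 0 2] 2 mult_nonneg_nonneg[OF M(1) t0] by simp
        next
          case 3
          have "cmod (\<phi> n q) \<le> cmod (A 3 q) + (cmod (B 3 q * of_real (ln q)) + 3 * cmod (B 2 q * of_real (1 / q ^ 1)) + 3 * cmod (B 1 q * of_real (1 / q ^ 2)) + 2 * cmod (B 0 q * of_real (1 / q ^ 3)))"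
            unfolding \<phi>_def n3[symmetric] using 3
            by (auto intro!: norm_triangle_mono norm_triangle_le_diff simp del: of_real_divide norm_mult)
          then show ?thesis using tA[of 3] tL[of 3] tP[of 2 1] tP[of 1 2] tP[of 0 3] 3 mult_nonneg_nonneg[OF M(1) t0] by simp
        qed
        then show ?thesis by (simp add: t_def mult.assoc)
      qed
      then show ?thesis by (intro exI[of _ "20 * M * Q ^ 4"]) (use M Q in auto)
    qed
  qed
  then show ?thesis by blast
qed

section \<open>Kernels of the layer potentials\<close>

text \<open>
  Kernels of \<open>S\<close>, \<open>S'\<close>, \<open>D\<close>, \<open>D'\<close> and the second derivatives of the first and third of them along
  the target curve. All have the form \<open>\<Sum>n. \<alpha>\<^sub>n \<phi> n (\<bar>v\<bar>\<^sup>2)\<close> with \<open>v = x - y\<close>; here \<open>a\<close>, \<open>b\<close>, \<open>d\<close> are the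
  normal, the tangent and the derivative of the tangent at the target, and \<open>w\<close> is the normal at the source.
\<close>

datatype kind = KS | KSn | KD | KDn | KSss | KDss

fun coef :: "kind \<Rightarrow> nat \<Rightarrow> complex \<Rightarrow> complex \<Rightarrow> complex \<Rightarrow> complex \<Rightarrow> complex \<Rightarrow> real" where
  "coef KS n v a b d w = (if n = 0 then 1 else 0)"
| "coef KSn n v a b d w = (if n = 1 then 2 * (v \<bullet> a) else 0)"
| "coef KD n v a b d w = (if n = 1 then - 2 * (v \<bullet> w) else 0)"
| "coef KDn n v a b d w = (if n = 1 then - 2 * (a \<bullet> w) else if n = 2 then - 4 * (v \<bullet> a) * (v \<bullet> w) else 0)"
| "coef KSss n v a b d w = (if n = 1 then 2 * (b \<bullet> b) + 2 * (v \<bullet> d) else if n = 2 then (2 * (v \<bullet> b))\<^sup>2 else 0)"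
| "coef KDss n v a b d w = (if n = 1 then - 2 * (d \<bullet> w)
     else if n = 2 then - 8 * (b \<bullet> w) * (v \<bullet> b) - 2 * (v \<bullet> w) * (2 * (b \<bullet> b) + 2 * (v \<bullet> d))
     else if n = 3 then - 2 * (v \<bullet> w) * (2 * (v \<bullet> b))\<^sup>2 else 0)"

lemma continuous_on_coef:
  assumes "continuous_on S v" "continuous_on S a" "continuous_on S b" "continuous_on S d" "continuous_on S w"
  shows "continuous_on S (\<lambda>z. coef kind n (v z) (a z) (b z) (d z) (w z))"
  by (cases kind; cases "n = 0"; cases "n = 1"; cases "n = 2"; cases "n = 3")
     (auto intro!: continuous_intros assms)

context radial_kernel
begin

definition ker :: "kind \<Rightarrow> complex \<Rightarrow> complex \<Rightarrow> complex \<Rightarrow> complex \<Rightarrow> complex \<Rightarrow> complex" where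
  "ker kind v a b d w = (\<Sum>n\<le>3. of_real (coef kind n v a b d w) * \<phi> n ((norm v)\<^sup>2))"

lemma sum_atMost_3: "(\<Sum>n\<le>3. f n) = f 0 + f 1 + f 2 + f 3" for f :: "nat \<Rightarrow> complex"
  by (simp add: numeral_3_eq_3 numeral_2_eq_2)

lemma ker_simps:
  "ker KS v a b d w = \<phi> 0 ((norm v)\<^sup>2)"
  "ker KSn v a b d w = of_real (2 * (v \<bullet> a)) * \<phi> 1 ((norm v)\<^sup>2)"
  "ker KD v a b d w = of_real (- 2 * (v \<bullet> w)) * \<phi> 1 ((norm v)\<^sup>2)"
  "ker KDn v a b d w = of_real (- 2 * (a \<bullet> w)) * \<phi> 1 ((norm v)\<^sup>2) + of_real (- 4 * (v \<bullet> a) * (v \<bullet> w)) * \<phi> 2 ((norm v)\<^sup>2)"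
  "ker KSss v a b d w = of_real (2 * (b \<bullet> b) + 2 * (v \<bullet> d)) * \<phi> 1 ((norm v)\<^sup>2) + of_real ((2 * (v \<bullet> b))\<^sup>2) * \<phi> 2 ((norm v)\<^sup>2)"
  "ker KDss v a b d w = of_real (- 2 * (d \<bullet> w)) * \<phi> 1 ((norm v)\<^sup>2)
     + of_real (- 8 * (b \<bullet> w) * (v \<bullet> b) - 2 * (v \<bullet> w) * (2 * (b \<bullet> b) + 2 * (v \<bullet> d))) * \<phi> 2 ((norm v)\<^sup>2)
     + of_real (- 2 * (v \<bullet> w) * (2 * (v \<bullet> b))\<^sup>2) * \<phi> 3 ((norm v)\<^sup>2)"
  unfolding ker_def sum_atMost_3 by simp_all

lemma continuous_phi: "n \<le> 3 \<Longrightarrow> continuous_on {0<..} (\<phi> n)"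
proof (cases "n = 3")
  case False
  assume "n \<le> 3"
  with False have "n < 3" by simp
  show ?thesis
    by (rule continuous_on_vector_derivative[OF has_vector_derivative_at_within[OF deriv[OF \<open>n < 3\<close>]]]) simp
qed (simp add: continuous3)

lemma continuous_on_ker:
  assumes "continuous_on S v" "continuous_on S a" "continuous_on S b" "continuous_on S d" "continuous_on S w"
    and "\<And>z. z \<in> S \<Longrightarrow> v z \<noteq> 0"
  shows "continuous_on S (\<lambda>z. ker kind (v z) (a z) (b z) (d z) (w z))"
proof -
  have "continuous_on S (\<lambda>z. \<phi> n ((norm (v z))\<^sup>2))" if "n \<le> 3" for n
    by (rule continuous_on_compose2[OF continuous_phi[OF that]])
       (use assms in \<open>auto intro!: continuous_intros\<close>)
  then show ?thesis
    unfolding ker_def by (intro continuous_intros continuous_on_coef assms) auto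
qed

section \<open>Derivatives of the layer kernels in the target and in the source\<close>

lemma phi_chain:
  assumes q: "(q has_real_derivative q') (at t within S)" and "0 < q t" "n < 3"
  shows "((\<lambda>t. \<phi> n (q t)) has_vector_derivative of_real q' * \<phi> (Suc n) (q t)) (at t within S)"
proof -
  have "(q has_vector_derivative q') (at t within S)"
    using q by (simp add: has_real_derivative_iff_has_vector_derivative)
  from vector_diff_chain_within[OF this has_vector_derivative_at_within[OF deriv[OF assms(3,2)]]]
  show ?thesis by (simp add: comp_def scaleR_conv_of_real)
qed

lemma norm_square_deriv:
  fixes v :: "real \<Rightarrow> complex"
  assumes "(v has_vector_derivative b) (at t within S)"
  shows "((\<lambda>t. (norm (v t))\<^sup>2) has_real_derivative 2 * (v t \<bullet> b)) (at t within S)"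
proof -
  have "((\<lambda>t. v t \<bullet> v t) has_real_derivative v t \<bullet> b + b \<bullet> v t) (at t within S)"
    using bounded_bilinear.has_vector_derivative[OF bounded_bilinear_inner assms assms]
    by (simp add: has_real_derivative_iff_has_vector_derivative)
  then show ?thesis by (simp add: power2_norm_eq_inner inner_commute)
qed

lemma inner_deriv:
  fixes v :: "real \<Rightarrow> complex"
  assumes "(v has_vector_derivative b) (at t within S)"
  shows "((\<lambda>t. v t \<bullet> w) has_real_derivative b \<bullet> w) (at t within S)"
  using bounded_bilinear.has_vector_derivative[OF bounded_bilinear_inner assms has_vector_derivative_const[of w]]
  by (simp add: has_real_derivative_iff_has_vector_derivative)

text \<open>The formula through \<open>\<phi>\<close> holds off the diagonal. Avoiding
  \<open>y\<close> is an open condition on the parameter of the line through \<open>x\<close>, so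
  the formula is valid near parameter 0 and determines the derivative.\<close>

lemma dir_deriv_target:
  assumes "x \<noteq> y"
  shows "dir_deriv a (\<lambda>x. helmholtz_G k x y) x = ker KSn (x - y) a b d w"
proof -
  have l: "((\<lambda>t. x + of_real t * a - y) has_vector_derivative a) (at 0)"
    by (auto intro!: derivative_eq_intros)
  have "((\<lambda>t. \<phi> 0 ((norm (x + of_real t * a - y))\<^sup>2)) has_vector_derivative ker KSn (x - y) a b d w) (at 0)"
    using phi_chain[OF norm_square_deriv[OF l], of 0] assms by (simp add: ker_simps)
  then have "((\<lambda>t. helmholtz_G k (x + of_real t * a) y) has_vector_derivative ker KSn (x - y) a b d w) (at 0)"
  proof (rule has_vector_derivative_transform_within_open)
    show "open {t :: real. x + of_real t * a \<noteq> y}" by (intro open_Collect_neq continuous_intros)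
  qed (use assms in \<open>auto simp: kernel dist_norm\<close>)
  then show ?thesis unfolding dir_deriv_def by (rule vector_derivative_at)
qed

lemma dir_deriv_source:
  assumes "x \<noteq> y"
  shows "dir_deriv w (helmholtz_G k x) y = ker KD (x - y) a b d w"
proof -
  have l: "((\<lambda>t. x - (y + of_real t * w)) has_vector_derivative - w) (at 0)"
    by (auto intro!: derivative_eq_intros)
  have "((\<lambda>t. \<phi> 0 ((norm (x - (y + of_real t * w)))\<^sup>2)) has_vector_derivative ker KD (x - y) a b d w) (at 0)"
    using phi_chain[OF norm_square_deriv[OF l], of 0] assms by (simp add: ker_simps)
  then have "((\<lambda>t. helmholtz_G k x (y + of_real t * w)) has_vector_derivative ker KD (x - y) a b d w) (at 0)"
  proof (rule has_vector_derivative_transform_within_open)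
    show "open {t :: real. y + of_real t * w \<noteq> x}" by (intro open_Collect_neq continuous_intros)
  qed (use assms in \<open>auto simp: kernel dist_norm\<close>)
  then show ?thesis unfolding dir_deriv_def by (rule vector_derivative_at)
qed

lemma dir_deriv_both:
  assumes "x \<noteq> y"
  shows "dir_deriv a (\<lambda>x. dir_deriv w (helmholtz_G k x) y) x = ker KDn (x - y) a b d w"
proof -
  have l: "((\<lambda>t. x + of_real t * a - y) has_vector_derivative a) (at 0)"
    by (auto intro!: derivative_eq_intros)
  have 1: "((\<lambda>t. complex_of_real (- 2 * ((x + of_real t * a - y) \<bullet> w))) has_vector_derivative of_real (- 2 * (a \<bullet> w))) (at 0)"
    by (intro has_vector_derivative_of_real DERIV_cmult inner_deriv l)
  have "((\<lambda>t. of_real (- 2 * ((x + of_real t * a - y) \<bullet> w)) * \<phi> 1 ((norm (x + of_real t * a - y))\<^sup>2))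
     has_vector_derivative ker KDn (x - y) a b d w) (at 0)"
    using has_vector_derivative_mult[OF 1 phi_chain[OF norm_square_deriv[OF l], of 1]] assms
    by (simp add: ker_simps numeral_2_eq_2 algebra_simps)
  then have "((\<lambda>t. dir_deriv w (helmholtz_G k (x + of_real t * a)) y) has_vector_derivative ker KDn (x - y) a b d w) (at 0)"
  proof (rule has_vector_derivative_transform_within_open)
    show "open {t :: real. x + of_real t * a \<noteq> y}" by (intro open_Collect_neq continuous_intros)
  qed (use assms in \<open>auto simp: dir_deriv_source[where a = 0 and b = 0 and d = 0] ker_simps\<close>)
  then show ?thesis unfolding dir_deriv_def by (rule vector_derivative_at)
qed

text \<open>The first derivative stays existential because it enters later only through its value at
  0, as the slope in Taylor's formula; the second derivative is explicit because it has to be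
  estimated.\<close>

lemma ker_deriv2:
  assumes X: "\<And>s. s \<in> S \<Longrightarrow> (X has_vector_derivative b s) (at s within S)"
    and b: "\<And>s. s \<in> S \<Longrightarrow> (b has_vector_derivative d s) (at s within S)"
    and neq: "\<And>s. s \<in> S \<Longrightarrow> X s \<noteq> y"
    and kind: "(kind, kind2) \<in> {(KS, KSss), (KD, KDss)}"
  shows "\<exists>K1. \<forall>s\<in>S. ((\<lambda>s. ker kind (X s - y) (a s) (b s) (d s) w) has_vector_derivative K1 s) (at s within S) \<and>
    (K1 has_vector_derivative ker kind2 (X s - y) (a s) (b s) (d s) w) (at s within S)"
proof -
  define q q1 q2 where "q s = (norm (X s - y))\<^sup>2" and "q1 s = 2 * ((X s - y) \<bullet> b s)"
    and "q2 s = 2 * (b s \<bullet> b s) + 2 * ((X s - y) \<bullet> d s)" for s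
  define r r1 r2 where "r s = - 2 * ((X s - y) \<bullet> w)" and "r1 s = - 2 * (b s \<bullet> w)" and "r2 s = - 2 * (d s \<bullet> w)" for s
  have Xy: "((\<lambda>s. X s - y) has_vector_derivative b s) (at s within S)" if "s \<in> S" for s
    using has_vector_derivative_diff[OF X[OF that] has_vector_derivative_const[of y]] by simp
  have q0: "0 < q s" if "s \<in> S" for s using neq[OF that] by (simp add: q_def)
  have q: "(q has_real_derivative q1 s) (at s within S)" if "s \<in> S" for s
    unfolding q_def[abs_def] q1_def by (rule norm_square_deriv[OF Xy[OF that]])
  have q1: "((\<lambda>s. complex_of_real (q1 s)) has_vector_derivative of_real (q2 s)) (at s within S)" if "s \<in> S" for s
  proof -
    have "((\<lambda>s. (X s - y) \<bullet> b s) has_real_derivative (X s - y) \<bullet> d s + b s \<bullet> b s) (at s within S)"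
      using bounded_bilinear.has_vector_derivative[OF bounded_bilinear_inner Xy[OF that] b[OF that]]
      by (simp add: has_real_derivative_iff_has_vector_derivative)
    from DERIV_cmult[OF this, of 2] show ?thesis
      unfolding q1_def[abs_def] q2_def by (intro has_vector_derivative_of_real) (simp add: algebra_simps)
  qed
  have r: "((\<lambda>s. complex_of_real (r s)) has_vector_derivative of_real (r1 s)) (at s within S)" if "s \<in> S" for s
    unfolding r_def[abs_def] r1_def by (intro has_vector_derivative_of_real DERIV_cmult inner_deriv Xy that)
  have r1: "((\<lambda>s. complex_of_real (r1 s)) has_vector_derivative of_real (r2 s)) (at s within S)" if "s \<in> S" for s
    unfolding r1_def[abs_def] r2_def by (intro has_vector_derivative_of_real DERIV_cmult inner_deriv b that)
  have p: "((\<lambda>s. \<phi> 0 (q s)) has_vector_derivative of_real (q1 s) * \<phi> 1 (q s)) (at s within S)"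
    "((\<lambda>s. \<phi> 1 (q s)) has_vector_derivative of_real (q1 s) * \<phi> 2 (q s)) (at s within S)"
    "((\<lambda>s. \<phi> 2 (q s)) has_vector_derivative of_real (q1 s) * \<phi> 3 (q s)) (at s within S)" if "s \<in> S" for s
    using phi_chain[OF q[OF that] q0[OF that]] by (simp_all add: numeral_2_eq_2 numeral_3_eq_3)
  from kind consider "kind = KS" "kind2 = KSss" | "kind = KD" "kind2 = KDss" by auto
  then show ?thesis
  proof cases
    case 1
    show ?thesis unfolding 1
    proof (intro exI[of _ "\<lambda>s. of_real (q1 s) * \<phi> 1 (q s)"] ballI conjI)
      fix s assume s: "s \<in> S"
      show "((\<lambda>s. ker KS (X s - y) (a s) (b s) (d s) w) has_vector_derivative of_real (q1 s) * \<phi> 1 (q s)) (at s within S)"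
        using p(1)[OF s] by (simp add: ker_simps q_def)
      have "((\<lambda>s. of_real (q1 s) * \<phi> 1 (q s)) has_vector_derivative of_real (q1 s) * (of_real (q1 s) * \<phi> 2 (q s)) + of_real (q2 s) * \<phi> 1 (q s)) (at s within S)"
        by (rule has_vector_derivative_mult[OF q1[OF s] p(2)[OF s]])
      moreover have "of_real (q1 s) * (of_real (q1 s) * \<phi> 2 (q s)) + of_real (q2 s) * \<phi> 1 (q s) = ker KSss (X s - y) (a s) (b s) (d s) w"
        unfolding ker_simps q_def q1_def q2_def by (simp add: power2_eq_square)
      ultimately show "((\<lambda>s. of_real (q1 s) * \<phi> 1 (q s)) has_vector_derivative ker KSss (X s - y) (a s) (b s) (d s) w) (at s within S)"
        by simp
    qed
  next
    case 2
    show ?thesis unfolding 2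
    proof (intro exI[of _ "\<lambda>s. of_real (r s) * (of_real (q1 s) * \<phi> 2 (q s)) + of_real (r1 s) * \<phi> 1 (q s)"] ballI conjI)
      fix s assume s: "s \<in> S"
      show "((\<lambda>s. ker KD (X s - y) (a s) (b s) (d s) w) has_vector_derivative
          of_real (r s) * (of_real (q1 s) * \<phi> 2 (q s)) + of_real (r1 s) * \<phi> 1 (q s)) (at s within S)"
        using has_vector_derivative_mult[OF r[OF s] p(2)[OF s]] by (simp add: ker_simps q_def r_def)
      have "((\<lambda>s. of_real (r s) * (of_real (q1 s) * \<phi> 2 (q s)) + of_real (r1 s) * \<phi> 1 (q s)) has_vector_derivative
          (of_real (r s) * (of_real (q1 s) * (of_real (q1 s) * \<phi> 3 (q s)) + of_real (q2 s) * \<phi> 2 (q s)) + of_real (r1 s) * (of_real (q1 s) * \<phi> 2 (q s)))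
          + (of_real (r1 s) * (of_real (q1 s) * \<phi> 2 (q s)) + of_real (r2 s) * \<phi> 1 (q s))) (at s within S)"
        by (intro has_vector_derivative_add has_vector_derivative_mult r r1 q1 p s)
      moreover have "(of_real (r s) * (of_real (q1 s) * (of_real (q1 s) * \<phi> 3 (q s)) + of_real (q2 s) * \<phi> 2 (q s)) + of_real (r1 s) * (of_real (q1 s) * \<phi> 2 (q s)))
          + (of_real (r1 s) * (of_real (q1 s) * \<phi> 2 (q s)) + of_real (r2 s) * \<phi> 1 (q s)) = ker KDss (X s - y) (a s) (b s) (d s) w"
        unfolding ker_simps q_def q1_def q2_def r_def r1_def r2_def by (simp add: power2_eq_square algebra_simps)
      ultimately show "((\<lambda>s. of_real (r s) * (of_real (q1 s) * \<phi> 2 (q s)) + of_real (r1 s) * \<phi> 1 (q s)) has_vector_derivative ker KDss (X s - y) (a s) (b s) (d s) w) (at s within S)"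
        by simp
    qed
  qed
qed

section \<open>Size and cancellation of the kernels near a corner\<close>

lemma phi_mean_value:
  assumes n: "n < 3" and C: "\<And>q. q \<in> {0<..Q} \<Longrightarrow> cmod (\<phi> (Suc n) q) \<le> C / q ^ Suc n" "0 \<le> C"
    and \<rho>: "0 < \<rho>" "q \<in> {\<rho>..Q}" "q' \<in> {\<rho>..Q}"
  shows "cmod (\<phi> n q - \<phi> n q') \<le> C / \<rho> ^ Suc n * \<bar>q - q'\<bar>"
proof -
  have "norm (\<phi> n q - \<phi> n q') \<le> C / \<rho> ^ Suc n * norm (q - q')"
  proof (rule differentiable_bound[of "{\<rho>..Q}"])
    fix r assume r: "r \<in> {\<rho>..Q}"
    show "(\<phi> n has_derivative (\<lambda>h. h *\<^sub>R \<phi> (Suc n) r)) (at r within {\<rho>..Q})"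
      using has_vector_derivative_at_within[OF deriv[OF n, of r]] r \<rho>(1) by (simp add: has_vector_derivative_def)
    have "cmod (\<phi> (Suc n) r) \<le> C / r ^ Suc n" using C(1)[of r] r \<rho>(1) by simp
    also have "\<dots> \<le> C / \<rho> ^ Suc n"
      using r \<rho>(1) C(2) by (intro divide_left_mono power_mono mult_pos_pos zero_less_power) auto
    finally have le: "cmod (\<phi> (Suc n) r) \<le> C / \<rho> ^ Suc n" .
    have "onorm (\<lambda>h. h *\<^sub>R \<phi> (Suc n) r) \<le> norm (\<phi> (Suc n) r)"
      by (intro onorm_bound) (auto simp: mult.commute)
    then show "onorm (\<lambda>h. h *\<^sub>R \<phi> (Suc n) r) \<le> C / \<rho> ^ Suc n" using le by simp
  qed (use \<rho> in auto)
  then show ?thesis by simp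
qed

text \<open>
  The cancellation between a curve and its fin at a corner, where \<open>h\<close> is the distance to the corner:
  a difference of two terms of order \<open>h powr - 2\<close> with nearly equal data is of order \<open>1 / h\<close>.
\<close>

lemma corner_cancellation:
  assumes M: "0 \<le> M" and \<gamma>: "0 < \<gamma>"
  obtains B where "0 \<le> B" "\<And>h q q' A A' E E'. 0 < h \<Longrightarrow> q \<in> {\<gamma> * h\<^sup>2..Q} \<Longrightarrow> q' \<in> {\<gamma> * h\<^sup>2..Q} \<Longrightarrow>
    \<bar>q - q'\<bar> \<le> M * h ^ 3 \<Longrightarrow> \<bar>A\<bar> \<le> M * h\<^sup>2 \<Longrightarrow> \<bar>A - A'\<bar> \<le> M * h ^ 3 \<Longrightarrow> \<bar>E\<bar> \<le> M \<Longrightarrow> \<bar>E - E'\<bar> \<le> M * h \<Longrightarrow>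
    cmod ((of_real E * \<phi> 1 q + of_real A * \<phi> 2 q) - (of_real E' * \<phi> 1 q' + of_real A' * \<phi> 2 q')) \<le> B / h"
proof -
  obtain C1 where C1: "0 \<le> C1" "\<And>q. q \<in> {0<..Q} \<Longrightarrow> cmod (\<phi> 1 q) \<le> C1 / q ^ 1" using deriv_bound[of 1 Q] by auto
  obtain C2 where C2: "0 \<le> C2" "\<And>q. q \<in> {0<..Q} \<Longrightarrow> cmod (\<phi> 2 q) \<le> C2 / q ^ 2" using deriv_bound[of 2 Q] by auto
  obtain C3 where C3: "0 \<le> C3" "\<And>q. q \<in> {0<..Q} \<Longrightarrow> cmod (\<phi> 3 q) \<le> C3 / q ^ 3" using deriv_bound[of 3 Q] by auto
  \<comment> \<open>One summand for each of the four terms of the telescoped difference: the changes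
    of \<open>\<phi> 1\<close>, \<open>E\<close>, \<open>\<phi> 2\<close> and \<open>A\<close>, in
    this order.\<close>
  define B where "B = M * (C2 / \<gamma>\<^sup>2 * M) + M * (C1 / \<gamma>) + M * (C3 / \<gamma> ^ 3 * M) + M * (C2 / \<gamma>\<^sup>2)"
  have B: "0 \<le> B" using M \<gamma> C1(1) C2(1) C3(1) by (simp add: B_def)
  have "cmod ((of_real E * \<phi> 1 q + of_real A * \<phi> 2 q) - (of_real E' * \<phi> 1 q' + of_real A' * \<phi> 2 q')) \<le> B / h"
    if h: "0 < h" and q: "q \<in> {\<gamma> * h\<^sup>2..Q}" and q': "q' \<in> {\<gamma> * h\<^sup>2..Q}" and qq: "\<bar>q - q'\<bar> \<le> M * h ^ 3"
      and A: "\<bar>A\<bar> \<le> M * h\<^sup>2" "\<bar>A - A'\<bar> \<le> M * h ^ 3" and E: "\<bar>E\<bar> \<le> M" "\<bar>E - E'\<bar> \<le> M * h"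
    for h q q' A A' E E'
  proof -
    have \<rho>: "0 < \<gamma> * h\<^sup>2" using \<gamma> h by simp
    have q'0: "q' \<in> {0<..Q}" "\<gamma> * h\<^sup>2 \<le> q'" using q' \<rho> by auto
    have d1: "cmod (\<phi> 1 q - \<phi> 1 q') \<le> C2 / \<gamma>\<^sup>2 * M / h"
    proof -
      have "cmod (\<phi> 1 q - \<phi> 1 q') \<le> C2 / (\<gamma> * h\<^sup>2) ^ 2 * \<bar>q - q'\<bar>"
        using phi_mean_value[of 1 Q C2, OF _ _ C2(1) \<rho> q q'] C2(2) by (simp add: numeral_2_eq_2)
      also have "\<dots> \<le> C2 / (\<gamma> * h\<^sup>2) ^ 2 * (M * h ^ 3)" using C2(1) by (intro mult_left_mono qq) auto
      also have "\<dots> = C2 / \<gamma>\<^sup>2 * M / h" using h by (simp add: field_simps power2_eq_square power3_eq_cube)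
      finally show ?thesis .
    qed
    have d2: "cmod (\<phi> 2 q - \<phi> 2 q') \<le> C3 / \<gamma> ^ 3 * M / h ^ 3"
    proof -
      have "cmod (\<phi> 2 q - \<phi> 2 q') \<le> C3 / (\<gamma> * h\<^sup>2) ^ 3 * \<bar>q - q'\<bar>"
        using phi_mean_value[of 2 Q C3, OF _ _ C3(1) \<rho> q q'] C3(2) by (simp add: numeral_3_eq_3)
      also have "\<dots> \<le> C3 / (\<gamma> * h\<^sup>2) ^ 3 * (M * h ^ 3)" using C3(1) \<rho> by (intro mult_left_mono qq divide_nonneg_nonneg zero_le_power) auto
      also have "\<dots> = C3 / \<gamma> ^ 3 * M / h ^ 3" using h by (simp add: field_simps power2_eq_square power3_eq_cube)
      finally show ?thesis .
    qed
    have e1: "cmod (\<phi> 1 q') \<le> C1 / (\<gamma> * h\<^sup>2)"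
      using C1(2)[OF q'0(1)] divide_left_mono[OF q'0(2) C1(1)] \<rho> q'0 by (auto intro: order.trans)
    have "0 < q'" using q'0 by simp
    then have "0 < q'\<^sup>2 * (\<gamma> * h\<^sup>2)\<^sup>2" using \<rho> by (rule mult_pos_pos[OF zero_less_power zero_less_power])
    then have e2: "cmod (\<phi> 2 q') \<le> C2 / (\<gamma> * h\<^sup>2)\<^sup>2"
      using C2(2)[OF q'0(1)] divide_left_mono[OF power_mono[OF q'0(2), of 2] C2(1)] \<rho> q'0 by (auto intro: order.trans)
    have "(of_real E * \<phi> 1 q + of_real A * \<phi> 2 q) - (of_real E' * \<phi> 1 q' + of_real A' * \<phi> 2 q')
      = of_real E * (\<phi> 1 q - \<phi> 1 q') + of_real (E - E') * \<phi> 1 q' + of_real A * (\<phi> 2 q - \<phi> 2 q') + of_real (A - A') * \<phi> 2 q'"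
      by (simp add: algebra_simps)
    also have "cmod \<dots> \<le> \<bar>E\<bar> * cmod (\<phi> 1 q - \<phi> 1 q') + \<bar>E - E'\<bar> * cmod (\<phi> 1 q') + \<bar>A\<bar> * cmod (\<phi> 2 q - \<phi> 2 q') + \<bar>A - A'\<bar> * cmod (\<phi> 2 q')"
      by (intro order.trans[OF norm_triangle_ineq] add_mono; simp only: norm_mult norm_of_real order_refl)
    also have "\<dots> \<le> M * (C2 / \<gamma>\<^sup>2 * M / h) + M * h * (C1 / (\<gamma> * h\<^sup>2)) + M * h\<^sup>2 * (C3 / \<gamma> ^ 3 * M / h ^ 3) + M * h ^ 3 * (C2 / (\<gamma> * h\<^sup>2)\<^sup>2)"
      using M h by (intro add_mono mult_mono A E d1 d2 e1 e2) auto
    also have "\<dots> = B / h" unfolding B_def using h \<gamma> by (simp add: field_simps power2_eq_square power3_eq_cube)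
    finally show ?thesis .
  qed
  then show ?thesis using that B by blast
qed

text \<open>For these kinds the kernel itself is at most of order \<open>1 / norm v\<close>: one
  factor \<open>norm v\<close> from the inner product tames \<open>\<phi> 1\<close>, and the
  logarithm of S is weaker still. The Hardy bound then holds sheet by sheet, whatever the
  parity.\<close>

lemma ker_inverse_bound:
  assumes \<gamma>: "0 < \<gamma>"
  obtains B where "0 \<le> B" "\<And>kind v a b d w h. kind \<in> {KS, KSn, KD} \<Longrightarrow> 0 < h \<Longrightarrow> h \<le> 1 \<Longrightarrow> \<gamma> * h \<le> norm v \<Longrightarrow> norm v \<le> 1 \<Longrightarrow>
    norm a \<le> 1 \<Longrightarrow> norm w \<le> 1 \<Longrightarrow> cmod (ker kind v a b d w) \<le> B / h"
proof -
  obtain C0 where C0: "0 \<le> C0" "\<And>r. r \<in> {0<..1} \<Longrightarrow> cmod (\<phi> 0 (r\<^sup>2)) \<le> C0 / sqrt (sqrt r)" using log_bound[of 1] by auto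
  obtain C1 where C1: "0 \<le> C1" "\<And>q. q \<in> {0<..1} \<Longrightarrow> cmod (\<phi> 1 q) \<le> C1 / q ^ 1" using deriv_bound[of 1 1] by auto
  have "cmod (ker kind v a b d w) \<le> ((C0 + 2 * C1) / \<gamma>) / h"
    if kind: "kind \<in> {KS, KSn, KD}" and h: "0 < h" and v: "\<gamma> * h \<le> norm v" "norm v \<le> 1" and aw: "norm a \<le> 1" "norm w \<le> 1"
    for kind v a b d w h
  proof -
    have v0: "0 < norm v" using v(1) \<gamma> h by (meson less_le_trans mult_pos_pos)
    have i: "1 / norm v \<le> 1 / (\<gamma> * h)" using v(1) \<gamma> h v0 by (intro divide_left_mono) auto
    have "cmod (ker kind v a b d w) \<le> (C0 + 2 * C1) * (1 / norm v)"
    proof (cases "kind = KS")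
      case True
      have "norm v \<le> sqrt (sqrt (norm v))"
      proof -
        have "norm v \<le> sqrt (norm v)" using v(2) v0 by (intro real_le_rsqrt) (simp add: power2_eq_square mult_left_le)
        then show ?thesis using real_sqrt_le_mono by (meson order.trans)
      qed
      then have "C0 / sqrt (sqrt (norm v)) \<le> C0 / norm v" using C0(1) v0 by (intro divide_left_mono) auto
      also have "\<dots> \<le> (C0 + 2 * C1) / norm v" using C1(1) v0 by (intro divide_right_mono) auto
      finally show ?thesis using C0(2)[of "norm v"] v(2) v0 by (simp add: True ker_simps)
    next
      case False
      have p: "cmod (\<phi> 1 ((norm v)\<^sup>2)) \<le> C1 / (norm v)\<^sup>2"
        using C1(2)[of "(norm v)\<^sup>2"] v(2) v0 by (simp add: power_le_one)
      have "\<bar>v \<bullet> a\<bar> \<le> norm v" "\<bar>v \<bullet> w\<bar> \<le> norm v"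
        using Cauchy_Schwarz_ineq2[of v a] Cauchy_Schwarz_ineq2[of v w] aw mult_left_le[of "norm a" "norm v"] mult_left_le[of "norm w" "norm v"]
        by auto
      then have "2 * \<bar>v \<bullet> a\<bar> * cmod (\<phi> 1 ((norm v)\<^sup>2)) \<le> 2 * norm v * (C1 / (norm v)\<^sup>2)"
        "2 * \<bar>v \<bullet> w\<bar> * cmod (\<phi> 1 ((norm v)\<^sup>2)) \<le> 2 * norm v * (C1 / (norm v)\<^sup>2)"
        by (intro mult_mono p; simp)+
      moreover have "2 * norm v * (C1 / (norm v)\<^sup>2) = 2 * C1 * (1 / norm v)"
        using v0 by (simp add: power2_eq_square)
      moreover have "\<dots> \<le> (C0 + 2 * C1) * (1 / norm v)" using C0(1) v0 by (intro mult_right_mono) auto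
      ultimately show ?thesis using kind False by (auto simp: ker_simps norm_mult abs_mult)
    qed
    also have "\<dots> \<le> (C0 + 2 * C1) * (1 / (\<gamma> * h))" using C0(1) C1(1) by (intro mult_left_mono i) auto
    finally show ?thesis by simp
  qed
  then show ?thesis using that[of "(C0 + 2 * C1) / \<gamma>"] C0(1) C1(1) \<gamma> by auto
qed

end

section \<open>Geometry of the waveguide\<close>

text \<open>A finite subcover, with the sum of the local constants as global one. Local bounds are
  demanded at every point of \<open>K\<close>, also at limit points outside \<open>D\<close>: the
  corners are such points.\<close>

lemma compact_local_bound:
  fixes F g :: "'a::metric_space \<Rightarrow> real"
  assumes K: "compact K" and D: "D \<subseteq> K" and g: "\<And>z. z \<in> D \<Longrightarrow> 0 \<le> g z"
    and loc: "\<And>z. z \<in> K \<Longrightarrow> \<exists>d>0. \<exists>C. \<forall>w\<in>D. dist w z < d \<longrightarrow> F w \<le> C * g w"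
  shows "\<exists>C\<ge>0. \<forall>w\<in>D. F w \<le> C * g w"
proof -
  from loc have "\<forall>z. \<exists>d C. z \<in> K \<longrightarrow> 0 < d \<and> (\<forall>w\<in>D. dist w z < d \<longrightarrow> F w \<le> C * g w)" by blast
  then obtain d C where dC: "\<And>z. z \<in> K \<Longrightarrow> 0 < d z" "\<And>z w. z \<in> K \<Longrightarrow> w \<in> D \<Longrightarrow> dist w z < d z \<Longrightarrow> F w \<le> C z * g w"
    by metis
  have "K \<subseteq> (\<Union>z\<in>K. ball z (d z))" using dC(1) by force
  then obtain K' where K': "K' \<subseteq> K" "finite K'" "K \<subseteq> (\<Union>z\<in>K'. ball z (d z))"
    by (rule compactE_image[OF K, rotated]) auto
  have "F w \<le> (\<Sum>z\<in>K'. \<bar>C z\<bar>) * g w" if w: "w \<in> D" for w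
  proof -
    obtain z where z: "z \<in> K'" "dist w z < d z" using K' w D by (auto simp: dist_commute)
    have "F w \<le> C z * g w" using dC(2)[OF _ w z(2)] z(1) K'(1) by blast
    also have "\<dots> \<le> \<bar>C z\<bar> * g w" using g[OF w] by (intro mult_right_mono) auto
    also have "\<dots> \<le> (\<Sum>z\<in>K'. \<bar>C z\<bar>) * g w"
      using g[OF w] K'(2) z(1) by (intro mult_right_mono member_le_sum) auto
    finally show ?thesis .
  qed
  then show ?thesis by (intro exI[of _ "\<Sum>z\<in>K'. \<bar>C z\<bar>"]) (auto intro: sum_nonneg)
qed

text \<open>In the plane a unit vector orthogonal to \<open>b\<close> is a quarter turn of
  \<open>b\<close>, so both together form an orthonormal basis.\<close>

lemma orthonormal_decomposition:
  fixes b \<tau> w :: complex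
  assumes "norm b = 1" "norm \<tau> = 1" "b \<bullet> \<tau> = 0"
  shows "w - (w \<bullet> \<tau>) *\<^sub>R \<tau> = (w \<bullet> b) *\<^sub>R b"
proof -
  have n: "Re b * Re b + Im b * Im b = 1" "Re \<tau> * Re \<tau> + Im \<tau> * Im \<tau> = 1"
    using assms by (auto simp: norm_complex_def power2_eq_square)
  have o: "Re b * Re \<tau> + Im b * Im \<tau> = 0" using assms by (simp add: inner_complex_def)
  have 1: "Re b * Re b + Re \<tau> * Re \<tau> = 1" "Im b * Im b + Im \<tau> * Im \<tau> = 1" "Re b * Im b + Re \<tau> * Im \<tau> = 0"
  proof -
    \<comment> \<open>Lagrange's identity: the squared determinant equals the product of the squared
      norms minus the squared inner product.\<close>
    have "(Re b * Im \<tau> - Im b * Re \<tau>)\<^sup>2 = 1"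
      using n o by algebra
    then have "Re b * Im \<tau> - Im b * Re \<tau> = 1 \<or> Re b * Im \<tau> - Im b * Re \<tau> = -1" by (simp add: power2_eq_1_iff)
    then have "(Re \<tau> = - Im b \<and> Im \<tau> = Re b) \<or> (Re \<tau> = Im b \<and> Im \<tau> = - Re b)"
    proof
      assume c: "Re b * Im \<tau> - Im b * Re \<tau> = 1"
      have "Re \<tau> = - Im b" "Im \<tau> = Re b" using c n o by algebra+
      then show ?thesis by simp
    next
      assume c: "Re b * Im \<tau> - Im b * Re \<tau> = -1"
      have "Re \<tau> = Im b" "Im \<tau> = - Re b" using c n o by algebra+
      then show ?thesis by simp
    qed
    then show "Re b * Re b + Re \<tau> * Re \<tau> = 1" "Im b * Im b + Im \<tau> * Im \<tau> = 1" "Re b * Im b + Re \<tau> * Im \<tau> = 0"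
      using n by (auto simp: algebra_simps)
  qed
  show ?thesis
  proof (rule complex_eqI)
    have "Re w = Re w * (Re b * Re b + Re \<tau> * Re \<tau>) + Im w * (Re b * Im b + Re \<tau> * Im \<tau>)" using 1 by simp
    then show "Re (w - (w \<bullet> \<tau>) *\<^sub>R \<tau>) = Re ((w \<bullet> b) *\<^sub>R b)" by (simp add: inner_complex_def algebra_simps)
    have "Im w = Im w * (Im b * Im b + Im \<tau> * Im \<tau>) + Re w * (Re b * Im b + Re \<tau> * Im \<tau>)" using 1 by simp
    then show "Im (w - (w \<bullet> \<tau>) *\<^sub>R \<tau>) = Im ((w \<bullet> b) *\<^sub>R b)" by (simp add: inner_complex_def algebra_simps)
  qed
qed

text \<open>Curves of the same kind are equal or disjoint; curves of different kinds may share
  corners, and only for them is cancellation an issue.\<close>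

fun same_kind :: "label \<Rightarrow> label \<Rightarrow> bool" where
  "same_kind (Star i) (Star j) = True"
| "same_kind (Circ i) (Circ j) = True"
| "same_kind _ _ = False"

text \<open>The sheet \<open>None\<close> is the curve itself, \<open>Some e\<close> its fin at the endpoint \<open>e\<close>.\<close>

fun sheet_pt :: "waveguide \<Rightarrow> label \<Rightarrow> real option \<Rightarrow> real \<Rightarrow> complex" where
  "sheet_pt W c None u = curve W c u"
| "sheet_pt W c (Some e) u = fin_point W c e (curve W c u)"

fun sheet_normal :: "waveguide \<Rightarrow> label \<Rightarrow> real option \<Rightarrow> real \<Rightarrow> complex" where
  "sheet_normal W c None u = unit_normal W c u"
| "sheet_normal W c (Some e) u = fin_vec W c e (unit_normal W c u)"

fun sheet_dom :: "waveguide \<Rightarrow> label \<Rightarrow> real option \<Rightarrow> real set" where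
  "sheet_dom W c None = {0..len W c}"
| "sheet_dom W c (Some e) = {s\<in>{0..len W c}. curve W c s \<in> ball (curve W c e) (fin_radius W)}"

fun sheet_sign :: "label \<Rightarrow> real option \<Rightarrow> complex" where
  "sheet_sign c None = 1"
| "sheet_sign c (Some e) = parity c"

definition sheets :: "waveguide \<Rightarrow> label \<Rightarrow> real option set" where
  "sheets W c = {None, Some 0, Some (len W c)}"

lemma norm_parity [simp]: "cmod (parity c) = 1"
  by (cases c) auto

lemma norm_sheet_sign [simp]: "cmod (sheet_sign c j) = 1"
  by (cases j) auto

definition tangent' :: "waveguide \<Rightarrow> label \<Rightarrow> real \<Rightarrow> complex" where
  "tangent' W c s = vector_derivative (tangent W c) (at s within {0..len W c})"

locale waveguide_kernels = radial_kernel "wave_number W" \<phi> for W \<phi> +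
  assumes admissible: "admissible W"
begin

abbreviation "X \<equiv> curve W"
abbreviation "T \<equiv> tangent W"
abbreviation "N \<equiv> unit_normal W"
abbreviation "L \<equiv> len W"

section \<open>Regularity of the arcs\<close>

lemma arcs: "arcs_ok W" and corners: "corners_ok W" and region: "region_ok W" and fins: "fins_ok W"
  using admissible by (auto simp: admissible_def)

lemma L_pos: "0 < L c"
  using arcs unfolding arcs_ok_def by blast

lemma ends_mem: "e \<in> {0, L c} \<Longrightarrow> e \<in> {0..L c}"
  using L_pos[of c] by auto

lemma X_inj: "s \<in> {0..L c} \<Longrightarrow> u \<in> {0..L c} \<Longrightarrow> X c s = X c u \<Longrightarrow> s = u"
  using arcs unfolding arcs_ok_def by (blast dest: inj_onD)

lemma T_norm: "s \<in> {0..L c} \<Longrightarrow> norm (T c s) = 1"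
  using arcs unfolding arcs_ok_def by blast

lemma N_norm: "s \<in> {0..L c} \<Longrightarrow> norm (N c s) = 1"
  using T_norm by (simp add: unit_normal_def norm_mult)

lemma N_orth: "T c s \<bullet> N c s = 0"
  by (simp add: unit_normal_def inner_complex_def)

lemma curve_derivs:
  shows X_deriv: "\<And>s. s \<in> {0..L c} \<Longrightarrow> (X c has_vector_derivative T c s) (at s within {0..L c})"
    and T_deriv: "\<And>s. s \<in> {0..L c} \<Longrightarrow> (T c has_vector_derivative tangent' W c s) (at s within {0..L c})"
    and T'_cont: "continuous_on {0..L c} (tangent' W c)"
proof -
  obtain d where d0: "\<And>s. s \<in> {0..L c} \<Longrightarrow> d 0 s = X c s"
    and d: "\<And>m s. s \<in> {0..L c} \<Longrightarrow> (d m has_vector_derivative d (Suc m) s) (at s within {0..L c})"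
    using arcs unfolding arcs_ok_def smooth_on_interval_def by blast
  have 1: "(X c has_vector_derivative d (Suc 0) s) (at s within {0..L c})" if "s \<in> {0..L c}" for s
    by (rule has_vector_derivative_transform[OF that _ d[OF that, of 0]]) (simp add: d0)
  have T: "T c s = d (Suc 0) s" if "s \<in> {0..L c}" for s
    unfolding tangent_def by (rule vector_derivative_within_interval[OF L_pos that 1[OF that]])
  show "(X c has_vector_derivative T c s) (at s within {0..L c})" if "s \<in> {0..L c}" for s
    using 1[OF that] T[OF that] by simp
  have 2: "(T c has_vector_derivative d (Suc (Suc 0)) s) (at s within {0..L c})" if "s \<in> {0..L c}" for s
    by (rule has_vector_derivative_transform[OF that T d[OF that]])
  have T': "tangent' W c s = d (Suc (Suc 0)) s" if "s \<in> {0..L c}" for s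
    unfolding tangent'_def by (rule vector_derivative_within_interval[OF L_pos that 2[OF that]])
  show "(T c has_vector_derivative tangent' W c s) (at s within {0..L c})" if "s \<in> {0..L c}" for s
    using 2[OF that] T'[OF that] by simp
  have "continuous_on {0..L c} (d (Suc (Suc 0)))" by (rule continuous_on_vector_derivative[OF d])
  then show "continuous_on {0..L c} (tangent' W c)" by (rule continuous_on_eq) (simp add: T')
qed

lemma X_cont: "continuous_on {0..L c} (X c)"
  by (rule continuous_on_vector_derivative[OF X_deriv])

lemma T_cont: "continuous_on {0..L c} (T c)"
  by (rule continuous_on_vector_derivative[OF T_deriv])

lemma N_cont: "continuous_on {0..L c} (N c)"
  unfolding unit_normal_def[abs_def] by (intro continuous_intros T_cont)

lemma vector_derivative_bound:
  fixes f :: "real \<Rightarrow> complex"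
  assumes f: "\<And>r. r \<in> {0..l} \<Longrightarrow> (f has_vector_derivative f' r) (at r within {0..l})"
    and B: "\<And>r. r \<in> {min s u..max s u} \<Longrightarrow> norm (f' r) \<le> B" and su: "s \<in> {0..l}" "u \<in> {0..l}"
  shows "norm (f s - f u) \<le> B * \<bar>s - u\<bar>"
proof -
  let ?S = "{min s u..max s u}"
  have "norm (f s - f u) \<le> B * norm (s - u)"
  proof (rule differentiable_bound[of ?S])
    fix r assume r: "r \<in> ?S"
    then have r': "r \<in> {0..l}" using su by auto
    show "(f has_derivative (\<lambda>h. h *\<^sub>R f' r)) (at r within ?S)"
      using has_vector_derivative_within_subset[OF f[OF r'], of ?S] su by (auto simp: has_vector_derivative_def)
    have "onorm (\<lambda>h. h *\<^sub>R f' r) \<le> norm (f' r)" by (intro onorm_bound) (auto simp: mult.commute)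
    then show "onorm (\<lambda>h. h *\<^sub>R f' r) \<le> B" using B[OF r] by simp
  qed auto
  then show ?thesis by simp
qed

text \<open>One constant, from the bound of the second derivative on the compact arc, serves all
  first- and second-order estimates. \<open>1 \<le> K\<close> is convenient for radii such as
  \<open>1 / (8 * K)\<close>.\<close>

lemma taylor_constant:
  obtains K where "1 \<le> K" "\<And>s. s \<in> {0..L c} \<Longrightarrow> norm (tangent' W c s) \<le> K"
    "\<And>s u. s \<in> {0..L c} \<Longrightarrow> u \<in> {0..L c} \<Longrightarrow> norm (T c s - T c u) \<le> K * \<bar>s - u\<bar>"
    "\<And>s u. s \<in> {0..L c} \<Longrightarrow> u \<in> {0..L c} \<Longrightarrow> norm (X c s - X c u) \<le> \<bar>s - u\<bar>"
    "\<And>s u. s \<in> {0..L c} \<Longrightarrow> u \<in> {0..L c} \<Longrightarrow> norm (X c s - X c u - (s - u) *\<^sub>R T c u) \<le> K * \<bar>s - u\<bar>\<^sup>2"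
proof -
  have "bounded (tangent' W c ` {0..L c})"
    by (intro compact_imp_bounded compact_continuous_image T'_cont compact_Icc)
  then obtain K0 where K0: "\<forall>s\<in>{0..L c}. norm (tangent' W c s) \<le> K0" by (auto simp: bounded_iff)
  define K where "K = max 1 K0"
  have K: "norm (tangent' W c s) \<le> K" if "s \<in> {0..L c}" for s using K0 that by (auto simp: K_def le_max_iff_disj)
  have T: "norm (T c s - T c u) \<le> K * \<bar>s - u\<bar>" if "s \<in> {0..L c}" "u \<in> {0..L c}" for s u
    by (rule vector_derivative_bound[OF T_deriv _ that], assumption, rule K) (use that in auto)
  have X: "norm (X c s - X c u) \<le> \<bar>s - u\<bar>" if "s \<in> {0..L c}" "u \<in> {0..L c}" for s u
  proof -
    have "norm (T c r) \<le> 1" if "r \<in> {min s u..max s u}" for r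
    proof -
      have "r \<in> {0..L c}"
        using that \<open>s \<in> {0..L c}\<close> \<open>u \<in> {0..L c}\<close> by (auto simp: min_def max_def split: if_splits)
      then show ?thesis by (simp add: T_norm)
    qed
    from vector_derivative_bound[OF X_deriv this that] show ?thesis by simp
  qed
  have X2: "norm (X c s - X c u - (s - u) *\<^sub>R T c u) \<le> K * \<bar>s - u\<bar>\<^sup>2" if su: "s \<in> {0..L c}" "u \<in> {0..L c}" for s u
  proof -
    have "norm ((X c s - s *\<^sub>R T c u) - (X c u - u *\<^sub>R T c u)) \<le> (K * \<bar>s - u\<bar>) * \<bar>s - u\<bar>"
    proof (rule vector_derivative_bound[OF _ _ su])
      show "((\<lambda>r. X c r - r *\<^sub>R T c u) has_vector_derivative T c r - T c u) (at r within {0..L c})" if "r \<in> {0..L c}" for r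
        by (auto intro!: derivative_eq_intros X_deriv[OF that])
      show "norm (T c r - T c u) \<le> K * \<bar>s - u\<bar>" if r: "r \<in> {min s u..max s u}" for r
      proof -
        have "norm (T c r - T c u) \<le> K * \<bar>r - u\<bar>" using r su by (intro T) auto
        also have "\<dots> \<le> K * \<bar>s - u\<bar>" using r by (intro mult_left_mono) (auto simp: K_def)
        finally show ?thesis .
      qed
    qed
    then show ?thesis by (simp add: power2_eq_square algebra_simps)
  qed
  show ?thesis by (rule that[of K]) (use K T X X2 in \<open>auto simp: K_def\<close>)
qed

section \<open>A curve and its two fins as sheets\<close>

lemma sheets_cases: "j \<in> sheets W c \<Longrightarrow> (j = None \<Longrightarrow> P) \<Longrightarrow> (\<And>e. e \<in> {0, L c} \<Longrightarrow> j = Some e \<Longrightarrow> P) \<Longrightarrow> P"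
  by (auto simp: sheets_def)

text \<open>\<open>L c - e\<close> is the opposite end. The fin at the corner under study is thereby
  listed next to the curve, and the remote fin separately.\<close>

lemma sum_sheets:
  fixes f :: "real option \<Rightarrow> complex"
  assumes "e \<in> {0, L c}"
  shows "(\<Sum>j\<in>sheets W c. f j) = f None + f (Some e) + f (Some (L c - e))"
  using assms L_pos[of c] by (auto simp: sheets_def)

lemma fin_vec_diff: "fin_vec W c e (v - w) = fin_vec W c e v - fin_vec W c e w"
  by (simp add: fin_vec_def inner_diff_left algebra_simps)

lemma norm_fin_vec:
  assumes "e \<in> {0, L c}"
  shows "norm (fin_vec W c e v) = norm v"
proof -
  have n: "T c e \<bullet> T c e = 1" using T_norm[OF ends_mem[OF assms]] by (simp add: dot_square_norm)
  have "fin_vec W c e v \<bullet> fin_vec W c e v = v \<bullet> v"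
    unfolding fin_vec_def by (simp add: inner_diff_left inner_diff_right n inner_commute algebra_simps)
  then show ?thesis by (simp add: norm_eq)
qed

lemma sheet_pt_cont: "continuous_on {0..L c} (sheet_pt W c j)"
  by (cases j) (auto simp: fin_point_def fin_vec_def intro!: continuous_intros X_cont)

lemma sheet_normal_cont: "continuous_on {0..L c} (sheet_normal W c j)"
  by (cases j) (auto simp: fin_vec_def intro!: continuous_intros N_cont)

lemma sheet_dom_subset: "sheet_dom W c j \<subseteq> {0..L c}"
  by (cases j) auto

lemma closure_sheet_dom: "closure (sheet_dom W c j) \<subseteq> {0..L c}"
  by (rule closure_minimal[OF sheet_dom_subset]) simp

lemma compact_closure_sheet_dom: "compact (closure (sheet_dom W c j))"
  unfolding compact_closure by (rule bounded_subset[OF bounded_closed_interval sheet_dom_subset])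

lemma sheet_dom_borel: "sheet_dom W c j \<in> sets borel"
proof (cases j)
  case (Some e)
  have "openin (top_of_set {0..L c}) ({0..L c} \<inter> X c -` ball (X c e) (fin_radius W))"
    by (rule continuous_openin_preimage_gen[OF X_cont open_ball])
  then obtain U where "open U" "{0..L c} \<inter> X c -` ball (X c e) (fin_radius W) = {0..L c} \<inter> U"
    by (auto simp: openin_open)
  moreover have "sheet_dom W c j = {0..L c} \<inter> X c -` ball (X c e) (fin_radius W)"
    using Some by auto
  ultimately show ?thesis by simp
qed simp

lemma fin_radius_pos: "0 < fin_radius W"
  using fins by (simp add: fins_ok_def)

lemma sheet_dom_near_end:
  assumes "e \<in> {0, L c}" "u \<in> {0..L c}" "\<bar>u - e\<bar> < fin_radius W"
  shows "u \<in> sheet_dom W c (Some e)"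
proof -
  obtain K where "norm (X c u - X c e) \<le> \<bar>u - e\<bar>"
    using taylor_constant[of c] assms ends_mem by metis
  then show ?thesis using assms by (simp add: dist_norm norm_minus_commute)
qed

section \<open>Where curves and fins can meet\<close>

lemma X_in_closure_region: "s \<in> {0..L c} \<Longrightarrow> X c s \<in> closure (region W)"
proof -
  assume "s \<in> {0..L c}"
  then have "X c s \<in> (\<Union>c. arc_of W c)" unfolding arc_of_def by blast
  then have "X c s \<in> frontier (region W)" using region by (simp add: region_ok_def)
  then show ?thesis by (simp add: frontier_def)
qed

text \<open>By continuity the closed parameter domain is mapped into the closed fin, which touches
  the closed region in the corner alone. Reflection is an isometry and the curve is injective, so
  only the parameter \<open>e\<close> reaches the corner.\<close>

lemma fin_meets_curve:
  assumes e: "e \<in> {0, L c}" and u: "u \<in> closure (sheet_dom W c (Some e))" and s: "s \<in> {0..L t}"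
    and eq: "X t s = sheet_pt W c (Some e) u"
  shows "u = e" "X t s = X c e"
proof -
  have u': "u \<in> {0..L c}" using u closure_sheet_dom by blast
  have "sheet_pt W c (Some e) ` sheet_dom W c (Some e) \<subseteq> fin_of W c e"
    by (auto simp: fin_of_def arc_of_def)
  then have "sheet_pt W c (Some e) ` sheet_dom W c (Some e) \<subseteq> closure (fin_of W c e)"
    using closure_subset by (rule order.trans)
  then have "sheet_pt W c (Some e) ` closure (sheet_dom W c (Some e)) \<subseteq> closure (fin_of W c e)"
    by (rule image_closure_subset[OF continuous_on_subset[OF sheet_pt_cont closure_sheet_dom] closed_closure])
  then have "sheet_pt W c (Some e) u \<in> closure (fin_of W c e) \<inter> closure (region W)"
    using u eq X_in_closure_region[OF s] by auto
  also have "\<dots> = {X c e}" using fins e by (auto simp: fins_ok_def)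
  finally have 1: "sheet_pt W c (Some e) u = X c e" by simp
  then show "X t s = X c e" using eq by simp
  from 1 have "fin_vec W c e (X c u - X c e) = 0" by (simp add: fin_point_def)
  then have "X c u = X c e" using norm_fin_vec[OF e, of "X c u - X c e"] by simp
  then show "u = e" using X_inj[OF u' ends_mem[OF e]] by simp
qed

lemma same_kind_disjoint:
  assumes "same_kind t c" "t \<noteq> c" "s \<in> {0..L t}" "u \<in> {0..L c}"
  shows "X t s \<noteq> X c u"
proof
  assume eq: "X t s = X c u"
  have "X t s \<in> arc_of W t" "X c u \<in> arc_of W c" using assms by (auto simp: arc_of_def)
  then have *: "arc_of W t \<inter> arc_of W c \<noteq> {}" using eq by auto
  have dis: "arc_of W (Star One) \<inter> arc_of W (Star Two) = {}" "arc_of W (Circ One) \<inter> arc_of W (Circ Two) = {}"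
    using arcs by (auto simp: arcs_ok_def)
  obtain i j where "t = Star i \<and> c = Star j \<or> t = Circ i \<and> c = Circ j" "i \<noteq> j"
    using assms(1,2) by (cases t; cases c) auto
  then show False using * dis by (cases i; cases j) (auto simp: Int_commute)
qed

text \<open>A common point is an end of some wall and of some cap. Disjointness of the two walls and
  of the two caps identifies the curves, and injectivity then identifies the parameters.\<close>

lemma star_circ_meet:
  assumes s: "s \<in> {0..L (Star i)}" and u: "u \<in> {0..L (Circ j)}" and eq: "X (Star i) s = X (Circ j) u"
  shows "s \<in> {0, L (Star i)}" "u \<in> {0, L (Circ j)}" "T (Star i) s \<bullet> T (Circ j) u = 0"
proof -
  have c1: "(\<Union>i. arc_of W (Star i)) \<inter> (\<Union>j. arc_of W (Circ j)) = (\<Union>i. ends_of W (Star i))"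
    and c2: "(\<Union>j. ends_of W (Circ j)) = (\<Union>i. ends_of W (Star i))"
    and c3: "\<And>i j s t. s \<in> {0, L (Star i)} \<Longrightarrow> t \<in> {0, L (Circ j)} \<Longrightarrow> X (Star i) s = X (Circ j) t \<Longrightarrow>
        T (Star i) s \<bullet> T (Circ j) t = 0"
    using corners unfolding corners_ok_def by blast+
  have "X (Star i) s \<in> (\<Union>i. arc_of W (Star i)) \<inter> (\<Union>j. arc_of W (Circ j))"
  proof -
    have "X (Star i) s \<in> arc_of W (Star i)" unfolding arc_of_def by (rule imageI[OF s])
    moreover have "X (Star i) s \<in> arc_of W (Circ j)" unfolding arc_of_def by (rule image_eqI[where f = "X (Circ j)", OF eq u])
    ultimately show ?thesis by blast
  qed
  then have "X (Star i) s \<in> (\<Union>i. ends_of W (Star i))" "X (Star i) s \<in> (\<Union>j. ends_of W (Circ j))"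
    using c1 c2 by auto
  then have s_star: "X (Star i) s \<in> (\<Union>i. ends_of W (Star i))" and s_circ: "X (Star i) s \<in> (\<Union>j. ends_of W (Circ j))"
    by auto
  from s_star obtain i' p where p: "p \<in> {0, L (Star i')}" "X (Star i) s = X (Star i') p"
    unfolding ends_of_def by blast
  from s_circ obtain j' q where q: "q \<in> {0, L (Circ j')}" "X (Star i) s = X (Circ j') q"
    unfolding ends_of_def by blast
  have "i' = i" using same_kind_disjoint[of "Star i" "Star i'" s p] s ends_mem[OF p(1)] p(2) by auto
  then have sp: "s = p" using X_inj[OF s] ends_mem[OF p(1)] p(2) by auto
  have "j' = j" using same_kind_disjoint[of "Circ j" "Circ j'" u q] u ends_mem[OF q(1)] q(2) eq by auto
  then have uq: "u = q" using X_inj[OF u] ends_mem[OF q(1)] q(2) eq by auto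
  show "s \<in> {0, L (Star i)}" "u \<in> {0, L (Circ j)}" using p(1) q(1) sp uq \<open>i' = i\<close> \<open>j' = j\<close> by auto
  then show "T (Star i) s \<bullet> T (Circ j) u = 0" using c3 eq by blast
qed

lemma adjacent_meet:
  assumes "\<not> same_kind t c" "s \<in> {0..L t}" "u \<in> {0..L c}" "X t s = X c u"
  shows "s \<in> {0, L t}" "u \<in> {0, L c}" "T t s \<bullet> T c u = 0"
proof -
  have "s \<in> {0, L t} \<and> u \<in> {0, L c} \<and> T t s \<bullet> T c u = 0"
  proof (cases t)
    case (Star i)
    then obtain j where c: "c = Circ j" using assms(1) by (cases c) auto
    show ?thesis using star_circ_meet[OF assms(2-4)[unfolded Star c]] unfolding Star c by blast
  next
    case (Circ j)
    then obtain i where c: "c = Star i" using assms(1) by (cases c) auto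
    show ?thesis
      using star_circ_meet[OF assms(3)[unfolded c] assms(2)[unfolded Circ] assms(4)[unfolded Circ c, symmetric]]
      unfolding Circ c by (simp add: inner_commute)
  qed
  then show "s \<in> {0, L t}" "u \<in> {0, L c}" "T t s \<bullet> T c u = 0" by auto
qed

text \<open>All contacts between a curve and the closed sheets of another reduce to common corners,
  and a fin is touched only at its own end. Away from these the kernels are continuous.\<close>

lemma sheet_meet:
  assumes j: "j \<in> sheets W c" and u: "u \<in> closure (sheet_dom W c j)" and s: "s \<in> {0..L t}"
    and eq: "X t s = sheet_pt W c j u" and tc: "t \<noteq> c"
  shows "\<not> same_kind t c" "s \<in> {0, L t}" "u \<in> {0, L c}" "X t s = X c u" "\<And>e. j = Some e \<Longrightarrow> u = e"
proof -
  have u': "u \<in> {0..L c}" using u closure_sheet_dom by blast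
  have *: "X t s = X c u \<and> (\<forall>e. j = Some e \<longrightarrow> u = e)"
    using j
  proof (rule sheets_cases)
    show ?thesis if "j = None" using eq that by simp
    show ?thesis if "e \<in> {0, L c}" "j = Some e" for e
    proof -
      have 1: "u \<in> closure (sheet_dom W c (Some e))" and 2: "X t s = sheet_pt W c (Some e) u"
        using u eq that by simp_all
      have "u = e" "X t s = X c e" by (rule fin_meets_curve[OF that(1) 1 s 2])+
      then show ?thesis using that(2) by blast
    qed
  qed
  then show meet: "X t s = X c u" and "\<And>e. j = Some e \<Longrightarrow> u = e" by blast+
  show nk: "\<not> same_kind t c" using same_kind_disjoint[OF _ tc s u'] meet by blast
  show "s \<in> {0, L t}" "u \<in> {0, L c}" by (rule adjacent_meet[OF nk s u' meet])+
qed

section \<open>The kernels pulled back to arc length on the source curve\<close>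

definition sheet_ker :: "kind \<Rightarrow> label \<Rightarrow> label \<Rightarrow> real option \<Rightarrow> real \<Rightarrow> real \<Rightarrow> complex" where
  "sheet_ker kind t c j s u =
     ker kind (X t s - sheet_pt W c j u) (N t s) (T t s) (tangent' W t s) (sheet_normal W c j u)"

text \<open>The fins are parametrized by the part of the curve they reflect, so the even or odd
  extension of the density turns into a sign in the kernel. A potential over curve and fins becomes
  an ordinary integral operator on \<open>{0..L c}\<close>.\<close>

definition total_ker :: "kind \<Rightarrow> label \<Rightarrow> label \<Rightarrow> real \<Rightarrow> real \<Rightarrow> complex" where
  "total_ker kind t c s u = (\<Sum>j\<in>sheets W c. sheet_sign c j * (indicator (sheet_dom W c j) u *\<^sub>R sheet_ker kind t c j s u))"

lemma sheet_ker_cont: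
  assumes "\<And>s u. (s, u) \<in> S \<Longrightarrow> s \<in> {0..L t} \<and> u \<in> {0..L c} \<and> X t s \<noteq> sheet_pt W c j u"
  shows "continuous_on S (\<lambda>(s, u). sheet_ker kind t c j s u)"
proof -
  have f: "continuous_on S (\<lambda>z. f (fst z))" if "continuous_on {0..L t} f" for f :: "real \<Rightarrow> complex"
    by (rule continuous_on_compose2[OF that]) (use assms in \<open>auto intro!: continuous_intros\<close>)
  have g: "continuous_on S (\<lambda>z. f (snd z))" if "continuous_on {0..L c} f" for f :: "real \<Rightarrow> complex"
    by (rule continuous_on_compose2[OF that]) (use assms in \<open>auto intro!: continuous_intros\<close>)
  show ?thesis
    unfolding sheet_ker_def case_prod_unfold
    by (intro continuous_on_ker continuous_on_diff f g X_cont T_cont N_cont T'_cont sheet_pt_cont sheet_normal_cont)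
       (use assms in force)
qed

text \<open>If \<open>e\<close> is outside the closed domain, no parameter of the sheet is near it;
  otherwise the kernel is continuous at \<open>(p, e)\<close>. The hypothesis \<open>ns\<close>
  concerns the closure because a fin domain is not closed.\<close>

lemma sheet_ker_local_bound:
  assumes p: "p \<in> {0..L t}" and e: "e \<in> {0..L c}"
    and ns: "e \<in> closure (sheet_dom W c j) \<Longrightarrow> X t p \<noteq> sheet_pt W c j e"
  shows "\<exists>d>0. \<exists>C\<ge>0. \<forall>s\<in>{0..L t}. \<forall>u\<in>sheet_dom W c j. dist (s, u) (p, e) < d \<longrightarrow> cmod (sheet_ker kind t c j s u) \<le> C"
proof (cases "e \<in> closure (sheet_dom W c j)")
  case False
  then obtain d where "0 < d" "ball e d \<subseteq> - closure (sheet_dom W c j)"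
    by (metis Compl_iff closed_closure open_Compl open_contains_ball)
  have "\<not> dist (s, u) (p, e) < d" if "u \<in> sheet_dom W c j" for s u
  proof
    assume "dist (s, u) (p, e) < d"
    then have "u \<in> ball e d" using dist_snd_le[of "(s, u)" "(p, e)"] by (simp add: dist_commute)
    moreover have "u \<in> closure (sheet_dom W c j)" using that closure_subset by blast
    ultimately show False using \<open>ball e d \<subseteq> - closure (sheet_dom W c j)\<close> by blast
  qed
  then show ?thesis using \<open>0 < d\<close> by (intro exI[of _ d] conjI exI[of _ d]) auto
next
  case True
  define S where "S = {(s, u). s \<in> {0..L t} \<and> u \<in> {0..L c} \<and> X t s \<noteq> sheet_pt W c j u}"
  have pe: "(p, e) \<in> S" using p e ns[OF True] by (simp add: S_def)
  let ?g = "\<lambda>z. X t (fst z) - sheet_pt W c j (snd z)"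
  have "continuous_on ({0..L t} \<times> {0..L c}) ?g"
    by (intro continuous_on_diff continuous_on_compose2[OF X_cont] continuous_on_compose2[OF sheet_pt_cont])
       (auto intro!: continuous_intros)
  moreover have "0 < norm (?g (p, e))" using ns[OF True] by simp
  moreover have "(p, e) \<in> {0..L t} \<times> {0..L c}" using p e by simp
  ultimately have "\<exists>d>0. \<forall>z\<in>{0..L t} \<times> {0..L c}. dist z (p, e) < d \<longrightarrow> dist (?g z) (?g (p, e)) < norm (?g (p, e))"
    unfolding continuous_on_iff by blast
  then obtain d1 where d1: "0 < d1" "\<And>z. z \<in> {0..L t} \<times> {0..L c} \<Longrightarrow> dist z (p, e) < d1 \<Longrightarrow> dist (?g z) (?g (p, e)) < norm (?g (p, e))"
    by blast
  let ?k = "\<lambda>z. case z of (s, u) \<Rightarrow> sheet_ker kind t c j s u"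
  have "continuous_on S ?k"
    by (rule sheet_ker_cont) (auto simp: S_def)
  then have "\<exists>d>0. \<forall>z\<in>S. dist z (p, e) < d \<longrightarrow> dist (?k z) (?k (p, e)) < 1"
    using pe zero_less_one unfolding continuous_on_iff by blast
  then obtain d2 where d2: "0 < d2" "\<And>z. z \<in> S \<Longrightarrow> dist z (p, e) < d2 \<Longrightarrow> dist (?k z) (?k (p, e)) < 1"
    by blast
  define C where "C = cmod (sheet_ker kind t c j p e) + 1"
  have "cmod (sheet_ker kind t c j s u) \<le> C"
    if s: "s \<in> {0..L t}" and u: "u \<in> sheet_dom W c j" and d: "dist (s, u) (p, e) < min d1 d2" for s u
  proof -
    have u': "u \<in> {0..L c}" using u sheet_dom_subset by blast
    have "dist (?g (s, u)) (?g (p, e)) < norm (?g (p, e))" using d1(2)[of "(s, u)"] s u' d by simp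
    then have "?g (s, u) \<noteq> 0" by (auto simp: dist_norm norm_minus_commute)
    then have "(s, u) \<in> S" using s u' by (simp add: S_def)
    from d2(2)[OF this] d have "dist (sheet_ker kind t c j s u) (sheet_ker kind t c j p e) < 1" by simp
    then show ?thesis
      using norm_triangle_sub[of "sheet_ker kind t c j s u" "sheet_ker kind t c j p e"] by (simp add: dist_norm C_def)
  qed
  moreover have "0 < min d1 d2" "0 \<le> C" using d1(1) d2(1) by (auto simp: C_def)
  ultimately show ?thesis by blast
qed

text \<open>To first order the target is \<open>(s - p) *\<^sub>R b\<close>, the source
  \<open>(u - e) *\<^sub>R \<tau>\<close> and its fin \<open>- (u - e) *\<^sub>R \<tau>\<close>,
  with orthonormal \<open>b\<close> and \<open>\<tau>\<close>. Orthogonality separates target and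
  source in proportion to the sum of the two distances from the corner; the other estimates say how
  fast the components that vanish to first order decay.\<close>

lemma corner_geometry:
  assumes p: "p \<in> {0, L t}" and e: "e \<in> {0, L c}" and eq: "X t p = X c e" and orth: "T t p \<bullet> T c e = 0"
  obtains K d where "1 \<le> K" "0 < d" "d \<le> 1/8" "d \<le> fin_radius W"
    "\<And>s u. s \<in> {0..L t} \<Longrightarrow> u \<in> {0..L c} \<Longrightarrow> \<bar>s - p\<bar> < d \<Longrightarrow> \<bar>u - e\<bar> < d \<Longrightarrow>
      norm (X t s - X t p) \<le> \<bar>s - p\<bar> \<and> norm (X c u - X c e) \<le> \<bar>u - e\<bar> \<and>
      (\<bar>s - p\<bar> + \<bar>u - e\<bar>) / 4 \<le> norm (X t s - sheet_pt W c None u) \<and>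
      (\<bar>s - p\<bar> + \<bar>u - e\<bar>) / 4 \<le> norm (X t s - sheet_pt W c (Some e) u) \<and>
      \<bar>(X t s - X t p) \<bullet> T c e\<bar> \<le> K * \<bar>s - p\<bar>\<^sup>2 \<and>
      norm (X c u - X c e - ((X c u - X c e) \<bullet> T c e) *\<^sub>R T c e) \<le> K * \<bar>u - e\<bar>\<^sup>2 \<and>
      \<bar>T c e \<bullet> T t s\<bar> \<le> K * \<bar>s - p\<bar> \<and> \<bar>(X t s - X t p) \<bullet> N t s\<bar> \<le> K * \<bar>s - p\<bar>\<^sup>2 \<and>
      \<bar>N t s \<bullet> T t p\<bar> \<le> K * \<bar>s - p\<bar> \<and> norm (tangent' W t s) \<le> K"
proof -
  obtain K1 where K1: "1 \<le> K1" "\<And>s. s \<in> {0..L t} \<Longrightarrow> norm (tangent' W t s) \<le> K1"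
    "\<And>s u. s \<in> {0..L t} \<Longrightarrow> u \<in> {0..L t} \<Longrightarrow> norm (T t s - T t u) \<le> K1 * \<bar>s - u\<bar>"
    "\<And>s u. s \<in> {0..L t} \<Longrightarrow> u \<in> {0..L t} \<Longrightarrow> norm (X t s - X t u) \<le> \<bar>s - u\<bar>"
    "\<And>s u. s \<in> {0..L t} \<Longrightarrow> u \<in> {0..L t} \<Longrightarrow> norm (X t s - X t u - (s - u) *\<^sub>R T t u) \<le> K1 * \<bar>s - u\<bar>\<^sup>2"
    by (rule taylor_constant[of t]) blast
  obtain K2 where K2: "1 \<le> K2" "\<And>s. s \<in> {0..L c} \<Longrightarrow> norm (tangent' W c s) \<le> K2"
    "\<And>s u. s \<in> {0..L c} \<Longrightarrow> u \<in> {0..L c} \<Longrightarrow> norm (T c s - T c u) \<le> K2 * \<bar>s - u\<bar>"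
    "\<And>s u. s \<in> {0..L c} \<Longrightarrow> u \<in> {0..L c} \<Longrightarrow> norm (X c s - X c u) \<le> \<bar>s - u\<bar>"
    "\<And>s u. s \<in> {0..L c} \<Longrightarrow> u \<in> {0..L c} \<Longrightarrow> norm (X c s - X c u - (s - u) *\<^sub>R T c u) \<le> K2 * \<bar>s - u\<bar>\<^sup>2"
    by (rule taylor_constant[of c]) blast
  define K where "K = K1 + K2"
  \<comment> \<open>Two distances below \<open>1 / (8 * K)\<close> have a sum \<open>h\<close> of at
    most \<open>1 / (4 * K)\<close>, which makes the quadratic error \<open>K * h\<^sup>2\<close> at
    most \<open>h / 4\<close>. The fin radius ensures that the fin is present near the
    corner.\<close>
  define d where "d = min (1 / (8 * K)) (fin_radius W)"
  have K: "1 \<le> K" "K1 \<le> K" "K2 \<le> K" using K1(1) K2(1) by (auto simp: K_def)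
  have d: "0 < d" "d \<le> 1 / (8 * K)" "d \<le> fin_radius W" using K(1) fin_radius_pos by (auto simp: d_def)
  have "1 / (8 * K) \<le> 1 / 8" using K(1) by (intro divide_left_mono) auto
  then have d8: "d \<le> 1/8" using d(2) by linarith
  note p' = ends_mem[OF p] and e' = ends_mem[OF e]
  define b \<tau> where "b = T t p" and "\<tau> = T c e"
  have n: "norm b = 1" "norm \<tau> = 1" "b \<bullet> \<tau> = 0" using T_norm p' e' orth by (auto simp: b_def \<tau>_def)
  have KK: "K1 * x \<le> K * x" "K2 * x \<le> K * x" if "0 \<le> x" for x using K that by (auto intro: mult_right_mono)
  show ?thesis
  proof (rule that[OF K(1) d(1) d8 d(3)])
    fix s u assume s: "s \<in> {0..L t}" and u: "u \<in> {0..L c}" and sd: "\<bar>s - p\<bar> < d" and ud: "\<bar>u - e\<bar> < d"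
    define z y where "z = X t s - X t p" and "y = X c u - X c e"
    define \<epsilon>1 \<epsilon>2 where "\<epsilon>1 = z - (s - p) *\<^sub>R b" and "\<epsilon>2 = y - (u - e) *\<^sub>R \<tau>"
    have E1: "norm \<epsilon>1 \<le> K1 * \<bar>s - p\<bar>\<^sup>2" using K1(5)[OF s p'] by (simp add: \<epsilon>1_def z_def b_def)
    have E2: "norm \<epsilon>2 \<le> K2 * \<bar>u - e\<bar>\<^sup>2" using K2(5)[OF u e'] by (simp add: \<epsilon>2_def y_def \<tau>_def)
    let ?h = "\<bar>s - p\<bar> + \<bar>u - e\<bar>"
    have Kh: "K * ?h\<^sup>2 \<le> ?h / 4"
    proof -
      have "?h \<le> 1 / (4 * K)" using sd ud d(2) by simp
      then have "K * ?h \<le> K * (1 / (4 * K))" using K(1) by (intro mult_left_mono) auto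
      then have "K * ?h \<le> 1 / 4" using K(1) by simp
      then have "K * ?h * ?h \<le> 1 / 4 * ?h" by (rule mult_right_mono) simp
      then show ?thesis by (simp add: power2_eq_square mult.assoc)
    qed
    have err: "norm \<epsilon>1 + norm \<epsilon>2 \<le> ?h / 4"
    proof -
      have "norm \<epsilon>1 + norm \<epsilon>2 \<le> K * \<bar>s - p\<bar>\<^sup>2 + K * \<bar>u - e\<bar>\<^sup>2"
        using E1 E2 KK(1)[of "\<bar>s - p\<bar>\<^sup>2"] KK(2)[of "\<bar>u - e\<bar>\<^sup>2"] by simp
      also have "\<dots> = K * (\<bar>s - p\<bar>\<^sup>2 + \<bar>u - e\<bar>\<^sup>2)" by (simp add: distrib_left)
      also have "\<dots> \<le> K * ?h\<^sup>2" using K(1) by (intro mult_left_mono) (auto simp: power2_sum)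
      finally show ?thesis using Kh by simp
    qed
    \<comment> \<open>By Pythagoras the linear part has length at least \<open>?h / 2\<close>; the
      error takes away at most half of that. The sign of \<open>\<sigma>\<close> is left open to
      cover the curve and its fin.\<close>
    have lower: "?h / 4 \<le> norm ((s - p) *\<^sub>R b + \<sigma> *\<^sub>R \<tau> + \<epsilon>)" if \<sigma>: "\<bar>\<sigma>\<bar> = \<bar>u - e\<bar>" and \<epsilon>: "norm \<epsilon> \<le> ?h / 4" for \<sigma> \<epsilon>
    proof -
      have "(norm ((s - p) *\<^sub>R b + \<sigma> *\<^sub>R \<tau>))\<^sup>2 = (s - p)\<^sup>2 + \<sigma>\<^sup>2"
      proof -
        have "b \<bullet> b = 1" "\<tau> \<bullet> \<tau> = 1" using n by (auto simp: dot_square_norm)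
        then show ?thesis using n(3) unfolding power2_norm_eq_inner
          by (simp add: inner_add_left inner_add_right inner_commute[of \<tau> b] power2_eq_square)
      qed
      also have "\<dots> = \<bar>s - p\<bar>\<^sup>2 + \<bar>u - e\<bar>\<^sup>2" using \<sigma> by (metis power2_abs)
      also have "\<dots> \<ge> (?h / 2)\<^sup>2"
      proof -
        have "((a + b) / 2)\<^sup>2 \<le> a\<^sup>2 + b\<^sup>2" for a b :: real
        proof -
          have "((a + b) / 2)\<^sup>2 = a\<^sup>2 + b\<^sup>2 - ((a - b)\<^sup>2 + 2 * a\<^sup>2 + 2 * b\<^sup>2) / 4"
            by (simp add: power2_eq_square field_simps)
          moreover have "0 \<le> (a - b)\<^sup>2 + 2 * a\<^sup>2 + 2 * b\<^sup>2" by (intro add_nonneg_nonneg) auto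
          ultimately show ?thesis by simp
        qed
        then show ?thesis .
      qed
      finally have "?h / 2 \<le> norm ((s - p) *\<^sub>R b + \<sigma> *\<^sub>R \<tau>)" by (rule power2_le_imp_le) simp
      then show ?thesis using norm_diff_ineq[of "(s - p) *\<^sub>R b + \<sigma> *\<^sub>R \<tau>" \<epsilon>] \<epsilon> by simp
    qed
    have R\<tau>: "fin_vec W c e \<tau> = - \<tau>"
      using n(2) by (simp add: fin_vec_def \<tau>_def[symmetric] dot_square_norm scaleR_2)
    have Ry: "fin_vec W c e y = - (u - e) *\<^sub>R \<tau> + fin_vec W c e \<epsilon>2"
    proof -
      have "fin_vec W c e y = fin_vec W c e (\<epsilon>2 - (- (u - e)) *\<^sub>R \<tau>)"
        by (rule arg_cong[where f = "fin_vec W c e"]) (simp add: \<epsilon>2_def algebra_simps)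
      also have "\<dots> = fin_vec W c e \<epsilon>2 - (- (u - e)) *\<^sub>R fin_vec W c e \<tau>"
        unfolding fin_vec_diff by (simp add: fin_vec_def algebra_simps)
      finally show ?thesis unfolding R\<tau> by simp
    qed
    have 1: "?h / 4 \<le> norm (X t s - sheet_pt W c None u)"
    proof -
      have "X t s - sheet_pt W c None u = (s - p) *\<^sub>R b + (- (u - e)) *\<^sub>R \<tau> + (\<epsilon>1 - \<epsilon>2)"
        using eq by (simp add: \<epsilon>1_def \<epsilon>2_def z_def y_def algebra_simps)
      moreover have "?h / 4 \<le> norm ((s - p) *\<^sub>R b + (- (u - e)) *\<^sub>R \<tau> + (\<epsilon>1 - \<epsilon>2))"
        by (rule lower) (use err norm_triangle_ineq4[of \<epsilon>1 \<epsilon>2] in auto)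
      ultimately show ?thesis by simp
    qed
    have 2: "?h / 4 \<le> norm (X t s - sheet_pt W c (Some e) u)"
    proof -
      have "X t s - sheet_pt W c (Some e) u = z - fin_vec W c e y"
        using eq by (simp add: fin_point_def z_def y_def)
      also have "\<dots> = (s - p) *\<^sub>R b + (u - e) *\<^sub>R \<tau> + (\<epsilon>1 - fin_vec W c e \<epsilon>2)"
        unfolding Ry by (simp add: \<epsilon>1_def algebra_simps)
      finally have 3: "X t s - sheet_pt W c (Some e) u = (s - p) *\<^sub>R b + (u - e) *\<^sub>R \<tau> + (\<epsilon>1 - fin_vec W c e \<epsilon>2)" .
      have "?h / 4 \<le> norm ((s - p) *\<^sub>R b + (u - e) *\<^sub>R \<tau> + (\<epsilon>1 - fin_vec W c e \<epsilon>2))"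
        by (rule lower) (use err norm_triangle_ineq4[of \<epsilon>1 "fin_vec W c e \<epsilon>2"] norm_fin_vec[OF e, of \<epsilon>2] in auto)
      then show ?thesis unfolding 3 .
    qed
    have ip: "\<bar>v \<bullet> w\<bar> \<le> norm v" if "norm w = 1" for v w :: complex
      using Cauchy_Schwarz_ineq2[of v w] that by simp
    have 4: "\<bar>z \<bullet> \<tau>\<bar> \<le> K * \<bar>s - p\<bar>\<^sup>2"
    proof -
      have "z \<bullet> \<tau> = \<epsilon>1 \<bullet> \<tau>" using n(3) by (simp add: \<epsilon>1_def inner_diff_left)
      then show ?thesis using ip[OF n(2), of \<epsilon>1] E1 KK(1)[of "\<bar>s - p\<bar>\<^sup>2"] by simp
    qed
    have 5: "norm (y - (y \<bullet> \<tau>) *\<^sub>R \<tau>) \<le> K * \<bar>u - e\<bar>\<^sup>2"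
    proof -
      have "y - (y \<bullet> \<tau>) *\<^sub>R \<tau> = (y \<bullet> b) *\<^sub>R b" by (rule orthonormal_decomposition[OF n])
      moreover have "y \<bullet> b = \<epsilon>2 \<bullet> b" using n(3) by (simp add: \<epsilon>2_def inner_diff_left inner_commute[of \<tau> b])
      ultimately show ?thesis using ip[OF n(1), of \<epsilon>2] E2 KK(2)[of "\<bar>u - e\<bar>\<^sup>2"] n(1) by simp
    qed
    have 6: "\<bar>\<tau> \<bullet> T t s\<bar> \<le> K * \<bar>s - p\<bar>"
    proof -
      have "\<tau> \<bullet> T t s = (T t s - b) \<bullet> \<tau>" using n(3) by (simp add: inner_diff_left inner_commute[of \<tau> "T t s"])
      then show ?thesis using ip[OF n(2), of "T t s - b"] K1(3)[OF s p'] KK(1)[of "\<bar>s - p\<bar>"] by (simp add: b_def)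
    qed
    have 7: "\<bar>z \<bullet> N t s\<bar> \<le> K * \<bar>s - p\<bar>\<^sup>2"
    proof -
      have "z \<bullet> N t s = - ((X t p - X t s - (p - s) *\<^sub>R T t s) \<bullet> N t s)"
        by (simp add: z_def inner_diff_left N_orth)
      then show ?thesis
        using ip[OF N_norm[OF s], of "X t p - X t s - (p - s) *\<^sub>R T t s"] K1(5)[OF p' s] KK(1)[of "\<bar>s - p\<bar>\<^sup>2"]
        by (simp add: abs_minus_commute)
    qed
    have 8: "\<bar>N t s \<bullet> b\<bar> \<le> K * \<bar>s - p\<bar>"
    proof -
      have "N t s \<bullet> b = - ((T t s - b) \<bullet> N t s)" using N_orth[of t s] by (simp add: inner_diff_left inner_commute[of "N t s" b])
      then show ?thesis using ip[OF N_norm[OF s], of "T t s - b"] K1(3)[OF s p'] KK(1)[of "\<bar>s - p\<bar>"] by (simp add: b_def)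
    qed
    have 9: "norm z \<le> \<bar>s - p\<bar>" "norm y \<le> \<bar>u - e\<bar>" "norm (tangent' W t s) \<le> K"
      using K1(4)[OF s p'] K2(4)[OF u e'] K1(2)[OF s] K(2) by (auto simp: z_def y_def)
    show "norm (X t s - X t p) \<le> \<bar>s - p\<bar> \<and> norm (X c u - X c e) \<le> \<bar>u - e\<bar> \<and>
      (\<bar>s - p\<bar> + \<bar>u - e\<bar>) / 4 \<le> norm (X t s - sheet_pt W c None u) \<and>
      (\<bar>s - p\<bar> + \<bar>u - e\<bar>) / 4 \<le> norm (X t s - sheet_pt W c (Some e) u) \<and>
      \<bar>(X t s - X t p) \<bullet> T c e\<bar> \<le> K * \<bar>s - p\<bar>\<^sup>2 \<and>
      norm (X c u - X c e - ((X c u - X c e) \<bullet> T c e) *\<^sub>R T c e) \<le> K * \<bar>u - e\<bar>\<^sup>2 \<and>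
      \<bar>T c e \<bullet> T t s\<bar> \<le> K * \<bar>s - p\<bar> \<and> \<bar>(X t s - X t p) \<bullet> N t s\<bar> \<le> K * \<bar>s - p\<bar>\<^sup>2 \<and>
      \<bar>N t s \<bullet> T t p\<bar> \<le> K * \<bar>s - p\<bar> \<and> norm (tangent' W t s) \<le> K"
      using 1 2 4 5 6 7 8 9 unfolding z_def y_def b_def \<tau>_def by blast
  qed
qed

end

section \<open>Cancellation between an arc and its fin at a corner\<close>

context waveguide_kernels
begin

text \<open>The reflection fixes the line that the target follows to first order, so both sheets lie
  at nearly the same distance. The normal at the target is nearly parallel to \<open>\<tau>\<close>
  and is flipped by the reflection, hence D' changes sign and an even density cancels it. The
  tangent at the target is nearly invariant, hence the second tangential derivative of S keeps its
  sign and an odd density is required.\<close>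

lemma corner_bound:
  assumes tc: "\<not> same_kind t c" and p: "p \<in> {0, L t}" and e: "e \<in> {0, L c}" and eq: "X t p = X c e"
    and kind: "kind \<in> {KS, KSn, KD} \<or> kind = KDn \<and> parity c = 1 \<or> kind = KSss \<and> parity c = - 1"
  shows "\<exists>d>0. \<exists>B\<ge>0. d \<le> fin_radius W \<and> (\<forall>s\<in>{0..L t}. \<forall>u\<in>{0..L c}. \<bar>s - p\<bar> < d \<and> \<bar>u - e\<bar> < d \<and> 0 < \<bar>s - p\<bar> + \<bar>u - e\<bar> \<longrightarrow>
    cmod (sheet_ker kind t c None s u + parity c * sheet_ker kind t c (Some e) s u) \<le> B / (\<bar>s - p\<bar> + \<bar>u - e\<bar>))"
proof -
  note p' = ends_mem[OF p] and e' = ends_mem[OF e]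
  have orth: "T t p \<bullet> T c e = 0" by (rule adjacent_meet(3)[OF tc p' e' eq])
  define b0 \<tau> where "b0 = T t p" and "\<tau> = T c e"
  have n: "norm b0 = 1" "norm \<tau> = 1" "b0 \<bullet> \<tau> = 0" using T_norm p' e' orth by (auto simp: b0_def \<tau>_def)
  obtain K d where K: "1 \<le> K" and d: "0 < d" "d \<le> 1/8" "d \<le> fin_radius W" and geo:
    "\<And>s u. s \<in> {0..L t} \<Longrightarrow> u \<in> {0..L c} \<Longrightarrow> \<bar>s - p\<bar> < d \<Longrightarrow> \<bar>u - e\<bar> < d \<Longrightarrow>
      norm (X t s - X t p) \<le> \<bar>s - p\<bar> \<and> norm (X c u - X c e) \<le> \<bar>u - e\<bar> \<and>
      (\<bar>s - p\<bar> + \<bar>u - e\<bar>) / 4 \<le> norm (X t s - sheet_pt W c None u) \<and>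
      (\<bar>s - p\<bar> + \<bar>u - e\<bar>) / 4 \<le> norm (X t s - sheet_pt W c (Some e) u) \<and>
      \<bar>(X t s - X t p) \<bullet> T c e\<bar> \<le> K * \<bar>s - p\<bar>\<^sup>2 \<and>
      norm (X c u - X c e - ((X c u - X c e) \<bullet> T c e) *\<^sub>R T c e) \<le> K * \<bar>u - e\<bar>\<^sup>2 \<and>
      \<bar>T c e \<bullet> T t s\<bar> \<le> K * \<bar>s - p\<bar> \<and> \<bar>(X t s - X t p) \<bullet> N t s\<bar> \<le> K * \<bar>s - p\<bar>\<^sup>2 \<and>
      \<bar>N t s \<bullet> T t p\<bar> \<le> K * \<bar>s - p\<bar> \<and> norm (tangent' W t s) \<le> K"
    by (rule corner_geometry[OF p e eq orth]) (rule that; assumption)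
  \<comment> \<open>The largest requirement is the variation of \<open>A\<close> for
    \<open>KDn\<close>, namely \<open>4 * (4 + 2) * K\<close> times \<open>h ^ 3\<close>.\<close>
  define M where "M = 24 * K"
  have M: "0 \<le> M" using K by (simp add: M_def)
  obtain B1 where B1: "0 \<le> B1" and inv: "\<And>kind v a b d w h. kind \<in> {KS, KSn, KD} \<Longrightarrow> 0 < h \<Longrightarrow> h \<le> 1 \<Longrightarrow> 1/4 * h \<le> norm v \<Longrightarrow> norm v \<le> 1 \<Longrightarrow>
    norm a \<le> 1 \<Longrightarrow> norm w \<le> 1 \<Longrightarrow> cmod (ker kind v a b d w) \<le> B1 / h"
    by (rule ker_inverse_bound[of "1/4"]) auto
  obtain B2 where B2: "0 \<le> B2" and canc: "\<And>h q q' A A' E E'. 0 < h \<Longrightarrow> q \<in> {1/16 * h\<^sup>2..1} \<Longrightarrow> q' \<in> {1/16 * h\<^sup>2..1} \<Longrightarrow>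
    \<bar>q - q'\<bar> \<le> M * h ^ 3 \<Longrightarrow> \<bar>A\<bar> \<le> M * h\<^sup>2 \<Longrightarrow> \<bar>A - A'\<bar> \<le> M * h ^ 3 \<Longrightarrow> \<bar>E\<bar> \<le> M \<Longrightarrow> \<bar>E - E'\<bar> \<le> M * h \<Longrightarrow>
    cmod ((of_real E * \<phi> 1 q + of_real A * \<phi> 2 q) - (of_real E' * \<phi> 1 q' + of_real A' * \<phi> 2 q')) \<le> B2 / h"
    by (rule corner_cancellation[OF M, of "1/16" 1]) auto
  have "cmod (sheet_ker kind t c None s u + parity c * sheet_ker kind t c (Some e) s u) \<le> (2 * B1 + B2) / (\<bar>s - p\<bar> + \<bar>u - e\<bar>)"
    if s: "s \<in> {0..L t}" and u: "u \<in> {0..L c}" and near: "\<bar>s - p\<bar> < d" "\<bar>u - e\<bar> < d" and h0: "0 < \<bar>s - p\<bar> + \<bar>u - e\<bar>" for s u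
  proof -
    define \<delta> \<eta> h where "\<delta> = \<bar>s - p\<bar>" and "\<eta> = \<bar>u - e\<bar>" and "h = \<delta> + \<eta>"
    have h: "0 < h" "0 \<le> \<delta>" "0 \<le> \<eta>" "\<delta> \<le> h" "\<eta> \<le> h" "h \<le> 1"
      using h0 near d(2) by (auto simp: \<delta>_def \<eta>_def h_def)
    define z y where "z = X t s - X t p" and "y = X c u - X c e"
    define yt where "yt = y \<bullet> \<tau>"
    \<comment> \<open>The fin reverses the \<open>\<tau>\<close>-component \<open>yt\<close> of
      \<open>y\<close>, which is the only difference between the two displacements.\<close>
    define v v' where "v = z - y" and "v' = z - y + (2 * yt) *\<^sub>R \<tau>"
    define a w w' b dd where "a = N t s" and "w = N c u" and "w' = fin_vec W c e w" and "b = T t s" and "dd = tangent' W t s"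
    have v_eq: "X t s - sheet_pt W c None u = v" "X t s - sheet_pt W c (Some e) u = v'"
      using eq by (auto simp: v_def v'_def z_def y_def yt_def fin_point_def fin_vec_def \<tau>_def)
    have ker_eq: "sheet_ker kind t c None s u = ker kind v a b dd w" "sheet_ker kind t c (Some e) s u = ker kind v' a b dd w'" for kind
      unfolding sheet_ker_def v_eq by (simp_all add: a_def b_def dd_def w_def w'_def)
    from geo[OF s u near] have g: "norm z \<le> \<delta>" "norm y \<le> \<eta>" "h / 4 \<le> norm v" "h / 4 \<le> norm v'" "\<bar>z \<bullet> \<tau>\<bar> \<le> K * \<delta>\<^sup>2"
      "norm (y - yt *\<^sub>R \<tau>) \<le> K * \<eta>\<^sup>2" "\<bar>\<tau> \<bullet> b\<bar> \<le> K * \<delta>" "\<bar>z \<bullet> a\<bar> \<le> K * \<delta>\<^sup>2" "\<bar>a \<bullet> b0\<bar> \<le> K * \<delta>" "norm dd \<le> K"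
      unfolding v_eq by (simp_all add: \<delta>_def \<eta>_def h_def z_def y_def yt_def \<tau>_def a_def b_def b0_def dd_def)
    have ip: "\<bar>x \<bullet> x'\<bar> \<le> norm x" if "norm x' = 1" for x x' :: complex
      using Cauchy_Schwarz_ineq2[of x x'] that by simp
    have na: "norm a = 1" "norm b = 1" "norm w = 1" "norm w' = 1"
      using N_norm s u T_norm norm_fin_vec[OF e] by (auto simp: a_def b_def w_def w'_def)
    have \<tau>\<tau>: "\<tau> \<bullet> \<tau> = 1" using n(2) by (simp add: dot_square_norm)
    have yt: "\<bar>yt\<bar> \<le> \<eta>" using ip[OF n(2), of y] g(2) by (simp add: yt_def)
    have nv: "norm v \<le> h" using norm_triangle_ineq4[of z y] g(1,2) by (simp add: v_def h_def)
    have nv': "norm v' \<le> h"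
    proof -
      have "v' = z - fin_vec W c e y" by (simp add: v'_def fin_vec_def yt_def \<tau>_def)
      then show ?thesis using norm_triangle_ineq4[of z "fin_vec W c e y"] g(1,2) norm_fin_vec[OF e, of y] by (simp add: h_def)
    qed
    have \<delta>2: "\<delta>\<^sup>2 \<le> h\<^sup>2" "\<eta>\<^sup>2 \<le> h\<^sup>2" using h by (auto intro: power_mono)
    have Kd: "K * \<delta> \<le> K * h" "K * \<delta>\<^sup>2 \<le> K * h\<^sup>2" "K * \<eta>\<^sup>2 \<le> K * h\<^sup>2"
      using K h(4) \<delta>2 by (auto intro!: mult_left_mono)
    have q: "(norm v)\<^sup>2 \<in> {1/16 * h\<^sup>2..1}" "(norm v')\<^sup>2 \<in> {1/16 * h\<^sup>2..1}"
    proof -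
      have "(h / 4)\<^sup>2 \<le> (norm v)\<^sup>2" "(h / 4)\<^sup>2 \<le> (norm v')\<^sup>2" using g(3,4) h by (auto intro!: power_mono)
      moreover have "(norm v)\<^sup>2 \<le> 1" "(norm v')\<^sup>2 \<le> 1" using nv nv' h by (auto intro!: power_le_one)
      ultimately show "(norm v)\<^sup>2 \<in> {1/16 * h\<^sup>2..1}" "(norm v')\<^sup>2 \<in> {1/16 * h\<^sup>2..1}" by (auto simp: power_divide)
    qed
    have h3: "h ^ 3 = h * h\<^sup>2" by (simp add: power3_eq_cube power2_eq_square)
    have qq: "\<bar>(norm v)\<^sup>2 - (norm v')\<^sup>2\<bar> \<le> M * h ^ 3"
    proof -
      \<comment> \<open>The gain of one order: \<open>z\<close> is orthogonal to
        \<open>\<tau>\<close> up to second order, while \<open>yt\<close> is of first order.\<close>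
      have "(norm v)\<^sup>2 - (norm v')\<^sup>2 = - (4 * yt * (z \<bullet> \<tau>))"
        unfolding power2_norm_eq_inner v_def v'_def
        by (simp add: inner_diff_left inner_diff_right inner_add_left inner_add_right inner_commute \<tau>\<tau> yt_def algebra_simps)
      then have "\<bar>(norm v)\<^sup>2 - (norm v')\<^sup>2\<bar> = 4 * (\<bar>yt\<bar> * \<bar>z \<bullet> \<tau>\<bar>)" by (simp add: abs_mult)
      also have "\<dots> \<le> 4 * (h * (K * h\<^sup>2))"
        using yt h g(5) Kd by (intro mult_left_mono mult_mono) auto
      also have "\<dots> \<le> M * h ^ 3" using K h by (simp add: M_def h3)
      finally show ?thesis .
    qed
    from kind consider "kind \<in> {KS, KSn, KD}" | "kind = KDn" "parity c = 1" | "kind = KSss" "parity c = - 1" by blast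
    then have "cmod (sheet_ker kind t c None s u + parity c * sheet_ker kind t c (Some e) s u) \<le> (2 * B1 + B2) / h"
    proof cases
      case 1
      have "cmod (ker kind v a b dd w) \<le> B1 / h" "cmod (ker kind v' a b dd w') \<le> B1 / h"
        using g(3,4) nv nv' na h by (intro inv[OF 1]; simp)+
      then have "cmod (ker kind v a b dd w + parity c * ker kind v' a b dd w') \<le> B1 / h + B1 / h"
        by (intro order.trans[OF norm_triangle_ineq] add_mono) (simp_all add: norm_mult)
      also have "\<dots> \<le> (2 * B1 + B2) / h" using B2 h by (simp add: add_divide_distrib)
      finally show ?thesis unfolding ker_eq .
    next
      case 2
      define wt where "wt = w \<bullet> \<tau>"
      have w'_eq: "w' = w - (2 * wt) *\<^sub>R \<tau>" by (simp add: w'_def fin_vec_def wt_def \<tau>_def)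
      have wt: "\<bar>wt\<bar> \<le> 1" using ip[OF n(2), of w] na by (simp add: wt_def)
      \<comment> \<open>\<open>A'\<close> and \<open>E'\<close> are taken with the opposite sign, so
        that the even sum of the two kernels appears as a difference of nearly equal terms.\<close>
      define A A' E E' where "A = - 4 * (v \<bullet> a) * (v \<bullet> w)" and "A' = 4 * (v' \<bullet> a) * (v' \<bullet> w')"
        and "E = - 2 * (a \<bullet> w)" and "E' = 2 * (a \<bullet> w')"
      have i: "\<bar>v \<bullet> a\<bar> \<le> h" "\<bar>v \<bullet> w\<bar> \<le> h" "\<bar>v' \<bullet> a\<bar> \<le> h"
        using ip na nv nv' by (meson order.trans)+
      have dw: "\<bar>v \<bullet> w - v' \<bullet> w'\<bar> \<le> 2 * (K * h\<^sup>2)"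
      proof -
        have "v \<bullet> w - v' \<bullet> w' = 2 * (wt * (z \<bullet> \<tau>))"
          unfolding v_def v'_def w'_eq
          by (simp add: inner_diff_left inner_diff_right inner_add_left inner_add_right inner_commute \<tau>\<tau> yt_def wt_def algebra_simps)
        then have "\<bar>v \<bullet> w - v' \<bullet> w'\<bar> = 2 * (\<bar>wt\<bar> * \<bar>z \<bullet> \<tau>\<bar>)" by (simp add: abs_mult)
        also have "\<dots> \<le> 2 * (1 * (K * h\<^sup>2))" using wt g(5) Kd by (intro mult_left_mono mult_mono) auto
        finally show ?thesis by simp
      qed
      have da: "\<bar>v \<bullet> a + v' \<bullet> a\<bar> \<le> 4 * (K * h\<^sup>2)"
      proof -
        \<comment> \<open>In the sum the \<open>\<tau>\<close>-components of \<open>y\<close>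
          cancel. What is left is \<open>z\<close> along its own normal and the deviation of
          \<open>y\<close> from its tangent line, both of second order.\<close>
        have "v \<bullet> a + v' \<bullet> a = 2 * (z \<bullet> a) - 2 * ((y - yt *\<^sub>R \<tau>) \<bullet> a)"
          unfolding v_def v'_def by (simp add: inner_diff_left inner_add_left)
        then show ?thesis using g(6,8) Kd ip[OF na(1), of "y - yt *\<^sub>R \<tau>"] by linarith
      qed
      have hM: "0 \<le> K * h\<^sup>2" using K by simp
      have dA: "\<bar>A - A'\<bar> \<le> M * h ^ 3"
      proof -
        have "A - A' = - (4 * ((v \<bullet> a + v' \<bullet> a) * (v \<bullet> w) - (v' \<bullet> a) * (v \<bullet> w - v' \<bullet> w')))"
          unfolding A_def A'_def by (simp add: algebra_simps)
        then have "\<bar>A - A'\<bar> = 4 * \<bar>(v \<bullet> a + v' \<bullet> a) * (v \<bullet> w) - (v' \<bullet> a) * (v \<bullet> w - v' \<bullet> w')\<bar>"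
          by (simp only: abs_minus_cancel abs_mult[of 4] abs_numeral)
        also have "\<dots> \<le> 4 * (\<bar>v \<bullet> a + v' \<bullet> a\<bar> * \<bar>v \<bullet> w\<bar> + \<bar>v' \<bullet> a\<bar> * \<bar>v \<bullet> w - v' \<bullet> w'\<bar>)"
          by (intro mult_left_mono order.trans[OF abs_triangle_ineq4]) (simp_all add: abs_mult)
        also have "\<dots> \<le> 4 * (4 * (K * h\<^sup>2) * h + h * (2 * (K * h\<^sup>2)))"
          using i dw da h hM by (intro mult_left_mono add_mono mult_mono) auto
        also have "\<dots> = M * h ^ 3" by (simp add: M_def h3 algebra_simps)
        finally show ?thesis .
      qed
      have A: "\<bar>A\<bar> \<le> M * h\<^sup>2"
      proof -
        have "\<bar>A\<bar> = 4 * (\<bar>v \<bullet> a\<bar> * \<bar>v \<bullet> w\<bar>)" by (simp add: A_def abs_mult)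
        also have "\<dots> \<le> 4 * (h * h)" using i h by (intro mult_left_mono mult_mono) auto
        also have "\<dots> \<le> M * h\<^sup>2" unfolding power2_eq_square using K by (intro mult_right_mono) (auto simp: M_def)
        finally show ?thesis .
      qed
      have E: "\<bar>E\<bar> \<le> M" using ip[OF na(3), of a] na(1) K by (simp add: E_def abs_mult M_def)
      have dE: "\<bar>E - E'\<bar> \<le> M * h"
      proof -
        \<comment> \<open>Only the component along \<open>b0\<close> survives, and the target normal
          \<open>a\<close> is orthogonal to \<open>b0\<close> up to first order.\<close>
        have "E - E' = - (4 * ((w - wt *\<^sub>R \<tau>) \<bullet> a))"
          unfolding E_def E'_def w'_eq by (simp add: inner_diff_left inner_diff_right inner_commute algebra_simps)
        also have "w - wt *\<^sub>R \<tau> = (w \<bullet> b0) *\<^sub>R b0" unfolding wt_def by (rule orthonormal_decomposition[OF n])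
        finally have "\<bar>E - E'\<bar> = 4 * (\<bar>w \<bullet> b0\<bar> * \<bar>a \<bullet> b0\<bar>)" by (simp add: abs_mult inner_commute)
        also have "\<dots> \<le> 4 * (1 * (K * h))"
          using ip[OF n(1), of w] na g(9) Kd by (intro mult_left_mono mult_mono) auto
        also have "\<dots> \<le> M * h" using K h by (simp add: M_def)
        finally show ?thesis .
      qed
      have "ker kind v a b dd w + parity c * ker kind v' a b dd w' =
        (of_real E * \<phi> 1 ((norm v)\<^sup>2) + of_real A * \<phi> 2 ((norm v)\<^sup>2)) - (of_real E' * \<phi> 1 ((norm v')\<^sup>2) + of_real A' * \<phi> 2 ((norm v')\<^sup>2))"
        unfolding 2 ker_simps E_def E'_def A_def A'_def by simp
      then show ?thesis
        unfolding ker_eq using canc[OF h(1) q qq A dA E dE] divide_right_mono[of B2 "2 * B1 + B2" h] B1 h by simp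
    next
      case 3
      define A A' E E' where "A = (2 * (v \<bullet> b))\<^sup>2" and "A' = (2 * (v' \<bullet> b))\<^sup>2"
        and "E = 2 * (b \<bullet> b) + 2 * (v \<bullet> dd)" and "E' = 2 * (b \<bullet> b) + 2 * (v' \<bullet> dd)"
      have i: "\<bar>v \<bullet> b\<bar> \<le> h" "\<bar>v' \<bullet> b\<bar> \<le> h"
        using ip na nv nv' by (meson order.trans)+
      have db: "\<bar>v \<bullet> b - v' \<bullet> b\<bar> \<le> 2 * (K * h\<^sup>2)"
      proof -
        \<comment> \<open>The displacements differ along \<open>\<tau>\<close>, to which the target
          tangent \<open>b\<close> is orthogonal up to first order.\<close>
        have "v \<bullet> b - v' \<bullet> b = - (2 * (yt * (\<tau> \<bullet> b)))"
          unfolding v_def v'_def by (simp add: inner_diff_left inner_add_left)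
        then have "\<bar>v \<bullet> b - v' \<bullet> b\<bar> = 2 * (\<bar>yt\<bar> * \<bar>\<tau> \<bullet> b\<bar>)" by (simp add: abs_mult)
        also have "\<dots> \<le> 2 * (h * (K * h))" using yt h g(7) Kd by (intro mult_left_mono mult_mono) auto
        finally show ?thesis by (simp add: power2_eq_square mult_ac)
      qed
      have dA: "\<bar>A - A'\<bar> \<le> M * h ^ 3"
      proof -
        have "A - A' = 4 * ((v \<bullet> b - v' \<bullet> b) * (v \<bullet> b + v' \<bullet> b))"
          unfolding A_def A'_def by (simp add: power2_eq_square algebra_simps)
        then have "\<bar>A - A'\<bar> = 4 * (\<bar>v \<bullet> b - v' \<bullet> b\<bar> * \<bar>v \<bullet> b + v' \<bullet> b\<bar>)" by (simp add: abs_mult)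
        also have "\<dots> \<le> 4 * (2 * (K * h\<^sup>2) * (2 * h))"
          using i db K by (intro mult_left_mono mult_mono) auto
        also have "\<dots> \<le> M * h ^ 3" using K h by (simp add: M_def h3)
        finally show ?thesis .
      qed
      have A: "\<bar>A\<bar> \<le> M * h\<^sup>2"
      proof -
        have "\<bar>A\<bar> = 4 * (\<bar>v \<bullet> b\<bar> * \<bar>v \<bullet> b\<bar>)" by (simp add: A_def power2_eq_square)
        also have "\<dots> \<le> 4 * (h * h)" using i h by (intro mult_left_mono mult_mono) auto
        also have "\<dots> \<le> M * h\<^sup>2" unfolding power2_eq_square using K by (intro mult_right_mono) (auto simp: M_def)
        finally show ?thesis .
      qed
      have E: "\<bar>E\<bar> \<le> M"
      proof -
        have "\<bar>v \<bullet> dd\<bar> \<le> 1 * K"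
        proof (rule order.trans[OF Cauchy_Schwarz_ineq2 mult_mono])
          show "norm v \<le> 1" using nv h by linarith
        qed (use g(10) in auto)
        moreover have "b \<bullet> b = 1" using na by (simp add: dot_square_norm)
        ultimately show ?thesis using K by (simp add: E_def M_def)
      qed
      have dE: "\<bar>E - E'\<bar> \<le> M * h"
      proof -
        have "E - E' = - (4 * (yt * (\<tau> \<bullet> dd)))"
          unfolding E_def E'_def v_def v'_def by (simp add: inner_diff_left inner_add_left)
        then have "\<bar>E - E'\<bar> = 4 * (\<bar>yt\<bar> * \<bar>\<tau> \<bullet> dd\<bar>)" by (simp add: abs_mult)
        also have "\<dots> \<le> 4 * (h * K)"
          using yt h Cauchy_Schwarz_ineq2[of \<tau> dd] n g(10) by (intro mult_left_mono mult_mono) auto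
        also have "\<dots> \<le> M * h" using K h by (simp add: M_def)
        finally show ?thesis .
      qed
      have "ker kind v a b dd w + parity c * ker kind v' a b dd w' =
        (of_real E * \<phi> 1 ((norm v)\<^sup>2) + of_real A * \<phi> 2 ((norm v)\<^sup>2)) - (of_real E' * \<phi> 1 ((norm v')\<^sup>2) + of_real A' * \<phi> 2 ((norm v')\<^sup>2))"
        unfolding 3 ker_simps E_def E'_def A_def A'_def by simp
      then show ?thesis
        unfolding ker_eq using canc[OF h(1) q qq A dA E dE] divide_right_mono[of B2 "2 * B1 + B2" h] B1 h by simp
    qed
    then show ?thesis by (simp add: h_def \<delta>_def \<eta>_def)
  qed
  then show ?thesis using d B1 B2 by (intro exI[of _ d]) (auto intro!: exI[of _ "2 * B1 + B2"])
qed

section \<open>Bounds and measurability of the kernels summed over the sheets\<close>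

lemma sheets_mem: "None \<in> sheets W c" "e \<in> {0, L c} \<Longrightarrow> Some e \<in> sheets W c"
  by (auto simp: sheets_def)

lemma finite_sheets: "finite (sheets W c)"
  by (simp add: sheets_def)

lemma sheets_nonempty: "sheets W c \<noteq> {}"
  by (simp add: sheets_def)

lemma norm_total_ker_le:
  "cmod (total_ker kind t c s u) \<le> (\<Sum>j\<in>sheets W c. cmod (indicator (sheet_dom W c j) u *\<^sub>R sheet_ker kind t c j s u))"
  unfolding total_ker_def by (intro order.trans[OF norm_sum] sum_mono) (simp add: norm_mult)

lemma total_ker_local_bound:
  assumes p: "p \<in> {0..L t}" and e: "e \<in> {0..L c}"
    and ns: "\<And>j. j \<in> sheets W c \<Longrightarrow> e \<in> closure (sheet_dom W c j) \<Longrightarrow> X t p \<noteq> sheet_pt W c j e"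
  shows "\<exists>d>0. \<exists>C\<ge>0. \<forall>s\<in>{0..L t}. \<forall>u\<in>{0..L c}. dist (s, u) (p, e) < d \<longrightarrow> cmod (total_ker kind t c s u) \<le> C"
proof -
  have "\<forall>j. \<exists>d C. j \<in> sheets W c \<longrightarrow> 0 < d \<and> 0 \<le> C \<and>
    (\<forall>s\<in>{0..L t}. \<forall>u\<in>sheet_dom W c j. dist (s, u) (p, e) < d \<longrightarrow> cmod (sheet_ker kind t c j s u) \<le> C)"
    using sheet_ker_local_bound[OF p e ns] by blast
  then obtain d C where dC: "\<And>j. j \<in> sheets W c \<Longrightarrow> 0 < d j" "\<And>j. j \<in> sheets W c \<Longrightarrow> 0 \<le> C j"
    "\<And>j s u. j \<in> sheets W c \<Longrightarrow> s \<in> {0..L t} \<Longrightarrow> u \<in> sheet_dom W c j \<Longrightarrow> dist (s, u) (p, e) < d j \<Longrightarrow> cmod (sheet_ker kind t c j s u) \<le> C j"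
    by metis
  define D where "D = Min (d ` sheets W c)"
  have D: "0 < D" "\<And>j. j \<in> sheets W c \<Longrightarrow> D \<le> d j"
    unfolding D_def using dC(1) finite_sheets sheets_nonempty by (auto simp: Min_gr_iff)
  have "cmod (total_ker kind t c s u) \<le> (\<Sum>j\<in>sheets W c. C j)" if s: "s \<in> {0..L t}" and "u \<in> {0..L c}" and d: "dist (s, u) (p, e) < D" for s u
  proof (rule order.trans[OF norm_total_ker_le sum_mono])
    fix j assume j: "j \<in> sheets W c"
    show "cmod (indicator (sheet_dom W c j) u *\<^sub>R sheet_ker kind t c j s u) \<le> C j"
      using dC(3)[OF j s, of u] dC(2)[OF j] d D(2)[OF j] by (auto simp: indicator_def)
  qed
  moreover have "0 \<le> (\<Sum>j\<in>sheets W c. C j)" by (intro sum_nonneg dC(2))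
  ultimately show ?thesis using D(1) by blast
qed

text \<open>By compactness the bound is local on the closed rectangle. At a common corner the curve
  is paired with the adjacent fin and \<open>corner_bound\<close> applies, while the remote fin is
  locally bounded; elsewhere local boundedness suffices because \<open>hardy\<close> has a positive
  lower bound.\<close>

lemma total_ker_hardy:
  assumes tc: "\<not> same_kind t c"
    and kind: "kind \<in> {KS, KSn, KD} \<or> kind = KDn \<and> parity c = 1 \<or> kind = KSss \<and> parity c = - 1"
  shows "\<exists>C\<ge>0. \<forall>s\<in>{0<..<L t}. \<forall>u\<in>{0<..<L c}. cmod (total_ker kind t c s u) \<le> C * hardy (L t) (L c) s u"
proof -
  have t_neq_c: "t \<noteq> c" using tc by (cases t) auto
  define D where "D = {0<..<L t} \<times> {0<..<L c}"
  have hl: "1 \<le> (L t + L c) * hardy (L t) (L c) (fst w) (snd w)" if "w \<in> D" for w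
    using hardy_lower_bound[of "fst w" "L t" "snd w" "L c"] that L_pos[of t] L_pos[of c]
    by (auto simp: D_def field_simps)
  have h0: "0 \<le> hardy (L t) (L c) (fst w) (snd w)" if "w \<in> D" for w
    using that by (auto simp: D_def intro!: hardy_nonneg)
  have "\<exists>C\<ge>0. \<forall>w\<in>D. cmod (total_ker kind t c (fst w) (snd w)) \<le> C * hardy (L t) (L c) (fst w) (snd w)"
  proof (rule compact_local_bound[of "{0..L t} \<times> {0..L c}"])
    show "compact ({0..L t} \<times> {0..L c})" by (intro compact_Times compact_Icc)
    show "D \<subseteq> {0..L t} \<times> {0..L c}" by (auto simp: D_def)
    fix z assume "z \<in> {0..L t} \<times> {0..L c}"
    then obtain p e where z: "z = (p, e)" and p: "p \<in> {0..L t}" and e: "e \<in> {0..L c}" by auto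
    have dist_le: "\<bar>fst w - p\<bar> \<le> dist w z" "\<bar>snd w - e\<bar> \<le> dist w z" for w
      using dist_fst_le[of w z] dist_snd_le[of w z] by (auto simp: z dist_real_def)
    show "\<exists>d>0. \<exists>C. \<forall>w\<in>D. dist w z < d \<longrightarrow> cmod (total_ker kind t c (fst w) (snd w)) \<le> C * hardy (L t) (L c) (fst w) (snd w)"
    proof (cases "\<forall>j\<in>sheets W c. e \<in> closure (sheet_dom W c j) \<longrightarrow> X t p \<noteq> sheet_pt W c j e")
      case True
      then have ns: "\<And>j. j \<in> sheets W c \<Longrightarrow> e \<in> closure (sheet_dom W c j) \<Longrightarrow> X t p \<noteq> sheet_pt W c j e" by blast
      obtain d C where d: "0 < d" and C: "0 \<le> C"
        and b: "\<And>s u. s \<in> {0..L t} \<Longrightarrow> u \<in> {0..L c} \<Longrightarrow> dist (s, u) (p, e) < d \<Longrightarrow> cmod (total_ker kind t c s u) \<le> C"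
        using total_ker_local_bound[OF p e ns, where kind = kind] by blast
      have "cmod (total_ker kind t c (fst w) (snd w)) \<le> (C * (L t + L c)) * hardy (L t) (L c) (fst w) (snd w)" if w: "w \<in> D" "dist w z < d" for w
        using b[of "fst w" "snd w"] w mult_left_mono[OF hl[OF w(1)] C] by (simp add: D_def z mem_Times_iff mult.assoc)
      then show ?thesis using d by blast
    next
      case False
      then obtain j where j: "j \<in> sheets W c" "e \<in> closure (sheet_dom W c j)" "X t p = sheet_pt W c j e" by blast
      note meet = sheet_meet[OF j(1,2) p j(3) t_neq_c]
      have e3: "L c - e \<in> {0, L c}" using meet(3) by auto
      obtain d B where d: "0 < d" "d \<le> fin_radius W" and B: "0 \<le> B"
        and b: "\<And>s u. s \<in> {0..L t} \<Longrightarrow> u \<in> {0..L c} \<Longrightarrow> \<bar>s - p\<bar> < d \<Longrightarrow> \<bar>u - e\<bar> < d \<Longrightarrow> 0 < \<bar>s - p\<bar> + \<bar>u - e\<bar> \<Longrightarrow>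
          cmod (sheet_ker kind t c None s u + parity c * sheet_ker kind t c (Some e) s u) \<le> B / (\<bar>s - p\<bar> + \<bar>u - e\<bar>)"
        using corner_bound[OF tc meet(2,3,4) kind] by blast
      have "X t p \<noteq> sheet_pt W c (Some (L c - e)) e" if "e \<in> closure (sheet_dom W c (Some (L c - e)))"
      proof
        assume "X t p = sheet_pt W c (Some (L c - e)) e"
        from sheet_meet(5)[OF sheets_mem(2)[OF e3] that p this t_neq_c, of "L c - e"] have "e = L c - e" by simp
        then show False using meet(3) L_pos[of c] by auto
      qed
      from sheet_ker_local_bound[OF p e this, where kind = kind]
      obtain d3 C3 where d3: "0 < d3" and C3: "0 \<le> C3"
        and b3: "\<And>s u. s \<in> {0..L t} \<Longrightarrow> u \<in> sheet_dom W c (Some (L c - e)) \<Longrightarrow> dist (s, u) (p, e) < d3 \<Longrightarrow> cmod (sheet_ker kind t c (Some (L c - e)) s u) \<le> C3"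
        by blast
      have "cmod (total_ker kind t c (fst w) (snd w)) \<le> (B + C3 * (L t + L c)) * hardy (L t) (L c) (fst w) (snd w)"
        if w: "w \<in> D" "dist w z < min d d3" for w
      proof -
        obtain s u where wsu: "w = (s, u)" by (cases w)
        have su: "s \<in> {0<..<L t}" "u \<in> {0<..<L c}" using w(1) by (auto simp: D_def wsu)
        then have su': "s \<in> {0..L t}" "u \<in> {0..L c}" by auto
        have near: "\<bar>s - p\<bar> < d" "\<bar>u - e\<bar> < d" using dist_le[of w] w(2) by (auto simp: wsu)
        have h: "0 < \<bar>s - p\<bar> + \<bar>u - e\<bar>" using su meet(2) by auto
        \<comment> \<open>\<open>end_dist\<close> measures the distance to the nearer end, so it is
          at most the distance to the corner considered and \<open>hardy\<close> dominates the
          corner bound.\<close>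
        have "end_dist (L t) s \<le> \<bar>s - p\<bar>" "end_dist (L c) u \<le> \<bar>u - e\<bar>" using meet(2,3) su by (auto simp: end_dist_def)
        then have hh: "1 / (\<bar>s - p\<bar> + \<bar>u - e\<bar>) \<le> hardy (L t) (L c) s u"
          unfolding hardy_def using end_dist_pos[OF su(1)] end_dist_pos[OF su(2)] h
          by (intro divide_left_mono mult_pos_pos) auto
        have ind: "u \<in> sheet_dom W c (Some e)" using sheet_dom_near_end[OF meet(3) su'(2)] near d(2) by simp
        have "total_ker kind t c s u = (sheet_ker kind t c None s u + parity c * sheet_ker kind t c (Some e) s u)
           + parity c * (indicator (sheet_dom W c (Some (L c - e))) u *\<^sub>R sheet_ker kind t c (Some (L c - e)) s u)"
          unfolding total_ker_def sum_sheets[OF meet(3)] using su'(2) ind by (simp del: sheet_dom.simps(2))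
        also have "cmod \<dots> \<le> B / (\<bar>s - p\<bar> + \<bar>u - e\<bar>) + C3"
        proof (rule order.trans[OF norm_triangle_ineq], rule add_mono, rule b[OF su' near h])
          show "cmod (parity c * (indicator (sheet_dom W c (Some (L c - e))) u *\<^sub>R sheet_ker kind t c (Some (L c - e)) s u)) \<le> C3"
            using b3[OF su'(1), of u] w(2) C3 by (cases "u \<in> sheet_dom W c (Some (L c - e))") (simp_all add: norm_mult wsu z del: sheet_dom.simps)
        qed
        also have "\<dots> \<le> B * hardy (L t) (L c) s u + C3 * ((L t + L c) * hardy (L t) (L c) s u)"
          using mult_left_mono[OF hh B] mult_left_mono[OF hl[OF w(1)] C3] by (simp add: wsu)
        finally show ?thesis by (simp add: wsu distrib_right mult.assoc)
      qed
      moreover have "0 < min d d3" using d d3 by simp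
      ultimately show ?thesis by blast
    qed
  qed (rule h0)
  then show ?thesis by (auto simp: D_def)
qed

text \<open>Two walls, or two caps, do not touch, not even through the closed fins of one of them,
  so there is no singular point.\<close>

lemma total_ker_bounded:
  assumes "same_kind t c" "t \<noteq> c"
  shows "\<exists>C\<ge>0. \<forall>s\<in>{0..L t}. \<forall>u\<in>{0..L c}. cmod (total_ker kind t c s u) \<le> C"
proof -
  have "\<exists>C\<ge>0. \<forall>w\<in>{0..L t} \<times> {0..L c}. cmod (total_ker kind t c (fst w) (snd w)) \<le> C * 1"
  proof (rule compact_local_bound[of "{0..L t} \<times> {0..L c}"])
    show "compact ({0..L t} \<times> {0..L c})" by (intro compact_Times compact_Icc)
    fix z assume "z \<in> {0..L t} \<times> {0..L c}"
    then obtain p e where z: "z = (p, e)" and p: "p \<in> {0..L t}" and e: "e \<in> {0..L c}" by auto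
    have ns: "X t p \<noteq> sheet_pt W c j e" if "j \<in> sheets W c" "e \<in> closure (sheet_dom W c j)" for j
      using sheet_meet(1)[OF that p _ assms(2)] assms(1) by blast
    obtain d C where d: "0 < d"
      and b: "\<And>s u. s \<in> {0..L t} \<Longrightarrow> u \<in> {0..L c} \<Longrightarrow> dist (s, u) (p, e) < d \<Longrightarrow> cmod (total_ker kind t c s u) \<le> C"
      using total_ker_local_bound[OF p e ns, where kind = kind] by blast
    have "cmod (total_ker kind t c (fst w) (snd w)) \<le> C * 1" if "w \<in> {0..L t} \<times> {0..L c}" "dist w z < d" for w
      using b[of "fst w" "snd w"] that by (auto simp: z)
    then show "\<exists>d>0. \<exists>C. \<forall>w\<in>{0..L t} \<times> {0..L c}. dist w z < d \<longrightarrow> cmod (total_ker kind t c (fst w) (snd w)) \<le> C * 1"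
      using d by blast
  qed auto
  then show ?thesis by auto
qed

lemma interior_disjoint:
  assumes "t \<noteq> c" "s \<in> {0..L t}" "j \<in> sheets W c" "u \<in> closure (sheet_dom W c j)"
    "same_kind t c \<or> s \<in> {0<..<L t} \<or> u \<in> {0<..<L c}"
  shows "X t s \<noteq> sheet_pt W c j u"
  using sheet_meet(1,2,3)[OF assms(3,4,2) _ assms(1)] assms(5) by auto

text \<open>On the open rectangle every sheet kernel is continuous on its domain. Cutting off to it
  removes the corners, at the cost of a null set.\<close>

lemma total_ker_measurable:
  assumes "t \<noteq> c"
  shows "(\<lambda>(s, u). if s \<in> {0<..<L t} \<and> u \<in> {0<..<L c} then total_ker kind t c s u else 0)
    \<in> borel_measurable (interval_measure (L t) \<Otimes>\<^sub>M interval_measure (L c))"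
proof -
  let ?S = "\<lambda>j. {0<..<L t} \<times> ({0<..<L c} \<inter> sheet_dom W c j)"
  have S: "?S j \<in> sets borel" for j
  proof -
    have "?S j \<in> sets (borel \<Otimes>\<^sub>M borel)" using sheet_dom_borel[of c j] by (intro pair_measureI) auto
    then show ?thesis by (simp only: borel_prod)
  qed
  have m: "(\<lambda>z. indicator (?S j) z *\<^sub>R (case z of (s, u) \<Rightarrow> sheet_ker kind t c j s u)) \<in> borel_measurable borel" if j: "j \<in> sheets W c" for j
  proof (rule borel_measurable_continuous_on_indicator[OF S sheet_ker_cont])
    fix s u assume "(s, u) \<in> ?S j"
    then show "s \<in> {0..L t} \<and> u \<in> {0..L c} \<and> X t s \<noteq> sheet_pt W c j u"
      using interior_disjoint[OF assms _ j, of s u] closure_subset[of "sheet_dom W c j"] by auto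
  qed
  have "(\<lambda>z. \<Sum>j\<in>sheets W c. sheet_sign c j * (indicator (?S j) z *\<^sub>R (case z of (s, u) \<Rightarrow> sheet_ker kind t c j s u))) \<in> borel_measurable borel"
    by (intro borel_measurable_sum borel_measurable_times m) auto
  from borel_product_interval_measurable[OF this, of "L t" "L c"]
  show ?thesis
  proof (rule measurable_cong[THEN iffD1, rotated])
    fix z :: "real \<times> real"
    obtain s u where z: "z = (s, u)" by (cases z)
    show "(case z of (s, u) \<Rightarrow> \<Sum>j\<in>sheets W c. sheet_sign c j * (indicator (?S j) (s, u) *\<^sub>R (case (s, u) of (s, u) \<Rightarrow> sheet_ker kind t c j s u))) =
      (case z of (s, u) \<Rightarrow> if s \<in> {0<..<L t} \<and> u \<in> {0<..<L c} then total_ker kind t c s u else 0)"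
      unfolding z total_ker_def by (auto simp: indicator_def intro!: sum.cong sum.neutral simp del: sheet_dom.simps)
  qed
qed

section \<open>Layer potentials as integrals over the parameter interval\<close>

lemma sheet_section_measurable:
  assumes s: "s \<in> {0..L t}" and ns: "\<And>u. u \<in> sheet_dom W c j \<Longrightarrow> u \<noteq> r \<Longrightarrow> X t s \<noteq> sheet_pt W c j u"
  shows "(\<lambda>u. indicator (sheet_dom W c j) u *\<^sub>R sheet_ker kind t c j s u) \<in> borel_measurable (interval_measure (L c))"
proof -
  let ?S = "sheet_dom W c j - {r}"
  have "continuous_on ({s} \<times> ?S) (\<lambda>(s, u). sheet_ker kind t c j s u)"
    by (rule sheet_ker_cont) (use s ns sheet_dom_subset in blast)
  then have "continuous_on ?S (\<lambda>u. (\<lambda>(s, u). sheet_ker kind t c j s u) (s, u))"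
    by (rule continuous_on_compose2) (auto intro!: continuous_intros)
  then have "(\<lambda>u. indicator ?S u *\<^sub>R sheet_ker kind t c j s u) \<in> borel_measurable borel"
    using sheet_dom_borel[of c j] by (intro borel_measurable_continuous_on_indicator) auto
  then have "(\<lambda>u. indicator ?S u *\<^sub>R sheet_ker kind t c j s u) \<in> borel_measurable (interval_measure (L c))"
    by (rule borel_interval_measurable)
  then show ?thesis
    by (rule measurable_discrete_difference[where X = "{r} \<inter> {0..L c}"]) (auto simp: sets_restrict_space indicator_def simp del: sheet_dom.simps)
qed

lemma sheet_section_L2:
  assumes s: "s \<in> {0..L t}" and ns: "\<And>u. u \<in> closure (sheet_dom W c j) \<Longrightarrow> X t s \<noteq> sheet_pt W c j u"
  shows "(\<lambda>u. indicator (sheet_dom W c j) u *\<^sub>R sheet_ker kind t c j s u) \<in> fs_set (L2 (L c))"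
proof -
  let ?B = "closure (sheet_dom W c j)"
  have "continuous_on ({s} \<times> ?B) (\<lambda>(s, u). sheet_ker kind t c j s u)"
    by (rule sheet_ker_cont) (use s ns closure_sheet_dom in blast)
  then have "continuous_on ?B (\<lambda>u. (\<lambda>(s, u). sheet_ker kind t c j s u) (s, u))"
    by (rule continuous_on_compose2) (auto intro!: continuous_intros)
  then have "bounded (sheet_ker kind t c j s ` ?B)"
    using compact_imp_bounded[OF compact_continuous_image[OF _ compact_closure_sheet_dom]] by auto
  then obtain C where C: "\<forall>u\<in>?B. cmod (sheet_ker kind t c j s u) \<le> C" by (auto simp: bounded_iff)
  show ?thesis
  proof (rule L2_bounded(1)[where B = "max C 0"])
    show "(\<lambda>u. indicator (sheet_dom W c j) u *\<^sub>R sheet_ker kind t c j s u) \<in> borel_measurable (interval_measure (L c))"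
      by (rule sheet_section_measurable[OF s]) (use ns closure_subset in blast)
    show "cmod (indicator (sheet_dom W c j) u *\<^sub>R sheet_ker kind t c j s u) \<le> max C 0" for u
      using C closure_subset[of "sheet_dom W c j"] by (auto simp: indicator_def le_max_iff_disj simp del: sheet_dom.simps)
  qed (use L_pos[of c] in auto)
qed

lemma integral_off_finite:
  fixes f g :: "real \<Rightarrow> complex"
  assumes g: "integrable (interval_measure l) g" and S: "finite S" and eq: "\<And>u. u \<in> {0..l} \<Longrightarrow> u \<notin> S \<Longrightarrow> f u = g u"
  shows "(LINT u|interval_measure l. f u) = (LINT u|interval_measure l. g u)"
proof (rule integral_cong_AE)
  show "g \<in> borel_measurable (interval_measure l)" using g by simp
  then show "f \<in> borel_measurable (interval_measure l)"
    by (rule measurable_discrete_difference[where X = "S \<inter> {0..l}"])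
       (use S eq in \<open>auto simp: sets_restrict_space countable_finite\<close>)
  have "AE u in lebesgue. u \<notin> S"
    using S by (intro AE_completion AE_not_in finite_imp_null_set_lborel)
  then have "AE u in interval_measure l. u \<in> {0..l} \<and> u \<notin> S"
    by (subst AE_restrict_space_iff) (auto elim: eventually_mono)
  then show "AE u in interval_measure l. f u = g u" by eventually_elim (use eq in auto)
qed

text \<open>The finite set \<open>S\<close> collects parameters where the target lies on a sheet:
  there the kernels in the definitions take default values, which need not match
  \<open>\<kappa>\<close> and do not affect the integral.\<close>

lemma fin_integral_eq:
  assumes \<kappa>: "\<And>j. j \<in> sheets W c \<Longrightarrow> (\<lambda>u. indicator (sheet_dom W c j) u *\<^sub>R \<kappa> j u) \<in> fs_set (L2 (L c))"
    and eq: "\<And>j u. j \<in> sheets W c \<Longrightarrow> u \<in> sheet_dom W c j \<Longrightarrow> u \<notin> S \<Longrightarrow> K (sheet_pt W c j u) (sheet_normal W c j u) = \<kappa> j u"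
    and S: "finite S" and \<sigma>: "\<sigma> \<in> fs_set (L2 (L c))"
  shows "fin_integral W c K \<sigma> = (LINT u|interval_measure (L c). (\<Sum>j\<in>sheets W c. sheet_sign c j * (indicator (sheet_dom W c j) u *\<^sub>R \<kappa> j u)) * \<sigma> u)"
proof -
  let ?M = "interval_measure (L c)"
  let ?I = "\<lambda>j. LINT u:sheet_dom W c j|lebesgue. K (sheet_pt W c j u) (sheet_normal W c j u) * \<sigma> u"
  have int: "integrable ?M (\<lambda>u. (indicator (sheet_dom W c j) u *\<^sub>R \<kappa> j u) * \<sigma> u)" if "j \<in> sheets W c" for j
    by (rule L2_mult_integrable(1)[OF \<kappa>[OF that] \<sigma>])
  have I: "?I j = (LINT u|?M. (indicator (sheet_dom W c j) u *\<^sub>R \<kappa> j u) * \<sigma> u)" if j: "j \<in> sheets W c" for j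
  proof -
    have "?I j = (LINT u|?M. indicator (sheet_dom W c j) u *\<^sub>R (K (sheet_pt W c j u) (sheet_normal W c j u) * \<sigma> u))"
      using sheet_dom_borel[of c j] sheet_dom_subset[of c j] by (intro set_integral_interval_measure sets_completionI_sets) auto
    also have "\<dots> = (LINT u|?M. (indicator (sheet_dom W c j) u *\<^sub>R \<kappa> j u) * \<sigma> u)"
      by (rule integral_off_finite[OF int[OF j] S]) (use eq[OF j] in \<open>auto simp: indicator_def simp del: sheet_dom.simps\<close>)
    finally show ?thesis .
  qed
  have "fin_integral W c K \<sigma> = ?I None + parity c * (\<Sum>e\<in>{0, L c}. ?I (Some e))"
    by (simp add: fin_integral_def)
  also have "\<dots> = (\<Sum>j\<in>sheets W c. sheet_sign c j * ?I j)"
    unfolding sum_sheets[of 0 c, simplified] using L_pos[of c] by (simp add: distrib_left add.assoc del: sheet_dom.simps sheet_pt.simps sheet_normal.simps)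
  also have "\<dots> = (\<Sum>j\<in>sheets W c. (LINT u|?M. sheet_sign c j * ((indicator (sheet_dom W c j) u *\<^sub>R \<kappa> j u) * \<sigma> u)))"
    by (intro sum.cong refl) (simp only: I integral_mult_right_zero)
  also have "\<dots> = (LINT u|?M. (\<Sum>j\<in>sheets W c. sheet_sign c j * ((indicator (sheet_dom W c j) u *\<^sub>R \<kappa> j u) * \<sigma> u)))"
    by (rule Bochner_Integration.integral_sum[symmetric]) (intro integrable_mult_right int)
  finally show ?thesis by (simp only: sum_distrib_right mult.assoc)
qed

text \<open>As \<open>finite_part\<close> is a definite description, all admissible expansions have
  to be excluded but one. The three functions \<open>1 / \<epsilon>\<close>,
  \<open>ln \<epsilon>\<close> and 1 grow at different rates, which forces \<open>A\<close> and then
  \<open>B\<close> to vanish.\<close>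

lemma finite_part_eventually_const:
  assumes "\<forall>\<^sub>F \<epsilon> in at_right 0. I \<epsilon> = c"
  shows "finite_part I = c"
  unfolding finite_part_def
proof (rule the_equality)
  have "((\<lambda>\<epsilon>. I \<epsilon> - 0 / of_real \<epsilon> - 0 * of_real (ln \<epsilon>)) \<longlongrightarrow> c) (at_right 0)"
    using tendsto_cong[THEN iffD2, OF assms tendsto_const] by simp
  then show "\<exists>A B. ((\<lambda>\<epsilon>. I \<epsilon> - A / of_real \<epsilon> - B * of_real (ln \<epsilon>)) \<longlongrightarrow> c) (at_right 0)" by blast
next
  fix l assume "\<exists>A B. ((\<lambda>\<epsilon>. I \<epsilon> - A / of_real \<epsilon> - B * of_real (ln \<epsilon>)) \<longlongrightarrow> l) (at_right 0)"
  then obtain A B where AB: "((\<lambda>\<epsilon>. I \<epsilon> - A / of_real \<epsilon> - B * of_real (ln \<epsilon>)) \<longlongrightarrow> l) (at_right 0)" by blast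
  have lim: "((\<lambda>\<epsilon>. c - A / of_real \<epsilon> - B * of_real (ln \<epsilon>)) \<longlongrightarrow> l) (at_right 0)"
    by (rule tendsto_cong[THEN iffD1, OF _ AB]) (use assms in eventually_elim, simp)
  have r: "((\<lambda>\<epsilon>. complex_of_real \<epsilon>) \<longlongrightarrow> 0) (at_right 0)"
    using tendsto_of_real[OF tendsto_ident_at, where 'a = complex, of 0 "{0<..}"] by simp
  have rl: "((\<lambda>\<epsilon>. complex_of_real (\<epsilon> * ln \<epsilon>)) \<longlongrightarrow> 0) (at_right 0)"
  proof -
    have "((\<lambda>\<epsilon>::real. \<epsilon> * ln \<epsilon>) \<longlongrightarrow> 0) (at_right 0)" by real_asymp
    from tendsto_of_real[OF this, where 'a = complex] show ?thesis by simp
  qed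
  have pos: "\<forall>\<^sub>F \<epsilon>::real in at_right 0. 0 < \<epsilon> \<and> \<epsilon> < 1"
    by (auto simp: eventually_at_right_field intro: exI[of _ 1])
  \<comment> \<open>Multiplication by \<open>\<epsilon>\<close> isolates \<open>A\<close>, since
    \<open>\<epsilon> * ln \<epsilon>\<close> tends to 0.\<close>
  have "((\<lambda>\<epsilon>. of_real \<epsilon> * (c - A / of_real \<epsilon> - B * of_real (ln \<epsilon>)) - (of_real \<epsilon> * c - B * of_real (\<epsilon> * ln \<epsilon>))) \<longlongrightarrow> 0 * l - (0 * c - B * 0)) (at_right 0)"
    by (intro tendsto_intros lim r rl)
  moreover have "\<forall>\<^sub>F \<epsilon> in at_right 0. of_real \<epsilon> * (c - A / of_real \<epsilon> - B * of_real (ln \<epsilon>)) - (of_real \<epsilon> * c - B * of_real (\<epsilon> * ln \<epsilon>)) = - A"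
    using pos by eventually_elim (simp add: field_simps)
  ultimately have "((\<lambda>_::real. - A) \<longlongrightarrow> 0) (at_right 0)" by (simp add: tendsto_cong)
  then have A: "A = 0" by (simp add: tendsto_const_iff)
  have il: "((\<lambda>\<epsilon>. complex_of_real (1 / ln \<epsilon>)) \<longlongrightarrow> 0) (at_right 0)"
  proof -
    have "((\<lambda>\<epsilon>::real. 1 / ln \<epsilon>) \<longlongrightarrow> 0) (at_right 0)" by real_asymp
    from tendsto_of_real[OF this, where 'a = complex] show ?thesis by simp
  qed
  \<comment> \<open>Division by \<open>ln \<epsilon>\<close> isolates \<open>B\<close> in the same
    way.\<close>
  have "((\<lambda>\<epsilon>. of_real (1 / ln \<epsilon>) * (c - A / of_real \<epsilon> - B * of_real (ln \<epsilon>)) - of_real (1 / ln \<epsilon>) * c) \<longlongrightarrow> 0 * l - 0 * c) (at_right 0)"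
    by (intro tendsto_intros lim il)
  moreover have "\<forall>\<^sub>F \<epsilon> in at_right 0. of_real (1 / ln \<epsilon>) * (c - A / of_real \<epsilon> - B * of_real (ln \<epsilon>)) - of_real (1 / ln \<epsilon>) * c = - B"
    using pos by eventually_elim (simp add: A field_simps)
  ultimately have "((\<lambda>_::real. - B) \<longlongrightarrow> 0) (at_right 0)" by (simp add: tendsto_cong)
  then have B: "B = 0" by (simp add: tendsto_const_iff)
  show "l = c" using lim by (simp add: A B tendsto_const_iff)
qed

text \<open>The target has positive distance from every sheet, so the kernels are bounded along the
  source. For small \<open>\<epsilon>\<close> the truncation in the finite part of D' removes
  nothing, and the finite part is the integral itself.\<close>

lemma potentials_eq:
  assumes tc: "t \<noteq> c" and s: "s \<in> {0..L t}" and ok: "same_kind t c \<or> s \<in> {0<..<L t}" and \<sigma>: "\<sigma> \<in> fs_set (L2 (L c))"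
  shows "SL W t c \<sigma> s = (LINT u|interval_measure (L c). total_ker KS t c s u * \<sigma> u)"
    and "DL W t c \<sigma> s = (LINT u|interval_measure (L c). total_ker KD t c s u * \<sigma> u)"
    and "SL' W t c \<sigma> s = (LINT u|interval_measure (L c). total_ker KSn t c s u * \<sigma> u)"
    and "DL' W t c \<sigma> s = (LINT u|interval_measure (L c). total_ker KDn t c s u * \<sigma> u)"
proof -
  have ns: "X t s \<noteq> sheet_pt W c j u" if "j \<in> sheets W c" "u \<in> closure (sheet_dom W c j)" for j u
    using interior_disjoint[OF tc s that] ok by auto
  have ns': "X t s \<noteq> sheet_pt W c j u" if "j \<in> sheets W c" "u \<in> sheet_dom W c j" for j u
    using ns[OF that(1)] that(2) closure_subset by blast
  note fi = fin_integral_eq[where \<kappa> = "\<lambda>j. sheet_ker kind t c j s" for kind, OF sheet_section_L2[OF s ns] _ finite.emptyI \<sigma>, folded total_ker_def]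
  show "SL W t c \<sigma> s = (LINT u|interval_measure (L c). total_ker KS t c s u * \<sigma> u)"
    unfolding SL_def by (rule fi) (use ns' in \<open>simp_all add: sheet_ker_def ker_simps kernel dist_norm del: sheet_dom.simps sheet_pt.simps sheet_normal.simps\<close>)
  show "DL W t c \<sigma> s = (LINT u|interval_measure (L c). total_ker KD t c s u * \<sigma> u)"
    unfolding DL_def by (rule fi) (use ns' dir_deriv_source in \<open>simp_all add: sheet_ker_def del: sheet_dom.simps sheet_pt.simps sheet_normal.simps\<close>)
  show "SL' W t c \<sigma> s = (LINT u|interval_measure (L c). total_ker KSn t c s u * \<sigma> u)"
    unfolding SL'_def by (rule fi) (use ns' dir_deriv_target in \<open>simp_all add: sheet_ker_def del: sheet_dom.simps sheet_pt.simps sheet_normal.simps\<close>)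
  have "\<exists>\<delta>>0. \<forall>u\<in>sheet_dom W c j. \<delta> \<le> dist (X t s) (sheet_pt W c j u)" if j: "j \<in> sheets W c" for j
  proof -
    have "compact (sheet_pt W c j ` closure (sheet_dom W c j))"
      by (rule compact_continuous_image[OF continuous_on_subset[OF sheet_pt_cont closure_sheet_dom] compact_closure_sheet_dom])
    moreover have "X t s \<notin> sheet_pt W c j ` closure (sheet_dom W c j)" using ns[OF j] by auto
    ultimately obtain \<delta> where "0 < \<delta>" "\<forall>y\<in>sheet_pt W c j ` closure (sheet_dom W c j). \<delta> \<le> dist (X t s) y"
      using separate_point_closed compact_imp_closed by metis
    then show ?thesis using closure_subset[of "sheet_dom W c j"] by blast
  qed
  then obtain \<delta> where \<delta>: "\<And>j. j \<in> sheets W c \<Longrightarrow> 0 < \<delta> j"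
    "\<And>j u. j \<in> sheets W c \<Longrightarrow> u \<in> sheet_dom W c j \<Longrightarrow> \<delta> j \<le> dist (X t s) (sheet_pt W c j u)"
    by metis
  define D where "D = Min (\<delta> ` sheets W c)"
  have D: "0 < D" "\<And>j. j \<in> sheets W c \<Longrightarrow> D \<le> \<delta> j"
    unfolding D_def using \<delta>(1) finite_sheets sheets_nonempty by (auto simp: Min_gr_iff)
  show "DL' W t c \<sigma> s = (LINT u|interval_measure (L c). total_ker KDn t c s u * \<sigma> u)"
    unfolding DL'_def fin_integral_fp_def
  proof (rule finite_part_eventually_const)
    have "\<forall>\<^sub>F \<epsilon> in at_right 0. \<epsilon> < D"
      using D(1) by (auto simp: eventually_at_right_field)
    then show "\<forall>\<^sub>F \<epsilon> in at_right 0. fin_integral W c (\<lambda>y n. if \<epsilon> < dist (X t s) y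
        then dir_deriv (N t s) (\<lambda>x. dir_deriv n (helmholtz_G (wave_number W) x) y) (X t s) else 0) \<sigma> =
      (LINT u|interval_measure (L c). total_ker KDn t c s u * \<sigma> u)"
    proof eventually_elim
      fix \<epsilon> assume \<epsilon>: "\<epsilon> < D"
      have far: "\<epsilon> < dist (X t s) (sheet_pt W c j u)" if "j \<in> sheets W c" "u \<in> sheet_dom W c j" for j u
        using \<epsilon> D(2)[OF that(1)] \<delta>(2)[OF that] by linarith
      show "fin_integral W c (\<lambda>y n. if \<epsilon> < dist (X t s) y
        then dir_deriv (N t s) (\<lambda>x. dir_deriv n (helmholtz_G (wave_number W) x) y) (X t s) else 0) \<sigma> =
        (LINT u|interval_measure (L c). total_ker KDn t c s u * \<sigma> u)"
        by (rule fi) (use ns' far dir_deriv_both in \<open>simp_all add: sheet_ker_def del: sheet_dom.simps sheet_pt.simps sheet_normal.simps\<close>)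
    qed
  qed
qed

end

lemma AE_interval_notin:
  assumes "finite S"
  shows "AE u in interval_measure l. u \<in> {0..l} \<and> u \<notin> S"
proof -
  have "AE u in lebesgue. u \<notin> S"
    using assms by (intro AE_completion AE_not_in finite_imp_null_set_lborel)
  then show ?thesis by (subst AE_restrict_space_iff) (auto elim: eventually_mono)
qed

lemma L2_of_root_bound:
  assumes f: "f \<in> borel_measurable (interval_measure l)"
    and b: "\<And>u. u \<in> {0..l} \<Longrightarrow> u \<noteq> r \<Longrightarrow> cmod (f u) \<le> C / sqrt (sqrt \<bar>u - r\<bar>)"
  shows "f \<in> fs_set (L2 l)"
proof -
  define D where "D = \<bar>l\<bar> + \<bar>r\<bar>"
  let ?g = "\<lambda>u. ennreal (C\<^sup>2) * (ennreal (1 / sqrt \<bar>u - r\<bar>) * indicator {r - D..r + D} u)"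
  have "(\<integral>\<^sup>+u. ennreal (cmod (f u))^2 \<partial>interval_measure l) \<le> (\<integral>\<^sup>+u. ?g u \<partial>interval_measure l)"
  proof (rule nn_integral_mono_AE)
    show "AE u in interval_measure l. ennreal (cmod (f u))^2 \<le> ?g u"
      using AE_interval_notin[OF finite.insertI[OF finite.emptyI], of l r]
    proof eventually_elim
      fix u assume u: "u \<in> {0..l} \<and> u \<notin> {r}"
      then have "(cmod (f u))\<^sup>2 \<le> (C / sqrt (sqrt \<bar>u - r\<bar>))\<^sup>2" using b[of u] by (intro power_mono) auto
      then have "(cmod (f u))\<^sup>2 \<le> C\<^sup>2 * (1 / sqrt \<bar>u - r\<bar>)" by (simp add: power_divide)
      moreover have "u \<in> {r - D..r + D}" using u by (auto simp: D_def)
      ultimately show "ennreal (cmod (f u))^2 \<le> ?g u"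
        by (simp add: ennreal_power ennreal_mult[symmetric] ennreal_leI)
    qed
  qed
  also have "\<dots> = (\<integral>\<^sup>+u. ?g u * indicator {0..l} u \<partial>lborel)"
    by (rule nn_integral_interval_measure) measurable
  also have "\<dots> \<le> (\<integral>\<^sup>+u. ?g u \<partial>lborel)"
    by (rule nn_integral_mono) (simp add: indicator_def)
  also have "\<dots> = ennreal (C\<^sup>2) * (\<integral>\<^sup>+u. ennreal (1 / sqrt \<bar>u - r\<bar>) * indicator {r - D..r + D} u \<partial>lborel)"
    by (rule nn_integral_cmult) measurable
  also have "\<dots> \<le> ennreal (C\<^sup>2) * ennreal (4 * sqrt D)"
    by (intro mult_left_mono nn_integral_inverse_sqrt) (simp_all add: D_def)
  also have "\<dots> = ennreal ((sqrt (C\<^sup>2 * (4 * sqrt D)))\<^sup>2)"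
    by (simp add: ennreal_mult[symmetric] D_def)
  finally show ?thesis by (rule L2_memI_nn(1)[OF f, rotated]) (simp add: D_def)
qed

lemma compact_op_cong:
  assumes X: "seminormed_fs X" and Y: "seminormed_fs Y" and T: "compact_op X Y T"
    and mem: "\<And>f. f \<in> fs_set X \<Longrightarrow> T' f \<in> fs_set Y"
    and eq: "\<And>f. f \<in> fs_set X \<Longrightarrow> fs_eq Y (T' f) (T f)"
  shows "compact_op X Y T'"
proof (rule compact_opI)
  interpret Y: seminormed_fs Y by fact
  show "linear_op X Y T'"
    by (rule linear_op_cong[OF X Y compact_op_linear[OF T] mem eq])
  fix f :: "nat \<Rightarrow> 'a \<Rightarrow> complex" and B
  assume f: "\<And>n. f n \<in> fs_set X" and B: "\<And>n. fs_norm X (f n) \<le> B"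
  obtain r g where r: "strict_mono r" and g: "g \<in> fs_set Y"
    and rg: "(\<lambda>n. fs_norm Y (\<lambda>y. T (f (r n)) y - g y)) \<longlonglongrightarrow> 0"
    by (rule compact_op_subseq[OF T, of f, OF f B])
  have "fs_norm Y (\<lambda>y. T' (f (r n)) y - g y) = fs_norm Y (\<lambda>y. T (f (r n)) y - g y)" for n
  proof (rule Y.eq_norm)
    let ?d = "\<lambda>h y. h y + -1 * g y"
    have "fs_eq Y (?d (T' (f (r n)))) (?d (T (f (r n))))"
      by (intro Y.eq_add eq f mem linear_op_mem[OF compact_op_linear[OF T]] Y.scale_mem g Y.eq_refl)
    then show "fs_eq Y (\<lambda>y. T' (f (r n)) y - g y) (\<lambda>y. T (f (r n)) y - g y)" by simp
  qed (intro Y.diff_mem mem linear_op_mem[OF compact_op_linear[OF T]] f g)+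
  then have "(\<lambda>n. fs_norm Y (\<lambda>y. T' (f (r n)) y - g y)) \<longlonglongrightarrow> 0" using rg by simp
  then show "\<exists>r g. strict_mono r \<and> g \<in> fs_set Y \<and> (\<lambda>n. fs_norm Y (\<lambda>y. T' (f (r n)) y - g y)) \<longlonglongrightarrow> 0"
    using r g by blast
qed

section \<open>The single layer at corner targets\<close>

context waveguide_kernels
begin

lemma log_kernel_bound:
  obtains C where "0 \<le> C" "\<And>v a b d w h. 0 < h \<Longrightarrow> h / 4 \<le> norm v \<Longrightarrow> norm v \<le> R \<Longrightarrow> cmod (ker KS v a b d w) \<le> C / sqrt (sqrt h)"
proof -
  obtain C where C: "0 \<le> C" "\<And>r. r \<in> {0<..R} \<Longrightarrow> cmod (\<phi> 0 (r\<^sup>2)) \<le> C / sqrt (sqrt r)" using log_bound[of R] by blast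
  have "cmod (ker KS v a b d w) \<le> (2 * C) / sqrt (sqrt h)" if h: "0 < h" "h / 4 \<le> norm v" "norm v \<le> R" for v a b d w h
  proof -
    have "sqrt (sqrt h) / 2 \<le> sqrt (sqrt (norm v))"
    proof -
      \<comment> \<open>\<open>h / 4\<close> is weakened to \<open>h / 16\<close> because 16 has the
        exact fourth root 2.\<close>
      have "sqrt (sqrt (h / 16)) \<le> sqrt (sqrt (norm v))" using h by (intro real_sqrt_le_mono) auto
      moreover have "sqrt (sqrt (h / 16)) = sqrt (sqrt h) / 2"
      proof -
        have "sqrt 16 = (4::real)" "sqrt 4 = (2::real)" by (simp_all add: real_sqrt_unique)
        then show ?thesis by (simp add: real_sqrt_divide)
      qed
      ultimately show ?thesis by simp
    qed
    then have "C / sqrt (sqrt (norm v)) \<le> C / (sqrt (sqrt h) / 2)"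
      using C(1) h by (intro divide_left_mono mult_pos_pos) auto
    moreover have "cmod (ker KS v a b d w) \<le> C / sqrt (sqrt (norm v))" using C(2)[of "norm v"] h by (cases "v = 0") (simp_all add: ker_simps)
    ultimately show ?thesis by (simp add: mult.commute)
  qed
  then show ?thesis using that[of "2 * C"] C(1) by auto
qed

lemma sheet_norm_bounded: "\<exists>R. \<forall>s\<in>{0..L t}. \<forall>u\<in>{0..L c}. norm (X t s - sheet_pt W c j u) \<le> R"
proof -
  have "bounded (X t ` {0..L t})" "bounded (sheet_pt W c j ` {0..L c})"
    by (intro compact_imp_bounded compact_continuous_image X_cont sheet_pt_cont compact_Icc)+
  then obtain a b where "\<forall>s\<in>{0..L t}. norm (X t s) \<le> a" "\<forall>u\<in>{0..L c}. norm (sheet_pt W c j u) \<le> b"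
    by (auto simp: bounded_iff)
  then show ?thesis by (intro exI[of _ "a + b"] ballI order.trans[OF norm_triangle_ineq4] add_mono) auto
qed

text \<open>A corner target meets the closed sheet at a single parameter \<open>r\<close>, and there
  the logarithmic kernel is bounded by a negative fourth root of \<open>\<bar>u - r\<bar>\<close>.
  Sections of S therefore stay square integrable at the ends of the target arc, where the
  \<open>H2\<close> criterion evaluates them.\<close>

lemma corner_section_L2:
  assumes tc: "\<not> same_kind t c" and j: "j \<in> sheets W c" and s: "s \<in> {0..L t}"
  shows "(\<lambda>u. indicator (sheet_dom W c j) u *\<^sub>R sheet_ker KS t c j s u) \<in> fs_set (L2 (L c))"
proof (cases "\<exists>e0\<in>closure (sheet_dom W c j). X t s = sheet_pt W c j e0")
  case False
  then show ?thesis by (intro sheet_section_L2 s) blast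
next
  case True
  have t_neq_c: "t \<noteq> c" using tc by (cases t) auto
  from True obtain r where r: "r \<in> closure (sheet_dom W c j)" "X t s = sheet_pt W c j r" by blast
  note meet = sheet_meet[OF j r(1) s r(2) t_neq_c]
  have r': "r \<in> {0..L c}" using r(1) closure_sheet_dom by blast
  have unique: "e = r" if "e \<in> closure (sheet_dom W c j)" "X t s = sheet_pt W c j e" for e
  proof -
    have "X c e = X c r" using sheet_meet(4)[OF j that(1) s that(2) t_neq_c] meet(4) by simp
    moreover have "e \<in> {0..L c}" using that(1) closure_sheet_dom by blast
    ultimately show ?thesis using X_inj r' by blast
  qed
  have jr: "j = None \<or> j = Some r" using meet(5) by (cases j) auto
  have orth: "T t s \<bullet> T c r = 0" by (rule adjacent_meet(3)[OF tc s r' meet(4)])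
  obtain R where R: "\<And>u. u \<in> {0..L c} \<Longrightarrow> norm (X t s - sheet_pt W c j u) \<le> R" using sheet_norm_bounded[of t c j] s by blast
  obtain C0 where C0: "0 \<le> C0" "\<And>v a b d w h. 0 < h \<Longrightarrow> h / 4 \<le> norm v \<Longrightarrow> norm v \<le> R \<Longrightarrow> cmod (ker KS v a b d w) \<le> C0 / sqrt (sqrt h)"
    by (rule log_kernel_bound[of R]) blast
  obtain d where d: "0 < d" and lower: "\<And>u. u \<in> {0..L c} \<Longrightarrow> \<bar>u - r\<bar> < d \<Longrightarrow> \<bar>u - r\<bar> / 4 \<le> norm (X t s - sheet_pt W c j u)"
  proof -
    obtain K d where "0 < d" and geo: "\<And>s' u. s' \<in> {0..L t} \<Longrightarrow> u \<in> {0..L c} \<Longrightarrow> \<bar>s' - s\<bar> < d \<Longrightarrow> \<bar>u - r\<bar> < d \<Longrightarrow>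
      (\<bar>s' - s\<bar> + \<bar>u - r\<bar>) / 4 \<le> norm (X t s' - sheet_pt W c None u) \<and>
      (\<bar>s' - s\<bar> + \<bar>u - r\<bar>) / 4 \<le> norm (X t s' - sheet_pt W c (Some r) u)"
      by (rule corner_geometry[OF meet(2,3,4) orth]) blast
    then show ?thesis using that[of d] geo[OF s] jr by fastforce
  qed
  define D where "D = sheet_dom W c j - {r}"
  have D: "D \<subseteq> {0..L c}" using sheet_dom_subset by (auto simp: D_def)
  have "\<exists>C\<ge>0. \<forall>u\<in>D. cmod (sheet_ker KS t c j s u) \<le> C * (1 / sqrt (sqrt \<bar>u - r\<bar>))"
  proof (rule compact_local_bound[OF compact_Icc D])
    fix e assume e: "e \<in> {0..L c}"
    show "\<exists>d>0. \<exists>C. \<forall>u\<in>D. dist u e < d \<longrightarrow> cmod (sheet_ker KS t c j s u) \<le> C * (1 / sqrt (sqrt \<bar>u - r\<bar>))"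
    proof (cases "e = r")
      case True
      have "cmod (sheet_ker KS t c j s u) \<le> C0 * (1 / sqrt (sqrt \<bar>u - r\<bar>))" if u: "u \<in> D" "dist u e < d" for u
        unfolding sheet_ker_def using C0(2)[of "\<bar>u - r\<bar>" "X t s - sheet_pt W c j u"] lower[of u] R[of u] u D True
        by (auto simp: D_def dist_real_def)
      then show ?thesis using d by blast
    next
      case False
      then have "X t s \<noteq> sheet_pt W c j e" if "e \<in> closure (sheet_dom W c j)" using unique[OF that] by blast
      from sheet_ker_local_bound[OF s e this, where kind = KS] obtain d' C where d': "0 < d'" and C: "0 \<le> C"
        and b: "\<And>u. u \<in> sheet_dom W c j \<Longrightarrow> dist (s, u) (s, e) < d' \<Longrightarrow> cmod (sheet_ker KS t c j s u) \<le> C"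
        using s by blast
      have "cmod (sheet_ker KS t c j s u) \<le> (C * sqrt (sqrt (L c))) * (1 / sqrt (sqrt \<bar>u - r\<bar>))" if u: "u \<in> D" "dist u e < d'" for u
      proof -
        have "0 < sqrt (sqrt \<bar>u - r\<bar>)" using u by (simp add: D_def)
        moreover have "sqrt (sqrt \<bar>u - r\<bar>) \<le> sqrt (sqrt (L c))"
          using u D r' by (intro real_sqrt_le_mono) (auto simp: abs_le_iff subset_iff)
        ultimately have "1 \<le> sqrt (sqrt (L c)) * (1 / sqrt (sqrt \<bar>u - r\<bar>))" by simp
        from mult_left_mono[OF this C] show ?thesis
          using b[of u] u by (simp add: D_def dist_Pair_Pair mult.assoc)
      qed
      then show ?thesis using d' by blast
    qed
  qed auto
  then obtain C where C: "0 \<le> C" "\<And>u. u \<in> D \<Longrightarrow> cmod (sheet_ker KS t c j s u) \<le> C / sqrt (sqrt \<bar>u - r\<bar>)" by auto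
  show ?thesis
  proof (rule L2_of_root_bound)
    show "(\<lambda>u. indicator (sheet_dom W c j) u *\<^sub>R sheet_ker KS t c j s u) \<in> borel_measurable (interval_measure (L c))"
      by (rule sheet_section_measurable[OF s, where r = r]) (use unique closure_subset in blast)
    show "cmod (indicator (sheet_dom W c j) u *\<^sub>R sheet_ker KS t c j s u) \<le> C / sqrt (sqrt \<bar>u - r\<bar>)" if "u \<noteq> r" for u
      using C that by (auto simp: indicator_def D_def simp del: sheet_dom.simps)
  qed
qed

text \<open>The target can lie on a sheet only for \<open>u\<close> at an end of the source, so the
  two ends form the exceptional set of \<open>fin_integral_eq\<close>.\<close>

lemma SL_adjacent_eq:
  assumes tc: "\<not> same_kind t c" and s: "s \<in> {0..L t}" and \<sigma>: "\<sigma> \<in> fs_set (L2 (L c))"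
  shows "SL W t c \<sigma> s = (LINT u|interval_measure (L c). total_ker KS t c s u * \<sigma> u)"
proof -
  have t_neq_c: "t \<noteq> c" using tc by (cases t) auto
  show ?thesis
    unfolding SL_def
  proof (rule fin_integral_eq[where c = c and \<kappa> = "\<lambda>j. sheet_ker KS t c j s" and S = "{0, L c}", folded total_ker_def])
    show "(\<lambda>u. indicator (sheet_dom W c j) u *\<^sub>R sheet_ker KS t c j s u) \<in> fs_set (L2 (L c))" if "j \<in> sheets W c" for j
      by (rule corner_section_L2[OF tc that s])
    fix j u assume j: "j \<in> sheets W c" and u: "u \<in> sheet_dom W c j" "u \<notin> {0, L c}"
    have "u \<in> {0<..<L c}" using u sheet_dom_subset[of c j] by auto
    then have "X t s \<noteq> sheet_pt W c j u"
      using interior_disjoint[OF t_neq_c s j] u(1) closure_subset[of "sheet_dom W c j"] by blast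
    then show "helmholtz_G (wave_number W) (X t s) (sheet_pt W c j u) = sheet_ker KS t c j s u"
      by (simp add: sheet_ker_def ker_simps kernel dist_norm)
  qed (use \<sigma> in auto)
qed

lemma total_ker_L2:
  assumes "\<And>j. j \<in> sheets W c \<Longrightarrow> (\<lambda>u. indicator (sheet_dom W c j) u *\<^sub>R sheet_ker kind t c j s u) \<in> fs_set (L2 (L c))"
  shows "total_ker kind t c s \<in> fs_set (L2 (L c))"
proof -
  have "(\<lambda>u. \<Sum>j\<in>J. sheet_sign c j * (indicator (sheet_dom W c j) u *\<^sub>R sheet_ker kind t c j s u)) \<in> fs_set (L2 (L c))"
    if "finite J" "J \<subseteq> sheets W c" for J
    using that
  proof (induction J)
    case (insert j J)
    then have "(\<lambda>u. sheet_sign c j * (indicator (sheet_dom W c j) u *\<^sub>R sheet_ker kind t c j s u)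
      + (\<Sum>j\<in>J. sheet_sign c j * (indicator (sheet_dom W c j) u *\<^sub>R sheet_ker kind t c j s u))) \<in> fs_set (L2 (L c))"
      by (intro L2.add_mem L2.scale_mem assms) auto
    then show ?case by (simp only: sum.insert[OF insert.hyps])
  qed (simp add: L2.zero_mem)
  from this[OF finite_sheets subset_refl] show ?thesis by (simp add: total_ker_def[abs_def])
qed

section \<open>Boundedness of the potentials between different curves\<close>

lemma interior_hardy_kernel:
  assumes "t \<noteq> c" "\<And>s u. s \<in> {0<..<L t} \<Longrightarrow> u \<in> {0<..<L c} \<Longrightarrow> cmod (total_ker kind t c s u) \<le> C * hardy (L t) (L c) s u" "0 \<le> C"
  shows "hardy_kernel (L t) (L c) (\<lambda>s u. if s \<in> {0<..<L t} \<and> u \<in> {0<..<L c} then total_ker kind t c s u else 0) C"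
proof
  show "cmod (if s \<in> {0<..<L t} \<and> u \<in> {0<..<L c} then total_ker kind t c s u else 0) \<le> C * hardy (L t) (L c) s u"
    if "s \<in> {0<..<L t}" "u \<in> {0..L c}" for s u
    using assms(2)[of s u] assms(3) hardy_nonneg[of s "L t" u "L c"] that by auto
qed (use L_pos total_ker_measurable[OF assms(1)] in auto)

lemma interior_integral_eq:
  assumes s: "s \<in> {0<..<L t}" and f: "integrable (interval_measure (L c)) (\<lambda>u. total_ker kind t c s u * f u)"
  shows "(LINT u|interval_measure (L c). total_ker kind t c s u * f u) =
    (LINT u|interval_measure (L c). (if s \<in> {0<..<L t} \<and> u \<in> {0<..<L c} then total_ker kind t c s u else 0) * f u)"
  by (rule integral_off_finite[OF f, of "{0, L c}", symmetric]) (use s in auto)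

lemma total_ker_bound:
  assumes "t \<noteq> c" "same_kind t c \<or> kind \<in> {KS, KSn, KD} \<or> kind = KDn \<and> parity c = 1 \<or> kind = KSss \<and> parity c = - 1"
  obtains C where "0 \<le> C" "\<And>s u. s \<in> {0<..<L t} \<Longrightarrow> u \<in> {0<..<L c} \<Longrightarrow> cmod (total_ker kind t c s u) \<le> C * hardy (L t) (L c) s u"
proof (cases "same_kind t c")
  case True
  obtain C where C: "0 \<le> C" "\<And>s u. s \<in> {0..L t} \<Longrightarrow> u \<in> {0..L c} \<Longrightarrow> cmod (total_ker kind t c s u) \<le> C"
    using total_ker_bounded[OF True assms(1), where kind = kind] by blast
  show ?thesis
  proof (rule that[of "C * (L t + L c)"])
    show "0 \<le> C * (L t + L c)" using C(1) L_pos[of t] L_pos[of c] by simp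
    fix s u assume s: "s \<in> {0<..<L t}" and u: "u \<in> {0<..<L c}"
    have "1 \<le> (L t + L c) * hardy (L t) (L c) s u"
      using hardy_lower_bound[OF s u] L_pos[of t] L_pos[of c] by (simp add: field_simps)
    from mult_left_mono[OF this C(1)] show "cmod (total_ker kind t c s u) \<le> C * (L t + L c) * hardy (L t) (L c) s u"
      using C(2)[of s u] s u by (simp add: mult.assoc)
  qed
next
  case False
  then show ?thesis using total_ker_hardy[OF False, of kind] assms(2) that by blast
qed

lemma bounded_potential_L2:
  assumes tc: "t \<noteq> c"
    and kind: "same_kind t c \<or> kind \<in> {KS, KSn, KD} \<or> kind = KDn \<and> parity c = 1 \<or> kind = KSss \<and> parity c = - 1"
    and P: "\<And>f s. f \<in> fs_set (L2 (L c)) \<Longrightarrow> s \<in> {0<..<L t} \<Longrightarrow> P f s = (LINT u|interval_measure (L c). total_ker kind t c s u * f u)"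
  shows "bounded_op (L2 (L c)) (L2 (L t)) P"
proof -
  obtain C where C: "0 \<le> C" "\<And>s u. s \<in> {0<..<L t} \<Longrightarrow> u \<in> {0<..<L c} \<Longrightarrow> cmod (total_ker kind t c s u) \<le> C * hardy (L t) (L c) s u"
    by (rule total_ker_bound[OF tc kind]) blast
  interpret hardy_kernel "L t" "L c" "\<lambda>s u. if s \<in> {0<..<L t} \<and> u \<in> {0<..<L c} then total_ker kind t c s u else 0" C
    by (rule interior_hardy_kernel[OF tc C(2,1)])
  show ?thesis
  proof (rule bounded_op_L2)
    fix f s assume f: "f \<in> fs_set (L2 (L c))" and s: "s \<in> {0<..<L t}"
    have "total_ker kind t c s \<in> fs_set (L2 (L c))"
      by (intro total_ker_L2 sheet_section_L2 interior_disjoint[OF tc]) (use s in auto)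
    from interior_integral_eq[OF s L2_mult_integrable(1)[OF this f]]
    show "P f s = (LINT u|interval_measure (L c). (if s \<in> {0<..<L t} \<and> u \<in> {0<..<L c} then total_ker kind t c s u else 0) * f u)"
      by (simp only: P[OF f s])
  qed
qed

text \<open>For interior \<open>u\<close> the whole closed target arc avoids the sheets, so the
  kernel is twice continuously differentiable in \<open>s\<close> up to the ends and
  \<open>taylor_ramp\<close> applies. Its second derivative is of Hardy type; for an adjacent cap as
  source this is where odd parity enters.\<close>

lemma bounded_potential_H2:
  assumes tc: "t \<noteq> c" and kinds: "(kind, kind2) \<in> {(KS, KSss), (KD, KDss)}"
    and kind2: "same_kind t c \<or> kind2 = KSss \<and> parity c = - 1"
    and K: "\<And>s. s \<in> {0..L t} \<Longrightarrow> total_ker kind t c s \<in> fs_set (L2 (L c))"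
    and P: "\<And>f s. f \<in> fs_set (L2 (L c)) \<Longrightarrow> s \<in> {0..L t} \<Longrightarrow> P f s = (LINT u|interval_measure (L c). total_ker kind t c s u * f u)"
  shows "bounded_op (L2 (L c)) (H2 (L t)) P"
proof -
  obtain C where C: "0 \<le> C" "\<And>s u. s \<in> {0<..<L t} \<Longrightarrow> u \<in> {0<..<L c} \<Longrightarrow> cmod (total_ker kind2 t c s u) \<le> C * hardy (L t) (L c) s u"
    by (rule total_ker_bound[OF tc, of kind2]) (use kind2 in blast)+
  interpret hardy_kernel "L t" "L c" "\<lambda>s u. if s \<in> {0<..<L t} \<and> u \<in> {0<..<L c} then total_ker kind2 t c s u else 0" C
    by (rule interior_hardy_kernel[OF tc C(2,1)])
  define J where "J s u = (LINT r|interval_measure (L t). complex_of_real (max 0 (s - r)) * (if r \<in> {0<..<L t} \<and> u \<in> {0<..<L c} then total_ker kind2 t c r u else 0))" for s u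
  have "\<exists>b. \<forall>s\<in>{0..L t}. total_ker kind t c s u = total_ker kind t c 0 u + of_real s * b
      + (LINT r|interval_measure (L t). complex_of_real (max 0 (s - r)) * (if r \<in> {0<..<L t} \<and> u \<in> {0<..<L c} then total_ker kind2 t c r u else 0))"
    if u: "u \<in> {0<..<L c}" for u
  proof -
    have ns: "X t s \<noteq> sheet_pt W c j u" if "j \<in> sheets W c" "u \<in> sheet_dom W c j" "s \<in> {0..L t}" for j s
      using interior_disjoint[OF tc that(3,1)] that(2) u closure_subset[of "sheet_dom W c j"] by blast
    have "\<exists>K1. \<forall>s\<in>{0..L t}. ((\<lambda>s. indicator (sheet_dom W c j) u *\<^sub>R sheet_ker kind t c j s u) has_vector_derivative K1 s) (at s within {0..L t}) \<and>
        (K1 has_vector_derivative indicator (sheet_dom W c j) u *\<^sub>R sheet_ker kind2 t c j s u) (at s within {0..L t})"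
      if j: "j \<in> sheets W c" for j
    proof (cases "u \<in> sheet_dom W c j")
      case True
      then show ?thesis
        unfolding sheet_ker_def using ker_deriv2[OF X_deriv T_deriv ns[OF j True] kinds, where a = "N t" and w = "sheet_normal W c j u"] by simp
    qed (auto intro: exI[of _ "\<lambda>_. 0"])
    then obtain K1 where K1: "\<And>j s. j \<in> sheets W c \<Longrightarrow> s \<in> {0..L t} \<Longrightarrow> ((\<lambda>s. indicator (sheet_dom W c j) u *\<^sub>R sheet_ker kind t c j s u) has_vector_derivative K1 j s) (at s within {0..L t})"
      "\<And>j s. j \<in> sheets W c \<Longrightarrow> s \<in> {0..L t} \<Longrightarrow> (K1 j has_vector_derivative indicator (sheet_dom W c j) u *\<^sub>R sheet_ker kind2 t c j s u) (at s within {0..L t})"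
      by metis
    define F1 where "F1 s = (\<Sum>j\<in>sheets W c. sheet_sign c j * K1 j s)" for s
    have d1: "((\<lambda>s. total_ker kind t c s u) has_vector_derivative F1 s) (at s within {0..L t})" if "s \<in> {0..L t}" for s
      unfolding total_ker_def F1_def by (intro has_vector_derivative_sum has_vector_derivative_mult_right K1 that)
    have d2: "(F1 has_vector_derivative total_ker kind2 t c s u) (at s within {0..L t})" if "s \<in> {0..L t}" for s
      unfolding total_ker_def F1_def[abs_def] by (intro has_vector_derivative_sum has_vector_derivative_mult_right K1 that)
    have cont: "continuous_on {0..L t} (\<lambda>s. total_ker kind2 t c s u)"
    proof -
      have "continuous_on {0..L t} (\<lambda>s. indicator (sheet_dom W c j) u *\<^sub>R sheet_ker kind2 t c j s u)" if j: "j \<in> sheets W c" for j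
      proof (cases "u \<in> sheet_dom W c j")
        case True
        have "continuous_on ({0..L t} \<times> {u}) (\<lambda>(s, u). sheet_ker kind2 t c j s u)"
          by (rule sheet_ker_cont) (use ns[OF j True] u in auto)
        then have "continuous_on {0..L t} (\<lambda>s. (\<lambda>(s, u). sheet_ker kind2 t c j s u) (s, u))"
          by (rule continuous_on_compose2) (auto intro!: continuous_intros)
        then show ?thesis using True by simp
      qed simp
      then show ?thesis unfolding total_ker_def by (intro continuous_on_sum continuous_on_mult_left)
    qed
    show ?thesis
    proof (intro exI[of _ "F1 0"] ballI)
      fix s assume s: "s \<in> {0..L t}"
      have int: "integrable (interval_measure (L t)) (\<lambda>r. complex_of_real (max 0 (s - r)) * total_ker kind2 t c r u)"
        using L_pos[of t] by (intro L2_integrable L2_continuous continuous_intros cont) auto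
      have "(LINT r|interval_measure (L t). complex_of_real (max 0 (s - r)) * (if r \<in> {0<..<L t} \<and> u \<in> {0<..<L c} then total_ker kind2 t c r u else 0)) =
        (LINT r|interval_measure (L t). complex_of_real (max 0 (s - r)) * total_ker kind2 t c r u)"
        by (rule integral_off_finite[OF int, of "{0, L t}"]) (use u in auto)
      then show "total_ker kind t c s u = total_ker kind t c 0 u + of_real s * F1 0
        + (LINT r|interval_measure (L t). complex_of_real (max 0 (s - r)) * (if r \<in> {0<..<L t} \<and> u \<in> {0<..<L c} then total_ker kind2 t c r u else 0))"
        using taylor_ramp[OF d1 d2 cont s] by simp
    qed
  qed
  then have "\<forall>u\<in>{0<..<L c}. \<exists>b. \<forall>s\<in>{0..L t}. total_ker kind t c s u = total_ker kind t c 0 u + of_real s * b + J s u"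
    unfolding J_def by (intro ballI)
  \<comment> \<open>The slopes are gathered by choice, without any regularity in \<open>u\<close>,
    which is all that \<open>bounded_op_H2\<close> asks of them.\<close>
  then have "\<exists>b. \<forall>u\<in>{0<..<L c}. \<forall>s\<in>{0..L t}. total_ker kind t c s u = total_ker kind t c 0 u + of_real s * b u + J s u"
    by (rule bchoice)
  then obtain b where b: "\<forall>u\<in>{0<..<L c}. \<forall>s\<in>{0..L t}. total_ker kind t c s u = total_ker kind t c 0 u + of_real s * b u + J s u"
    by (rule exE)
  show ?thesis
  proof (rule bounded_op_H2[where K = "total_ker kind t c" and b = b and \<gamma> = 0])
    fix s u assume "s \<in> {0..L t}" "u \<in> {0<..<L c}"
    from b[rule_format, OF this(2,1)] show "total_ker kind t c s u = total_ker kind t c 0 u + of_real s * b u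
      + (LINT r|interval_measure (L t). complex_of_real (max 0 (s - r)) * (if r \<in> {0<..<L t} \<and> u \<in> {0<..<L c} then total_ker kind2 t c r u else 0))
      + 0 * complex_of_real (max 0 (s - u))"
      by (simp only: J_def mult_zero_left add_0_right)
  qed (fact K P | simp)+
qed

text \<open>These bounds make the kernels of \<open>S\<close> and \<open>S'\<close> weakly singular on a curve with its fins.\<close>

lemma diagonal_geometry:
  assumes j: "j \<in> sheets W c" and p: "p \<in> {0..L c}" and e: "e \<in> closure (sheet_dom W c j)" and eq: "X c p = sheet_pt W c j e"
  shows "p = e"
    and "\<exists>d>0. \<exists>K. \<forall>s\<in>{0..L c}. \<forall>u\<in>{0..L c}. \<bar>s - p\<bar> < d \<and> \<bar>u - e\<bar> < d \<longrightarrow> (\<exists>h\<ge>\<bar>s - u\<bar>.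
      h / 4 \<le> norm (X c s - sheet_pt W c j u) \<and> \<bar>(X c s - sheet_pt W c j u) \<bullet> N c s\<bar> \<le> K * h\<^sup>2)"
proof -
  obtain K where K: "1 \<le> K"
    "\<And>s u. s \<in> {0..L c} \<Longrightarrow> u \<in> {0..L c} \<Longrightarrow> norm (T c s - T c u) \<le> K * \<bar>s - u\<bar>"
    "\<And>s u. s \<in> {0..L c} \<Longrightarrow> u \<in> {0..L c} \<Longrightarrow> norm (X c s - X c u - (s - u) *\<^sub>R T c u) \<le> K * \<bar>s - u\<bar>\<^sup>2"
    by (rule taylor_constant[of c]) blast
  define d where "d = 1 / (8 * K)"
  have d: "0 < d" using K(1) by (simp add: d_def)
  have Kh: "K * h\<^sup>2 \<le> h / 4" if "0 \<le> h" "h < 2 * d" for h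
  proof -
    have "K * h \<le> K * (1 / (4 * K))" using that(2) K(1) by (intro mult_left_mono) (auto simp: d_def)
    then have "K * h \<le> 1 / 4" using K(1) by simp
    then have "K * h * h \<le> 1 / 4 * h" by (rule mult_right_mono) fact
    then show ?thesis by (simp add: power2_eq_square mult.assoc)
  qed
  have ip: "\<bar>x \<bullet> N c s\<bar> \<le> norm x" if "s \<in> {0..L c}" for x s
    using Cauchy_Schwarz_ineq2[of x "N c s"] N_norm[OF that] by simp
  have zN: "\<bar>(X c s - X c u) \<bullet> N c s\<bar> \<le> K * \<bar>s - u\<bar>\<^sup>2" if s: "s \<in> {0..L c}" and u: "u \<in> {0..L c}" for s u
  proof -
    have "(X c s - X c u) \<bullet> N c s = - ((X c u - X c s - (u - s) *\<^sub>R T c s) \<bullet> N c s)"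
      by (simp add: inner_diff_left N_orth)
    then show ?thesis using ip[OF s, of "X c u - X c s - (u - s) *\<^sub>R T c s"] K(3)[OF u s] by (simp add: abs_minus_commute)
  qed
  have e': "e \<in> {0..L c}" using e closure_sheet_dom by blast
  from j have "p = e \<and> (\<exists>d>0. \<exists>K. \<forall>s\<in>{0..L c}. \<forall>u\<in>{0..L c}. \<bar>s - p\<bar> < d \<and> \<bar>u - e\<bar> < d \<longrightarrow> (\<exists>h\<ge>\<bar>s - u\<bar>.
      h / 4 \<le> norm (X c s - sheet_pt W c j u) \<and> \<bar>(X c s - sheet_pt W c j u) \<bullet> N c s\<bar> \<le> K * h\<^sup>2))"
  proof (rule sheets_cases)
    assume jN: "j = None"
    have pe: "p = e" using X_inj[OF p e'] eq jN by simp
    have "\<exists>h\<ge>\<bar>s - u\<bar>. h / 4 \<le> norm (X c s - sheet_pt W c j u) \<and> \<bar>(X c s - sheet_pt W c j u) \<bullet> N c s\<bar> \<le> K * h\<^sup>2"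
      if s: "s \<in> {0..L c}" and u: "u \<in> {0..L c}" and near: "\<bar>s - p\<bar> < d \<and> \<bar>u - e\<bar> < d" for s u
    proof (intro exI[of _ "\<bar>s - u\<bar>"] conjI)
      have "\<bar>s - u\<bar> < 2 * d" using near pe by auto
      from Kh[OF _ this] have k: "K * \<bar>s - u\<bar>\<^sup>2 \<le> \<bar>s - u\<bar> / 4" by simp
      have "norm ((s - u) *\<^sub>R T c u) = \<bar>s - u\<bar>" using T_norm[OF u] by simp
      then have "\<bar>s - u\<bar> \<le> norm (X c s - X c u) + norm (X c s - X c u - (s - u) *\<^sub>R T c u)"
        using norm_triangle_sub[of "(s - u) *\<^sub>R T c u" "X c s - X c u"] norm_minus_commute[of "(s - u) *\<^sub>R T c u" "X c s - X c u"] by linarith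
      then show "\<bar>s - u\<bar> / 4 \<le> norm (X c s - sheet_pt W c j u)" using K(3)[OF s u] k jN by simp
      show "\<bar>(X c s - sheet_pt W c j u) \<bullet> N c s\<bar> \<le> K * \<bar>s - u\<bar>\<^sup>2" using zN[OF s u] jN by simp
    qed simp
    then show ?thesis using pe d by blast
  next
    fix e0 assume e0: "e0 \<in> {0, L c}" and je: "j = Some e0"
    have cl: "e \<in> closure (sheet_dom W c (Some e0))" and eq': "X c p = sheet_pt W c (Some e0) e" using e eq je by simp_all
    have ee: "e = e0" and "X c p = X c e0" using fin_meets_curve[OF e0 cl p eq'] by auto
    then have pe: "p = e0" using X_inj[OF p ends_mem[OF e0]] by simp
    define \<tau> where "\<tau> = T c e0"
    have n: "norm \<tau> = 1" "\<tau> \<bullet> \<tau> = 1" using T_norm[OF ends_mem[OF e0]] by (auto simp: \<tau>_def dot_square_norm)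
    have "\<exists>h\<ge>\<bar>s - u\<bar>. h / 4 \<le> norm (X c s - sheet_pt W c j u) \<and> \<bar>(X c s - sheet_pt W c j u) \<bullet> N c s\<bar> \<le> (3 * K) * h\<^sup>2"
      if s: "s \<in> {0..L c}" and u: "u \<in> {0..L c}" and near: "\<bar>s - p\<bar> < d \<and> \<bar>u - e\<bar> < d" for s u
    proof -
      \<comment> \<open>Curve and fin continue each other across the corner, so the arc length
        between the two points is the sum of their distances from it, not
        \<open>\<bar>s - u\<bar>\<close>.\<close>
      define \<delta> \<eta> h where "\<delta> = \<bar>s - e0\<bar>" and "\<eta> = \<bar>u - e0\<bar>" and "h = \<delta> + \<eta>"
      have h: "0 \<le> \<delta>" "0 \<le> \<eta>" "0 \<le> h" "h < 2 * d" using near pe ee by (auto simp: \<delta>_def \<eta>_def h_def)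
      \<comment> \<open>At an end of the interval \<open>s - e0\<close> and \<open>u - e0\<close>
        have the same sign, so their absolute values add up.\<close>
      have same: "\<bar>(s - e0) + (u - e0)\<bar> = h" using e0 s u by (auto simp: h_def \<delta>_def \<eta>_def)
      define \<epsilon>1 \<epsilon>2 where "\<epsilon>1 = X c s - X c e0 - (s - e0) *\<^sub>R \<tau>" and "\<epsilon>2 = X c u - X c e0 - (u - e0) *\<^sub>R \<tau>"
      have E: "norm \<epsilon>1 \<le> K * \<delta>\<^sup>2" "norm (fin_vec W c e0 \<epsilon>2) \<le> K * \<eta>\<^sup>2"
        using K(3)[OF s ends_mem[OF e0]] K(3)[OF u ends_mem[OF e0]] norm_fin_vec[OF e0, of \<epsilon>2]
        by (auto simp: \<epsilon>1_def \<epsilon>2_def \<tau>_def \<delta>_def \<eta>_def)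
      have R\<tau>: "fin_vec W c e0 ((u - e0) *\<^sub>R \<tau>) = - ((u - e0) *\<^sub>R \<tau>)"
        using n(2) by (simp add: fin_vec_def flip: \<tau>_def) (simp add: scaleR_conv_of_real algebra_simps)
      have Ry: "fin_vec W c e0 (X c u - X c e0) = - ((u - e0) *\<^sub>R \<tau>) + fin_vec W c e0 \<epsilon>2"
        unfolding \<epsilon>2_def fin_vec_diff[of c e0 "X c u - X c e0"] R\<tau> by simp
      have v: "X c s - sheet_pt W c j u = ((s - e0) + (u - e0)) *\<^sub>R \<tau> + (\<epsilon>1 - fin_vec W c e0 \<epsilon>2)"
        unfolding je sheet_pt.simps fin_point_def Ry by (simp add: \<epsilon>1_def scaleR_conv_of_real algebra_simps)
      have v2: "X c s - sheet_pt W c j u = (X c s - X c e0) + ((u - e0) *\<^sub>R \<tau> - fin_vec W c e0 \<epsilon>2)"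
        unfolding je sheet_pt.simps fin_point_def Ry by simp
      have sq: "\<delta>\<^sup>2 + \<eta>\<^sup>2 \<le> h\<^sup>2" "\<eta> * \<delta> \<le> h\<^sup>2" "\<delta>\<^sup>2 \<le> h\<^sup>2" "\<eta>\<^sup>2 \<le> h\<^sup>2"
        using h(1,2) by (auto simp: h_def power2_sum)
      show ?thesis
      proof (intro exI[of _ h] conjI)
        show "\<bar>s - u\<bar> \<le> h" by (auto simp: h_def \<delta>_def \<eta>_def)
        have "norm (\<epsilon>1 - fin_vec W c e0 \<epsilon>2) \<le> K * \<delta>\<^sup>2 + K * \<eta>\<^sup>2" using E norm_triangle_ineq4[of \<epsilon>1 "fin_vec W c e0 \<epsilon>2"] by linarith
        also have "\<dots> = K * (\<delta>\<^sup>2 + \<eta>\<^sup>2)" by (simp add: distrib_left)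
        also have "\<dots> \<le> K * h\<^sup>2" using K(1) sq(1) by (intro mult_left_mono) auto
        finally have err: "norm (\<epsilon>1 - fin_vec W c e0 \<epsilon>2) \<le> h / 4" using Kh[OF h(3,4)] by linarith
        have "norm (((s - e0) + (u - e0)) *\<^sub>R \<tau>) = h" using n(1) same by simp
        then show "h / 4 \<le> norm (X c s - sheet_pt W c j u)"
          unfolding v using norm_diff_ineq[of "((s - e0) + (u - e0)) *\<^sub>R \<tau>" "\<epsilon>1 - fin_vec W c e0 \<epsilon>2"] err h(3) by linarith
        \<comment> \<open>The reflected curve shares the tangent line of the curve at the corner;
          this keeps the normal component of the displacement quadratic in \<open>h\<close>, as on a
          single smooth curve.\<close>
        have t: "\<bar>\<tau> \<bullet> N c s\<bar> \<le> K * \<delta>"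
        proof -
          have "\<tau> \<bullet> N c s = - ((T c s - \<tau>) \<bullet> N c s)" by (simp add: inner_diff_left N_orth)
          then show ?thesis using ip[OF s, of "T c s - \<tau>"] K(2)[OF s ends_mem[OF e0]] by (simp add: \<tau>_def \<delta>_def)
        qed
        have "\<bar>(X c s - sheet_pt W c j u) \<bullet> N c s\<bar> \<le> \<bar>(X c s - X c e0) \<bullet> N c s\<bar> + (\<eta> * \<bar>\<tau> \<bullet> N c s\<bar> + norm (fin_vec W c e0 \<epsilon>2))"
        proof -
          have "(X c s - sheet_pt W c j u) \<bullet> N c s = (X c s - X c e0) \<bullet> N c s + ((u - e0) * (\<tau> \<bullet> N c s) - fin_vec W c e0 \<epsilon>2 \<bullet> N c s)"
            unfolding v2 by (simp add: inner_add_left inner_diff_left)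
          moreover have "\<bar>(u - e0) * (\<tau> \<bullet> N c s)\<bar> = \<eta> * \<bar>\<tau> \<bullet> N c s\<bar>" by (simp add: abs_mult \<eta>_def)
          ultimately show ?thesis using ip[OF s, of "fin_vec W c e0 \<epsilon>2"] by linarith
        qed
        also have "\<dots> \<le> K * \<delta>\<^sup>2 + (\<eta> * (K * \<delta>) + K * \<eta>\<^sup>2)"
          using zN[OF s ends_mem[OF e0]] t E(2) h(2) by (intro add_mono mult_left_mono) (auto simp: \<delta>_def)
        also have "\<dots> = K * \<delta>\<^sup>2 + K * (\<eta> * \<delta>) + K * \<eta>\<^sup>2" by simp
        also have "\<dots> \<le> K * h\<^sup>2 + K * h\<^sup>2 + K * h\<^sup>2" using K(1) sq by (intro add_mono mult_left_mono) auto
        finally show "\<bar>(X c s - sheet_pt W c j u) \<bullet> N c s\<bar> \<le> (3 * K) * h\<^sup>2" by simp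
      qed
    qed
    then show ?thesis using pe ee d by blast
  qed
  then show "p = e" "\<exists>d>0. \<exists>K. \<forall>s\<in>{0..L c}. \<forall>u\<in>{0..L c}. \<bar>s - p\<bar> < d \<and> \<bar>u - e\<bar> < d \<longrightarrow> (\<exists>h\<ge>\<bar>s - u\<bar>.
      h / 4 \<le> norm (X c s - sheet_pt W c j u) \<and> \<bar>(X c s - sheet_pt W c j u) \<bullet> N c s\<bar> \<le> K * h\<^sup>2)"
    by blast+
qed

text \<open>In S' the normal component of the displacement is of order \<open>h\<^sup>2\<close> and
  offsets the factor \<open>h powr - 2\<close> in \<open>\<phi> 1\<close>, so that kernel is
  bounded; S is logarithmic. The negative fourth root dominates both.\<close>

lemma weak_singularity:
  assumes tc: "same_kind t c" and j: "j \<in> sheets W c" and kind: "kind \<in> {KS, KSn}"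
  shows "\<exists>C. \<forall>s\<in>{0..L t}. \<forall>u\<in>sheet_dom W c j. s \<noteq> u \<longrightarrow> cmod (sheet_ker kind t c j s u) \<le> C / sqrt (sqrt \<bar>s - u\<bar>)"
proof -
  define D where "D = {(s, u). s \<in> {0..L t} \<and> u \<in> sheet_dom W c j \<and> s \<noteq> u}"
  have D: "D \<subseteq> {0..L t} \<times> {0..L c}" using sheet_dom_subset by (auto simp: D_def)
  define M where "M = L t + L c"
  have g1: "1 \<le> sqrt (sqrt M) * (1 / sqrt (sqrt \<bar>fst w - snd w\<bar>))" if "w \<in> D" for w
  proof -
    have "0 < sqrt (sqrt \<bar>fst w - snd w\<bar>)" using that by (auto simp: D_def)
    moreover have "sqrt (sqrt \<bar>fst w - snd w\<bar>) \<le> sqrt (sqrt M)"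
    proof (intro real_sqrt_le_mono)
      have "w \<in> {0..L t} \<times> {0..L c}" using that D by blast
      then have "0 \<le> fst w" "fst w \<le> L t" "0 \<le> snd w" "snd w \<le> L c" by (auto simp: mem_Times_iff)
      then show "\<bar>fst w - snd w\<bar> \<le> M" unfolding M_def by linarith
    qed
    ultimately show ?thesis by simp
  qed
  have const: "F \<le> (C * sqrt (sqrt M)) * (1 / sqrt (sqrt \<bar>fst w - snd w\<bar>))" if "w \<in> D" "F \<le> C" "0 \<le> C" for w and F C :: real
    using mult_left_mono[OF g1[OF that(1)] that(3)] that(2) by (simp add: mult.assoc)
  obtain R where R: "\<And>s u. s \<in> {0..L t} \<Longrightarrow> u \<in> {0..L c} \<Longrightarrow> norm (X t s - sheet_pt W c j u) \<le> R" using sheet_norm_bounded[of t c j] by blast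
  obtain C0 where C0: "0 \<le> C0" "\<And>v a b d w h. 0 < h \<Longrightarrow> h / 4 \<le> norm v \<Longrightarrow> norm v \<le> R \<Longrightarrow> cmod (ker KS v a b d w) \<le> C0 / sqrt (sqrt h)"
    by (rule log_kernel_bound[of R]) blast
  obtain C1 where C1: "0 \<le> C1" "\<And>q. q \<in> {0<..R\<^sup>2} \<Longrightarrow> cmod (\<phi> 1 q) \<le> C1 / q ^ 1" using deriv_bound[of 1 "R\<^sup>2"] by auto
  have "\<exists>C\<ge>0. \<forall>w\<in>D. cmod (sheet_ker kind t c j (fst w) (snd w)) \<le> C * (1 / sqrt (sqrt \<bar>fst w - snd w\<bar>))"
  proof (rule compact_local_bound[OF _ D])
    show "compact ({0..L t} \<times> {0..L c})" by (intro compact_Times compact_Icc)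
    fix z assume "z \<in> {0..L t} \<times> {0..L c}"
    then obtain p e where z: "z = (p, e)" and p: "p \<in> {0..L t}" and e: "e \<in> {0..L c}" by auto
    show "\<exists>d>0. \<exists>C. \<forall>w\<in>D. dist w z < d \<longrightarrow> cmod (sheet_ker kind t c j (fst w) (snd w)) \<le> C * (1 / sqrt (sqrt \<bar>fst w - snd w\<bar>))"
    proof (cases "e \<in> closure (sheet_dom W c j) \<and> X t p = sheet_pt W c j e")
      case False
      then have "X t p \<noteq> sheet_pt W c j e" if "e \<in> closure (sheet_dom W c j)" using that by blast
      from sheet_ker_local_bound[OF p e this, where kind = kind] obtain d C where d: "0 < d" "0 \<le> C"
        and b: "\<And>s u. s \<in> {0..L t} \<Longrightarrow> u \<in> sheet_dom W c j \<Longrightarrow> dist (s, u) (p, e) < d \<Longrightarrow> cmod (sheet_ker kind t c j s u) \<le> C"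
        by blast
      have "cmod (sheet_ker kind t c j (fst w) (snd w)) \<le> (C * sqrt (sqrt M)) * (1 / sqrt (sqrt \<bar>fst w - snd w\<bar>))" if "w \<in> D" "dist w z < d" for w
        by (rule const[OF that(1) b d(2)]) (use that in \<open>auto simp: D_def z\<close>)
      then show ?thesis using d(1) by blast
    next
      case True
      have t: "t = c" using sheet_meet(1)[OF j _ p] True tc by blast
      obtain d K where d: "0 < d" and K: "\<And>s u. s \<in> {0..L c} \<Longrightarrow> u \<in> {0..L c} \<Longrightarrow> \<bar>s - p\<bar> < d \<Longrightarrow> \<bar>u - e\<bar> < d \<Longrightarrow> \<exists>h\<ge>\<bar>s - u\<bar>.
        h / 4 \<le> norm (X c s - sheet_pt W c j u) \<and> \<bar>(X c s - sheet_pt W c j u) \<bullet> N c s\<bar> \<le> K * h\<^sup>2"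
        using diagonal_geometry(2)[OF j, of p e] p True unfolding t by blast
      \<comment> \<open>32 is the factor 2 in the kernel of S' times the 16 from
        \<open>(h / 4)\<^sup>2\<close> in the denominator.\<close>
      have "cmod (sheet_ker kind t c j (fst w) (snd w)) \<le> (C0 + (32 * \<bar>K\<bar> * C1) * sqrt (sqrt M)) * (1 / sqrt (sqrt \<bar>fst w - snd w\<bar>))"
        if w: "w \<in> D" "dist w z < d" for w
      proof -
        obtain s u where wsu: "w = (s, u)" by (cases w)
        have su: "s \<in> {0..L c}" "u \<in> {0..L c}" "s \<noteq> u" using w(1) sheet_dom_subset[of c j] by (auto simp: D_def wsu t)
        have near: "\<bar>s - p\<bar> < d" "\<bar>u - e\<bar> < d"
          using dist_fst_le[of w z] dist_snd_le[of w z] w(2) by (auto simp: wsu z dist_real_def)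
        from K[OF su(1,2) near] obtain h where h: "\<bar>s - u\<bar> \<le> h" "h / 4 \<le> norm (X c s - sheet_pt W c j u)"
          "\<bar>(X c s - sheet_pt W c j u) \<bullet> N c s\<bar> \<le> K * h\<^sup>2" by blast
        have h0: "0 < h" using h(1) su(3) by auto
        let ?v = "X c s - sheet_pt W c j u"
        have vR: "norm ?v \<le> R" using R[of s u] su t by simp
        from kind consider "kind = KS" | "kind = KSn" by blast
        then show ?thesis
        proof cases
          case 1
          have "cmod (sheet_ker kind t c j s u) \<le> C0 / sqrt (sqrt h)"
            unfolding sheet_ker_def 1 t by (rule C0(2)[OF h0 h(2) vR])
          also have "\<dots> \<le> C0 / sqrt (sqrt \<bar>s - u\<bar>)"
            using C0(1) h(1) h0 su(3) by (intro divide_left_mono mult_pos_pos) auto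
          also have "\<dots> \<le> (C0 + (32 * \<bar>K\<bar> * C1) * sqrt (sqrt M)) * (1 / sqrt (sqrt \<bar>s - u\<bar>))"
            using C1(1) L_pos[of t] L_pos[of c] by (simp add: divide_right_mono M_def)
          finally show ?thesis by (simp add: wsu)
        next
          case 2
          have nv: "0 < norm ?v" using h(2) h0 by linarith
          have "cmod (\<phi> 1 ((norm ?v)\<^sup>2)) \<le> C1 / (norm ?v)\<^sup>2"
            using C1(2)[of "(norm ?v)\<^sup>2"] nv vR by (simp add: power_mono)
          also have "\<dots> \<le> C1 / (h / 4)\<^sup>2"
            using C1(1) h(2) h0 nv by (intro divide_left_mono power_mono mult_pos_pos zero_less_power) auto
          finally have p1: "cmod (\<phi> 1 ((norm ?v)\<^sup>2)) \<le> C1 / (h / 4)\<^sup>2" .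
          have "cmod (sheet_ker kind t c j s u) = 2 * \<bar>?v \<bullet> N c s\<bar> * cmod (\<phi> 1 ((norm ?v)\<^sup>2))"
            unfolding sheet_ker_def 2 t by (simp add: ker_simps norm_mult abs_mult)
          also have "\<dots> \<le> 2 * (\<bar>K\<bar> * h\<^sup>2) * (C1 / (h / 4)\<^sup>2)"
          proof (rule mult_mono[OF _ p1])
            have "K * h\<^sup>2 \<le> \<bar>K\<bar> * h\<^sup>2" by (intro mult_right_mono) auto
            then show "2 * \<bar>?v \<bullet> N c s\<bar> \<le> 2 * (\<bar>K\<bar> * h\<^sup>2)" using h(3) by simp
          qed auto
          also have "\<dots> = 32 * \<bar>K\<bar> * C1" using h0 by (simp add: power_divide)
          finally have "cmod (sheet_ker kind t c j (fst w) (snd w)) \<le> (32 * \<bar>K\<bar> * C1 * sqrt (sqrt M)) * (1 / sqrt (sqrt \<bar>fst w - snd w\<bar>))"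
            using C1(1) by (intro const[OF w(1)]) (auto simp: wsu)
          also have "\<dots> \<le> (C0 + (32 * \<bar>K\<bar> * C1) * sqrt (sqrt M)) * (1 / sqrt (sqrt \<bar>fst w - snd w\<bar>))"
            using C0(1) by (intro mult_right_mono) auto
          finally show ?thesis .
        qed
      qed
      then show ?thesis using d by blast
    qed
  qed auto
  then show ?thesis by (fastforce simp: D_def)
qed

text \<open>Each of the three sheets contributes a weakly singular kernel with sections continuous
  into L2, hence a compact operator. The case of one curve acting on itself is included.\<close>

lemma compact_cap_potential:
  assumes tc: "same_kind t c" and kind: "kind \<in> {KS, KSn}"
    and P: "\<And>f s. f \<in> fs_set (L2 (L c)) \<Longrightarrow> s \<in> {0..L t} \<Longrightarrow> P f s = fin_integral W c (K s) f"
    and K: "\<And>s y n a. s \<in> {0..L t} \<Longrightarrow> X t s \<noteq> y \<Longrightarrow> K s y n = ker kind (X t s - y) (N t s) (T t s) (tangent' W t s) n"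
  shows "bounded_op (L2 (L c)) (L2 (L t)) P" "compact_op (L2 (L c)) (L2 (L t)) P"
proof -
  have disj: "X t s \<noteq> sheet_pt W c j u" if "j \<in> sheets W c" "s \<in> {0..L t}" "u \<in> closure (sheet_dom W c j)" "s \<noteq> u" for j s u
  proof
    assume eq: "X t s = sheet_pt W c j u"
    have t: "t = c" using sheet_meet(1)[OF that(1,3,2) eq] tc by blast
    have "s = u" by (rule diagonal_geometry(1)[OF that(1) that(2)[unfolded t] that(3) eq[unfolded t]])
    then show False using that(4) by simp
  qed
  define k where "k j s u = (if u \<in> sheet_dom W c j \<and> u \<noteq> s then sheet_ker kind t c j s u else 0)" for j s u
  have ops: "bounded_op (L2 (L c)) (L2 (L t)) (\<lambda>f s. LINT u|interval_measure (L c). k j s u * f u)"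
    "compact_op (L2 (L c)) (L2 (L t)) (\<lambda>f s. LINT u|interval_measure (L c). k j s u * f u)"
    "\<And>s. s \<in> {0..L t} \<Longrightarrow> k j s \<in> fs_set (L2 (L c))" if j: "j \<in> sheets W c" for j
  proof -
    obtain C where C: "\<And>s u. s \<in> {0..L t} \<Longrightarrow> u \<in> sheet_dom W c j \<Longrightarrow> s \<noteq> u \<Longrightarrow> cmod (sheet_ker kind t c j s u) \<le> C / sqrt (sqrt \<bar>s - u\<bar>)"
      using weak_singularity[OF tc j kind] by blast
    have cont: "continuous_on {(s, u). s \<in> {0..L t} \<and> u \<in> closure (sheet_dom W c j) \<and> s \<noteq> u} (\<lambda>(s, u). sheet_ker kind t c j s u)"
      by (rule sheet_ker_cont) (use disj[OF j] closure_sheet_dom in blast)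
    have leb: "sheet_dom W c j \<in> sets lebesgue" using sheet_dom_borel by (intro sets_completionI_sets) simp
    note ws = weakly_singular_L2_continuous[OF L_pos L_pos leb closure_subset compact_closure_sheet_dom closure_sheet_dom cont C,
        folded k_def[of j for j, abs_def]]
    show kL2: "k j s \<in> fs_set (L2 (L c))" if "s \<in> {0..L t}" for s
      using ws(1)[OF _ _ _ that] unfolding k_def[abs_def] by blast
    have kc: "\<exists>d>0. \<forall>r\<in>{0..L t}. \<bar>r - s\<bar> < d \<longrightarrow> fs_norm (L2 (L c)) (\<lambda>u. k j r u - k j s u) < e" if "s \<in> {0..L t}" "0 < e" for s e
      using ws(2)[OF _ _ _ that] unfolding k_def[abs_def] by blast
    show "bounded_op (L2 (L c)) (L2 (L t)) (\<lambda>f s. LINT u|interval_measure (L c). k j s u * f u)"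
      "compact_op (L2 (L c)) (L2 (L t)) (\<lambda>f s. LINT u|interval_measure (L c). k j s u * f u)"
      by (rule L2_continuous_kernel_op[OF L_pos L_pos kL2 kc refl]; assumption)+
  qed
  let ?T = "\<lambda>j f s. LINT u|interval_measure (L c). k j s u * f u"
  let ?e = "L c"
  have mem: "None \<in> sheets W c" "Some ?e \<in> sheets W c" "Some (L c - ?e) \<in> sheets W c" by (auto simp: sheets_def)
  have eq: "P f s = (?T None f s + parity c * ?T (Some ?e) f s) + parity c * ?T (Some (L c - ?e)) f s"
    if f: "f \<in> fs_set (L2 (L c))" and s: "s \<in> {0..L t}" for f s
  proof -
    \<comment> \<open>By \<open>disj\<close> a target can meet a sheet only at the parameter
      \<open>u = s\<close>, so this single point is exempted.\<close>
    let ?\<kappa> = "\<lambda>j u. if u \<noteq> s then sheet_ker kind t c j s u else 0"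
    have ind: "indicator (sheet_dom W c j) u *\<^sub>R ?\<kappa> j u = k j s u" for j u by (auto simp: k_def indicator_def)
    have "P f s = (LINT u|interval_measure (L c). (\<Sum>j\<in>sheets W c. sheet_sign c j * (indicator (sheet_dom W c j) u *\<^sub>R ?\<kappa> j u)) * f u)"
      unfolding P[OF f s]
    proof (rule fin_integral_eq[where S = "{s}"])
      show "(\<lambda>u. indicator (sheet_dom W c j) u *\<^sub>R ?\<kappa> j u) \<in> fs_set (L2 (L c))" if "j \<in> sheets W c" for j
        unfolding ind by (rule ops(3)[OF that s])
      fix j u assume j: "j \<in> sheets W c" and u: "u \<in> sheet_dom W c j" "u \<notin> {s}"
      have "X t s \<noteq> sheet_pt W c j u" using disj[OF j s, of u] u closure_subset[of "sheet_dom W c j"] by blast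
      then show "K s (sheet_pt W c j u) (sheet_normal W c j u) = ?\<kappa> j u" using K[OF s] u by (simp add: sheet_ker_def)
    qed (use f in auto)
    also have "\<dots> = (LINT u|interval_measure (L c). (\<Sum>j\<in>sheets W c. sheet_sign c j * (k j s u * f u)))"
      unfolding ind by (simp only: sum_distrib_right mult.assoc)
    also have "\<dots> = (\<Sum>j\<in>sheets W c. (LINT u|interval_measure (L c). sheet_sign c j * (k j s u * f u)))"
      by (rule Bochner_Integration.integral_sum) (intro integrable_mult_right L2_mult_integrable(1)[OF ops(3) f] s)
    also have "\<dots> = (\<Sum>j\<in>sheets W c. sheet_sign c j * ?T j f s)"
      by (simp only: integral_mult_right_zero)
    also have "\<dots> = ?T None f s + parity c * ?T (Some ?e) f s + parity c * ?T (Some (L c - ?e)) f s"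
      by (subst sum_sheets[of "?e"]) simp_all
    finally show ?thesis .
  qed
  let ?S = "\<lambda>f s. (?T None f s + parity c * ?T (Some ?e) f s) + parity c * ?T (Some (L c - ?e)) f s"
  have b: "bounded_op (L2 (L c)) (L2 (L t)) ?S"
    by (intro bounded_op_add bounded_op_scale seminormed_L2 ops(1) mem)
  have cs: "compact_op (L2 (L c)) (L2 (L t)) (\<lambda>f s. parity c * ?T j f s)" if "j \<in> sheets W c" for j
    by (rule bounded_compact_op[OF seminormed_L2 seminormed_L2 seminormed_L2 ops(2)[OF that] bounded_op_scaling[OF seminormed_L2]])
  have c: "compact_op (L2 (L c)) (L2 (L t)) ?S"
    by (intro compact_op_add seminormed_L2 ops(2) cs mem)
  have cong: "P f \<in> fs_set (L2 (L t))" "fs_eq (L2 (L t)) (P f) (?S f)" if f: "f \<in> fs_set (L2 (L c))" for f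
  proof -
    have "P f s = ?S f s" if "s \<in> {0<..<L t}" for s using eq[OF f, of s] that by auto
    note L2_cong_interior[OF bounded_op_mem[OF b f] this]
    then show "P f \<in> fs_set (L2 (L t))" "fs_eq (L2 (L t)) (P f) (?S f)" using L2.eq_sym bounded_op_mem[OF b f] by blast+
  qed
  show "bounded_op (L2 (L c)) (L2 (L t)) P" by (rule bounded_op_cong[OF seminormed_L2 seminormed_L2 b cong])
  show "compact_op (L2 (L c)) (L2 (L t)) P" by (rule compact_op_cong[OF seminormed_L2 seminormed_L2 c cong])
qed

end

section \<open>The reduced operator\<close>

lemma L2_circ_mem: "\<rho> \<in> fs_set (L2_circ W) \<Longrightarrow> (\<lambda>s. \<rho> (j, s)) \<in> fs_set (L2 (len W (Circ j)))"
  by (simp add: L2_circ_def)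

lemma L2_circ_norm: "fs_norm (L2_circ W) \<rho> =
    sqrt ((fs_norm (L2 (len W (Circ One))) (\<lambda>s. \<rho> (One, s)))\<^sup>2 + (fs_norm (L2 (len W (Circ Two))) (\<lambda>s. \<rho> (Two, s)))\<^sup>2)"
  by (simp add: L2_circ_def)

lemma seminormed_L2_circ: "seminormed_fs (L2_circ W)"
proof
  show "(\<lambda>_. 0) \<in> fs_set (L2_circ W)" by (simp add: L2_circ_def L2.zero_mem)
  fix f g :: "side \<times> real \<Rightarrow> complex" and c :: complex
  assume f: "f \<in> fs_set (L2_circ W)"
  show "(\<lambda>x. c * f x) \<in> fs_set (L2_circ W)" using f by (simp add: L2_circ_def L2.scale_mem)
  show "0 \<le> fs_norm (L2_circ W) f" by (simp add: L2_circ_norm)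
  have "(a * x)\<^sup>2 + (a * y)\<^sup>2 = a\<^sup>2 * (x\<^sup>2 + y\<^sup>2)" for a x y :: real by (simp add: power_mult_distrib distrib_left)
  then show "fs_norm (L2_circ W) (\<lambda>x. c * f x) = cmod c * fs_norm (L2_circ W) f"
    by (simp add: L2_circ_norm L2.norm_scale L2_circ_mem[OF f] real_sqrt_mult)
  assume g: "g \<in> fs_set (L2_circ W)"
  show "(\<lambda>x. f x + g x) \<in> fs_set (L2_circ W)" using f g by (simp add: L2_circ_def L2.add_mem)
  let ?n = "\<lambda>h j. fs_norm (L2 (len W (Circ j))) (\<lambda>s. h (j, s))"
  have "fs_norm (L2_circ W) (\<lambda>x. f x + g x) \<le> sqrt ((?n f One + ?n g One)\<^sup>2 + (?n f Two + ?n g Two)\<^sup>2)"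
    unfolding L2_circ_norm
    by (intro real_sqrt_le_mono add_mono power_mono L2.norm_add L2.norm_nonneg L2.add_mem L2_circ_mem f g)
  then show "fs_norm (L2_circ W) (\<lambda>x. f x + g x) \<le> fs_norm (L2_circ W) f + fs_norm (L2_circ W) g"
    unfolding L2_circ_norm using real_sqrt_sum_squares_triangle_ineq by (rule order.trans)
qed

lemma bounded_circ_component: "bounded_op (L2_circ W) (L2 (len W (Circ j))) (\<lambda>\<rho> s. \<rho> (j, s))"
proof (rule bounded_opI[where B = 1])
  show "linear_op (L2_circ W) (L2 (len W (Circ j))) (\<lambda>\<rho> s. \<rho> (j, s))"
    by (simp add: linear_op_def L2_circ_mem L2.eq_refl)
  show "fs_norm (L2 (len W (Circ j))) (\<lambda>s. \<rho> (j, s)) \<le> 1 * fs_norm (L2_circ W) \<rho>" for \<rho>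
    by (cases j) (simp_all add: L2_circ_norm real_le_rsqrt)
qed

text \<open>Sums of these extensions by zero assemble the rows of a block operator, so that
  statements about one cap carry over to the product space.\<close>

definition cap_extend :: "side \<Rightarrow> (real \<Rightarrow> complex) \<Rightarrow> side \<times> real \<Rightarrow> complex" where
  "cap_extend j f = (\<lambda>(i, s). if i = j then f s else 0)"

lemma bounded_cap_extend: "bounded_op (L2 (len W (Circ j))) (L2_circ W) (cap_extend j)"
proof (rule bounded_opI[where B = 1])
  have mem: "cap_extend j f \<in> fs_set (L2_circ W)" if "f \<in> fs_set (L2 (len W (Circ j)))" for f
    proof -
    have "(\<lambda>s. cap_extend j f (i, s)) \<in> fs_set (L2 (len W (Circ i)))" for i
      using that L2.zero_mem by (cases "i = j") (simp_all add: cap_extend_def)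
    then show ?thesis by (simp add: L2_circ_def)
  qed
  have add: "cap_extend j (\<lambda>x. f x + g x) = (\<lambda>y. cap_extend j f y + cap_extend j g y)" for f g
    by (auto simp: cap_extend_def fun_eq_iff)
  have scale: "cap_extend j (\<lambda>x. c * f x) = (\<lambda>y. c * cap_extend j f y)" for c f
    by (auto simp: cap_extend_def fun_eq_iff)
  show "linear_op (L2 (len W (Circ j))) (L2_circ W) (cap_extend j)"
    by (simp add: linear_op_def mem add scale seminormed_fs.eq_refl[OF seminormed_L2_circ])
  show "fs_norm (L2_circ W) (cap_extend j f) \<le> 1 * fs_norm (L2 (len W (Circ j))) f"
    if "f \<in> fs_set (L2 (len W (Circ j)))" for f
    using L2.norm_nonneg[OF that] by (cases j) (simp_all add: L2_circ_norm cap_extend_def L2.norm_zero)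
qed

lemma opp_opp [simp]: "opp (opp i) = i"
  by (cases i) auto

lemma opp_neq: "opp i \<noteq> i"
  by (cases i) auto

section \<open>Mapping properties of the blocks\<close>

context waveguide_kernels
begin

text \<open>Distinct walls do not touch, so S and D between them gain two derivatives by boundedness
  of the differentiated kernels, and \<open>G_op\<close> does the same for S' and D'. The entry is
  bounded even from L2 and is then restricted to \<open>H2\<close>.\<close>

lemma bounded_K_star_star:
  assumes "h \<noteq> i"
  shows "bounded_op (H2_star W i) (H2_star W h) (K_op W (Star h) (Star i))"
proof -
  let ?t = "Star h" and ?c = "Star i"
  have tc: "?t \<noteq> ?c" using assms by simp
  note eq = potentials_eq[OF tc]
  have K: "total_ker kind ?t ?c s \<in> fs_set (L2 (L ?c))" if "s \<in> {0..L ?t}" for kind s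
    by (intro total_ker_L2 sheet_section_L2 interior_disjoint[OF tc]) (use that in auto)
  have H: "bounded_op (L2 (L ?c)) (H2 (L ?t)) (SL W ?t ?c)" "bounded_op (L2 (L ?c)) (H2 (L ?t)) (DL W ?t ?c)"
    by (rule bounded_potential_H2[where ?kind2.0 = KSss, OF tc _ _ K eq(1)]; simp)
       (rule bounded_potential_H2[where ?kind2.0 = KDss, OF tc _ _ K eq(2)]; simp)
  have L2: "bounded_op (L2 (L ?c)) (L2 (L ?t)) (SL' W ?t ?c)" "bounded_op (L2 (L ?c)) (L2 (L ?t)) (DL' W ?t ?c)"
    by (rule bounded_potential_L2[OF tc _ eq(3)]; simp) (rule bounded_potential_L2[OF tc _ eq(4)]; simp)
  note sn = seminormed_L2 seminormed_H2[OF L_pos]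
  let ?c1 = "coef_c1 W"
  let ?Q = "\<lambda>\<sigma> s. DL W ?t ?c \<sigma> s - 1 / ?c1 * SL W ?t ?c \<sigma> s"
  let ?Q' = "\<lambda>\<sigma> s. DL' W ?t ?c \<sigma> s - 1 / ?c1 * SL' W ?t ?c \<sigma> s"
  have Q: "bounded_op (L2 (L ?c)) (H2 (L ?t)) ?Q" by (intro bounded_op_diff bounded_op_scale H sn)
  have Q': "bounded_op (L2 (L ?c)) (L2 (L ?t)) ?Q'" by (intro bounded_op_diff bounded_op_scale L2 sn)
  note G = bounded_G_op[OF admissible]
  have GQ: "bounded_op (L2 (L ?c)) (H2 (L ?t)) (\<lambda>\<sigma>. G_op W h (?Q \<sigma>))"
    by (rule bounded_op_comp[OF sn(1) sn(1) sn(2) bounded_op_comp[OF sn(1) sn(2) sn(1) Q bounded_H2_L2[OF L_pos]] G])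
  have GQ': "bounded_op (L2 (L ?c)) (H2 (L ?t)) (\<lambda>\<sigma>. G_op W h (?Q' \<sigma>))"
    by (rule bounded_op_comp[OF sn(1) sn(1) sn(2) Q' G])
  have "bounded_op (L2 (L ?c)) (H2 (L ?t)) (\<lambda>\<sigma> s. ?c1 * ?Q \<sigma> s - 1 / ?c1 * G_op W h (?Q \<sigma>) s + G_op W h (?Q' \<sigma>) s)"
    by (intro bounded_op_add[OF sn] bounded_op_diff[OF sn] bounded_op_scale[OF sn] Q GQ GQ')
  moreover have "K_op W ?t ?c = (\<lambda>\<sigma> s. ?c1 * ?Q \<sigma> s - 1 / ?c1 * G_op W h (?Q \<sigma>) s + G_op W h (?Q' \<sigma>) s)"
    using assms by (simp add: fun_eq_iff Let_def)
  ultimately have "bounded_op (L2 (L ?c)) (H2 (L ?t)) (K_op W ?t ?c)" by simp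
  from bounded_op_comp[OF sn(2) sn(1) sn(2) bounded_H2_L2[OF L_pos] this] show ?thesis by (simp add: H2_star_def del: K_op.simps)
qed

text \<open>S reaches \<open>H2\<close> through the odd reflection. S' is merely bounded on L2 near
  the corners, and \<open>G_op\<close> supplies the two derivatives it lacks.\<close>

lemma bounded_K_star_cap: "bounded_op (L2 (L (Circ j))) (H2_star W i) (K_op W (Star i) (Circ j))"
proof -
  let ?t = "Star i" and ?c = "Circ j"
  have tc: "?t \<noteq> ?c" and ns: "\<not> same_kind ?t ?c" by simp_all
  note sn = seminormed_L2 seminormed_H2[OF L_pos]
  have S: "bounded_op (L2 (L ?c)) (H2 (L ?t)) (SL W ?t ?c)"
    by (rule bounded_potential_H2[where ?kind2.0 = KSss, OF tc _ _ total_ker_L2[OF corner_section_L2[OF ns]] SL_adjacent_eq[OF ns]]) simp_all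
  have "bounded_op (L2 (L ?c)) (L2 (L ?t)) (SL' W ?t ?c)"
    by (rule bounded_potential_L2[OF tc _ potentials_eq(3)[OF tc]]) auto
  note GS' = bounded_op_comp[OF sn(1) sn(1) sn(2) this bounded_G_op[OF admissible]]
  note GS = bounded_op_comp[OF sn(1) sn(1) sn(2) bounded_op_comp[OF sn(1) sn(2) sn(1) S bounded_H2_L2[OF L_pos]] bounded_G_op[OF admissible]]
  have "bounded_op (L2 (L ?c)) (H2 (L ?t)) (\<lambda>\<sigma> s. coef_c1 W * SL W ?t ?c \<sigma> s - 1 / coef_c1 W * G_op W i (SL W ?t ?c \<sigma>) s + G_op W i (SL' W ?t ?c \<sigma>) s)"
    by (intro bounded_op_add[OF sn] bounded_op_diff[OF sn] bounded_op_scale[OF sn] S GS GS')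
  moreover have "K_op W ?t ?c = (\<lambda>\<sigma> s. coef_c1 W * SL W ?t ?c \<sigma> s - 1 / coef_c1 W * G_op W i (SL W ?t ?c \<sigma>) s + G_op W i (SL' W ?t ?c \<sigma>) s)"
    by (simp add: fun_eq_iff)
  ultimately show ?thesis by (simp add: H2_star_def del: K_op.simps)
qed

text \<open>The even reflection makes D' bounded on L2, as are the other three potentials.
  Compactness arises only on the domain side, from the embedding of \<open>H2\<close>.\<close>

lemma K_cap_star: "compact_op (H2_star W i) (L2 (L (Circ j))) (K_op W (Circ j) (Star i))"
  "bounded_op (H2_star W i) (L2 (L (Circ j))) (K_op W (Circ j) (Star i))"
proof -
  let ?t = "Circ j" and ?c = "Star i"
  have tc: "?t \<noteq> ?c" by simp
  note sn = seminormed_L2 seminormed_H2[OF L_pos]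
  have eq: "bounded_op (L2 (L ?c)) (L2 (L ?t)) P"
    if "kind \<in> {KS, KSn, KD, KDn}" "\<And>f s. f \<in> fs_set (L2 (L ?c)) \<Longrightarrow> s \<in> {0<..<L ?t} \<Longrightarrow> P f s = (LINT u|interval_measure (L ?c). total_ker kind ?t ?c s u * f u)" for P kind
    by (rule bounded_potential_L2[OF tc _ that(2)]) (use that(1) in auto)
  note ops = eq[OF _ potentials_eq(1)[OF tc]] eq[OF _ potentials_eq(2)[OF tc]] eq[OF _ potentials_eq(3)[OF tc]] eq[OF _ potentials_eq(4)[OF tc]]
  let ?a = "coef_a W" and ?c1 = "coef_c1 W"
  let ?K = "\<lambda>\<sigma> s. ?a * (DL W ?t ?c \<sigma> s - 1 / ?c1 * SL W ?t ?c \<sigma> s) + DL' W ?t ?c \<sigma> s - 1 / ?c1 * SL' W ?t ?c \<sigma> s"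
  have "bounded_op (L2 (L ?c)) (L2 (L ?t)) ?K"
    by (intro bounded_op_add bounded_op_diff bounded_op_scale sn(1) ops) auto
  moreover have "K_op W ?t ?c = ?K" by (simp add: fun_eq_iff)
  ultimately have b: "bounded_op (L2 (L ?c)) (L2 (L ?t)) (K_op W ?t ?c)" by simp
  show "compact_op (H2_star W i) (L2 (L ?t)) (K_op W ?t ?c)"
    using bounded_compact_op[OF sn(2) sn(1) sn(1) compact_H2_L2[OF L_pos] b] by (simp add: H2_star_def del: K_op.simps)
  show "bounded_op (H2_star W i) (L2 (L ?t)) (K_op W ?t ?c)"
    using bounded_op_comp[OF sn(2) sn(1) sn(1) bounded_H2_L2[OF L_pos] b] by (simp add: H2_star_def del: K_op.simps)
qed

text \<open>\<open>E\<close> is the entry between two caps without the jump term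
  \<open>1 / 2\<close>, so the diagonal and the off-diagonal case are treated alike.\<close>

lemma K_cap_cap:
  fixes h j
  defines "E \<equiv> \<lambda>\<sigma> s. coef_a W * SL W (Circ h) (Circ j) \<sigma> s + SL' W (Circ h) (Circ j) \<sigma> s"
  shows "bounded_op (L2 (L (Circ j))) (L2 (L (Circ h))) E" "compact_op (L2 (L (Circ j))) (L2 (L (Circ h))) E"
proof -
  let ?t = "Circ h" and ?c = "Circ j"
  note S = compact_cap_potential[where t = ?t and c = ?c and kind = KS, OF _ _ SL_def, simplified ker_simps kernel dist_norm, simplified]
  note S' = compact_cap_potential[where t = ?t and c = ?c, OF _ _ SL'_def dir_deriv_target, simplified]
  note sn = seminormed_L2 seminormed_L2
  show "bounded_op (L2 (L ?c)) (L2 (L ?t)) E"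
    unfolding E_def by (intro bounded_op_add[OF sn] bounded_op_scale[OF sn] S(1) S'(1)) (simp_all add: ker_simps kernel dist_norm)
  show "compact_op (L2 (L ?c)) (L2 (L ?t)) E"
    unfolding E_def by (intro compact_op_add[OF sn] S'(2) bounded_compact_op[OF sn seminormed_L2 S(2) bounded_op_scaling[OF seminormed_L2]])
     (simp_all add: ker_simps kernel dist_norm)
qed

lemma seminormed_H2_star: "seminormed_fs (H2_star W i)"
  unfolding H2_star_def by (rule seminormed_H2[OF L_pos])

text \<open>Both compactness and boundedness of the block are recorded: the latter supplies the
  compatibility with \<open>fs_eq\<close> that composition with \<open>P\<close> requires.\<close>

lemma compact_K_circ_star:
  assumes P: "bounded_op (L2_circ W) (H2_star W i) P"
  shows "compact_op (L2_circ W) (L2_circ W) (\<lambda>\<rho>. K_circ_star W i (P \<rho>))"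
proof -
  note sn = seminormed_H2_star seminormed_L2 seminormed_L2_circ
  have "K_circ_star W i = (\<lambda>\<sigma> x. cap_extend One (K_op W (Circ One) (Star i) \<sigma>) x + cap_extend Two (K_op W (Circ Two) (Star i) \<sigma>) x)"
  proof (intro ext)
    fix \<sigma> and x :: "side \<times> real"
    obtain j s where x: "x = (j, s)" by (cases x)
    show "K_circ_star W i \<sigma> x = cap_extend One (K_op W (Circ One) (Star i) \<sigma>) x + cap_extend Two (K_op W (Circ Two) (Star i) \<sigma>) x"
      unfolding x by (cases j) (simp_all add: K_circ_star_def cap_extend_def del: K_op.simps)
  qed
  moreover have "compact_op (H2_star W i) (L2_circ W) (\<lambda>\<sigma> x. cap_extend One (K_op W (Circ One) (Star i) \<sigma>) x + cap_extend Two (K_op W (Circ Two) (Star i) \<sigma>) x)"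
    by (intro compact_op_add sn bounded_compact_op[OF sn(1,2,3) K_cap_star(1) bounded_cap_extend])
  moreover have "bounded_op (H2_star W i) (L2_circ W) (\<lambda>\<sigma> x. cap_extend One (K_op W (Circ One) (Star i) \<sigma>) x + cap_extend Two (K_op W (Circ Two) (Star i) \<sigma>) x)"
    by (intro bounded_op_add sn bounded_op_comp[OF sn(1,2,3) K_cap_star(2) bounded_cap_extend])
  ultimately have c: "compact_op (H2_star W i) (L2_circ W) (K_circ_star W i)" and b: "bounded_op (H2_star W i) (L2_circ W) (K_circ_star W i)"
    by simp_all
  show ?thesis by (rule compact_bounded_op[OF sn(3,1,3) P c bounded_op_eq[OF sn(1,3) b]])
qed

lemma bounded_A_op:
  assumes "invertible_op (H2_star W i) (K_op W (Star i) (Star i))"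
  shows "bounded_op (H2_star W i) (H2_star W (opp i)) (A_op W i)"
  using bounded_op_comp[OF seminormed_H2_star seminormed_H2_star seminormed_H2_star
      bounded_inverse_op[OF seminormed_H2_star assms] bounded_K_star_star[OF opp_neq]]
  by (simp add: A_op_def[abs_def] del: K_op.simps)

text \<open>Every factor of \<open>B_op\<close> is bounded between the right spaces: the cap-to-wall
  blocks gain two derivatives, \<open>A_op\<close> maps one wall space into the other, and
  \<open>bounded_inverse_op\<close> covers the Schur complement.\<close>

lemma bounded_B_op:
  assumes K: "\<And>i. invertible_op (H2_star W i) (K_op W (Star i) (Star i))" and "invertible_op (H2_star W i) (schur_op W i)"
  shows "bounded_op (L2_circ W) (H2_star W i) (B_op W i)"
proof -
  note sn = seminormed_H2_star seminormed_L2 seminormed_L2_circ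
  have c: "bounded_op (L2_circ W) (H2_star W i) (\<lambda>\<rho>. K_op W (Star i) (Circ j) (\<lambda>u. \<rho> (j, u)))" for i j
    by (rule bounded_op_comp[OF sn(3,2,1) bounded_circ_component bounded_K_star_cap])
  have K_star_circ: "bounded_op (L2_circ W) (H2_star W i) (K_star_circ W i)" for i
    using bounded_op_add[OF sn(3,1) c c, of i One Two] by (simp add: K_star_circ_def[abs_def] del: K_op.simps)
  have "bounded_op (H2_star W (opp i)) (H2_star W i) (A_op W (opp i))"
    using bounded_A_op[OF K, of "opp i"] by simp
  from bounded_op_comp[OF sn(3,1,1) K_star_circ this]
  have "bounded_op (L2_circ W) (H2_star W i) (\<lambda>\<rho> s. A_op W (opp i) (K_star_circ W (opp i) \<rho>) s - K_star_circ W i \<rho> s)"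
    by (intro bounded_op_diff sn K_star_circ)
  from bounded_op_comp[OF sn(3,1,1) this bounded_inverse_op[OF sn(1) assms(2)]] show ?thesis
    by (simp add: B_op_def[abs_def])
qed

text \<open>The jump term \<open>1 / 2\<close> of the diagonal entries is the whole part of
  \<open>K_circ\<close> that fails to be compact; it becomes the scalar of the final
  decomposition.\<close>

lemma K_circ_compact_part:
  obtains C where "compact_op (L2_circ W) (L2_circ W) C" "\<And>\<rho> x. K_circ W \<rho> x = 1 / 2 * \<rho> x + C \<rho> x"
proof -
  note sn = seminormed_L2 seminormed_L2_circ
  define E where "E h j \<sigma> s = coef_a W * SL W (Circ h) (Circ j) \<sigma> s + SL' W (Circ h) (Circ j) \<sigma> s" for h j \<sigma> s
  note E = K_cap_cap[folded E_def]
  define R where "R h \<rho> s = E h One (\<lambda>u. \<rho> (One, u)) s + E h Two (\<lambda>u. \<rho> (Two, u)) s" for h \<rho> s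
  have R: "compact_op (L2_circ W) (L2 (L (Circ h))) (R h)" for h
    unfolding R_def[abs_def]
    by (intro compact_op_add sn compact_bounded_op[OF sn(2,1,1) bounded_circ_component E(2) bounded_op_eq[OF sn(1,1) E(1)]])
  let ?C = "\<lambda>\<rho> x. cap_extend One (R One \<rho>) x + cap_extend Two (R Two \<rho>) x"
  show ?thesis
  proof
    show "compact_op (L2_circ W) (L2_circ W) ?C"
      by (intro compact_op_add sn bounded_compact_op[OF sn(2,1,2) R bounded_cap_extend])
    fix \<rho> and x :: "side \<times> real"
    obtain j s where x: "x = (j, s)" by (cases x)
    show "K_circ W \<rho> x = 1 / 2 * \<rho> x + ?C \<rho> x"
      unfolding x by (cases j) (simp_all add: K_circ_def cap_extend_def R_def E_def)
  qed
qed

end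

theorem corollary3p4p1:
  fixes W :: waveguide
  assumes "admissible W"
    and "\<And>i. invertible_op (H2_star W i) (K_op W (Star i) (Star i))"
    and "\<And>i. invertible_op (H2_star W i) (schur_op W i)"
  shows "fredholm_second_kind (L2_circ W) (M_op W)"
proof -
  obtain \<phi> where "radial_kernel (wave_number W) \<phi>"
    using radial_kernel_exists assms(1) by (auto simp: admissible_def)
  then interpret waveguide_kernels W \<phi>
    using assms(1) by (simp add: waveguide_kernels_def waveguide_kernels_axioms_def)
  interpret L2_circ: seminormed_fs "L2_circ W" by (rule seminormed_L2_circ)
  obtain C where C: "compact_op (L2_circ W) (L2_circ W) C" "\<And>\<rho> x. K_circ W \<rho> x = 1 / 2 * \<rho> x + C \<rho> x"
    by (rule K_circ_compact_part) blast
  let ?C = "\<lambda>\<rho> x. C \<rho> x + K_circ_star W One (B_op W One \<rho>) x + K_circ_star W Two (B_op W Two \<rho>) x"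
  have c: "compact_op (L2_circ W) (L2_circ W) ?C"
    by (intro compact_op_add seminormed_L2_circ C(1) compact_K_circ_star bounded_B_op assms)
  have M: "M_op W \<rho> = (\<lambda>x. 1 / 2 * \<rho> x + ?C \<rho> x)" for \<rho>
    by (simp add: M_op_def fun_eq_iff C(2))
  show ?thesis
    unfolding fredholm_second_kind_def
  proof (intro conjI ballI exI[of _ "1 / 2"] exI[of _ ?C])
    fix \<rho> assume \<rho>: "\<rho> \<in> fs_set (L2_circ W)"
    show "M_op W \<rho> \<in> fs_set (L2_circ W)"
      unfolding M by (intro L2_circ.add_mem L2_circ.scale_mem \<rho> linear_op_mem[OF compact_op_linear[OF c]])
    show "fs_eq (L2_circ W) (M_op W \<rho>) (\<lambda>x. 1 / 2 * \<rho> x + ?C \<rho> x)"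
      unfolding M by (rule L2_circ.eq_refl)
  qed (use c in simp_all)
qed

end
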